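(* Let $C_{23}$ be an absolute constant such that $\delta_3^*(s)\le C_{23}\,\delta_2^*(s)^{3/2}$ holds for every exponential family as in the context whose base measure $\mu$ has a log concave density, every $\theta^*\in\Theta$ and every $s\ge0$ with $\mathcal U^*(s)\subset\Theta$. Then there is an absolute constant $C>0$ such that the following holds. In the i.i.d. exponential family model described in the context, suppose the base measure $\mu$ has a log concave density. Suppose that for some $s\geq12$ it holds $$\delta_2^*(2s)=\sup_{\theta\in\mathcal U^*(2s)}\|F(\theta^* )^{-1/2}F(\theta)F(\theta^* )^{-1/2}\|\leq \tfrac32,$$ $$s\sqrt{d/n}\leq (16C_{23})^{-1},\qquad \delta_{01}^*(2s)\leq\sqrt{nd}/6,\qquad \mathcal U^*(2s)\subset\Theta.$$ Then on an event of probability at least $1-\exp(-ds^2/10)$ with respect to the distribution of the $Y_i$, we have $$\mathrm{TV}(\pi_v,\gamma^* )\leq C\left(\frac{\delta_{01}^*(2s)}{\sqrt n}+s\frac{d}{\sqrt n}+e^{d(M_0^*-(s/12)^2)}\right).$$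
   Context: Model. Let $\mu$ be a measure on $\mathcal Y\subseteq\mathbb R^d$, $\psi(\theta)=\log\int_{\mathcal Y}e^{\theta^\top y}d\mu(y)$, $\Theta=\{\theta\in\mathbb R^d:\int_{\mathcal Y} e^{\theta^\top y}d\mu(y)<\infty\}$, and $p(y\mid\theta)=\exp(\theta^\top y-\psi(\theta))$ for $\theta\in\Theta$. This exponential family is assumed full, minimal and regular (the parameter space is all of $\Theta$, $\Theta$ is open, and $\mu$ is not concentrated on a proper affine subspace), so $\Theta$ is open and convex and $\psi$ is $C^\infty$ and strictly convex on $\Theta$. For a ground truth $\theta^*\in\Theta$, $Y_1,\dots,Y_n$ are i.i.d. from $p(\cdot\mid\theta^* )\,d\mu$. $\mathbb E_\theta,\mathrm{Var}_\theta$ denote expectation and covariance under $Y\sim p(\cdot\mid\theta)d\mu$. $F(\theta)=\mathrm{Var}_\theta(Y)=\nabla^2\psi(\theta)$ and $F^*=F(\theta^* )$. Normalized negative log likelihood: $\ell(\theta)=\psi(\theta)-\frac1n\sum_{i=1}^nY_i^\top\theta$. The MLE is $\hat\theta=\arg\min_{\theta\in\Theta}\ell(\theta)$ when it exists and is unique. The prior is a probability density $\pi_0$, strictly positive on $\Theta$; the posterior is $\pi_v(\theta)\propto e^{-n\ell(\theta)}\pi_0(\theta)$, $\theta\in\Theta$; and $\gamma^*=\mathcal N(\hat\theta,(nF^* )^{-1})$ (the assertion that a bound on $\mathrm{TV}(\pi_v,\gamma^* )$ holds on an event includes that $\hat\theta$ exists and is unique on that event). Norms: $|u|_A=|A^{1/2}u|$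 for vectors $u$ and positive definite $A$; for a gradient vector $S$, $\|S\|_A=|A^{-1/2}S|$; $\|\cdot\|$ is the matrix operator norm. $\mathrm{TV}(P,Q)=\sup_B|P(B)-Q(B)|$. Quantities: $\mathcal U^*(s)=\{\theta\in\mathbb R^d:|\theta-\theta^*|_{F^*}\le s\sqrt{d/n}\}$; $\delta_2^*(s)=\sup_{\theta\in\mathcal U^*(s)}\|F(\theta^* )^{-1/2}F(\theta)F(\theta^* )^{-1/2}\|$; $$\delta_3^*(s)=\sup_{\theta\in\mathcal U^*(s),\,u\neq0}\frac{\mathbb E_\theta[(u^\top Y-u^\top\mathbb E_\theta[Y])^3]}{\mathrm{Var}_{\theta^*}(u^\top Y)^{3/2}};$$ $\delta_{01}^*(s)=\sup_{\theta\in\mathcal U^*(s)}\|\nabla\log\pi_0(\theta)\|_{F^*}$, with $\delta_{01}^*(s)=\infty$ if $\pi_0$ is not $C^1$ or not strictly positive on $\mathcal U^*(s)$; $M_0^*=d^{-1}\log\sup_{\theta\in\Theta}\pi_0(\theta)/\pi_0(\theta^* )$. *)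

theory Defs
  imports
    "HOL-Probability.Probability"
    "Jordan_Normal_Form.Gauss_Jordan_Elimination"
    "Jordan_Normal_Form.Determinant"
begin

(* The dimension d is quantified inside the statement (the constants must not depend on it), so
   points of R^d are extensional functions on {..<d}, i.e. the points of the library's product
   measure spaces over {..<d}. Matrices and the vectors they act on are those of
   Jordan_Normal_Form; Matrix.vec d converts a point of R^d into such a vector. *)

type_synonym point = "nat \<Rightarrow> real"

definition Rd :: "nat \<Rightarrow> point set" where
  "Rd d = {..<d} \<rightarrow>\<^sub>E UNIV"

definition leb :: "nat \<Rightarrow> point measure" where
  "leb d = (\<Pi>\<^sub>M i\<in>{..<d}. (lborel :: real measure))"

definition dot :: "nat \<Rightarrow> point \<Rightarrow> point \<Rightarrow> real" where
  "dot d x y = (\<Sum>i<d. x i * y i)"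

definition zero_pt :: "nat \<Rightarrow> point" where
  "zero_pt d = (\<lambda>i\<in>{..<d}. 0)"

definition segment_pt :: "nat \<Rightarrow> real \<Rightarrow> point \<Rightarrow> point \<Rightarrow> point" where
  "segment_pt d t x y = (\<lambda>i\<in>{..<d}. (1 - t) * x i + t * y i)"

definition diff_vec :: "nat \<Rightarrow> point \<Rightarrow> point \<Rightarrow> real Matrix.vec" where
  "diff_vec d x y = Matrix.vec d (\<lambda>i. x i - y i)"


definition vnorm :: "real Matrix.vec \<Rightarrow> real" where
  "vnorm v = sqrt (scalar_prod v v)"

definition opnorm :: "real Matrix.mat \<Rightarrow> real" where
  "opnorm A = (SUP v \<in> {v \<in> carrier_vec (dim_col A). vnorm v \<le> 1}. vnorm (mult_mat_vec A v))"

definition inv_mat :: "real Matrix.mat \<Rightarrow> real Matrix.mat" where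
  "inv_mat A = the (mat_inverse A)"

(* The symmetric positive semidefinite square root; meaningful for A symmetric positive
   semidefinite, where it exists and is unique. *)
definition sqrt_mat :: "real Matrix.mat \<Rightarrow> real Matrix.mat" where
  "sqrt_mat A = (THE B. B \<in> carrier_mat (dim_row A) (dim_row A) \<and> transpose_mat B = B
      \<and> (\<forall>v \<in> carrier_vec (dim_row A). 0 \<le> scalar_prod v (mult_mat_vec B v))
      \<and> B * B = A)"

definition inv_sqrt_mat :: "real Matrix.mat \<Rightarrow> real Matrix.mat" where
  "inv_sqrt_mat A = inv_mat (sqrt_mat A)"

definition wnorm :: "real Matrix.mat \<Rightarrow> real Matrix.vec \<Rightarrow> real" where
  "wnorm A u = vnorm (mult_mat_vec (sqrt_mat A) u)"

(* the norm used for gradients *)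
definition dual_wnorm :: "real Matrix.mat \<Rightarrow> real Matrix.vec \<Rightarrow> real" where
  "dual_wnorm A S = vnorm (mult_mat_vec (inv_sqrt_mat A) S)"

definition gaussian :: "nat \<Rightarrow> point \<Rightarrow> real Matrix.mat \<Rightarrow> point measure" where
  "gaussian d m \<Sigma> = density (leb d) (\<lambda>x. ennreal
     (exp (- scalar_prod (diff_vec d x m) (mult_mat_vec (inv_mat \<Sigma>) (diff_vec d x m)) / 2)
        / sqrt ((2 * pi) ^ d * Determinant.det \<Sigma>)))"

definition TV :: "'a measure \<Rightarrow> 'a measure \<Rightarrow> ereal" where
  "TV P Q = (SUP B \<in> sets P. ereal \<bar>measure P B - measure Q B\<bar>)"


definition ereal_exp :: "ereal \<Rightarrow> ereal" where
  "ereal_exp x = (case x of ereal r \<Rightarrow> ereal (exp r) | PInfty \<Rightarrow> \<infinity> | MInfty \<Rightarrow> 0)"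

definition ereal_ln :: "ereal \<Rightarrow> ereal" where
  "ereal_ln x = (if x = \<infinity> then \<infinity> else if x \<le> 0 then - \<infinity> else ereal (ln (real_of_ereal x)))"

(* for 0 \<le> x and 0 < p *)
definition ereal_powr :: "ereal \<Rightarrow> real \<Rightarrow> ereal" where
  "ereal_powr x p = (if x = \<infinity> then \<infinity> else ereal (real_of_ereal x powr p))"


(* A base measure on a subset of R^d is represented as the Borel measure on R^d that it induces. *)

definition Theta :: "nat \<Rightarrow> point measure \<Rightarrow> point set" where
  "Theta d \<mu> = {\<theta> \<in> Rd d. (\<integral>\<^sup>+ y. ennreal (exp (dot d \<theta> y)) \<partial>\<mu>) < \<infinity>}"

definition psi :: "nat \<Rightarrow> point measure \<Rightarrow> point \<Rightarrow> real" where
  "psi d \<mu> \<theta> = ln (\<integral> y. exp (dot d \<theta> y) \<partial>\<mu>)"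

definition proper_affine_subspace :: "nat \<Rightarrow> point set \<Rightarrow> bool" where
  "proper_affine_subspace d A \<longleftrightarrow> A \<subset> Rd d \<and> (\<forall>x \<in> A. \<forall>y \<in> A. \<forall>t. segment_pt d t x y \<in> A)"

(* Fullness is built in: the parameter space is always the whole of Theta d \<mu>. *)
definition regular_minimal_family :: "nat \<Rightarrow> point measure \<Rightarrow> bool" where
  "regular_minimal_family d \<mu> \<longleftrightarrow>
     sets \<mu> = sets (leb d)
     \<and> openin (powertop_real {..<d}) (Theta d \<mu>)
     \<and> \<not> (\<exists>A. proper_affine_subspace d A \<and> (AE y in \<mu>. y \<in> A))"

definition has_log_concave_density :: "nat \<Rightarrow> point measure \<Rightarrow> bool" where
  "has_log_concave_density d \<mu> \<longleftrightarrow>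
     (\<exists>f \<in> borel_measurable (leb d).
        (\<forall>x \<in> Rd d. 0 \<le> f x)
        \<and> (\<forall>x \<in> Rd d. \<forall>y \<in> Rd d. \<forall>t \<in> {0<..<1}.
             f x powr (1 - t) * f y powr t \<le> f (segment_pt d t x y))
        \<and> \<mu> = density (leb d) (\<lambda>x. ennreal (f x)))"

definition P_fam :: "nat \<Rightarrow> point measure \<Rightarrow> point \<Rightarrow> point measure" where
  "P_fam d \<mu> \<theta> = density \<mu> (\<lambda>y. ennreal (exp (dot d \<theta> y - psi d \<mu> \<theta>)))"

definition E_fam :: "nat \<Rightarrow> point measure \<Rightarrow> point \<Rightarrow> (point \<Rightarrow> real) \<Rightarrow> real" where
  "E_fam d \<mu> \<theta> g = (\<integral> y. g y \<partial>P_fam d \<mu> \<theta>)"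

definition central_moment :: "nat \<Rightarrow> point measure \<Rightarrow> point \<Rightarrow> nat \<Rightarrow> point \<Rightarrow> real" where
  "central_moment d \<mu> \<theta> k u = E_fam d \<mu> \<theta> (\<lambda>y. (dot d u y - E_fam d \<mu> \<theta> (dot d u)) ^ k)"

definition Fmat :: "nat \<Rightarrow> point measure \<Rightarrow> point \<Rightarrow> real Matrix.mat" where
  "Fmat d \<mu> \<theta> = Matrix.mat d d (\<lambda>(i, j).
     E_fam d \<mu> \<theta> (\<lambda>y. (y i - E_fam d \<mu> \<theta> (\<lambda>z. z i)) * (y j - E_fam d \<mu> \<theta> (\<lambda>z. z j))))"

definition sample :: "nat \<Rightarrow> nat \<Rightarrow> point measure \<Rightarrow> point \<Rightarrow> (nat \<Rightarrow> point) measure" where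
  "sample d n \<mu> \<theta>s = (\<Pi>\<^sub>M i\<in>{..<n}. P_fam d \<mu> \<theta>s)"

definition nll :: "nat \<Rightarrow> nat \<Rightarrow> point measure \<Rightarrow> (nat \<Rightarrow> point) \<Rightarrow> point \<Rightarrow> real" where
  "nll d n \<mu> Y \<theta> = psi d \<mu> \<theta> - (1 / real n) * (\<Sum>i<n. dot d (Y i) \<theta>)"

definition MLE_exists_unique :: "nat \<Rightarrow> nat \<Rightarrow> point measure \<Rightarrow> (nat \<Rightarrow> point) \<Rightarrow> bool" where
  "MLE_exists_unique d n \<mu> Y \<longleftrightarrow> (\<exists>!\<theta>. is_arg_min (nll d n \<mu> Y) (\<lambda>\<theta>. \<theta> \<in> Theta d \<mu>) \<theta>)"

definition MLE :: "nat \<Rightarrow> nat \<Rightarrow> point measure \<Rightarrow> (nat \<Rightarrow> point) \<Rightarrow> point" where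
  "MLE d n \<mu> Y = arg_min_on (nll d n \<mu> Y) (Theta d \<mu>)"

definition is_prior :: "nat \<Rightarrow> point measure \<Rightarrow> (point \<Rightarrow> real) \<Rightarrow> bool" where
  "is_prior d \<mu> \<pi>0 \<longleftrightarrow>
     \<pi>0 \<in> borel_measurable (leb d) \<and> (\<forall>\<theta> \<in> Rd d. 0 \<le> \<pi>0 \<theta>)
     \<and> (\<integral>\<^sup>+ \<theta>. ennreal (\<pi>0 \<theta>) \<partial>leb d) = 1
     \<and> (\<forall>\<theta> \<in> Theta d \<mu>. 0 < \<pi>0 \<theta>)"

definition posterior ::
  "nat \<Rightarrow> nat \<Rightarrow> point measure \<Rightarrow> (point \<Rightarrow> real) \<Rightarrow> (nat \<Rightarrow> point) \<Rightarrow> point measure" where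
  "posterior d n \<mu> \<pi>0 Y =
     (let w = (\<lambda>\<theta>. ennreal (indicator (Theta d \<mu>) \<theta> * (exp (- real n * nll d n \<mu> Y \<theta>) * \<pi>0 \<theta>)))
      in density (leb d) (\<lambda>\<theta>. w \<theta> / (\<integral>\<^sup>+ \<theta>. w \<theta> \<partial>leb d)))"

definition gamma_star ::
  "nat \<Rightarrow> nat \<Rightarrow> point measure \<Rightarrow> point \<Rightarrow> (nat \<Rightarrow> point) \<Rightarrow> point measure" where
  "gamma_star d n \<mu> \<theta>s Y = gaussian d (MLE d n \<mu> Y) (inv_mat (smult_mat (real n) (Fmat d \<mu> \<theta>s)))"

definition Ustar :: "nat \<Rightarrow> nat \<Rightarrow> point measure \<Rightarrow> point \<Rightarrow> real \<Rightarrow> point set" where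
  "Ustar d n \<mu> \<theta>s s =
     {\<theta> \<in> Rd d. wnorm (Fmat d \<mu> \<theta>s) (diff_vec d \<theta> \<theta>s) \<le> s * sqrt (real d / real n)}"

definition delta2 :: "nat \<Rightarrow> nat \<Rightarrow> point measure \<Rightarrow> point \<Rightarrow> real \<Rightarrow> ereal" where
  "delta2 d n \<mu> \<theta>s s = (SUP \<theta> \<in> Ustar d n \<mu> \<theta>s s. ereal (opnorm
     (inv_sqrt_mat (Fmat d \<mu> \<theta>s) * Fmat d \<mu> \<theta> * inv_sqrt_mat (Fmat d \<mu> \<theta>s))))"

definition delta3 :: "nat \<Rightarrow> nat \<Rightarrow> point measure \<Rightarrow> point \<Rightarrow> real \<Rightarrow> ereal" where
  "delta3 d n \<mu> \<theta>s s = (SUP (\<theta>, u) \<in> Ustar d n \<mu> \<theta>s s \<times> (Rd d - {zero_pt d}).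
     ereal (central_moment d \<mu> \<theta> 3 u / central_moment d \<mu> \<theta>s 2 u powr (3 / 2)))"

(* Frechet differentiability on R^d, written out because points are functions *)
definition has_grad :: "nat \<Rightarrow> (point \<Rightarrow> real) \<Rightarrow> point \<Rightarrow> point \<Rightarrow> bool" where
  "has_grad d f x g \<longleftrightarrow> g \<in> Rd d \<and>
     (\<forall>e>0. \<exists>r>0. \<forall>y \<in> Rd d. vnorm (diff_vec d y x) < r \<longrightarrow>
        \<bar>f y - f x - (\<Sum>i<d. g i * (y i - x i))\<bar> \<le> e * vnorm (diff_vec d y x))"

definition grad :: "nat \<Rightarrow> (point \<Rightarrow> real) \<Rightarrow> point \<Rightarrow> point" where
  "grad d f x = (THE g. has_grad d f x g)"

(* As in C1_differentiable_on, derivatives are two-sided also at boundary points of U; their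
   continuity is required relative to U only. *)
definition C1_on :: "nat \<Rightarrow> (point \<Rightarrow> real) \<Rightarrow> point set \<Rightarrow> bool" where
  "C1_on d f U \<longleftrightarrow> (\<exists>g. (\<forall>x \<in> U. has_grad d f x (g x))
     \<and> continuous_map (subtopology (powertop_real {..<d}) U) (powertop_real {..<d}) g)"

definition delta01 ::
  "nat \<Rightarrow> nat \<Rightarrow> point measure \<Rightarrow> (point \<Rightarrow> real) \<Rightarrow> point \<Rightarrow> real \<Rightarrow> ereal" where
  "delta01 d n \<mu> \<pi>0 \<theta>s s =
     (if C1_on d \<pi>0 (Ustar d n \<mu> \<theta>s s) \<and> (\<forall>\<theta> \<in> Ustar d n \<mu> \<theta>s s. 0 < \<pi>0 \<theta>)
      then (SUP \<theta> \<in> Ustar d n \<mu> \<theta>s s. ereal (dual_wnorm (Fmat d \<mu> \<theta>s)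
              (Matrix.vec d (grad d (\<lambda>\<theta>. ln (\<pi>0 \<theta>)) \<theta>))))
      else \<infinity>)"

definition M0 :: "nat \<Rightarrow> point measure \<Rightarrow> (point \<Rightarrow> real) \<Rightarrow> point \<Rightarrow> ereal" where
  "M0 d \<mu> \<pi>0 \<theta>s = ereal_ln (SUP \<theta> \<in> Theta d \<mu>. ereal (\<pi>0 \<theta> / \<pi>0 \<theta>s)) / ereal (real d)"

end

theory Submission
  imports Defs
begin

text \<open>Work in the norm of \<open>n F*\<close>. By polarization the bound on the diagonal third moments bounds the
  mixed ones, so \<open>n F\<close> is close to \<open>n F*\<close> on a ball whose radius \<open>R\<close> is \<open>s\<close> times the square root of
  \<open>d\<close>. A Chernoff bound, averaged over all directions of the score, shows that the norm of the score is
  at most \<open>0.7 R\<close> with the required probability; then convexity of the likelihood forces a unique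
  minimiser within distance \<open>R\<close> of the truth.

  Relative to the Gaussian centred there, the posterior density is \<open>exp \<phi>\<close> up to normalisation, where
  the gradient of \<open>\<phi>\<close> at \<open>y\<close> is bounded by a small multiple of \<open>|y|\<close> plus the prior's contribution. The
  total variation distance is controlled by the \<open>L\<^sup>1\<close> norm of this gradient after a smooth cutoff, by
  the \<open>L\<^sup>1\<close> Poincare inequality for the Gaussian (turn \<open>x\<close> into an independent copy \<open>y\<close> along
  \<open>x cos t + y sin t\<close>). Outside the ball, convexity makes the posterior decay exponentially in \<open>R |y|\<close>,
  which yields the term with \<open>M0\<close>.\<close>

section \<open>Points of the Euclidean space and Lebesgue measure\<close>

text \<open>The constant must not depend on the dimension, so masses are compared only with one
  another: each is bounded through the volume of the unit ball of the form, and this volume cancels.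
  \<open>16 * C23\<close> makes the relative change of the information at most 1/5 at distance
  \<open>R\<close> from \<theta>s and 2/5 at distance \<open>2 R\<close>. At distance
  \<open>R\<close> the mean has therefore moved by at least \<open>4/5 R\<close>, more than a score
  of \<open>7/10 R\<close> can undo. The hypotheses concern \<open>2 * s\<close> because the ball of
  radius \<open>R\<close> around the estimator, itself within \<open>R\<close> of \<theta>s, must
  stay under control. On that ball \<phi> is at most \<open>|y|^2 / 5\<close> plus a linear term,
  against \<open>- |y|^2 / 2\<close> in the Gaussian, so the posterior keeps Gaussian decay. The
  rate: the gradient of \<phi> is of order \<open>R |y| / sqrt n\<close>, and the mean of
  \<open>|y|\<close> is of order \<open>sqrt d\<close>, which gives \<open>s d / sqrt n\<close>. An
  inequality in L1 fits because total variation is an L1 distance, and it is applied to the density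
  ratio under the exact Gaussian, so no functional inequality for the posterior is called
  for.\<close>

definition lc :: "nat \<Rightarrow> real \<Rightarrow> point \<Rightarrow> real \<Rightarrow> point \<Rightarrow> point" where
  "lc d a x b y = (\<lambda>i\<in>{..<d}. a * x i + b * y i)"

lemma lc_apply [simp]: "i < d \<Longrightarrow> lc d a x b y i = a * x i + b * y i"
  by (simp add: lc_def)

lemma lc_in_Rd [simp, intro]: "lc d a x b y \<in> Rd d"
  by (auto simp: lc_def Rd_def)

lemma zero_pt_in_Rd [simp, intro]: "zero_pt d \<in> Rd d"
  by (auto simp: zero_pt_def Rd_def)

lemma zero_pt_apply [simp]: "i < d \<Longrightarrow> zero_pt d i = 0"
  by (simp add: zero_pt_def)

lemma Rd_eqI: "x \<in> Rd d \<Longrightarrow> y \<in> Rd d \<Longrightarrow> (\<And>i. i < d \<Longrightarrow> x i = y i) \<Longrightarrow> x = y"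
  unfolding Rd_def by (rule PiE_ext) auto

lemma lc_eq_iff: "z \<in> Rd d \<Longrightarrow> lc d a x b y = z \<longleftrightarrow> (\<forall>i<d. a * x i + b * y i = z i)"
  by (auto intro!: Rd_eqI)

text \<open>Sums, differences, multiples and rays are all written with \<open>lc\<close>, as in
  \<open>lc d 1 x (-1) y\<close> for a difference and \<open>lc d c x 0 x\<close> for a multiple.
  This rule reduces the identities between them to real arithmetic in one coordinate.\<close>

lemma lc_cong: "(\<And>i. i < d \<Longrightarrow> a * x i + b * y i = a' * x' i + b' * y' i) \<Longrightarrow>
    lc d a x b y = lc d a' x' b' y'"
  by (rule Rd_eqI) auto

lemma lc_0_1 [simp]: "y \<in> Rd d \<Longrightarrow> lc d 0 x 1 y = y" "y \<in> Rd d \<Longrightarrow> lc d 1 y 0 x = y"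
  by (simp_all add: lc_eq_iff)

lemma lc_zero_pt [simp]: "y \<in> Rd d \<Longrightarrow> lc d a (zero_pt d) 1 y = y"
  "y \<in> Rd d \<Longrightarrow> lc d 1 y a (zero_pt d) = y"
  by (simp_all add: lc_eq_iff)

lemma lc_lc_line: "lc d 1 (lc d 1 \<theta> t u) s u = lc d 1 \<theta> (t + s) u"
  by (rule lc_cong) (simp add: algebra_simps)

text \<open>Rebasing a line at its point with parameter \<open>t\<close> reduces directional
  derivatives to parameter 0, where they are computed by hand.\<close>

lemma DERIV_line_shift:
  assumes "((\<lambda>s. f (lc d 1 (lc d 1 \<theta> t u) s u)) has_real_derivative D) (at 0)"
  shows "((\<lambda>t. f (lc d 1 \<theta> t u)) has_real_derivative D) (at t)"
  using assms DERIV_shift[of "\<lambda>t. f (lc d 1 \<theta> t u)" D 0 t] unfolding lc_lc_line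
  by (simp add: add.commute)

lemma segment_pt_lc: "segment_pt d t x y = lc d (1 - t) x t y"
  by (simp add: segment_pt_def lc_def)

lemma dot_lc_left: "dot d (lc d a x b y) z = a * dot d x z + b * dot d y z"
  by (simp add: dot_def sum_distrib_left sum.distrib[symmetric] algebra_simps)

lemma dot_lc_right: "dot d z (lc d a x b y) = a * dot d z x + b * dot d z y"
  by (simp add: dot_def sum_distrib_left sum.distrib[symmetric] algebra_simps)

lemma dot_commute: "dot d x y = dot d y x"
  by (simp add: dot_def mult.commute)

lemma dot_zero_pt [simp]: "dot d (zero_pt d) x = 0" "dot d x (zero_pt d) = 0"
  by (simp_all add: dot_def)

lemma space_leb [simp]: "space (leb d) = Rd d"
  by (simp add: leb_def space_PiM Rd_def)

lemma measurable_leb_component [measurable]: "i < d \<Longrightarrow> (\<lambda>x. x i) \<in> borel_measurable (leb d)"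
  unfolding leb_def by simp

lemma measurable_into_leb:
  assumes "\<And>i. i < d \<Longrightarrow> (\<lambda>x. f x i) \<in> borel_measurable M" "\<And>x. x \<in> space M \<Longrightarrow> f x \<in> Rd d"
  shows "f \<in> M \<rightarrow>\<^sub>M leb d"
  unfolding leb_def
proof (rule measurable_PiM_single')
  show "f \<in> space M \<rightarrow> {..<d} \<rightarrow>\<^sub>E space lborel" using assms(2) by (auto simp: Rd_def)
qed (use assms(1) in auto)

lemma measurable_lc [measurable]:
  assumes [measurable]: "f \<in> M \<rightarrow>\<^sub>M leb d" "g \<in> M \<rightarrow>\<^sub>M leb d"
    "a \<in> borel_measurable M" "b \<in> borel_measurable M"
  shows "(\<lambda>x. lc d (a x) (f x) (b x) (g x)) \<in> M \<rightarrow>\<^sub>M leb d"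
proof (rule measurable_into_leb)
  fix i assume i: "i < d"
  have [measurable]: "(\<lambda>x. f x i) \<in> borel_measurable M" "(\<lambda>x. g x i) \<in> borel_measurable M"
    using i measurable_compose[OF _ measurable_leb_component] assms by blast+
  show "(\<lambda>x. lc d (a x) (f x) (b x) (g x) i) \<in> borel_measurable M"
    using i by simp
qed simp

lemma measurable_dot [measurable]:
  assumes [measurable]: "f \<in> M \<rightarrow>\<^sub>M leb d" "g \<in> M \<rightarrow>\<^sub>M leb d"
  shows "(\<lambda>x. dot d (f x) (g x)) \<in> borel_measurable M"
proof -
  have [measurable]: "(\<lambda>x. f x i) \<in> borel_measurable M" "(\<lambda>x. g x i) \<in> borel_measurable M" if "i < d" for i
    using that measurable_compose[OF _ measurable_leb_component] assms by blast+
  show ?thesis unfolding dot_def by simp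
qed

interpretation lborel_prod: product_sigma_finite "\<lambda>i::nat. lborel :: real measure"
  by standard

lemma sigma_finite_leb [simp, intro]: "sigma_finite_measure (leb d)"
  unfolding leb_def by (rule lborel_prod.sigma_finite) simp

text \<open>Induction over the coordinates: Tonelli separates one of them, and the substitution rule
  on the line contributes one factor \<open>1 / c\<close>.\<close>

lemma nn_integral_PiM_lborel_affine:
  fixes c :: real and I :: "nat set"
  assumes "finite I" "c > 0" and [measurable]: "f \<in> borel_measurable (\<Pi>\<^sub>M i\<in>I. (lborel :: real measure))"
  shows "(\<integral>\<^sup>+x. f (\<lambda>i\<in>I. a i + c * x i) \<partial>(\<Pi>\<^sub>M i\<in>I. lborel)) =
    ennreal (1 / c ^ card I) * (\<integral>\<^sup>+x. f x \<partial>(\<Pi>\<^sub>M i\<in>I. lborel))"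
  using assms(1,3)
proof (induction I arbitrary: f)
  case empty
  then show ?case
    by (simp add: PiM_empty nn_integral_count_space_finite restrict_def)
next
  case (insert k I)
  note [measurable] = insert.prems
  have aff: "(\<lambda>x. a i + c * x i) \<in> borel_measurable (\<Pi>\<^sub>M i\<in>J. (lborel :: real measure))" if "i \<in> J" for i J
    using measurable_component_singleton[OF that, of "\<lambda>_. lborel :: real measure"]
    by (intro borel_measurable_add borel_measurable_times borel_measurable_const) simp
  have eq: "(\<lambda>i\<in>insert k I. a i + c * (x(k := y)) i) = (\<lambda>i\<in>I. a i + c * x i)(k := a k + c * y)" for x y
    using insert by (auto simp: fun_eq_iff)
  have [measurable]: "(\<lambda>x. \<integral>\<^sup>+y. f (x(k := y)) \<partial>lborel) \<in> borel_measurable (\<Pi>\<^sub>M i\<in>I. (lborel :: real measure))"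
    by measurable
  have m: "f \<circ> (\<lambda>y. x(k := y)) \<in> borel_measurable borel" if "x \<in> space (\<Pi>\<^sub>M i\<in>I. (lborel :: real measure))" for x
  proof -
    have "(\<lambda>y. x(k := y)) \<in> (lborel :: real measure) \<rightarrow>\<^sub>M (\<Pi>\<^sub>M i\<in>insert k I. (lborel :: real measure))"
      using that by measurable
    then show ?thesis using insert.prems measurable_comp by (metis measurable_lborel2)
  qed
  have "(\<integral>\<^sup>+x. f (\<lambda>i\<in>insert k I. a i + c * x i) \<partial>(\<Pi>\<^sub>M i\<in>insert k I. lborel)) =
    (\<integral>\<^sup>+x. (\<integral>\<^sup>+y. f (\<lambda>i\<in>insert k I. a i + c * (x(k := y)) i) \<partial>lborel) \<partial>(\<Pi>\<^sub>M i\<in>I. lborel))"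
  proof (rule lborel_prod.product_nn_integral_insert)
    show "(\<lambda>x. f (\<lambda>i\<in>insert k I. a i + c * x i)) \<in> borel_measurable (\<Pi>\<^sub>M i\<in>insert k I. lborel)"
      by (rule measurable_compose[OF _ insert.prems], rule measurable_restrict) (use aff in simp)
  qed (use insert in auto)
  also have "\<dots> = (\<integral>\<^sup>+x. (\<integral>\<^sup>+y. f ((\<lambda>i\<in>I. a i + c * x i)(k := a k + c * y)) \<partial>lborel) \<partial>(\<Pi>\<^sub>M i\<in>I. lborel))"
    by (simp only: eq)
  also have "\<dots> = (\<integral>\<^sup>+x. ennreal (1 / c) * (\<integral>\<^sup>+y. f ((\<lambda>i\<in>I. a i + c * x i)(k := y)) \<partial>lborel) \<partial>(\<Pi>\<^sub>M i\<in>I. lborel))"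
  proof (rule nn_integral_cong)
    fix x :: point
    let ?z = "\<lambda>i\<in>I. a i + c * x i"
    have z: "?z \<in> space (\<Pi>\<^sub>M i\<in>I. (lborel :: real measure))" by (auto simp: space_PiM)
    have "(\<integral>\<^sup>+y. f (?z(k := y)) \<partial>lborel) = ennreal c * (\<integral>\<^sup>+y. f (?z(k := a k + c * y)) \<partial>lborel)"
      using nn_integral_real_affine[of "\<lambda>y. f (?z(k := y))" c "a k"] m[OF z] \<open>c > 0\<close> by (simp add: o_def)
    then have "ennreal (1 / c) * (\<integral>\<^sup>+y. f (?z(k := y)) \<partial>lborel) =
      ennreal (1/c) * ennreal c * (\<integral>\<^sup>+y. f (?z(k := a k + c * y)) \<partial>lborel)" by (simp add: mult.assoc)
    also have "ennreal (1/c) * ennreal c = 1" using \<open>c > 0\<close> by (simp add: ennreal_mult[symmetric])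
    finally show "(\<integral>\<^sup>+y. f (?z(k := a k + c * y)) \<partial>lborel) =
      ennreal (1 / c) * (\<integral>\<^sup>+y. f (?z(k := y)) \<partial>lborel)" by (simp only: mult_1)
  qed
  also have "\<dots> = ennreal (1 / c) * (\<integral>\<^sup>+x. (\<integral>\<^sup>+y. f ((\<lambda>i\<in>I. a i + c * x i)(k := y)) \<partial>lborel) \<partial>(\<Pi>\<^sub>M i\<in>I. lborel))"
  proof (rule nn_integral_cmult)
    show "(\<lambda>x. \<integral>\<^sup>+y. f ((\<lambda>i\<in>I. a i + c * x i)(k := y)) \<partial>lborel) \<in> borel_measurable (\<Pi>\<^sub>M i\<in>I. lborel)"
      by (rule measurable_compose[where g = "\<lambda>x. \<integral>\<^sup>+y. f (x(k := y)) \<partial>lborel" and N = "\<Pi>\<^sub>M i\<in>I. lborel"],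
          rule measurable_restrict) (use aff in simp_all)
  qed
  also have "(\<integral>\<^sup>+x. (\<integral>\<^sup>+y. f ((\<lambda>i\<in>I. a i + c * x i)(k := y)) \<partial>lborel) \<partial>(\<Pi>\<^sub>M i\<in>I. lborel)) =
     ennreal (1 / c ^ card I) * (\<integral>\<^sup>+x. (\<integral>\<^sup>+y. f (x(k := y)) \<partial>lborel) \<partial>(\<Pi>\<^sub>M i\<in>I. lborel))"
    by (rule insert.IH) measurable
  also have "(\<integral>\<^sup>+x. (\<integral>\<^sup>+y. f (x(k := y)) \<partial>lborel) \<partial>(\<Pi>\<^sub>M i\<in>I. lborel)) =
     (\<integral>\<^sup>+x. f x \<partial>(\<Pi>\<^sub>M i\<in>insert k I. lborel))"
    by (rule lborel_prod.product_nn_integral_insert[symmetric]) (use insert in auto)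
  also have "ennreal (1 / c) * (ennreal (1 / c ^ card I) * (\<integral>\<^sup>+x. f x \<partial>(\<Pi>\<^sub>M i\<in>insert k I. lborel))) =
    ennreal (1 / c ^ card (insert k I)) * (\<integral>\<^sup>+x. f x \<partial>(\<Pi>\<^sub>M i\<in>insert k I. lborel))"
    using insert \<open>c > 0\<close> by (simp add: mult.assoc[symmetric] ennreal_mult[symmetric] field_simps)
  finally show ?case .
qed

lemma nn_integral_leb_affine:
  assumes "c > 0" and [measurable]: "f \<in> borel_measurable (leb d)"
  shows "(\<integral>\<^sup>+x. f (lc d 1 a c x) \<partial>leb d) = ennreal (1 / c ^ d) * (\<integral>\<^sup>+x. f x \<partial>leb d)"
  using nn_integral_PiM_lborel_affine[of "{..<d}" c f a] assms
  by (simp add: leb_def lc_def)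

lemma nn_integral_leb_translate:
  assumes [measurable]: "f \<in> borel_measurable (leb d)"
  shows "(\<integral>\<^sup>+x. f (lc d 1 a 1 x) \<partial>leb d) = (\<integral>\<^sup>+x. f x \<partial>leb d)"
  using nn_integral_leb_affine[of 1 f d a] by simp

lemma nn_integral_leb_scale:
  assumes "c > 0" and [measurable]: "f \<in> borel_measurable (leb d)"
  shows "(\<integral>\<^sup>+x. f (lc d c x 0 x) \<partial>leb d) = ennreal (1 / c ^ d) * (\<integral>\<^sup>+x. f x \<partial>leb d)"
proof -
  have "lc d c x 0 x = lc d 1 (zero_pt d) c x" for x by (rule lc_cong) simp
  then show ?thesis using nn_integral_leb_affine[OF assms, of "zero_pt d"] by simp
qed

lemma pair_sigma_finite_leb: "pair_sigma_finite (leb d) (leb d)"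
  by (intro pair_sigma_finite.intro) auto

text \<open>A rotation in the plane spanned by two independent copies of the space is the composition of
  two affine substitutions, one in each copy.\<close>

lemma nn_integral_leb_rotate:
  assumes "c > 0" "c\<^sup>2 + s\<^sup>2 = 1"
    and [measurable]: "(\<lambda>(x, y). f x y) \<in> borel_measurable (leb d \<Otimes>\<^sub>M leb d)"
  shows "(\<integral>\<^sup>+x. \<integral>\<^sup>+y. f (lc d c x s y) (lc d c y (- s) x) \<partial>leb d \<partial>leb d) =
    (\<integral>\<^sup>+x. \<integral>\<^sup>+y. f x y \<partial>leb d \<partial>leb d)"
proof -
  interpret pair_sigma_finite "leb d" "leb d" by (rule pair_sigma_finite_leb)
  have mf: "(\<lambda>x. f (g x) (h x)) \<in> borel_measurable M" if "g \<in> M \<rightarrow>\<^sub>M leb d" "h \<in> M \<rightarrow>\<^sub>M leb d"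
    for g h and M :: "point measure"
    using measurable_compose[OF measurable_Pair[OF that] assms(3)] by simp
  have mf': "(\<lambda>x. f (g x) (h x)) \<in> borel_measurable M" if "g \<in> M \<rightarrow>\<^sub>M leb d" "h \<in> M \<rightarrow>\<^sub>M leb d"
    for g h and M :: "(point \<times> point) measure"
    using measurable_compose[OF measurable_Pair[OF that] assms(3)] by simp
  have mf'': "(\<lambda>x. f (g x) (h x)) \<in> borel_measurable M" if "g \<in> M \<rightarrow>\<^sub>M leb d" "h \<in> M \<rightarrow>\<^sub>M leb d"
    for g h and M :: "point measure"
    using measurable_compose[OF measurable_Pair[OF that] assms(3)] by simp
  have "(\<integral>\<^sup>+x. \<integral>\<^sup>+y. f (lc d c x s y) (lc d c y (- s) x) \<partial>leb d \<partial>leb d) =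
    (\<integral>\<^sup>+y. \<integral>\<^sup>+x. f (lc d c x s y) (lc d c y (- s) x) \<partial>leb d \<partial>leb d)"
    by (rule Fubini'[symmetric]) (auto intro!: mf' simp: case_prod_beta')
  \<comment> \<open>For fixed \<open>y\<close> put \<open>x' = c x + s y\<close>; then
    \<open>c y - s x = (y - s x') / c\<close> because \<open>c^2 + s^2 = 1\<close>. The later
    substitution in \<open>y\<close> has the reciprocal Jacobian, so the two factors cancel.\<close>
  also have "\<dots> = (\<integral>\<^sup>+y. \<integral>\<^sup>+x. f (lc d 1 (lc d s y 0 y) c x) (lc d (1/c) y (- s/c) (lc d 1 (lc d s y 0 y) c x)) \<partial>leb d \<partial>leb d)"
  proof (intro nn_integral_cong)
    fix x y
    have "lc d c x s y = lc d 1 (lc d s y 0 y) c x" by (rule lc_cong) simp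
    moreover have "lc d c y (- s) x = lc d (1/c) y (- s/c) (lc d 1 (lc d s y 0 y) c x)"
    proof (rule lc_cong)
      fix i assume "i < d"
      have "c = (1 - s\<^sup>2) / c" using assms(1,2) by (simp add: field_simps power2_eq_square)
      then have "c * y i = ((1 - s\<^sup>2) / c) * y i" by simp
      then show "c * y i + - s * x i = 1 / c * y i + - s / c * lc d 1 (lc d s y 0 y) c x i"
        using \<open>i < d\<close> assms(1) by (simp add: field_simps power2_eq_square)
    qed
    ultimately show "f (lc d c x s y) (lc d c y (- s) x) =
      f (lc d 1 (lc d s y 0 y) c x) (lc d (1/c) y (- s/c) (lc d 1 (lc d s y 0 y) c x))" by simp
  qed
  also have "\<dots> = (\<integral>\<^sup>+y. ennreal (1 / c ^ d) * (\<integral>\<^sup>+x. f x (lc d (1/c) y (- s/c) x) \<partial>leb d) \<partial>leb d)"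
    by (rule nn_integral_cong, rule nn_integral_leb_affine[OF \<open>c > 0\<close>]) (auto intro!: mf'')
  also have "\<dots> = ennreal (1 / c ^ d) * (\<integral>\<^sup>+y. \<integral>\<^sup>+x. f x (lc d (1/c) y (- s/c) x) \<partial>leb d \<partial>leb d)"
    by (rule nn_integral_cmult, rule sigma_finite_measure.borel_measurable_nn_integral)
      (auto intro!: mf' simp: case_prod_beta')
  also have "(\<integral>\<^sup>+y. \<integral>\<^sup>+x. f x (lc d (1/c) y (- s/c) x) \<partial>leb d \<partial>leb d) =
     (\<integral>\<^sup>+x. \<integral>\<^sup>+y. f x (lc d (1/c) y (- s/c) x) \<partial>leb d \<partial>leb d)"
    by (rule Fubini') (auto intro!: mf' simp: case_prod_beta')
  also have "\<dots> = (\<integral>\<^sup>+x. \<integral>\<^sup>+y. f x (lc d 1 (lc d (- s/c) x 0 x) (1/c) y) \<partial>leb d \<partial>leb d)"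
  proof (intro nn_integral_cong)
    fix x y
    have "lc d (1/c) y (- s/c) x = lc d 1 (lc d (- s/c) x 0 x) (1/c) y" by (rule lc_cong) simp
    then show "f x (lc d (1/c) y (- s/c) x) = f x (lc d 1 (lc d (- s/c) x 0 x) (1/c) y)" by simp
  qed
  also have "\<dots> = (\<integral>\<^sup>+x. ennreal (1 / (1/c) ^ d) * (\<integral>\<^sup>+y. f x y \<partial>leb d) \<partial>leb d)"
    by (rule nn_integral_cong, rule nn_integral_leb_affine) (use assms(1) in \<open>auto intro!: mf''\<close>)
  also have "\<dots> = ennreal (1 / (1/c) ^ d) * (\<integral>\<^sup>+x. \<integral>\<^sup>+y. f x y \<partial>leb d \<partial>leb d)"
    by (rule nn_integral_cmult) measurable
  also have "ennreal (1 / c ^ d) * \<dots> = (\<integral>\<^sup>+x. \<integral>\<^sup>+y. f x y \<partial>leb d \<partial>leb d)"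
    using assms(1) by (simp add: mult.assoc[symmetric] ennreal_mult[symmetric] field_simps)
  finally show ?thesis .
qed

section \<open>Positive definite forms and Gaussian integrals\<close>

definition qf :: "nat \<Rightarrow> (nat \<Rightarrow> nat \<Rightarrow> real) \<Rightarrow> point \<Rightarrow> point \<Rightarrow> real" where
  "qf d a x y = (\<Sum>i<d. \<Sum>j<d. a i j * x i * y j)"

definition posdef :: "nat \<Rightarrow> (nat \<Rightarrow> nat \<Rightarrow> real) \<Rightarrow> bool" where
  "posdef d a \<longleftrightarrow> (\<forall>i<d. \<forall>j<d. a i j = a j i) \<and> (\<forall>x\<in>Rd d. x \<noteq> zero_pt d \<longrightarrow> 0 < qf d a x x)"

definition form_mat :: "nat \<Rightarrow> (nat \<Rightarrow> nat \<Rightarrow> real) \<Rightarrow> real Matrix.mat" where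
  "form_mat d a = Matrix.mat d d (\<lambda>(i, j). a i j)"

lemma form_mat_carrier [simp]: "form_mat d a \<in> carrier_mat d d"
  "dim_row (form_mat d a) = d" "dim_col (form_mat d a) = d"
  by (simp_all add: form_mat_def)

lemma qf_cong: "(\<And>i. i < d \<Longrightarrow> x i = x' i) \<Longrightarrow> (\<And>i. i < d \<Longrightarrow> y i = y' i) \<Longrightarrow> qf d a x y = qf d a x' y'"
  unfolding qf_def by (intro sum.cong) auto

lemma scalar_prod_form_mat:
  "scalar_prod (Matrix.vec d x) (form_mat d a *\<^sub>v Matrix.vec d y) = qf d a x y"
  by (simp add: scalar_prod_def form_mat_def qf_def atLeast0LessThan sum_distrib_left mult_ac)

lemma vec_of_Rd:
  assumes "v \<in> carrier_vec d"
  obtains x where "x \<in> Rd d" "v = Matrix.vec d x"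
proof
  show "(\<lambda>i\<in>{..<d}. v $ i) \<in> Rd d" by (auto simp: Rd_def)
  show "v = Matrix.vec d (\<lambda>i\<in>{..<d}. v $ i)" using assms by auto
qed

lemma qf_lc_left: "qf d a (lc d s x t y) z = s * qf d a x z + t * qf d a y z"
  by (simp add: qf_def sum_distrib_left sum.distrib[symmetric] algebra_simps)

lemma qf_lc_right: "qf d a z (lc d s x t y) = s * qf d a z x + t * qf d a z y"
  by (simp add: qf_def sum_distrib_left sum.distrib[symmetric] algebra_simps)

lemma qf_zero_pt [simp]: "qf d a (zero_pt d) x = 0" "qf d a x (zero_pt d) = 0"
  by (simp_all add: qf_def)

lemma qf_commute:
  assumes "posdef d a"
  shows "qf d a x y = qf d a y x"
proof -
  have "qf d a x y = (\<Sum>j<d. \<Sum>i<d. a i j * x i * y j)"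
    unfolding qf_def by (rule sum.swap)
  also have "\<dots> = qf d a y x"
    unfolding qf_def using assms by (intro sum.cong refl) (auto simp: posdef_def mult_ac)
  finally show ?thesis .
qed

lemma qf_pos: "posdef d a \<Longrightarrow> x \<in> Rd d \<Longrightarrow> x \<noteq> zero_pt d \<Longrightarrow> 0 < qf d a x x"
  by (simp add: posdef_def)

lemma qf_nonneg: "posdef d a \<Longrightarrow> 0 \<le> qf d a x x"
proof -
  assume a: "posdef d a"
  have "qf d a x x = qf d a (lc d 1 x 0 x) (lc d 1 x 0 x)" by (rule qf_cong) auto
  also have "\<dots> \<ge> 0" using qf_pos[OF a lc_in_Rd, of 1 x 0 x]
    by (cases "lc d 1 x 0 x = zero_pt d") auto
  finally show ?thesis .
qed

lemma det_form_mat_nonzero: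
  assumes "posdef d a"
  shows "det (form_mat d a) \<noteq> 0"
proof
  assume "det (form_mat d a) = 0"
  then obtain v where v: "v \<in> carrier_vec d" "v \<noteq> 0\<^sub>v d" "form_mat d a *\<^sub>v v = 0\<^sub>v d"
    using det_0_iff_vec_prod_zero[OF form_mat_carrier(1)] by blast
  obtain x where x: "x \<in> Rd d" "v = Matrix.vec d x" using vec_of_Rd v(1) by blast
  have "x \<noteq> zero_pt d" using v x by (auto simp: zero_pt_def)
  then have "0 < qf d a x x" using assms x by (simp add: qf_pos)
  also have "qf d a x x = 0" using v(3) x scalar_prod_form_mat[of d x a x] by simp
  finally show False by simp
qed

lemma invertible_matE:
  fixes A :: "real Matrix.mat"
  assumes "A \<in> carrier_mat n n" "det A \<noteq> 0"
  shows "inv_mat A \<in> carrier_mat n n" "A * inv_mat A = 1\<^sub>m n" "inv_mat A * A = 1\<^sub>m n"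
proof -
  have "A \<in> Units (ring_mat TYPE(real) n ())" by (rule det_non_zero_imp_unit[OF assms])
  then obtain B where B: "mat_inverse A = Some B" using mat_inverse(1)[OF assms(1), where b = "()"] by (cases "mat_inverse A") auto
  then have "inv_mat A = B" by (simp add: inv_mat_def)
  with mat_inverse(2)[OF assms(1) B]
  show "inv_mat A \<in> carrier_mat n n" "A * inv_mat A = 1\<^sub>m n" "inv_mat A * A = 1\<^sub>m n" by auto
qed

lemma inverse_mat_unique:
  fixes A :: "real Matrix.mat"
  assumes "A \<in> carrier_mat n n" "B \<in> carrier_mat n n" "A * B = 1\<^sub>m n"
  shows "inv_mat A = B"
proof -
  have "det A * det B = 1" using det_mult[OF assms(1,2)] assms(3) by simp
  then have "det A \<noteq> 0" by auto
  note inv = invertible_matE[OF assms(1) this]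
  have "inv_mat A = inv_mat A * (A * B)" using inv(1) assms by simp
  also have "\<dots> = (inv_mat A * A) * B" using inv(1) assms by (simp add: assoc_mult_mat[of _ n n])
  also have "\<dots> = B" using inv assms by simp
  finally show ?thesis .
qed

text \<open>Solve \<open>A v = g\<close> with the inverse matrix. Cauchy-Schwarz for
  \<open>qf\<close> then bounds the functional by the norm of \<open>v\<close>, which is how
  coordinates, gradients and scores are measured in the geometry of the form.\<close>

lemma posdef_riesz:
  assumes "posdef d a"
  obtains v where "v \<in> Rd d" "\<And>u. qf d a v u = dot d g u"
proof -
  let ?A = "form_mat d a"
  note inv = invertible_matE[OF form_mat_carrier(1) det_form_mat_nonzero[OF assms]]
  obtain v where v: "v \<in> Rd d" "inv_mat ?A *\<^sub>v Matrix.vec d g = Matrix.vec d v"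
    using vec_of_Rd[of "inv_mat ?A *\<^sub>v Matrix.vec d g" d] inv by auto
  have "?A *\<^sub>v Matrix.vec d v = (?A * inv_mat ?A) *\<^sub>v Matrix.vec d g"
    unfolding v(2)[symmetric] using inv by (subst assoc_mult_mat_vec[of _ d d]) auto
  then have *: "?A *\<^sub>v Matrix.vec d v = Matrix.vec d g" using inv by simp
  have "qf d a v u = dot d g u" for u
  proof -
    have "qf d a v u = qf d a u v" by (rule qf_commute[OF assms])
    also have "\<dots> = scalar_prod (Matrix.vec d u) (Matrix.vec d g)"
      by (simp only: scalar_prod_form_mat[symmetric] *)
    also have "\<dots> = dot d g u" by (simp add: scalar_prod_def dot_def atLeast0LessThan mult.commute)
    finally show ?thesis .
  qed
  with v(1) show ?thesis by (rule that)
qed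

section \<open>Schur complements and the Gaussian integral\<close>

lemma nn_integral_gaussian_1d:
  assumes "\<alpha> > 0"
  shows "(\<integral>\<^sup>+w. ennreal (exp (- (\<alpha> * (w + \<beta>)\<^sup>2 / 2))) \<partial>lborel) = ennreal (sqrt (2 * pi / \<alpha>))"
proof -
  let ?s = "1 / sqrt \<alpha>"
  interpret prob_space "density lborel (normal_density (- \<beta>) ?s)"
    using assms by (intro prob_space_normal_density) auto
  have 1: "(\<integral>\<^sup>+w. ennreal (normal_density (- \<beta>) ?s w) \<partial>lborel) = 1"
    using emeasure_space_1 by (simp add: emeasure_density)
  have "exp (- (\<alpha> * (w + \<beta>)\<^sup>2 / 2)) = sqrt (2 * pi / \<alpha>) * normal_density (- \<beta>) ?s w" for w
    using assms by (simp add: normal_density_def power_divide real_sqrt_divide real_sqrt_mult)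
  then have "(\<integral>\<^sup>+w. ennreal (exp (- (\<alpha> * (w + \<beta>)\<^sup>2 / 2))) \<partial>lborel) =
      ennreal (sqrt (2 * pi / \<alpha>)) * (\<integral>\<^sup>+w. ennreal (normal_density (- \<beta>) ?s w) \<partial>lborel)"
    using assms by (simp add: ennreal_mult nn_integral_cmult)
  then show ?thesis using 1 by simp
qed

text \<open>Completing the square in the last coordinate leaves the form of the Schur complement.
  Testing the form on the last unit vector shows that the pivot is positive.\<close>

lemma qf_Suc:
  assumes "posdef (Suc d) a"
  shows "qf (Suc d) a x x = qf d (\<lambda>i j. a i j - a i d * a d j / a d d) x x
    + a d d * (x d + (\<Sum>i<d. a i d * x i) / a d d)\<^sup>2" "0 < a d d"
proof -
  have sym: "a d i = a i d" if "i < d" for i using assms that by (simp add: posdef_def)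
  define e where "e = (\<lambda>i\<in>{..<Suc d}. if i = d then 1 else (0::real))"
  have "e \<in> Rd (Suc d)" "e \<noteq> zero_pt (Suc d)" by (auto simp: e_def Rd_def zero_pt_def fun_eq_iff)
  then have "0 < qf (Suc d) a e e" using assms qf_pos by blast
  also have "qf (Suc d) a e e = a d d" by (simp add: qf_def e_def)
  finally show pos: "0 < a d d" .
  define b where "b = (\<Sum>i<d. a i d * x i)"
  have b2: "b\<^sup>2 = (\<Sum>i<d. \<Sum>j<d. a i d * a d j * x i * x j)"
    unfolding b_def power2_eq_square sum_product by (intro sum.cong refl) (simp add: sym mult_ac)
  have "qf (Suc d) a x x = qf d a x x + (\<Sum>i<d. a i d * x i * x d) + (\<Sum>j<d. a d j * x d * x j) + a d d * x d * x d"
    by (simp add: qf_def sum.distrib)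
  also have "(\<Sum>i<d. a i d * x i * x d) = b * x d" by (simp add: b_def sum_distrib_right)
  also have "(\<Sum>j<d. a d j * x d * x j) = b * x d"
    unfolding b_def sum_distrib_right by (intro sum.cong refl) (simp add: sym)
  also have "qf d (\<lambda>i j. a i j - a i d * a d j / a d d) x x = qf d a x x - b\<^sup>2 / a d d"
    by (simp add: b2 qf_def sum_subtractf[symmetric] sum_divide_distrib left_diff_distrib)
  then have "qf d a x x = qf d (\<lambda>i j. a i j - a i d * a d j / a d d) x x + b\<^sup>2 / a d d" by simp
  finally show "qf (Suc d) a x x = qf d (\<lambda>i j. a i j - a i d * a d j / a d d) x x
    + a d d * (x d + (\<Sum>i<d. a i d * x i) / a d d)\<^sup>2"
    using pos unfolding b_def[symmetric] by (simp add: field_simps power2_eq_square)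
qed

lemma posdef_schur:
  assumes "posdef (Suc d) a"
  shows "posdef d (\<lambda>i j. a i j - a i d * a d j / a d d)"
  unfolding posdef_def
proof (intro conjI ballI allI impI)
  fix x assume x: "x \<in> Rd d" "x \<noteq> zero_pt d"
  \<comment> \<open>The last coordinate makes the completed square vanish, so the large form at
    \<open>y\<close> equals the Schur complement at \<open>x\<close>.\<close>
  define y where "y = x(d := - (\<Sum>i<d. a i d * x i) / a d d)"
  have "y \<in> Rd (Suc d)" using x by (auto simp: y_def Rd_def PiE_def extensional_def)
  moreover have "y \<noteq> zero_pt (Suc d)"
  proof
    assume "y = zero_pt (Suc d)"
    then have "y i = 0" if "i < d" for i using that by simp
    then have "x = zero_pt d" using x by (intro Rd_eqI) (auto simp: y_def)
    with x show False by simp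
  qed
  ultimately have "0 < qf (Suc d) a y y" using assms qf_pos by blast
  also have "\<dots> = qf d (\<lambda>i j. a i j - a i d * a d j / a d d) y y"
    using qf_Suc(2)[OF assms] by (subst qf_Suc(1)[OF assms]) (simp add: y_def)
  also have "\<dots> = qf d (\<lambda>i j. a i j - a i d * a d j / a d d) x x"
    by (rule qf_cong) (auto simp: y_def)
  finally show "0 < qf d (\<lambda>i j. a i j - a i d * a d j / a d d) x x" .
next
  fix i j assume "i < d" "j < d"
  then have "a i j = a j i" "a i d = a d i" "a d j = a j d" using assms by (simp_all add: posdef_def)
  then show "a i j - a i d * a d j / a d d = a j i - a j d * a d i / a d d" by simp
qed

text \<open>Block elimination: the matrix is a unit upper triangular block matrix times a lower
  triangular one whose diagonal blocks are the Schur complement and the pivot.\<close>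

lemma det_schur:
  fixes a :: "nat \<Rightarrow> nat \<Rightarrow> real"
  assumes "a d d \<noteq> 0"
  shows "det (form_mat (Suc d) a) = a d d * det (form_mat d (\<lambda>i j. a i j - a i d * a d j / a d d))"
proof -
  let ?S = "form_mat d (\<lambda>i j. a i j - a i d * a d j / a d d)"
  let ?U = "four_block_mat (1\<^sub>m d) (Matrix.mat d 1 (\<lambda>(i, j). a i d / a d d)) (0\<^sub>m 1 d) (1\<^sub>m 1)"
  let ?L = "four_block_mat ?S (0\<^sub>m d 1) (Matrix.mat 1 d (\<lambda>(i, j). a d j)) (Matrix.mat 1 1 (\<lambda>_. a d d))"
  have "?U * ?L = four_block_mat (1\<^sub>m d * ?S + Matrix.mat d 1 (\<lambda>(i, j). a i d / a d d) * Matrix.mat 1 d (\<lambda>(i, j). a d j))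
      (1\<^sub>m d * 0\<^sub>m d 1 + Matrix.mat d 1 (\<lambda>(i, j). a i d / a d d) * Matrix.mat 1 1 (\<lambda>_. a d d))
      (0\<^sub>m 1 d * ?S + 1\<^sub>m 1 * Matrix.mat 1 d (\<lambda>(i, j). a d j))
      (0\<^sub>m 1 d * 0\<^sub>m d 1 + 1\<^sub>m 1 * Matrix.mat 1 1 (\<lambda>_. a d d))"
    by (rule mult_four_block_mat[of _ d d _ 1 _ 1]) auto
  also have "\<dots> = form_mat (Suc d) a"
    using assms by (intro eq_matI) (auto simp: form_mat_def scalar_prod_def less_Suc_eq not_less)
  finally have eq: "form_mat (Suc d) a = ?U * ?L" ..
  have "det (form_mat (Suc d) a) = det ?U * det ?L"
    unfolding eq by (rule det_mult[of _ "Suc d"]) (auto intro!: carrier_matI)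
  also have "det ?U = 1"
    by (subst det_four_block_mat_lower_left_zero[of _ d _ 1]) auto
  also have "det ?L = det ?S * a d d"
    by (subst det_four_block_mat_upper_right_zero[of _ d _ 1]) (auto simp: det_single)
  finally show ?thesis by simp
qed

lemma measurable_qf [measurable]:
  assumes [measurable]: "f \<in> M \<rightarrow>\<^sub>M leb d" "g \<in> M \<rightarrow>\<^sub>M leb d"
  shows "(\<lambda>x. qf d a (f x) (g x)) \<in> borel_measurable M"
proof -
  have [measurable]: "(\<lambda>x. f x i) \<in> borel_measurable M" "(\<lambda>x. g x i) \<in> borel_measurable M" if "i < d" for i
    using that measurable_compose[OF _ measurable_leb_component] assms by blast+
  show ?thesis unfolding qf_def by simp
qed

text \<open>Integrating out the last coordinate contributes \<open>sqrt (2 * pi / a d d)\<close>,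
  and the same pivot is the factor that \<open>det_schur\<close> splits off. The induction replaces
  a diagonalisation and yields the sign of the determinant on the way.\<close>

lemma gaussian_integral:
  assumes "posdef d a"
  shows "0 < det (form_mat d a) \<and>
    (\<integral>\<^sup>+x. ennreal (exp (- qf d a x x / 2)) \<partial>leb d) = ennreal (sqrt ((2 * pi) ^ d / det (form_mat d a)))"
  using assms
proof (induction d arbitrary: a)
  case 0
  have "det (form_mat 0 a) = 1" by (simp add: form_mat_def det_def)
  then show ?case by (simp add: leb_def PiM_empty nn_integral_count_space_finite qf_def)
next
  case (Suc d)
  let ?S = "\<lambda>i j. a i j - a i d * a d j / a d d"
  let ?\<beta> = "\<lambda>x::point. (\<Sum>i<d. a i d * x i) / a d d"
  note IH = Suc.IH[OF posdef_schur[OF Suc.prems]]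
  have pos: "0 < a d d" by (rule qf_Suc(2)[OF Suc.prems])
  have det: "det (form_mat (Suc d) a) = a d d * det (form_mat d ?S)" using pos by (intro det_schur) simp
  have leb_eq: "leb (Suc d) = (\<Pi>\<^sub>M i\<in>insert d {..<d}. lborel)" by (simp add: leb_def lessThan_Suc)
  have "(\<integral>\<^sup>+x. ennreal (exp (- qf (Suc d) a x x / 2)) \<partial>leb (Suc d)) =
     (\<integral>\<^sup>+x. \<integral>\<^sup>+w. ennreal (exp (- qf (Suc d) a (x(d := w)) (x(d := w)) / 2)) \<partial>lborel \<partial>leb d)"
    unfolding leb_eq leb_def[of d]
    by (rule lborel_prod.product_nn_integral_insert)
       (use measurable_qf[of "\<lambda>x. x" "leb (Suc d)" "Suc d" "\<lambda>x. x" a] in \<open>simp_all add: leb_eq[symmetric]\<close>)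
  also have "\<dots> = (\<integral>\<^sup>+x. ennreal (exp (- qf d ?S x x / 2)) * ennreal (sqrt (2 * pi / a d d)) \<partial>leb d)"
  proof (rule nn_integral_cong)
    fix x
    have "qf (Suc d) a (x(d := w)) (x(d := w)) = qf d ?S x x + a d d * (w + ?\<beta> x)\<^sup>2" for w
    proof -
      have "qf d ?S (x(d := w)) (x(d := w)) = qf d ?S x x" by (rule qf_cong) auto
      then show ?thesis by (simp add: qf_Suc(1)[OF Suc.prems])
    qed
    then have "(\<integral>\<^sup>+w. ennreal (exp (- qf (Suc d) a (x(d := w)) (x(d := w)) / 2)) \<partial>lborel) =
       (\<integral>\<^sup>+w. ennreal (exp (- qf d ?S x x / 2)) * ennreal (exp (- (a d d * (w + ?\<beta> x)\<^sup>2 / 2))) \<partial>lborel)"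
      by (intro nn_integral_cong) (simp add: ennreal_mult[symmetric] exp_add[symmetric] field_simps)
    also have "\<dots> = ennreal (exp (- qf d ?S x x / 2)) * ennreal (sqrt (2 * pi / a d d))"
      by (simp add: nn_integral_cmult nn_integral_gaussian_1d[OF pos])
    finally show "(\<integral>\<^sup>+w. ennreal (exp (- qf (Suc d) a (x(d := w)) (x(d := w)) / 2)) \<partial>lborel) =
      ennreal (exp (- qf d ?S x x / 2)) * ennreal (sqrt (2 * pi / a d d))" .
  qed
  also have "\<dots> = ennreal (sqrt ((2 * pi) ^ d / det (form_mat d ?S))) * ennreal (sqrt (2 * pi / a d d))"
    by (subst nn_integral_multc) (simp_all only: IH, measurable)
  also have "\<dots> = ennreal (sqrt ((2 * pi) ^ Suc d / det (form_mat (Suc d) a)))"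
    using pos IH by (simp add: ennreal_mult[symmetric] real_sqrt_mult[symmetric] det mult_ac)
  finally show ?case using det pos IH by simp
qed

section \<open>Square roots of positive definite matrices\<close>

lemma qf_cauchy_schwarz:
  assumes "posdef d a" "y \<in> Rd d"
  shows "(qf d a x y)\<^sup>2 \<le> qf d a x x * qf d a y y"
proof (cases "y = zero_pt d")
  case False
  then have pos: "0 < qf d a y y" using assms by (simp add: qf_pos)
  define t where "t = qf d a x y / qf d a y y"
  have "0 \<le> qf d a (lc d 1 x (- t) y) (lc d 1 x (- t) y)" by (rule qf_nonneg[OF assms(1)])
  also have "\<dots> = qf d a x x - 2 * t * qf d a x y + t\<^sup>2 * qf d a y y"
    using qf_commute[OF assms(1), of y x] by (simp add: qf_lc_left qf_lc_right power2_eq_square algebra_simps)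
  also have "\<dots> = qf d a x x - (qf d a x y)\<^sup>2 / qf d a y y"
    using pos by (simp add: t_def power2_eq_square field_simps)
  finally show ?thesis using pos by (simp add: field_simps)
qed simp

text \<open>Each coordinate is a linear functional, represented in the form by some
  \<open>v i\<close>; Cauchy-Schwarz bounds its square by a multiple of \<open>qf d a x x\<close>,
  and the bounds are summed. This replaces a compactness argument on the sphere.\<close>

lemma posdef_coercive:
  assumes "posdef d a"
  obtains l where "l > 0" "\<And>x. x \<in> Rd d \<Longrightarrow> l * dot d x x \<le> qf d a x x"
proof -
  have "\<exists>v. v \<in> Rd d \<and> (\<forall>u. qf d a v u = dot d (\<lambda>j. if j = i then 1 else 0) u)" for i
    using posdef_riesz[OF assms] by metis
  then obtain v where v: "\<And>i. v i \<in> Rd d" "\<And>i u. qf d a (v i) u = dot d (\<lambda>j. if j = i then 1 else 0) u"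
    by metis
  define K where "K = 1 + (\<Sum>i<d. qf d a (v i) (v i))"
  have K: "K > 0" unfolding K_def by (intro add_pos_nonneg sum_nonneg qf_nonneg[OF assms]) simp
  show ?thesis
  proof (rule that[of "1 / K"])
    fix x assume x: "x \<in> Rd d"
    have "(x i)\<^sup>2 \<le> qf d a (v i) (v i) * qf d a x x" if "i < d" for i
    proof -
      have "qf d a (v i) x = x i" using that by (simp add: v(2) dot_def if_distrib [of "\<lambda>z. z * _"] cong: if_cong)
      then show ?thesis using qf_cauchy_schwarz[OF assms x, of "v i"] by simp
    qed
    then have "dot d x x \<le> (\<Sum>i<d. qf d a (v i) (v i) * qf d a x x)"
      unfolding dot_def power2_eq_square[symmetric] by (intro sum_mono) simp
    also have "\<dots> \<le> K * qf d a x x"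
      using qf_nonneg[OF assms, of x] by (simp add: K_def sum_distrib_right sum_distrib_left algebra_simps)
    finally show "1 / K * dot d x x \<le> qf d a x x" using K by (simp add: field_simps)
  qed (use K in simp)
qed

section \<open>Roots of positive definite forms by the binomial series\<close>

fun mpow :: "nat \<Rightarrow> (nat \<Rightarrow> nat \<Rightarrow> real) \<Rightarrow> nat \<Rightarrow> nat \<Rightarrow> nat \<Rightarrow> real" where
  "mpow d m 0 i j = (if i = j then 1 else 0)"
| "mpow d m (Suc k) i j = (\<Sum>l<d. m i l * mpow d m k l j)"

lemma mpow_add:
  assumes "i < d"
  shows "(\<Sum>l<d. mpow d m k i l * mpow d m k' l j) = mpow d m (k + k') i j"
  using assms
proof (induction k arbitrary: i)
  case 0
  then show ?case by (simp add: if_distrib [of "\<lambda>z. z * _"] cong: if_cong)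
next
  case (Suc k)
  have "(\<Sum>l<d. mpow d m (Suc k) i l * mpow d m k' l j) =
    (\<Sum>l<d. \<Sum>l'<d. m i l' * (mpow d m k l' l * mpow d m k' l j))"
    by (simp add: sum_distrib_right sum_distrib_left mult_ac)
  also have "\<dots> = (\<Sum>l'<d. m i l' * (\<Sum>l<d. mpow d m k l' l * mpow d m k' l j))"
    by (subst sum.swap) (simp add: sum_distrib_left)
  also have "\<dots> = (\<Sum>l'<d. m i l' * mpow d m (k + k') l' j)" using Suc.IH by simp
  finally show ?case by simp
qed

lemma mpow_sym:
  assumes "\<And>i j. i < d \<Longrightarrow> j < d \<Longrightarrow> m i j = m j i" "i < d" "j < d"
  shows "mpow d m k i j = mpow d m k j i"
  using assms(2,3)
proof (induction k arbitrary: i j)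
  case (Suc k)
  have "mpow d m (Suc k) j i = (\<Sum>l<d. mpow d m k i l * m l j)"
    using Suc assms(1) by (auto intro!: sum.cong simp: mult.commute)
  also have "\<dots> = (\<Sum>l<d. mpow d m k i l * mpow d m 1 l j)"
    using Suc.prems by (simp add: if_distrib [of "\<lambda>z. _ * z"] cong: if_cong)
  also have "\<dots> = mpow d m (Suc k) i j" using mpow_add[OF Suc.prems(1), of m k 1 j] by simp
  finally show ?case by simp
qed auto

text \<open>The contraction hypothesis bounds the Euclidean norm of every column of the power, and
  an entry is at most the norm of its column.\<close>

lemma mpow_bound:
  assumes "\<And>x. (\<Sum>i<d. (\<Sum>l<d. m i l * x l)\<^sup>2) \<le> \<rho>\<^sup>2 * (\<Sum>i<d. (x i)\<^sup>2)" "0 \<le> \<rho>" "i < d" "j < d"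
  shows "\<bar>mpow d m k i j\<bar> \<le> \<rho> ^ k"
proof -
  have *: "(\<Sum>i<d. (mpow d m k i j)\<^sup>2) \<le> (\<rho> ^ k)\<^sup>2"
  proof (induction k)
    case (Suc k)
    have "(\<Sum>i<d. (mpow d m (Suc k) i j)\<^sup>2) \<le> \<rho>\<^sup>2 * (\<Sum>i<d. (mpow d m k i j)\<^sup>2)"
      using assms(1)[of "\<lambda>l. mpow d m k l j"] by simp
    also have "\<dots> \<le> \<rho>\<^sup>2 * (\<rho> ^ k)\<^sup>2" by (rule mult_left_mono[OF Suc]) simp
    finally show ?case by (simp add: power_mult_distrib)
  qed (use assms(4) in \<open>simp add: if_distrib [of "\<lambda>z. z\<^sup>2"] cong: if_cong\<close>)
  have "(mpow d m k i j)\<^sup>2 \<le> (\<Sum>i<d. (mpow d m k i j)\<^sup>2)"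
    using assms(3) by (intro member_le_sum) auto
  with * have "(mpow d m k i j)\<^sup>2 \<le> (\<rho> ^ k)\<^sup>2" by simp
  then show ?thesis using assms(2) by (metis abs_le_square_iff abs_of_nonneg zero_le_power)
qed

text \<open>Consecutive coefficients differ by the factor \<open>(a - k) / (k + 1)\<close>, of
  modulus at most one in this range. Hence the binomial series of a contraction is dominated by a
  geometric one.\<close>

lemma abs_gbinomial_le_1:
  fixes a :: real
  assumes "\<bar>a\<bar> \<le> 1"
  shows "\<bar>a gchoose k\<bar> \<le> 1"
proof (induction k)
  case (Suc k)
  have "a gchoose Suc k = (a gchoose k) * ((a - k) / (real k + 1))"
    using gbinomial_absorption'[of "Suc k" a]  gbinomial_mult_1[of a k]
    by (simp add: field_simps)
  moreover have "\<bar>(a - k) / (real k + 1)\<bar> \<le> 1" using assms by (simp add: field_simps abs_if split: if_splits)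
  ultimately show ?case using Suc mult_mono[OF Suc \<open>\<bar>(a - k) / (real k + 1)\<bar> \<le> 1\<close>] by (simp add: abs_mult)
qed simp

text \<open>The entries of \<open>1 - m\<close> raised to the power \<alpha>, as a binomial
  series.\<close>

definition msum :: "nat \<Rightarrow> (nat \<Rightarrow> nat \<Rightarrow> real) \<Rightarrow> real \<Rightarrow> nat \<Rightarrow> nat \<Rightarrow> real" where
  "msum d m \<alpha> i j = (\<Sum>k. (- 1) ^ k * (\<alpha> gchoose k) * mpow d m k i j)"

text \<open>Exponents add because Vandermonde's identity sums the Cauchy product of the two series.
  The contraction and the bounds on the exponents provide the absolute convergence.\<close>

lemma msum_mult:
  assumes m: "\<And>x. (\<Sum>i<d. (\<Sum>l<d. m i l * x l)\<^sup>2) \<le> \<rho>\<^sup>2 * (\<Sum>i<d. (x i)\<^sup>2)" "0 \<le> \<rho>" "\<rho> < 1"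
    and ij: "i < d" "j < d" and ab: "\<bar>\<alpha>\<bar> \<le> 1" "\<bar>\<beta>\<bar> \<le> 1"
  shows "(\<Sum>l<d. msum d m \<alpha> i l * msum d m \<beta> l j) = msum d m (\<alpha> + \<beta>) i j"
proof -
  let ?t = "\<lambda>\<alpha> i j k. (- 1) ^ k * (\<alpha> gchoose k) * mpow d m k i j"
  have s: "summable (\<lambda>k. norm (?t \<alpha> i j k))" if "i < d" "j < d" "\<bar>\<alpha>\<bar> \<le> 1" for \<alpha> i j
  proof (rule summable_comparison_test)
    show "\<exists>N. \<forall>k\<ge>N. norm (norm (?t \<alpha> i j k)) \<le> \<rho> ^ k"
    proof (intro exI allI impI)
      fix k
      show "norm (norm (?t \<alpha> i j k)) \<le> \<rho> ^ k"
        using mult_mono[OF abs_gbinomial_le_1[OF that(3), of k] mpow_bound[OF m(1,2) that(1,2), of k]]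
        by (simp add: abs_mult)
    qed
    show "summable (\<lambda>k. \<rho> ^ k)" using m by (simp add: summable_geometric)
  qed
  have c: "(\<lambda>k. \<Sum>p\<le>k. ?t \<alpha> i l p * ?t \<beta> l j (k - p)) sums (msum d m \<alpha> i l * msum d m \<beta> l j)" if "l < d" for l
    unfolding msum_def by (rule Cauchy_product_sums[OF s s]) (use that ij ab in auto)
  have "(\<lambda>k. \<Sum>l<d. \<Sum>p\<le>k. ?t \<alpha> i l p * ?t \<beta> l j (k - p)) sums (\<Sum>l<d. msum d m \<alpha> i l * msum d m \<beta> l j)"
    by (rule sums_sum) (use c in auto)
  moreover have "(\<Sum>l<d. \<Sum>p\<le>k. ?t \<alpha> i l p * ?t \<beta> l j (k - p)) = ?t (\<alpha> + \<beta>) i j k" for k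
  proof -
    have "(\<Sum>l<d. \<Sum>p\<le>k. ?t \<alpha> i l p * ?t \<beta> l j (k - p)) =
      (\<Sum>p\<le>k. \<Sum>l<d. ((- 1) ^ p * (- 1) ^ (k - p)) * ((\<alpha> gchoose p) * (\<beta> gchoose (k - p)) * (mpow d m p i l * mpow d m (k - p) l j)))"
      by (subst sum.swap) (simp add: mult_ac)
    also have "\<dots> = (\<Sum>p\<le>k. (- 1) ^ k * ((\<alpha> gchoose p) * (\<beta> gchoose (k - p)) * mpow d m k i j))"
    proof (rule sum.cong)
      fix p assume "p \<in> {..k}"
      then have "p + (k - p) = k" by simp
      then show "(\<Sum>l<d. ((- 1) ^ p * (- 1) ^ (k - p)) * ((\<alpha> gchoose p) * (\<beta> gchoose (k - p)) * (mpow d m p i l * mpow d m (k - p) l j))) =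
        (- 1) ^ k * ((\<alpha> gchoose p) * (\<beta> gchoose (k - p)) * mpow d m k i j)"
        using mpow_add[OF ij(1), of m p "k - p" j]
        by (simp only: power_add[symmetric] sum_distrib_left[symmetric])
    qed simp
    also have "\<dots> = (- 1) ^ k * ((\<Sum>p\<le>k. (\<alpha> gchoose p) * (\<beta> gchoose (k - p))) * mpow d m k i j)"
      by (simp only: sum_distrib_left sum_distrib_right)
    also have "(\<Sum>p\<le>k. (\<alpha> gchoose p) * (\<beta> gchoose (k - p))) = (\<alpha> + \<beta>) gchoose k"
      using gbinomial_Vandermonde[of \<alpha> \<beta> k] by (simp add: atMost_atLeast0)
    finally show ?thesis by simp
  qed
  ultimately show ?thesis by (simp add: msum_def sums_iff)
qed

lemma msum_1:
  "msum d m 1 i j = (if i = j then 1 else 0) - (\<Sum>l<d. m i l * (if l = j then 1 else 0))"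
proof -
  have "(1 gchoose k) = (0::real)" if "k \<notin> {0, 1}" for k
  proof -
    have "1 choose k = 0" using that by (intro binomial_eq_0) auto
    with binomial_gbinomial[of 1 k, where 'a=real] show ?thesis unfolding \<open>1 choose k = 0\<close> by simp
  qed
  then have "msum d m 1 i j = (\<Sum>k\<in>{0,1}. (- 1) ^ k * (1 gchoose k) * mpow d m k i j)"
    unfolding msum_def by (intro suminf_finite) auto
  then show ?thesis by simp
qed

text \<open>With \<open>m = 1 - a / c\<close> for large \<open>c\<close>, the binomial series gives the roots \<open>(1 - m)\<^sup>\<alpha>\<close>; taking the
  square root as the square of the fourth root makes its positivity obvious.\<close>

lemma posdef_roots:
  assumes "posdef d a"
  obtains r b where
    "\<And>i j. i < d \<Longrightarrow> j < d \<Longrightarrow> r i j = r j i" "\<And>i j. i < d \<Longrightarrow> j < d \<Longrightarrow> b i j = b j i"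
    "\<And>i j. i < d \<Longrightarrow> j < d \<Longrightarrow> (\<Sum>l<d. r i l * r l j) = b i j"
    "\<And>i j. i < d \<Longrightarrow> j < d \<Longrightarrow> (\<Sum>l<d. b i l * b l j) = (a i j :: real)"
proof -
  obtain l where l: "l > 0" "\<And>x. x \<in> Rd d \<Longrightarrow> l * dot d x x \<le> qf d a x x"
    using posdef_coercive[OF assms] by blast
  define K where "K = l\<^sup>2 + (\<Sum>i<d. \<Sum>j<d. (a i j)\<^sup>2)"
  have K: "K \<ge> l\<^sup>2" by (simp add: K_def sum_nonneg)
  then have K0: "K > 0" using l by (smt (verit) zero_less_power2)
  \<comment> \<open>\<open>K\<close> dominates the squared Frobenius norm of \<open>a\<close>, so
    \<open>|x - a x / c|^2\<close> is at most \<open>1 - 2 l / c + K / c^2\<close> times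
    \<open>|x|^2\<close>. This \<open>c\<close> minimises that factor, and the summand
    \<open>l^2\<close> of \<open>K\<close> keeps the minimum \<open>1 - l^2 / K\<close>
    nonnegative.\<close>
  define c where "c = K / l"
  have c: "c > 0" using K0 l by (simp add: c_def)
  define m where "m = (\<lambda>i j. (if i = j then 1 else 0) - a i j / c)"
  define \<rho> where "\<rho> = sqrt (1 - l\<^sup>2 / K)"
  have \<rho>: "0 \<le> \<rho>" "\<rho> < 1" "\<rho>\<^sup>2 = 1 - l\<^sup>2 / K"
    using K K0 l by (simp_all add: \<rho>_def)
  have sym: "m i j = m j i" if "i < d" "j < d" for i j
    using that assms by (simp add: m_def posdef_def)
  have m: "(\<Sum>i<d. (\<Sum>l<d. m i l * x l)\<^sup>2) \<le> \<rho>\<^sup>2 * (\<Sum>i<d. (x i)\<^sup>2)" for x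
  proof -
    have mx: "(\<Sum>l<d. m i l * x l) = x i - (\<Sum>l<d. a i l * x l) / c" if "i < d" for i
      using that by (simp add: m_def left_diff_distrib sum_subtractf sum_divide_distrib
          if_distrib [of "\<lambda>z. z * _"] cong: if_cong)
    have "(\<Sum>i<d. (\<Sum>l<d. m i l * x l)\<^sup>2) = (\<Sum>i<d. (x i)\<^sup>2 - (2 / c) * (\<Sum>l<d. a i l * x i * x l) + (\<Sum>l<d. a i l * x l)\<^sup>2 / c\<^sup>2)"
    proof (intro sum.cong refl)
      fix i assume "i \<in> {..<d}"
      moreover have "(\<Sum>l<d. a i l * x i * x l) = x i * (\<Sum>l<d. a i l * x l)"
        unfolding sum_distrib_left by (intro sum.cong refl) simp
      ultimately show "(\<Sum>l<d. m i l * x l)\<^sup>2 = (x i)\<^sup>2 - (2 / c) * (\<Sum>l<d. a i l * x i * x l) + (\<Sum>l<d. a i l * x l)\<^sup>2 / c\<^sup>2"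
        by (simp add: mx power2_diff power_divide)
    qed
    also have "\<dots> = (\<Sum>i<d. (x i)\<^sup>2) - (2 / c) * qf d a x x + (\<Sum>i<d. (\<Sum>l<d. a i l * x l)\<^sup>2) / c\<^sup>2"
      by (simp add: qf_def sum.distrib sum_subtractf sum_distrib_left sum_divide_distrib)
    also have "\<dots> \<le> (\<Sum>i<d. (x i)\<^sup>2) - (2 / c) * (l * (\<Sum>i<d. (x i)\<^sup>2)) + (K * (\<Sum>i<d. (x i)\<^sup>2)) / c\<^sup>2"
    proof (intro add_mono diff_mono mult_left_mono divide_right_mono order_refl)
      have "dot d x x = dot d (lc d 1 x 0 x) (lc d 1 x 0 x)" "qf d a x x = qf d a (lc d 1 x 0 x) (lc d 1 x 0 x)"
        by (simp_all add: dot_lc_left dot_lc_right qf_lc_left qf_lc_right)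
      then show "l * (\<Sum>i<d. (x i)\<^sup>2) \<le> qf d a x x"
        using l(2)[of "lc d 1 x 0 x"] by (simp add: dot_def power2_eq_square)
      have "(\<Sum>l<d. a i l * x l)\<^sup>2 \<le> (\<Sum>l<d. (a i l)\<^sup>2) * (\<Sum>l<d. (x l)\<^sup>2)" for i
        by (rule Cauchy_Schwarz_ineq_sum)
      then have "(\<Sum>i<d. (\<Sum>l<d. a i l * x l)\<^sup>2) \<le> (\<Sum>i<d. (\<Sum>l<d. (a i l)\<^sup>2) * (\<Sum>l<d. (x l)\<^sup>2))"
        by (intro sum_mono)
      also have "\<dots> \<le> K * (\<Sum>l<d. (x l)\<^sup>2)"
        unfolding K_def sum_distrib_right[symmetric] by (intro mult_right_mono sum_nonneg) auto
      finally show "(\<Sum>i<d. (\<Sum>l<d. a i l * x l)\<^sup>2) \<le> K * (\<Sum>i<d. (x i)\<^sup>2)" .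
    qed (use c in auto)
    also have "\<dots> = \<rho>\<^sup>2 * (\<Sum>i<d. (x i)\<^sup>2)"
      unfolding \<rho>(3) c_def using l(1) K0 by (simp add: field_simps power2_eq_square)
    finally show ?thesis .
  qed
  note mult = msum_mult[OF m \<rho>(1,2)]
  have symm: "msum d m \<alpha> i j = msum d m \<alpha> j i" if "i < d" "j < d" for \<alpha> i j
    unfolding msum_def using mpow_sym[OF sym that] by simp
  show ?thesis
  proof (rule that[of "\<lambda>i j. sqrt (sqrt c) * msum d m (1/4) i j" "\<lambda>i j. sqrt c * msum d m (1/2) i j"])
    fix i j assume ij: "i < d" "j < d"
    have "(\<Sum>l<d. sqrt (sqrt c) * msum d m (1/4) i l * (sqrt (sqrt c) * msum d m (1/4) l j)) =
      (sqrt (sqrt c) * sqrt (sqrt c)) * (\<Sum>l<d. msum d m (1/4) i l * msum d m (1/4) l j)"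
      by (simp only: sum_distrib_left mult_ac)
    then show "(\<Sum>l<d. sqrt (sqrt c) * msum d m (1/4) i l * (sqrt (sqrt c) * msum d m (1/4) l j)) = sqrt c * msum d m (1/2) i j"
      using c by (simp add: mult[OF ij])
    have "(\<Sum>l<d. sqrt c * msum d m (1/2) i l * (sqrt c * msum d m (1/2) l j)) =
      (sqrt c * sqrt c) * (\<Sum>l<d. msum d m (1/2) i l * msum d m (1/2) l j)"
      by (simp only: sum_distrib_left mult_ac)
    also have "\<dots> = c * msum d m 1 i j" using c by (simp add: mult[OF ij])
    also have "\<dots> = a i j" using c ij
      by (simp add: msum_1 m_def if_distrib [of "\<lambda>z. _ * z"] left_diff_distrib cong: if_cong)
    finally show "(\<Sum>l<d. sqrt c * msum d m (1/2) i l * (sqrt c * msum d m (1/2) l j)) = a i j" .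
  qed (use symm in auto)
qed

lemma form_mat_mult:
  "form_mat d f * form_mat d g = form_mat d (\<lambda>i j. \<Sum>l<d. f i l * g l j)"
  by (intro eq_matI) (auto simp: form_mat_def scalar_prod_def atLeast0LessThan)

lemma form_mat_of_carrier:
  assumes "B \<in> carrier_mat d d"
  shows "form_mat d (\<lambda>i j. B $$ (i, j)) = B"
  using assms by (intro eq_matI) (auto simp: form_mat_def)

lemma form_mat_eq_iff: "form_mat d f = form_mat d g \<longleftrightarrow> (\<forall>i<d. \<forall>j<d. f i j = g i j)"
proof
  assume eq: "form_mat d f = form_mat d g"
  have "f i j = g i j" if "i < d" "j < d" for i j
    using arg_cong[OF eq, of "\<lambda>M. M $$ (i, j)"] that by (simp add: form_mat_def)
  then show "\<forall>i<d. \<forall>j<d. f i j = g i j" by simp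
qed (auto simp: form_mat_def intro!: eq_matI)

text \<open>With \<open>D = b - c\<close> one has \<open>b D + D c = b^2 - c^2 = 0\<close>.
  Multiplying by \<open>D\<close> and taking the trace gives a vanishing sum of values of the forms
  \<open>b\<close> and \<open>c\<close> at the rows of \<open>D\<close>. Both forms are nonnegative,
  and \<open>b = r^2\<close> is definite because \<open>b^2 = a\<close> is, so \<open>D = 0\<close>.
  This settles the definite description in \<open>sqrt_mat\<close>.\<close>

lemma nonneg_square_root_unique:
  assumes a: "posdef d a"
    and r: "\<And>i j. i < d \<Longrightarrow> j < d \<Longrightarrow> r i j = r j i" "\<And>i j. i < d \<Longrightarrow> j < d \<Longrightarrow> (\<Sum>l<d. r i l * r l j) = b i j"
    and b: "\<And>i j. i < d \<Longrightarrow> j < d \<Longrightarrow> b i j = b j i" "\<And>i j. i < d \<Longrightarrow> j < d \<Longrightarrow> (\<Sum>l<d. b i l * b l j) = a i j"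
    and c: "\<And>i j. i < d \<Longrightarrow> j < d \<Longrightarrow> c i j = c j i" "\<And>i j. i < d \<Longrightarrow> j < d \<Longrightarrow> (\<Sum>l<d. c i l * c l j) = a i j"
      "\<And>x. x \<in> Rd d \<Longrightarrow> 0 \<le> qf d c x x"
    and ij: "i < d" "j < d"
  shows "c i j = b i j"
proof -
  define D where "D = (\<lambda>i j. b i j - c i j)"
  have Ds: "D i j = D j i" if "i < d" "j < d" for i j using that b c by (simp add: D_def)
  have rr: "qf d b x x = (\<Sum>l<d. (\<Sum>i<d. r l i * x i)\<^sup>2)" for x
  proof -
    have "(\<Sum>l<d. (\<Sum>i<d. r l i * x i)\<^sup>2) = (\<Sum>l<d. \<Sum>i<d. \<Sum>j<d. r i l * r l j * x i * x j)"
      unfolding power2_eq_square sum_product by (intro sum.cong refl) (simp add: r(1) mult_ac)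
    also have "\<dots> = (\<Sum>i<d. \<Sum>l<d. \<Sum>j<d. r i l * r l j * x i * x j)" by (rule sum.swap)
    also have "\<dots> = (\<Sum>i<d. \<Sum>j<d. \<Sum>l<d. r i l * r l j * x i * x j)" by (intro sum.cong refl sum.swap)
    also have "\<dots> = (\<Sum>i<d. \<Sum>j<d. (\<Sum>l<d. r i l * r l j) * x i * x j)"
      by (simp add: sum_distrib_right)
    finally show ?thesis using r(2) by (simp add: qf_def)
  qed
  have bx0: "\<forall>i<d. x i = 0" if 0: "qf d b x x \<le> 0" for x
  proof (rule ccontr)
    assume nz: "\<not> ?thesis"
    have "(\<Sum>l<d. (\<Sum>i<d. r l i * x i)\<^sup>2) = 0"
      using 0 unfolding rr by (intro antisym sum_nonneg) auto
    then have rx: "(\<Sum>i<d. r l i * x i) = 0" if "l < d" for l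
      using that by (subst (asm) sum_nonneg_eq_0_iff) auto
    have bx: "(\<Sum>j<d. b i j * x j) = 0" if "i < d" for i
    proof -
      have "(\<Sum>j<d. b i j * x j) = (\<Sum>j<d. \<Sum>l<d. r i l * (r l j * x j))"
        using that r(2)[symmetric] by (simp add: sum_distrib_right mult.assoc)
      also have "\<dots> = (\<Sum>l<d. r i l * (\<Sum>j<d. r l j * x j))" by (subst sum.swap) (simp add: sum_distrib_left)
      finally show ?thesis by (simp add: rx)
    qed
    have ax: "(\<Sum>j<d. a i j * x j) = 0" if "i < d" for i
    proof -
      have "(\<Sum>j<d. a i j * x j) = (\<Sum>j<d. \<Sum>l<d. b i l * (b l j * x j))"
        using that b(2)[symmetric] by (simp add: sum_distrib_right mult.assoc)
      also have "\<dots> = (\<Sum>l<d. b i l * (\<Sum>j<d. b l j * x j))" by (subst sum.swap) (simp add: sum_distrib_left)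
      finally show ?thesis by (simp add: bx)
    qed
    have "qf d a x x = (\<Sum>i<d. x i * (\<Sum>j<d. a i j * x j))" by (simp add: qf_def sum_distrib_left mult_ac)
    then have "qf d a x x = 0" by (simp add: ax)
    moreover have "qf d a x x = qf d a (lc d 1 x 0 x) (lc d 1 x 0 x)" by (rule qf_cong) auto
    moreover have "lc d 1 x 0 x \<noteq> zero_pt d"
    proof
      assume eq: "lc d 1 x 0 x = zero_pt d"
      have "x i = 0" if "i < d" for i using fun_cong[OF eq, of i] that by simp
      with nz show False by simp
    qed
    ultimately show False using qf_pos[OF a lc_in_Rd, of 1 x 0 x] by simp
  qed
  have e1: "(\<Sum>l<d. b k l * D l i) + (\<Sum>l<d. D k l * c l i) = 0" if "k < d" "i < d" for k i
  proof -
    have "(\<Sum>l<d. b k l * D l i) + (\<Sum>l<d. D k l * c l i) = (\<Sum>l<d. b k l * b l i) - (\<Sum>l<d. c k l * c l i)"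
      by (simp add: D_def sum_subtractf[symmetric] sum.distrib[symmetric] algebra_simps)
    then show ?thesis using that b(2) c(2) by simp
  qed
  have "(\<Sum>i<d. qf d b (D i) (D i)) = (\<Sum>i<d. \<Sum>k<d. (\<Sum>l<d. b k l * D l i) * D i k)"
    by (intro sum.cong refl) (simp add: qf_def sum_distrib_right sum_distrib_left Ds mult_ac)
  moreover have "(\<Sum>k<d. qf d c (D k) (D k)) = (\<Sum>k<d. \<Sum>i<d. (\<Sum>l<d. D k l * c l i) * D i k)"
  proof (intro sum.cong refl)
    fix k assume "k \<in> {..<d}"
    then have "qf d c (D k) (D k) = (\<Sum>l<d. \<Sum>i<d. D k l * c l i * D i k)"
      unfolding qf_def by (intro sum.cong refl) (simp add: Ds mult_ac)
    also have "\<dots> = (\<Sum>i<d. \<Sum>l<d. D k l * c l i * D i k)" by (rule sum.swap)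
    finally show "qf d c (D k) (D k) = (\<Sum>i<d. (\<Sum>l<d. D k l * c l i) * D i k)"
      by (simp add: sum_distrib_right)
  qed
  moreover have "(\<Sum>i<d. \<Sum>k<d. (\<Sum>l<d. b k l * D l i) * D i k) = (\<Sum>k<d. \<Sum>i<d. (\<Sum>l<d. b k l * D l i) * D i k)"
    by (rule sum.swap)
  ultimately have "(\<Sum>i<d. qf d b (D i) (D i)) + (\<Sum>k<d. qf d c (D k) (D k)) =
     (\<Sum>k<d. \<Sum>i<d. ((\<Sum>l<d. b k l * D l i) + (\<Sum>l<d. D k l * c l i)) * D i k)"
    by (simp only: sum.distrib distrib_right)
  also have "\<dots> = 0" using e1 by simp
  finally have s: "(\<Sum>i<d. qf d b (D i) (D i)) + (\<Sum>k<d. qf d c (D k) (D k)) = 0" .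
  have cn: "0 \<le> qf d c x x" for x
  proof -
    have "qf d c x x = qf d c (lc d 1 x 0 x) (lc d 1 x 0 x)" by (rule qf_cong) auto
    then show ?thesis using c(3)[of "lc d 1 x 0 x"] by simp
  qed
  have bn: "0 \<le> qf d b x x" for x unfolding rr by (intro sum_nonneg) auto
  have "qf d b (D i) (D i) \<le> (\<Sum>i<d. qf d b (D i) (D i))"
    using ij(1) bn by (intro member_le_sum) auto
  also have "\<dots> \<le> 0" using s sum_nonneg[of "{..<d}" "\<lambda>k. qf d c (D k) (D k)"] cn by simp
  finally have "D i j = 0" using bx0 ij by blast
  then show ?thesis by (simp add: D_def)
qed

lemma sqrt_mat_form_mat:
  assumes "posdef d a"
  obtains b where "sqrt_mat (form_mat d a) = form_mat d b"
    "\<And>i j. i < d \<Longrightarrow> j < d \<Longrightarrow> b i j = b j i"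
    "\<And>i j. i < d \<Longrightarrow> j < d \<Longrightarrow> (\<Sum>l<d. b i l * b l j) = a i j"
proof -
  obtain r b where rb:
    "\<And>i j. i < d \<Longrightarrow> j < d \<Longrightarrow> r i j = r j i" "\<And>i j. i < d \<Longrightarrow> j < d \<Longrightarrow> b i j = b j i"
    "\<And>i j. i < d \<Longrightarrow> j < d \<Longrightarrow> (\<Sum>l<d. r i l * r l j) = b i j"
    "\<And>i j. i < d \<Longrightarrow> j < d \<Longrightarrow> (\<Sum>l<d. b i l * b l j) = a i j"
    using posdef_roots[OF assms] by blast
  let ?P = "\<lambda>B. B \<in> carrier_mat d d \<and> transpose_mat B = B
      \<and> (\<forall>v \<in> carrier_vec d. 0 \<le> scalar_prod v (mult_mat_vec B v)) \<and> B * B = form_mat d a"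
  have "qf d b x x \<ge> 0" for x
  proof -
    have "(\<Sum>l<d. (\<Sum>i<d. r l i * x i)\<^sup>2) = (\<Sum>l<d. \<Sum>i<d. \<Sum>j<d. r i l * r l j * x i * x j)"
      unfolding power2_eq_square sum_product by (intro sum.cong refl) (simp add: rb(1) mult_ac)
    also have "\<dots> = (\<Sum>i<d. \<Sum>l<d. \<Sum>j<d. r i l * r l j * x i * x j)" by (rule sum.swap)
    also have "\<dots> = (\<Sum>i<d. \<Sum>j<d. \<Sum>l<d. r i l * r l j * x i * x j)" by (intro sum.cong refl sum.swap)
    also have "\<dots> = (\<Sum>i<d. \<Sum>j<d. (\<Sum>l<d. r i l * r l j) * x i * x j)"
      by (simp add: sum_distrib_right)
    also have "\<dots> = qf d b x x" by (simp add: qf_def rb(3))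
    finally have "qf d b x x = (\<Sum>l<d. (\<Sum>i<d. r l i * x i)\<^sup>2)" by simp
    then show ?thesis by (simp add: sum_nonneg)
  qed
  then have P: "?P (form_mat d b)"
  proof (intro conjI ballI)
    show "transpose_mat (form_mat d b) = form_mat d b"
      using rb(2) by (intro eq_matI) (simp_all add: form_mat_def)
    show "0 \<le> scalar_prod v (form_mat d b *\<^sub>v v)" if v: "v \<in> carrier_vec d" for v
    proof -
      obtain x where "v = Matrix.vec d x" using vec_of_Rd[OF v] by blast
      then show ?thesis using \<open>qf d b x x \<ge> 0\<close> by (simp only: scalar_prod_form_mat)
    qed
    show "form_mat d b * form_mat d b = form_mat d a"
      using rb(4) by (simp add: form_mat_mult form_mat_eq_iff)
  qed simp
  have "sqrt_mat (form_mat d a) = form_mat d b"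
    unfolding sqrt_mat_def form_mat_carrier
  proof (rule the_equality)
    fix C assume C: "?P C"
    define c where "c = (\<lambda>i j. C $$ (i, j))"
    have Cc: "C = form_mat d c" using C form_mat_of_carrier[of C d] by (simp add: c_def)
    have "c i j = b i j" if "i < d" "j < d" for i j
    proof (rule nonneg_square_root_unique[OF assms rb(1,3,2,4) _ _ _ that])
      show "c i j = c j i" if "i < d" "j < d" for i j
      proof -
        have "C $$ (i, j) = transpose_mat C $$ (i, j)" using C by simp
        also have "\<dots> = C $$ (j, i)" using that C by (intro index_transpose_mat) auto
        finally show ?thesis by (simp add: c_def)
      qed
      show "(\<Sum>l<d. c i l * c l j) = a i j" if "i < d" "j < d" for i j
      proof -
        have "form_mat d c * form_mat d c = form_mat d a" using C by (simp only: Cc)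
        then show ?thesis using that unfolding form_mat_mult form_mat_eq_iff by blast
      qed
      show "0 \<le> qf d c x x" if "x \<in> Rd d" for x
      proof -
        have "0 \<le> scalar_prod (Matrix.vec d x) (C *\<^sub>v Matrix.vec d x)" using C vec_carrier by blast
        then show ?thesis unfolding Cc scalar_prod_form_mat .
      qed
    qed
    then show "C = form_mat d b" unfolding Cc by (simp add: form_mat_eq_iff)
  qed (use P in simp)
  then show ?thesis by (rule that[OF _ rb(2,4)])
qed

lemma vnorm_form_mat:
  assumes "\<And>i j. i < d \<Longrightarrow> j < d \<Longrightarrow> b i j = b j i"
    "\<And>i j. i < d \<Longrightarrow> j < d \<Longrightarrow> (\<Sum>l<d. b i l * b l j) = a i j"
  shows "vnorm (form_mat d b *\<^sub>v Matrix.vec d x) = sqrt (qf d a x x)"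
proof -
  have "scalar_prod (form_mat d b *\<^sub>v Matrix.vec d x) (form_mat d b *\<^sub>v Matrix.vec d x) = (\<Sum>l<d. (\<Sum>i<d. b l i * x i)\<^sup>2)"
    by (simp add: scalar_prod_def form_mat_def atLeast0LessThan power2_eq_square)
  also have "\<dots> = (\<Sum>l<d. \<Sum>i<d. \<Sum>j<d. b i l * b l j * x i * x j)"
    unfolding power2_eq_square sum_product by (intro sum.cong refl) (simp add: assms(1) mult_ac)
  also have "\<dots> = (\<Sum>i<d. \<Sum>l<d. \<Sum>j<d. b i l * b l j * x i * x j)" by (rule sum.swap)
  also have "\<dots> = (\<Sum>i<d. \<Sum>j<d. \<Sum>l<d. b i l * b l j * x i * x j)" by (intro sum.cong refl sum.swap)
  also have "\<dots> = (\<Sum>i<d. \<Sum>j<d. (\<Sum>l<d. b i l * b l j) * x i * x j)"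
    by (simp add: sum_distrib_right)
  also have "\<dots> = qf d a x x" by (simp add: qf_def assms(2))
  finally show ?thesis by (simp add: vnorm_def)
qed

lemma wnorm_form_mat:
  assumes "posdef d a"
  shows "wnorm (form_mat d a) (Matrix.vec d x) = sqrt (qf d a x x)"
proof -
  obtain b where b: "sqrt_mat (form_mat d a) = form_mat d b"
    "\<And>i j. i < d \<Longrightarrow> j < d \<Longrightarrow> b i j = b j i"
    "\<And>i j. i < d \<Longrightarrow> j < d \<Longrightarrow> (\<Sum>l<d. b i l * b l j) = a i j"
    using sqrt_mat_form_mat[OF assms] by blast
  show ?thesis unfolding wnorm_def b(1) by (rule vnorm_form_mat) (use b in auto)
qed

lemma vnorm_cauchy_schwarz:
  assumes "v \<in> carrier_vec d" "w \<in> carrier_vec d"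
  shows "\<bar>scalar_prod v w\<bar> \<le> vnorm v * vnorm w"
proof -
  have "(scalar_prod v w)\<^sup>2 \<le> scalar_prod v v * scalar_prod w w"
    using Cauchy_Schwarz_ineq_sum[of "\<lambda>i. v $ i" "\<lambda>i. w $ i" "{0..<d}"] assms
    by (simp add: scalar_prod_def power2_eq_square)
  then show ?thesis unfolding vnorm_def real_sqrt_mult[symmetric] by (rule real_le_rsqrt[of "\<bar>_\<bar>", simplified])
qed

lemma inv_sqrt_mat_form_mat:
  assumes "posdef d a"
  shows "inv_sqrt_mat (form_mat d a) \<in> carrier_mat d d"
    "sqrt_mat (form_mat d a) \<in> carrier_mat d d"
    "sqrt_mat (form_mat d a) * inv_sqrt_mat (form_mat d a) = 1\<^sub>m d"
    "inv_sqrt_mat (form_mat d a) * sqrt_mat (form_mat d a) = 1\<^sub>m d"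
    "sqrt_mat (form_mat d a) * sqrt_mat (form_mat d a) = form_mat d a"
    "transpose_mat (sqrt_mat (form_mat d a)) = sqrt_mat (form_mat d a)"
proof -
  obtain b where b: "sqrt_mat (form_mat d a) = form_mat d b"
    "\<And>i j. i < d \<Longrightarrow> j < d \<Longrightarrow> b i j = b j i"
    "\<And>i j. i < d \<Longrightarrow> j < d \<Longrightarrow> (\<Sum>l<d. b i l * b l j) = a i j"
    using sqrt_mat_form_mat[OF assms] by blast
  show sq: "sqrt_mat (form_mat d a) * sqrt_mat (form_mat d a) = form_mat d a"
    using b by (simp add: form_mat_mult form_mat_eq_iff)
  show c: "sqrt_mat (form_mat d a) \<in> carrier_mat d d" using b by simp
  show "transpose_mat (sqrt_mat (form_mat d a)) = sqrt_mat (form_mat d a)"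
    unfolding b(1) using b(2) by (intro eq_matI) (auto simp: form_mat_def)
  have "det (sqrt_mat (form_mat d a)) \<noteq> 0"
    using det_form_mat_nonzero[OF assms] det_mult[OF c c] by (auto simp: sq)
  from invertible_matE[OF c this]
  show "inv_sqrt_mat (form_mat d a) \<in> carrier_mat d d"
    "sqrt_mat (form_mat d a) * inv_sqrt_mat (form_mat d a) = 1\<^sub>m d"
    "inv_sqrt_mat (form_mat d a) * sqrt_mat (form_mat d a) = 1\<^sub>m d"
    by (simp_all add: inv_sqrt_mat_def)
qed

text \<open>With \<open>B\<close> the square root, pairing \<open>g\<close> with \<open>u\<close>
  amounts to pairing the inverse of \<open>B\<close> at \<open>g\<close> with \<open>B u\<close>;
  Cauchy-Schwarz then produces the two norms. This is how \<open>delta01\<close> turns into a bound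
  on directional derivatives.\<close>

lemma dual_wnorm_bound:
  assumes "posdef d a"
  shows "\<bar>dot d g u\<bar> \<le> dual_wnorm (form_mat d a) (Matrix.vec d g) * sqrt (qf d a u u)"
proof -
  let ?B = "sqrt_mat (form_mat d a)" and ?C = "inv_sqrt_mat (form_mat d a)"
  note i = inv_sqrt_mat_form_mat[OF assms]
  let ?w = "?C *\<^sub>v Matrix.vec d g"
  have w: "?w \<in> carrier_vec d" using i by simp
  have "?B *\<^sub>v ?w = Matrix.vec d g"
    using i by (subst assoc_mult_mat_vec[symmetric, of _ d d _ d]) auto
  then have "dot d g u = scalar_prod (transpose_mat ?B *\<^sub>v ?w) (Matrix.vec d u)"
    unfolding i(6) by (simp add: scalar_prod_def dot_def atLeast0LessThan)
  also have "\<dots> = scalar_prod ?w (?B *\<^sub>v Matrix.vec d u)"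
    by (rule transpose_vec_mult_scalar[of _ d d]) (use i w in auto)
  also have "\<bar>\<dots>\<bar> \<le> vnorm ?w * vnorm (?B *\<^sub>v Matrix.vec d u)"
    by (rule vnorm_cauchy_schwarz[of _ d]) (use i w in \<open>auto intro!: mult_mat_vec_carrier\<close>)
  also have "vnorm (?B *\<^sub>v Matrix.vec d u) = sqrt (qf d a u u)"
    using wnorm_form_mat[OF assms, of u] by (simp add: wnorm_def)
  finally show ?thesis by (simp add: dual_wnorm_def)
qed

section \<open>Moments of an exponential family\<close>

text \<open>Sigma-finiteness, inherited from the density of \<mu>, is what the measurability in
  \<theta> of \<open>psi\<close> and \<open>Theta\<close> rests on. Log concavity acts through the
  bound on \<open>delta3\<close>.\<close>

locale expfam =
  fixes d :: nat and \<mu> :: "point measure"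
  assumes regular: "regular_minimal_family d \<mu>" and sigma_finite: "sigma_finite_measure \<mu>"
begin

lemma sets_\<mu> [measurable_cong, simp]: "sets \<mu> = sets (leb d)"
  using regular by (simp add: regular_minimal_family_def)

lemma space_\<mu> [simp]: "space \<mu> = Rd d"
  using sets_eq_imp_space_eq[OF sets_\<mu>] by simp

lemma Theta_Rd: "\<theta> \<in> Theta d \<mu> \<Longrightarrow> \<theta> \<in> Rd d"
  by (simp add: Theta_def)

lemma openin_Theta: "openin (powertop_real {..<d}) (Theta d \<mu>)"
  using regular by (simp add: regular_minimal_family_def)

lemma Theta_line:
  assumes "\<theta> \<in> Theta d \<mu>"
  obtains \<delta> where "\<delta> > 0" "\<And>t. \<bar>t\<bar> < \<delta> \<Longrightarrow> lc d 1 \<theta> t u \<in> Theta d \<mu>"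
proof -
  have "continuous_map euclideanreal (powertop_real {..<d}) (\<lambda>t. lc d 1 \<theta> t u)"
    unfolding continuous_map_componentwise lc_def by (auto intro!: continuous_intros)
  from openin_continuous_map_preimage[OF this openin_Theta]
  have "open {t. lc d 1 \<theta> t u \<in> Theta d \<mu>}" by simp
  moreover have "0 \<in> {t. lc d 1 \<theta> t u \<in> Theta d \<mu>}" using assms Theta_Rd by simp
  ultimately obtain e where "e > 0" "\<forall>t. dist t 0 < e \<longrightarrow> t \<in> {t. lc d 1 \<theta> t u \<in> Theta d \<mu>}"
    unfolding open_dist by blast
  then show ?thesis by (intro that[of e]) auto
qed

definition l1 :: "point \<Rightarrow> real" where "l1 y = (\<Sum>i<d. \<bar>y i\<bar>)"

lemma l1_nonneg [simp]: "0 \<le> l1 y" by (simp add: l1_def sum_nonneg)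

lemma l1_measurable [measurable]: "l1 \<in> borel_measurable (leb d)"
  unfolding l1_def by measurable

lemma dot_measurable [measurable]: "dot d u \<in> borel_measurable (leb d)"
proof -
  have "dot d u y = dot d (lc d 1 u 0 u) y" for y by (simp add: dot_lc_left)
  then have "dot d u = (\<lambda>y. dot d (lc d 1 u 0 u) y)" by auto
  also have "\<dots> \<in> borel_measurable (leb d)" by (rule measurable_dot) auto
  finally show ?thesis .
qed

lemma abs_dot_le: "\<bar>dot d u y\<bar> \<le> l1 u * l1 y"
proof -
  have "\<bar>dot d u y\<bar> \<le> (\<Sum>i<d. \<bar>u i\<bar> * \<bar>y i\<bar>)" unfolding dot_def abs_mult[symmetric] by (rule sum_abs)
  also have "\<dots> \<le> (\<Sum>i<d. \<bar>u i\<bar> * l1 y)"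
    unfolding l1_def by (intro sum_mono mult_left_mono member_le_sum) auto
  finally show ?thesis by (simp add: l1_def[of u] sum_distrib_right)
qed

lemma Theta_exp_integrable: "\<theta> \<in> Theta d \<mu> \<Longrightarrow> integrable \<mu> (\<lambda>y. exp (dot d \<theta> y))"
  by (rule integrableI_bounded) (auto simp: Theta_def)

text \<open>Openness, used only along the coordinate axes, makes \<open>exp\<close> of
  \<open>\<theta> y\<close> plus or minus \<open>\<epsilon>0 * y i\<close> integrable. The l1 norm
  is at most \<open>d\<close> times the largest coordinate, so a smaller rate is dominated by the
  sum of these exponentials.\<close>

lemma Theta_exp_l1_integrable:
  assumes "\<theta> \<in> Theta d \<mu>"
  obtains \<epsilon> where "\<epsilon> > 0" "integrable \<mu> (\<lambda>y. exp (dot d \<theta> y + \<epsilon> * l1 y))"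
proof -
  let ?e = "\<lambda>i j. if j = i then 1 else (0::real)"
  have "\<exists>\<delta>>0. \<forall>t. \<bar>t\<bar> < \<delta> \<longrightarrow> lc d 1 \<theta> t (?e i) \<in> Theta d \<mu>" for i
    using Theta_line[OF assms] by metis
  then obtain \<delta> where \<delta>: "\<And>i. \<delta> i > 0" "\<And>i t. \<bar>t\<bar> < \<delta> i \<Longrightarrow> lc d 1 \<theta> t (?e i) \<in> Theta d \<mu>"
    by metis
  define \<epsilon>0 where "\<epsilon>0 = Min (insert 1 ((\<lambda>i. \<delta> i / 2) ` {..<d}))"
  have \<epsilon>0: "\<epsilon>0 > 0" "\<And>i. i < d \<Longrightarrow> \<epsilon>0 < \<delta> i"
  proof -
    show "\<epsilon>0 > 0" using \<delta>(1) by (auto simp: \<epsilon>0_def Min_gr_iff)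
    fix i assume "i < d"
    then have "\<epsilon>0 \<le> \<delta> i / 2" unfolding \<epsilon>0_def by (intro Min_le) auto
    then show "\<epsilon>0 < \<delta> i" using \<delta>(1)[of i] by simp
  qed
  \<comment> \<open>\<open>d + 1\<close> keeps the rate positive also in dimension zero, where
    division by \<open>d\<close> would return 0.\<close>
  define \<epsilon> where "\<epsilon> = \<epsilon>0 / (real d + 1)"
  have \<epsilon>: "\<epsilon> > 0" using \<epsilon>0 by (simp add: \<epsilon>_def)
  have de: "dot d (lc d 1 \<theta> t (?e i)) y = dot d \<theta> y + t * y i" if "i < d" for t i y
    using that by (simp add: dot_lc_left) (simp add: dot_def if_distrib [of "\<lambda>z. z * _"] cong: if_cong)
  let ?S = "\<lambda>y. exp (dot d \<theta> y) + (\<Sum>i<d. exp (dot d (lc d 1 \<theta> \<epsilon>0 (?e i)) y) + exp (dot d (lc d 1 \<theta> (- \<epsilon>0) (?e i)) y))"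
  have le: "exp (dot d \<theta> y + \<epsilon> * l1 y) \<le> ?S y" for y
  proof (cases "d = 0")
    case True
    have "l1 y = 0" by (subst l1_def) (simp add: True)
    then show ?thesis by (simp add: add_nonneg_nonneg sum_nonneg)
  next
    case False
    let ?F = "(\<lambda>i. \<bar>y i\<bar>) ` {..<d}"
    have "Max ?F \<in> ?F" using False by (intro Max_in) auto
    then obtain i where "i < d" and m: "Max ?F = \<bar>y i\<bar>" by auto
    have "\<bar>y j\<bar> \<le> \<bar>y i\<bar>" if "j < d" for j
      unfolding m[symmetric] using that by (intro Max_ge) auto
    note i = \<open>i < d\<close> this
    have "l1 y \<le> real d * \<bar>y i\<bar>" unfolding l1_def using sum_bounded_above[of "{..<d}" "\<lambda>i. \<bar>y i\<bar>" "\<bar>y i\<bar>"] i by simp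
    also have "\<dots> \<le> (real d + 1) * \<bar>y i\<bar>" by (intro mult_right_mono) auto
    finally have "\<epsilon> * l1 y \<le> \<epsilon> * ((real d + 1) * \<bar>y i\<bar>)"
      using \<epsilon> by (intro mult_left_mono) auto
    also have "\<dots> = \<epsilon>0 * \<bar>y i\<bar>" by (simp add: \<epsilon>_def)
    finally have "\<epsilon> * l1 y \<le> \<epsilon>0 * \<bar>y i\<bar>" .
    then have "exp (dot d \<theta> y + \<epsilon> * l1 y) \<le> exp (dot d \<theta> y + \<epsilon>0 * \<bar>y i\<bar>)" by simp
    also have "\<dots> \<le> exp (dot d (lc d 1 \<theta> \<epsilon>0 (?e i)) y) + exp (dot d (lc d 1 \<theta> (- \<epsilon>0) (?e i)) y)"
      unfolding de[OF i(1)] by (cases "y i \<ge> 0") auto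
    also have "\<dots> \<le> (\<Sum>i<d. exp (dot d (lc d 1 \<theta> \<epsilon>0 (?e i)) y) + exp (dot d (lc d 1 \<theta> (- \<epsilon>0) (?e i)) y))"
      using i(1) by (intro member_le_sum[of i "{..<d}" "\<lambda>i. exp (dot d (lc d 1 \<theta> \<epsilon>0 (?e i)) y) + exp (dot d (lc d 1 \<theta> (- \<epsilon>0) (?e i)) y)"]) (auto simp: add_nonneg_nonneg)
    finally show ?thesis using exp_gt_zero[of "dot d \<theta> y"] by linarith
  qed
  have "integrable \<mu> (\<lambda>y. exp (dot d \<theta> y + \<epsilon> * l1 y))"
  proof (rule Bochner_Integration.integrable_bound)
    show "integrable \<mu> ?S"
      using \<epsilon>0 \<delta>(2) assms by (intro Bochner_Integration.integrable_add Bochner_Integration.integrable_sum Theta_exp_integrable) auto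
    show "AE y in \<mu>. norm (exp (dot d \<theta> y + \<epsilon> * l1 y)) \<le> norm (?S y)"
      using le by (intro AE_I2) (auto intro: order_trans[OF _ abs_ge_self])
  qed measurable
  with \<epsilon> show ?thesis by (rule that)
qed

text \<open>Growth below every exponential rate, not just below one: the class is thereby closed
  under products. It contains the linear functionals, so all polynomial moments exist on
  \<open>Theta\<close> and may be differentiated under the integral.\<close>

definition subexp :: "(point \<Rightarrow> real) \<Rightarrow> bool" where
  "subexp g \<longleftrightarrow> g \<in> borel_measurable (leb d) \<and> (\<forall>\<epsilon>>0. \<exists>C. \<forall>y. \<bar>g y\<bar> \<le> C * exp (\<epsilon> * l1 y))"

lemma subexp_measurable: "subexp g \<Longrightarrow> g \<in> borel_measurable (leb d)"
  by (simp add: subexp_def)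

lemma subexpE:
  assumes "subexp g" "\<epsilon> > 0"
  obtains C where "C \<ge> 0" "\<And>y. \<bar>g y\<bar> \<le> C * exp (\<epsilon> * l1 y)"
proof -
  obtain C where C: "\<And>y. \<bar>g y\<bar> \<le> C * exp (\<epsilon> * l1 y)" using assms by (auto simp: subexp_def)
  have "0 \<le> C * exp (\<epsilon> * l1 (zero_pt d))" using C[of "zero_pt d"] by linarith
  then have "C \<ge> 0" by (simp add: zero_le_mult_iff)
  then show ?thesis using C by (rule that)
qed

lemma subexp_const [simp, intro]: "subexp (\<lambda>y. c)"
  unfolding subexp_def
proof (intro conjI allI impI)
  fix \<epsilon> :: real assume "\<epsilon> > 0"
  show "\<exists>C. \<forall>y. \<bar>c\<bar> \<le> C * exp (\<epsilon> * l1 y)"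
    using \<open>\<epsilon> > 0\<close> mult_left_mono[of 1 _ "\<bar>c\<bar>"] by (intro exI[of _ "\<bar>c\<bar>"] allI) simp
qed simp

lemma subexp_dot [simp, intro]: "subexp (dot d u)"
  unfolding subexp_def
proof (intro conjI allI impI)
  fix \<epsilon> :: real assume \<epsilon>: "\<epsilon> > 0"
  have "\<bar>dot d u y\<bar> \<le> (l1 u / \<epsilon>) * exp (\<epsilon> * l1 y)" for y
  proof -
    have "\<bar>dot d u y\<bar> \<le> (l1 u / \<epsilon>) * (\<epsilon> * l1 y)" using abs_dot_le[of u y] \<epsilon> by simp
    also have "\<dots> \<le> (l1 u / \<epsilon>) * exp (\<epsilon> * l1 y)"
    proof (rule mult_left_mono)
      show "\<epsilon> * l1 y \<le> exp (\<epsilon> * l1 y)" using exp_ge_add_one_self[of "\<epsilon> * l1 y"] by linarith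
    qed (use \<epsilon> in simp)
    finally show ?thesis .
  qed
  then show "\<exists>C. \<forall>y. \<bar>dot d u y\<bar> \<le> C * exp (\<epsilon> * l1 y)" by blast
qed measurable

lemma subexp_component [simp, intro]: "i < d \<Longrightarrow> subexp (\<lambda>y. y i)"
proof -
  assume "i < d"
  then have "(\<lambda>y. y i) = dot d (\<lambda>j. if j = i then 1 else 0)"
    by (auto simp: dot_def if_distrib [of "\<lambda>z. z * _"] cong: if_cong)
  then show ?thesis by simp
qed

lemma subexp_add [intro]:
  assumes "subexp f" "subexp g"
  shows "subexp (\<lambda>y. f y + g y)"
  unfolding subexp_def
proof (intro conjI allI impI)
  fix \<epsilon> :: real assume \<epsilon>: "\<epsilon> > 0"
  obtain C1 where 1: "\<And>y. \<bar>f y\<bar> \<le> C1 * exp (\<epsilon> * l1 y)" using subexpE[OF assms(1) \<epsilon>] by blast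
  obtain C2 where 2: "\<And>y. \<bar>g y\<bar> \<le> C2 * exp (\<epsilon> * l1 y)" using subexpE[OF assms(2) \<epsilon>] by blast
  have "\<bar>f y + g y\<bar> \<le> (C1 + C2) * exp (\<epsilon> * l1 y)" for y
    using 1[of y] 2[of y] by (simp add: distrib_right)
  then show "\<exists>C. \<forall>y. \<bar>f y + g y\<bar> \<le> C * exp (\<epsilon> * l1 y)" by blast
next
  show "(\<lambda>y. f y + g y) \<in> borel_measurable (leb d)" using assms by (auto simp: subexp_def)
qed

lemma subexp_mult [intro]:
  assumes "subexp f" "subexp g"
  shows "subexp (\<lambda>y. f y * g y)"
  unfolding subexp_def
proof (intro conjI allI impI)
  fix \<epsilon> :: real assume "\<epsilon> > 0"
  then have \<epsilon>: "\<epsilon> / 2 > 0" by simp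
  obtain C1 where 1: "C1 \<ge> 0" "\<And>y. \<bar>f y\<bar> \<le> C1 * exp (\<epsilon> / 2 * l1 y)" using subexpE[OF assms(1) \<epsilon>] by blast
  obtain C2 where 2: "C2 \<ge> 0" "\<And>y. \<bar>g y\<bar> \<le> C2 * exp (\<epsilon> / 2 * l1 y)" using subexpE[OF assms(2) \<epsilon>] by blast
  have "\<bar>f y * g y\<bar> \<le> (C1 * C2) * exp (\<epsilon> * l1 y)" for y
  proof -
    have "\<bar>f y * g y\<bar> \<le> (C1 * exp (\<epsilon> / 2 * l1 y)) * (C2 * exp (\<epsilon> / 2 * l1 y))"
      unfolding abs_mult using 1 2 by (intro mult_mono) auto
    also have "\<dots> = (C1 * C2) * (exp (\<epsilon> / 2 * l1 y) * exp (\<epsilon> / 2 * l1 y))" by (simp add: mult_ac)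
    also have "\<dots> = (C1 * C2) * exp (\<epsilon> * l1 y)" by (simp add: exp_add[symmetric])
    finally show ?thesis .
  qed
  then show "\<exists>C. \<forall>y. \<bar>f y * g y\<bar> \<le> C * exp (\<epsilon> * l1 y)" by blast
next
  show "(\<lambda>y. f y * g y) \<in> borel_measurable (leb d)" using assms by (auto simp: subexp_def)
qed

lemma subexp_diff [intro]: "subexp f \<Longrightarrow> subexp g \<Longrightarrow> subexp (\<lambda>y. f y - g y)"
  using subexp_add[of f "\<lambda>y. (-1) * g y"] subexp_mult[of "\<lambda>y. -1" g] by simp

definition J :: "point \<Rightarrow> (point \<Rightarrow> real) \<Rightarrow> real" where
  "J \<theta> g = (\<integral>y. g y * exp (dot d \<theta> y) \<partial>\<mu>)"

lemma J_integrable: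
  assumes "\<theta> \<in> Theta d \<mu>" "subexp g"
  shows "integrable \<mu> (\<lambda>y. g y * exp (dot d \<theta> y))"
proof -
  obtain \<epsilon> where \<epsilon>: "\<epsilon> > 0" "integrable \<mu> (\<lambda>y. exp (dot d \<theta> y + \<epsilon> * l1 y))"
    using Theta_exp_l1_integrable[OF assms(1)] by blast
  obtain C where C: "C \<ge> 0" "\<And>y. \<bar>g y\<bar> \<le> C * exp (\<epsilon> * l1 y)" using subexpE[OF assms(2) \<epsilon>(1)] by blast
  note [measurable] = subexp_measurable[OF assms(2)]
  show ?thesis
  proof (rule Bochner_Integration.integrable_bound)
    show "integrable \<mu> (\<lambda>y. C * exp (dot d \<theta> y + \<epsilon> * l1 y))" using \<epsilon> by simp
    show "AE y in \<mu>. norm (g y * exp (dot d \<theta> y)) \<le> norm (C * exp (dot d \<theta> y + \<epsilon> * l1 y))"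
    proof (rule AE_I2)
      fix y
      have "\<bar>g y\<bar> * exp (dot d \<theta> y) \<le> C * exp (\<epsilon> * l1 y) * exp (dot d \<theta> y)"
        using C(2)[of y] by (intro mult_right_mono) auto
      then show "norm (g y * exp (dot d \<theta> y)) \<le> norm (C * exp (dot d \<theta> y + \<epsilon> * l1 y))"
        using C(1) by (simp add: abs_mult exp_add mult_ac)
    qed
  qed measurable
qed

text \<open>A bound uniform in the increment \<open>h\<close>, from which the dominating function
  for \<open>J_DERIV_0\<close> is built.\<close>

lemma abs_exp_quotient_le:
  fixes x h b :: real
  assumes "\<bar>h\<bar> \<le> b" "h \<noteq> 0"
  shows "\<bar>(exp (h * x) - 1) / h\<bar> \<le> \<bar>x\<bar> * exp (b * \<bar>x\<bar>)"
proof -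
  have "norm (exp (h * x) - 1) \<le> norm (h * x) * exp (norm (h * x))"
  proof -
    have "\<bar>exp z - 1\<bar> \<le> \<bar>z\<bar> * exp \<bar>z\<bar>" for z :: real
    proof (cases "z \<ge> 0")
      case True
      have "1 - z \<le> exp (- z)" using exp_ge_add_one_self[of "- z"] by simp
      then have "exp z * (1 - z) \<le> exp z * exp (- z)" by (intro mult_left_mono) auto
      then have "exp z * (1 - z) \<le> 1" by (simp add: exp_minus)
      then show ?thesis using True by (simp add: algebra_simps)
    next
      case False
      then have "exp z < 1" by simp
      with False have "\<bar>exp z - 1\<bar> \<le> \<bar>z\<bar>" using exp_ge_add_one_self[of z] by linarith
      also have "\<dots> \<le> \<bar>z\<bar> * exp \<bar>z\<bar>" by (simp add: mult_le_cancel_left1)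
      finally show ?thesis .
    qed
    then show ?thesis by simp
  qed
  also have "\<dots> \<le> \<bar>h\<bar> * \<bar>x\<bar> * exp (b * \<bar>x\<bar>)"
    using assms by (simp add: abs_mult mult_left_mono mult_right_mono)
  finally show ?thesis using assms by (simp add: abs_divide field_simps)
qed

text \<open>Dominated convergence along an arbitrary null sequence. The integrability margin
  \<epsilon> at \<theta> is split in two: one half absorbs the growth of
  \<open>g y * dot d u y\<close>, the other that of the difference quotient.\<close>

lemma J_DERIV_0:
  assumes "\<theta> \<in> Theta d \<mu>" "subexp g"
  shows "((\<lambda>t. J (lc d 1 \<theta> t u) g) has_real_derivative J \<theta> (\<lambda>y. g y * dot d u y)) (at 0)"
  unfolding has_field_derivative_iff tendsto_at_iff_sequentially
proof (intro allI impI)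
  fix X :: "nat \<Rightarrow> real"
  assume X0: "\<forall>i. X i \<in> UNIV - {0}" and X: "X \<longlonglongrightarrow> 0"
  obtain \<epsilon> where \<epsilon>: "\<epsilon> > 0" "integrable \<mu> (\<lambda>y. exp (dot d \<theta> y + \<epsilon> * l1 y))"
    using Theta_exp_l1_integrable[OF assms(1)] by blast
  obtain \<delta> where \<delta>: "\<delta> > 0" "\<And>t. \<bar>t\<bar> < \<delta> \<Longrightarrow> lc d 1 \<theta> t u \<in> Theta d \<mu>"
    using Theta_line[OF assms(1)] by blast
  \<comment> \<open>Increments below \<open>b\<close> cost at most half of \<epsilon>; the summand 1
    covers \<open>l1 u = 0\<close>.\<close>
  define b where "b = \<epsilon> / (2 * (l1 u + 1))"
  have b: "b > 0" "b * l1 u \<le> \<epsilon> / 2" using \<epsilon> l1_nonneg[of u] by (simp_all add: b_def field_simps add_pos_nonneg)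
  have "subexp (\<lambda>y. g y * dot d u y)" using assms by auto
  then obtain C where C: "C \<ge> 0" "\<And>y. \<bar>g y * dot d u y\<bar> \<le> C * exp (\<epsilon> / 2 * l1 y)"
    using subexpE[of "\<lambda>y. g y * dot d u y" "\<epsilon> / 2"] \<epsilon> by (metis half_gt_zero)
  have "eventually (\<lambda>i. \<bar>X i\<bar> < min b \<delta>) sequentially"
    using tendstoD[OF X, of "min b \<delta>"] b \<delta> by (simp add: dist_real_def)
  then obtain n0 where n0: "\<And>i. i \<ge> n0 \<Longrightarrow> \<bar>X i\<bar> < min b \<delta>" by (auto simp: eventually_sequentially)
  note [measurable] = subexp_measurable[OF assms(2)]
  define q where "q = (\<lambda>i y. g y * exp (dot d \<theta> y) * ((exp (X (i + n0) * dot d u y) - 1) / X (i + n0)))"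
  have "(\<lambda>i. \<integral>y. q i y \<partial>\<mu>) \<longlonglongrightarrow> (\<integral>y. g y * dot d u y * exp (dot d \<theta> y) \<partial>\<mu>)"
  proof (rule integral_dominated_convergence)
    show "integrable \<mu> (\<lambda>y. C * exp (dot d \<theta> y + \<epsilon> * l1 y))" using \<epsilon> by simp
    show "AE y in \<mu>. (\<lambda>i. q i y) \<longlonglongrightarrow> g y * dot d u y * exp (dot d \<theta> y)"
    proof (rule AE_I2)
      fix y
      have "((\<lambda>h. exp (h * dot d u y)) has_real_derivative dot d u y) (at 0)"
        by (auto intro!: derivative_eq_intros)
      then have "((\<lambda>h. (exp (h * dot d u y) - 1) / h) \<longlongrightarrow> dot d u y) (at 0)"
        by (simp add: has_field_derivative_iff)
      then have "(\<lambda>i. (exp (X i * dot d u y) - 1) / X i) \<longlonglongrightarrow> dot d u y"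
        unfolding tendsto_at_iff_sequentially using X0 X by (auto simp: o_def)
      then have "(\<lambda>i. (exp (X (i + n0) * dot d u y) - 1) / X (i + n0)) \<longlonglongrightarrow> dot d u y"
        by (rule LIMSEQ_ignore_initial_segment)
      then have "(\<lambda>i. q i y) \<longlonglongrightarrow> g y * exp (dot d \<theta> y) * dot d u y" unfolding q_def by (intro tendsto_intros)
      then show "(\<lambda>i. q i y) \<longlonglongrightarrow> g y * dot d u y * exp (dot d \<theta> y)" by (simp add: mult_ac)
    qed
    show "AE y in \<mu>. norm (q i y) \<le> C * exp (dot d \<theta> y + \<epsilon> * l1 y)" for i
    proof (rule AE_I2)
      fix y
      have "\<bar>(exp (X (i + n0) * dot d u y) - 1) / X (i + n0)\<bar> \<le> \<bar>dot d u y\<bar> * exp (b * \<bar>dot d u y\<bar>)"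
        using n0[of "i + n0"] X0 by (intro abs_exp_quotient_le) auto
      also have "\<dots> \<le> \<bar>dot d u y\<bar> * exp (\<epsilon> / 2 * l1 y)"
      proof -
        have "b * \<bar>dot d u y\<bar> \<le> b * (l1 u * l1 y)" using abs_dot_le b by (intro mult_left_mono) auto
        also have "\<dots> \<le> \<epsilon> / 2 * l1 y" using b mult_right_mono[OF b(2), of "l1 y"] by (simp add: mult.assoc)
        finally show ?thesis by (intro mult_left_mono) auto
      qed
      finally have 1: "\<bar>(exp (X (i + n0) * dot d u y) - 1) / X (i + n0)\<bar> \<le> \<bar>dot d u y\<bar> * exp (\<epsilon> / 2 * l1 y)" .
      have "norm (q i y) = \<bar>g y\<bar> * exp (dot d \<theta> y) * \<bar>(exp (X (i + n0) * dot d u y) - 1) / X (i + n0)\<bar>"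
        by (simp add: q_def abs_mult)
      also have "\<dots> \<le> \<bar>g y\<bar> * exp (dot d \<theta> y) * (\<bar>dot d u y\<bar> * exp (\<epsilon> / 2 * l1 y))"
        by (intro mult_left_mono[OF 1]) auto
      also have "\<dots> = \<bar>g y * dot d u y\<bar> * exp (dot d \<theta> y) * exp (\<epsilon> / 2 * l1 y)" by (simp add: abs_mult)
      also have "\<dots> \<le> C * exp (\<epsilon> / 2 * l1 y) * exp (dot d \<theta> y) * exp (\<epsilon> / 2 * l1 y)"
        using C(2)[of y] by (intro mult_right_mono) auto
      also have "\<dots> = C * exp (dot d \<theta> y + \<epsilon> * l1 y)"
        by (simp add: exp_add[symmetric] mult.assoc)
      finally show "norm (q i y) \<le> C * exp (dot d \<theta> y + \<epsilon> * l1 y)" .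
    qed
  qed (auto simp: q_def)
  moreover have "(\<integral>y. q i y \<partial>\<mu>) = (J (lc d 1 \<theta> (X (i + n0)) u) g - J (lc d 1 \<theta> 0 u) g) / (X (i + n0) - 0)" for i
  proof -
    have "q i y = (g y * exp (dot d (lc d 1 \<theta> (X (i + n0)) u) y) - g y * exp (dot d \<theta> y)) / X (i + n0)" for y
      by (simp add: q_def dot_lc_left exp_add algebra_simps diff_divide_distrib)
    moreover have "integrable \<mu> (\<lambda>y. g y * exp (dot d (lc d 1 \<theta> (X (i + n0)) u) y))" "integrable \<mu> (\<lambda>y. g y * exp (dot d \<theta> y))"
      using n0[of "i + n0"] by (auto intro!: J_integrable assms \<delta>)
    ultimately show ?thesis using assms(1) Theta_Rd by (simp add: J_def)
  qed
  ultimately have "(\<lambda>i. (J (lc d 1 \<theta> (X (i + n0)) u) g - J (lc d 1 \<theta> 0 u) g) / (X (i + n0) - 0))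
     \<longlonglongrightarrow> J \<theta> (\<lambda>y. g y * dot d u y)" by (simp add: J_def mult_ac)
  then show "((\<lambda>y. (J (lc d 1 \<theta> y u) g - J (lc d 1 \<theta> 0 u) g) / (y - 0)) \<circ> X) \<longlonglongrightarrow> J \<theta> (\<lambda>y. g y * dot d u y)"
    unfolding o_def by (rule LIMSEQ_offset)
qed

lemma not_AE_affine: "proper_affine_subspace d A \<Longrightarrow> \<not> (AE y in \<mu>. y \<in> A)"
  using regular by (auto simp: regular_minimal_family_def)

lemma J_1_pos:
  assumes "\<theta> \<in> Theta d \<mu>"
  shows "0 < J \<theta> (\<lambda>_. 1)"
proof -
  have "J \<theta> (\<lambda>_. 1) \<noteq> 0"
  proof
    assume "J \<theta> (\<lambda>_. 1) = 0"
    then have "AE y in \<mu>. exp (dot d \<theta> y) = 0"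
      using integral_nonneg_eq_0_iff_AE[OF Theta_exp_integrable[OF assms]] by (simp add: J_def)
    \<comment> \<open>The empty set is a proper affine subspace, so minimality also excludes the
      zero measure.\<close>
    then have "AE y in \<mu>. y \<in> {}" by simp
    moreover have "proper_affine_subspace d {}"
      using zero_pt_in_Rd[of d] by (auto simp: proper_affine_subspace_def)
    ultimately show False using not_AE_affine by blast
  qed
  moreover have "0 \<le> J \<theta> (\<lambda>_. 1)" by (simp add: J_def)
  ultimately show ?thesis by simp
qed

lemma exp_psi: "\<theta> \<in> Theta d \<mu> \<Longrightarrow> exp (psi d \<mu> \<theta>) = J \<theta> (\<lambda>_. 1)"
  using J_1_pos[of \<theta>] by (simp add: psi_def J_def)

lemma sets_P_fam [simp, measurable_cong]: "sets (P_fam d \<mu> \<theta>) = sets (leb d)"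
  by (simp add: P_fam_def)

lemma space_P_fam [simp]: "space (P_fam d \<mu> \<theta>) = Rd d"
  using sets_eq_imp_space_eq[OF sets_P_fam] by simp

lemma P_fam_density:
  "\<theta> \<in> Theta d \<mu> \<Longrightarrow> P_fam d \<mu> \<theta> = density \<mu> (\<lambda>y. ennreal (exp (dot d \<theta> y) / J \<theta> (\<lambda>_. 1)))"
  unfolding P_fam_def by (simp add: exp_diff exp_psi)

lemma prob_space_P_fam:
  assumes "\<theta> \<in> Theta d \<mu>"
  shows "prob_space (P_fam d \<mu> \<theta>)"
proof
  have "emeasure (P_fam d \<mu> \<theta>) (space (P_fam d \<mu> \<theta>)) = (\<integral>\<^sup>+y. ennreal (exp (dot d \<theta> y) / J \<theta> (\<lambda>_. 1)) \<partial>\<mu>)"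
    using sets.top[of \<mu>] unfolding P_fam_density[OF assms] by (simp add: emeasure_density) (intro nn_integral_cong, simp)
  also have "\<dots> = ennreal (\<integral>y. exp (dot d \<theta> y) / J \<theta> (\<lambda>_. 1) \<partial>\<mu>)"
    using Theta_exp_integrable[OF assms] J_1_pos[OF assms]
    by (intro nn_integral_eq_integral) auto
  also have "(\<integral>y. exp (dot d \<theta> y) / J \<theta> (\<lambda>_. 1) \<partial>\<mu>) = 1"
    using J_1_pos[OF assms] by (simp add: J_def)
  finally show "emeasure (P_fam d \<mu> \<theta>) (space (P_fam d \<mu> \<theta>)) = 1" by simp
qed

lemma integrable_P_fam:
  assumes "\<theta> \<in> Theta d \<mu>" "subexp g"
  shows "integrable (P_fam d \<mu> \<theta>) g"
  using J_integrable[OF assms] J_1_pos[OF assms(1)] subexp_measurable[OF assms(2)]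
  unfolding P_fam_density[OF assms(1)] by (subst integrable_density) (auto simp: mult.commute)

lemma E_fam_J:
  assumes "\<theta> \<in> Theta d \<mu>" "subexp g"
  shows "E_fam d \<mu> \<theta> g = J \<theta> g / J \<theta> (\<lambda>_. 1)"
  using J_1_pos[OF assms(1)] subexp_measurable[OF assms(2)]
  unfolding E_fam_def P_fam_density[OF assms(1)]
  by (subst integral_density) (auto simp: J_def mult.commute)

text \<open>The quotient rule for \<open>J \<theta> g\<close> over \<open>J \<theta> 1\<close>:
  along \<open>u\<close>, an expectation changes at the rate of the covariance of \<open>g\<close>
  with \<open>dot d u\<close>.\<close>

lemma E_fam_DERIV:
  assumes "lc d 1 \<theta> t u \<in> Theta d \<mu>" "subexp g"
  shows "((\<lambda>t. E_fam d \<mu> (lc d 1 \<theta> t u) g) has_real_derivative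
    E_fam d \<mu> (lc d 1 \<theta> t u) (\<lambda>y. g y * dot d u y) - E_fam d \<mu> (lc d 1 \<theta> t u) g * E_fam d \<mu> (lc d 1 \<theta> t u) (dot d u)) (at t)"
proof (rule DERIV_line_shift)
  let ?\<theta> = "lc d 1 \<theta> t u"
  obtain \<delta> where \<delta>: "\<delta> > 0" "\<And>t. \<bar>t\<bar> < \<delta> \<Longrightarrow> lc d 1 ?\<theta> t u \<in> Theta d \<mu>"
    using Theta_line[OF assms(1)] by blast
  have g1: "subexp (\<lambda>y. g y * dot d u y)" using assms by auto
  have D: "((\<lambda>s. J (lc d 1 ?\<theta> s u) g / J (lc d 1 ?\<theta> s u) (\<lambda>_. 1)) has_real_derivative
     (J ?\<theta> (\<lambda>y. g y * dot d u y) * J ?\<theta> (\<lambda>_. 1) - J ?\<theta> g * J ?\<theta> (\<lambda>y. 1 * dot d u y)) / (J ?\<theta> (\<lambda>_. 1) * J ?\<theta> (\<lambda>_. 1))) (at 0)"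
    using DERIV_divide[OF J_DERIV_0[OF assms, of u] J_DERIV_0[OF assms(1) subexp_const, of u 1]] J_1_pos[OF assms(1)]
    by simp
  have "(J ?\<theta> (\<lambda>y. g y * dot d u y) * J ?\<theta> (\<lambda>_. 1) - J ?\<theta> g * J ?\<theta> (\<lambda>y. 1 * dot d u y)) / (J ?\<theta> (\<lambda>_. 1) * J ?\<theta> (\<lambda>_. 1))
     = E_fam d \<mu> ?\<theta> (\<lambda>y. g y * dot d u y) - E_fam d \<mu> ?\<theta> g * E_fam d \<mu> ?\<theta> (dot d u)"
    using J_1_pos[OF assms(1)]
    by (simp add: E_fam_J[OF assms] E_fam_J[OF assms(1) g1] E_fam_J[OF assms(1) subexp_dot] field_simps)
  moreover have "eventually (\<lambda>s. J (lc d 1 ?\<theta> s u) g / J (lc d 1 ?\<theta> s u) (\<lambda>_. 1) = E_fam d \<mu> (lc d 1 ?\<theta> s u) g) (nhds 0)"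
    unfolding eventually_nhds_metric using \<delta> assms(2) by (intro exI[of _ \<delta>]) (auto simp: E_fam_J)
  ultimately show "((\<lambda>s. E_fam d \<mu> (lc d 1 ?\<theta> s u) g) has_real_derivative
     E_fam d \<mu> ?\<theta> (\<lambda>y. g y * dot d u y) - E_fam d \<mu> ?\<theta> g * E_fam d \<mu> ?\<theta> (dot d u)) (at 0)"
    using D by (subst (asm) DERIV_cong_ev[OF refl _ refl]) auto
qed

lemma psi_DERIV:
  assumes "lc d 1 \<theta> t u \<in> Theta d \<mu>"
  shows "((\<lambda>t. psi d \<mu> (lc d 1 \<theta> t u)) has_real_derivative E_fam d \<mu> (lc d 1 \<theta> t u) (dot d u)) (at t)"
proof (rule DERIV_line_shift)
  let ?\<theta> = "lc d 1 \<theta> t u"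
  have "((\<lambda>s. ln (J (lc d 1 ?\<theta> s u) (\<lambda>_. 1))) has_real_derivative
     1 / J ?\<theta> (\<lambda>_. 1) * J ?\<theta> (\<lambda>y. 1 * dot d u y)) (at 0)"
    using DERIV_ln_divide[of "J ?\<theta> (\<lambda>_. 1)"] J_1_pos[OF assms] J_DERIV_0[OF assms subexp_const, of u 1]
    by (intro DERIV_chain2[where f = ln]) auto
  then show "((\<lambda>s. psi d \<mu> (lc d 1 ?\<theta> s u)) has_real_derivative E_fam d \<mu> ?\<theta> (dot d u)) (at 0)"
    by (simp add: E_fam_J[OF assms] psi_def J_def)
qed

section \<open>Central second and third moments as derivatives\<close>

abbreviation E :: "point \<Rightarrow> (point \<Rightarrow> real) \<Rightarrow> real" where "E \<equiv> E_fam d \<mu>"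

lemma E_add:
  assumes "\<theta> \<in> Theta d \<mu>" "subexp f" "subexp g"
  shows "E \<theta> (\<lambda>y. f y + g y) = E \<theta> f + E \<theta> g"
  unfolding E_fam_def by (intro Bochner_Integration.integral_add integrable_P_fam assms)

lemma E_diff:
  assumes "\<theta> \<in> Theta d \<mu>" "subexp f" "subexp g"
  shows "E \<theta> (\<lambda>y. f y - g y) = E \<theta> f - E \<theta> g"
  unfolding E_fam_def by (intro Bochner_Integration.integral_diff integrable_P_fam assms)

lemma E_cmult: "E \<theta> (\<lambda>y. c * g y) = c * E \<theta> g"
  unfolding E_fam_def by simp

lemma E_const [simp]: "\<theta> \<in> Theta d \<mu> \<Longrightarrow> E \<theta> (\<lambda>y. c) = c"
  unfolding E_fam_def using prob_space.prob_space[OF prob_space_P_fam[of \<theta>]] by simp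

lemma E_sum:
  assumes "\<theta> \<in> Theta d \<mu>" "\<And>i. i \<in> I \<Longrightarrow> subexp (f i)"
  shows "E \<theta> (\<lambda>y. \<Sum>i\<in>I. f i y) = (\<Sum>i\<in>I. E \<theta> (f i))"
  unfolding E_fam_def by (intro Bochner_Integration.integral_sum integrable_P_fam assms)

lemma E_dot:
  assumes "\<theta> \<in> Theta d \<mu>"
  shows "E \<theta> (dot d u) = (\<Sum>i<d. u i * E \<theta> (\<lambda>y. y i))"
proof -
  have "E \<theta> (dot d u) = (\<Sum>i<d. E \<theta> (\<lambda>y. u i * y i))"
    unfolding dot_def by (rule E_sum[OF assms]) (intro subexp_mult[OF subexp_const] subexp_component, simp)
  then show ?thesis by (simp add: E_cmult)
qed

lemma E_dot_lc:
  "\<theta> \<in> Theta d \<mu> \<Longrightarrow> E \<theta> (dot d (lc d a u b v)) = a * E \<theta> (dot d u) + b * E \<theta> (dot d v)"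
  by (simp add: E_dot sum_distrib_left sum.distrib algebra_simps)

definition cen :: "point \<Rightarrow> point \<Rightarrow> point \<Rightarrow> real" where
  "cen \<theta> u y = dot d u y - E \<theta> (dot d u)"

lemma subexp_cen [simp, intro]: "subexp (cen \<theta> u)"
  unfolding cen_def by (intro subexp_diff subexp_dot subexp_const)

lemma cen_lc: "\<theta> \<in> Theta d \<mu> \<Longrightarrow> cen \<theta> (lc d a u b v) y = a * cen \<theta> u y + b * cen \<theta> v y"
  by (simp add: cen_def E_dot_lc dot_lc_left algebra_simps)

definition Cov :: "point \<Rightarrow> point \<Rightarrow> point \<Rightarrow> real" where
  "Cov \<theta> u v = E \<theta> (\<lambda>y. cen \<theta> u y * cen \<theta> v y)"

definition T3 :: "point \<Rightarrow> point \<Rightarrow> point \<Rightarrow> point \<Rightarrow> real" where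
  "T3 \<theta> u v w = E \<theta> (\<lambda>y. cen \<theta> u y * cen \<theta> v y * cen \<theta> w y)"

lemma central_moment_2: "central_moment d \<mu> \<theta> 2 u = Cov \<theta> u u"
  by (simp add: central_moment_def Cov_def cen_def power2_eq_square)

lemma central_moment_3: "central_moment d \<mu> \<theta> 3 u = T3 \<theta> u u u"
  by (simp add: central_moment_def T3_def cen_def power3_eq_cube)

lemma Cov_raw:
  assumes "\<theta> \<in> Theta d \<mu>"
  shows "Cov \<theta> u v = E \<theta> (\<lambda>y. dot d u y * dot d v y) - E \<theta> (dot d u) * E \<theta> (dot d v)"
proof -
  let ?m = "E \<theta> (dot d u)" and ?k = "E \<theta> (dot d v)"
  have "Cov \<theta> u v = E \<theta> (\<lambda>y. dot d u y * dot d v y - (?k * dot d u y + ?m * dot d v y - ?m * ?k))"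
    by (simp add: Cov_def cen_def algebra_simps)
  also have "\<dots> = E \<theta> (\<lambda>y. dot d u y * dot d v y) - (?k * ?m + ?m * ?k - ?m * ?k)"
    using assms by (subst E_diff E_add | intro subexp_diff subexp_add subexp_mult subexp_dot subexp_const | simp add: E_cmult)+
  finally show ?thesis by simp
qed

text \<open>\<open>E_fam_DERIV\<close> differentiates the expectation of a fixed integrand, whereas
  a centred product moves with \<theta> through its mean. Expanding into raw moments lets
  \<open>T3_DERIV\<close> recognise the derivative of a covariance.\<close>

lemma T3_raw:
  assumes "\<theta> \<in> Theta d \<mu>"
  shows "T3 \<theta> u v v = E \<theta> (\<lambda>y. dot d v y * dot d v y * dot d u y) - E \<theta> (\<lambda>y. dot d v y * dot d v y) * E \<theta> (dot d u)
    - 2 * E \<theta> (dot d v) * (E \<theta> (\<lambda>y. dot d v y * dot d u y) - E \<theta> (dot d v) * E \<theta> (dot d u))"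
proof -
  let ?m = "E \<theta> (dot d u)" and ?k = "E \<theta> (dot d v)"
  have "T3 \<theta> u v v = E \<theta> (\<lambda>y. dot d v y * dot d v y * dot d u y - (?m * (dot d v y * dot d v y) +
      (2 * ?k * (dot d v y * dot d u y) - (2 * ?m * ?k * dot d v y + (?k * ?k * dot d u y - ?k * ?k * ?m)))))"
    unfolding T3_def cen_def by (intro arg_cong[where f = "E \<theta>"] ext) (simp add: algebra_simps)
  also have "\<dots> = E \<theta> (\<lambda>y. dot d v y * dot d v y * dot d u y) - (?m * E \<theta> (\<lambda>y. dot d v y * dot d v y) +
      (2 * ?k * E \<theta> (\<lambda>y. dot d v y * dot d u y) - (2 * ?m * ?k * ?k + (?k * ?k * ?m - ?k * ?k * ?m))))"
    using assms by (subst E_diff E_add | intro subexp_diff subexp_add subexp_mult subexp_dot subexp_const | simp add: E_cmult)+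
  finally show ?thesis by (simp add: algebra_simps)
qed

lemma Cov_lc_left:
  assumes "\<theta> \<in> Theta d \<mu>"
  shows "Cov \<theta> (lc d a u b v) w = a * Cov \<theta> u w + b * Cov \<theta> v w"
proof -
  have "Cov \<theta> (lc d a u b v) w = E \<theta> (\<lambda>y. a * (cen \<theta> u y * cen \<theta> w y) + b * (cen \<theta> v y * cen \<theta> w y))"
    by (simp add: Cov_def cen_lc[OF assms] algebra_simps)
  also have "\<dots> = a * Cov \<theta> u w + b * Cov \<theta> v w"
    unfolding Cov_def E_cmult[symmetric]
    by (intro E_add assms subexp_mult subexp_const subexp_cen)
  finally show ?thesis .
qed

lemma Cov_commute: "Cov \<theta> u v = Cov \<theta> v u"
  by (simp add: Cov_def mult.commute)

lemma Cov_DERIV: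
  assumes "lc d 1 \<theta> t u \<in> Theta d \<mu>"
  shows "((\<lambda>t. E (lc d 1 \<theta> t u) (dot d v)) has_real_derivative Cov (lc d 1 \<theta> t u) v u) (at t)"
  using E_fam_DERIV[OF assms subexp_dot] by (simp add: Cov_raw[OF assms])

lemma eventually_line_Theta:
  assumes "lc d 1 \<theta> t u \<in> Theta d \<mu>"
  shows "eventually (\<lambda>s. lc d 1 \<theta> s u \<in> Theta d \<mu>) (nhds t)"
proof -
  obtain \<delta> where \<delta>: "\<delta> > 0" "\<And>s. \<bar>s\<bar> < \<delta> \<Longrightarrow> lc d 1 (lc d 1 \<theta> t u) s u \<in> Theta d \<mu>"
    using Theta_line[OF assms] by blast
  have "lc d 1 \<theta> s u \<in> Theta d \<mu>" if "dist s t < \<delta>" for s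
    using \<delta>(2)[of "s - t"] that by (simp add: lc_lc_line dist_real_def)
  then show ?thesis unfolding eventually_nhds_metric using \<delta>(1) by blast
qed

lemma T3_DERIV:
  assumes "lc d 1 \<theta> t u \<in> Theta d \<mu>"
  shows "((\<lambda>t. Cov (lc d 1 \<theta> t u) v v) has_real_derivative T3 (lc d 1 \<theta> t u) u v v) (at t)"
proof -
  let ?\<theta> = "lc d 1 \<theta> t u"
  have vv: "subexp (\<lambda>y. dot d v y * dot d v y)" by auto
  have "((\<lambda>t. E (lc d 1 \<theta> t u) (\<lambda>y. dot d v y * dot d v y) - E (lc d 1 \<theta> t u) (dot d v) * E (lc d 1 \<theta> t u) (dot d v))
    has_real_derivative T3 ?\<theta> u v v) (at t)"
    unfolding T3_raw[OF assms]
    by (rule derivative_eq_intros E_fam_DERIV[OF assms vv] E_fam_DERIV[OF assms subexp_dot] refl)+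
       (simp add: algebra_simps)
  moreover have "eventually (\<lambda>s. E (lc d 1 \<theta> s u) (\<lambda>y. dot d v y * dot d v y) - E (lc d 1 \<theta> s u) (dot d v) * E (lc d 1 \<theta> s u) (dot d v)
     = Cov (lc d 1 \<theta> s u) v v) (nhds t)"
    using eventually_line_Theta[OF assms] by eventually_elim (simp add: Cov_raw)
  ultimately show ?thesis by (subst (asm) DERIV_cong_ev[OF refl _ refl]) auto
qed

definition fm :: "point \<Rightarrow> nat \<Rightarrow> nat \<Rightarrow> real" where
  "fm \<theta> i j = E \<theta> (\<lambda>y. (y i - E \<theta> (\<lambda>z. z i)) * (y j - E \<theta> (\<lambda>z. z j)))"

lemma Fmat_form: "Fmat d \<mu> \<theta> = form_mat d (fm \<theta>)"
  by (simp add: Fmat_def form_mat_def fm_def)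

lemma qf_fm:
  assumes "\<theta> \<in> Theta d \<mu>"
  shows "qf d (fm \<theta>) u v = Cov \<theta> u v"
proof -
  have c: "cen \<theta> u y = (\<Sum>i<d. u i * (y i - E \<theta> (\<lambda>z. z i)))" for u y
    unfolding cen_def E_dot[OF assms] dot_def by (simp add: sum_subtractf right_diff_distrib)
  have s: "subexp (\<lambda>y. (y i - E \<theta> (\<lambda>z. z i)) * (y j - E \<theta> (\<lambda>z. z j)))" if "i < d" "j < d" for i j
    using that by (intro subexp_mult subexp_diff subexp_component subexp_const)
  have "Cov \<theta> u v = E \<theta> (\<lambda>y. \<Sum>i<d. \<Sum>j<d. (u i * v j) * ((y i - E \<theta> (\<lambda>z. z i)) * (y j - E \<theta> (\<lambda>z. z j))))"
    unfolding Cov_def c sum_product by (simp add: mult_ac)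
  also have "\<dots> = (\<Sum>i<d. E \<theta> (\<lambda>y. \<Sum>j<d. (u i * v j) * ((y i - E \<theta> (\<lambda>z. z i)) * (y j - E \<theta> (\<lambda>z. z j)))))"
  proof (rule E_sum[OF assms])
    fix i assume i: "i \<in> {..<d}"
    have "subexp (\<lambda>y. \<Sum>j\<in>{..<k}. (u i * v j) * ((y i - E \<theta> (\<lambda>z. z i)) * (y j - E \<theta> (\<lambda>z. z j))))" if "k \<le> d" for k
      using that
    proof (induction k)
      case (Suc k)
      then show ?case unfolding sum.lessThan_Suc using i
        by (intro subexp_add subexp_mult[OF subexp_const] s) auto
    qed simp
    then show "subexp (\<lambda>y. \<Sum>j<d. (u i * v j) * ((y i - E \<theta> (\<lambda>z. z i)) * (y j - E \<theta> (\<lambda>z. z j))))" by simp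
  qed
  also have "\<dots> = (\<Sum>i<d. \<Sum>j<d. (u i * v j) * fm \<theta> i j)"
  proof (intro sum.cong refl)
    fix i assume i: "i \<in> {..<d}"
    have "E \<theta> (\<lambda>y. \<Sum>j<d. (u i * v j) * ((y i - E \<theta> (\<lambda>z. z i)) * (y j - E \<theta> (\<lambda>z. z j)))) =
       (\<Sum>j<d. E \<theta> (\<lambda>y. (u i * v j) * ((y i - E \<theta> (\<lambda>z. z i)) * (y j - E \<theta> (\<lambda>z. z j)))))"
      using i by (intro E_sum[OF assms] subexp_mult[OF subexp_const] s) auto
    then show "E \<theta> (\<lambda>y. \<Sum>j<d. (u i * v j) * ((y i - E \<theta> (\<lambda>z. z i)) * (y j - E \<theta> (\<lambda>z. z j)))) =
       (\<Sum>j<d. (u i * v j) * fm \<theta> i j)" by (simp add: E_cmult fm_def)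
  qed
  finally show ?thesis by (simp add: qf_def mult_ac)
qed

lemma AE_P_fam_iff:
  assumes "\<theta> \<in> Theta d \<mu>"
  shows "(AE y in P_fam d \<mu> \<theta>. Q y) \<longleftrightarrow> (AE y in \<mu>. Q y)"
  unfolding P_fam_density[OF assms] using J_1_pos[OF assms] by (subst AE_density) auto

text \<open>If the variance of \<open>dot d u\<close> vanished, \<mu> would live on a hyperplane
  orthogonal to \<open>u\<close>, which minimality forbids.\<close>

lemma Cov_pos:
  assumes "\<theta> \<in> Theta d \<mu>" "u \<in> Rd d" "u \<noteq> zero_pt d"
  shows "0 < Cov \<theta> u u"
proof -
  have nn: "0 \<le> Cov \<theta> u u" unfolding Cov_def E_fam_def by (intro integral_nonneg_AE AE_I2) auto
  moreover have "Cov \<theta> u u \<noteq> 0"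
  proof
    assume 0: "Cov \<theta> u u = 0"
    have "integrable (P_fam d \<mu> \<theta>) (\<lambda>y. cen \<theta> u y * cen \<theta> u y)" by (intro integrable_P_fam assms) auto
    then have "AE y in P_fam d \<mu> \<theta>. cen \<theta> u y * cen \<theta> u y = 0"
      using 0 integral_nonneg_eq_0_iff_AE[of "P_fam d \<mu> \<theta>" "\<lambda>y. cen \<theta> u y * cen \<theta> u y"]
      by (simp add: Cov_def E_fam_def)
    then have "AE y in \<mu>. dot d u y = E \<theta> (dot d u)"
      unfolding AE_P_fam_iff[OF assms(1)] by (simp add: cen_def)
    moreover define A where "A = {y \<in> Rd d. dot d u y = E \<theta> (dot d u)}"
    moreover have "AE y in \<mu>. y \<in> Rd d" using AE_space[of \<mu>] by simp
    ultimately have "AE y in \<mu>. y \<in> A" by (auto simp: A_def)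
    moreover have "proper_affine_subspace d A"
      unfolding proper_affine_subspace_def
    proof (intro conjI ballI allI)
      have nz: "dot d u u \<noteq> 0"
      proof
        assume "dot d u u = 0"
        then have "\<forall>i<d. u i * u i = 0" unfolding dot_def by (subst (asm) sum_nonneg_eq_0_iff) auto
        then have "u = zero_pt d" using assms(2) by (intro Rd_eqI) auto
        with assms(3) show False by simp
      qed
      \<comment> \<open>The hyperplane is a proper subset: this multiple of \<open>u\<close> has
        inner product one more than the required value.\<close>
      have "lc d ((E \<theta> (dot d u) + 1) / dot d u u) u 0 u \<notin> A"
        using nz by (simp add: A_def dot_lc_right)
      moreover have "lc d ((E \<theta> (dot d u) + 1) / dot d u u) u 0 u \<in> Rd d" by simp
      ultimately show "A \<subset> Rd d" unfolding A_def by blast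
    qed (auto simp: A_def segment_pt_lc dot_lc_right algebra_simps)
    ultimately show False using not_AE_affine by blast
  qed
  ultimately show ?thesis by simp
qed

lemma posdef_fm:
  assumes "\<theta> \<in> Theta d \<mu>"
  shows "posdef d (fm \<theta>)"
  unfolding posdef_def using Cov_pos[OF assms] by (auto simp: qf_fm[OF assms] fm_def mult.commute)

lemma T3_polarization:
  assumes "\<theta> \<in> Theta d \<mu>"
  shows "T3 \<theta> u v v = (T3 \<theta> (lc d 1 v 1 u) (lc d 1 v 1 u) (lc d 1 v 1 u)
    - T3 \<theta> (lc d 1 v (-1) u) (lc d 1 v (-1) u) (lc d 1 v (-1) u) - 2 * T3 \<theta> u u u) / 6"
proof -
  let ?p = "lc d 1 v 1 u" and ?q = "lc d 1 v (-1) u"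
  have s: "subexp (\<lambda>y. cen \<theta> u y * cen \<theta> v y * cen \<theta> w y)" for u v w
    by (intro subexp_mult subexp_cen)
  have "T3 \<theta> u v v = E \<theta> (\<lambda>y. (1/6) * (cen \<theta> ?p y * cen \<theta> ?p y * cen \<theta> ?p y
     - cen \<theta> ?q y * cen \<theta> ?q y * cen \<theta> ?q y - 2 * (cen \<theta> u y * cen \<theta> u y * cen \<theta> u y)))"
    unfolding T3_def cen_lc[OF assms] by (intro arg_cong[where f = "E \<theta>"] ext) (simp add: algebra_simps)
  also have "\<dots> = (1/6) * (T3 \<theta> ?p ?p ?p - T3 \<theta> ?q ?q ?q - 2 * T3 \<theta> u u u)"
    unfolding E_cmult T3_def using s assms by (simp add: E_diff E_cmult subexp_diff subexp_mult)
  finally show ?thesis by simp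
qed

lemma T3_scale_left: "\<theta> \<in> Theta d \<mu> \<Longrightarrow> T3 \<theta> (lc d c u 0 u) v v = c * T3 \<theta> u v v"
  by (simp add: T3_def cen_lc E_cmult[symmetric] mult.assoc)

text \<open>The polarization identity bounds the mixed third moment by the pure ones; the parallelogram
  law keeps the constant small.\<close>

lemma T3_mixed_bound:
  assumes \<theta>: "\<theta> \<in> Theta d \<mu>" and a: "posdef d a"
    and K: "\<And>w. w \<in> Rd d \<Longrightarrow> \<bar>T3 \<theta> w w w\<bar> \<le> K * sqrt (qf d a w w) ^ 3" and "0 \<le> K"
    and uv: "u \<in> Rd d" "v \<in> Rd d"
  shows "\<bar>T3 \<theta> u v v\<bar> \<le> 5 / 3 * K * sqrt (qf d a u u) * qf d a v v"
proof -
  let ?N = "\<lambda>w. sqrt (qf d a w w)"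
  \<comment> \<open>Equal norms first. By the parallelogram law the squared norms of
    \<open>v + u\<close> and \<open>v - u\<close> sum to \<open>4 b^2\<close>, so the cubes sum to
    at most \<open>8 b^3\<close>, and \<open>(8 + 2) / 6 = 5 / 3\<close>.\<close>
  have eq: "\<bar>T3 \<theta> u v v\<bar> \<le> 5 / 3 * K * b ^ 3" if b: "?N u = b" "?N v = b" "u \<in> Rd d" for u b
  proof -
    let ?p = "lc d 1 v 1 u" and ?q = "lc d 1 v (-1) u"
    have b0: "0 \<le> b" "qf d a u u = b\<^sup>2" "qf d a v v = b\<^sup>2" using b qf_nonneg[OF a] by auto
    have par: "qf d a ?p ?p + qf d a ?q ?q = 4 * b\<^sup>2"
      using b0 by (simp add: qf_lc_left qf_lc_right)
    have cube: "?N w ^ 3 \<le> 2 * b * qf d a w w" if "qf d a w w \<le> 4 * b\<^sup>2" for w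
    proof -
      have "?N w \<le> 2 * b" using that b0(1) by (intro real_le_lsqrt) (auto simp: power2_eq_square)
      then have "?N w * (?N w)\<^sup>2 \<le> 2 * b * (?N w)\<^sup>2" by (rule mult_right_mono) simp
      then show ?thesis using qf_nonneg[OF a, of w] by (simp add: power3_eq_cube power2_eq_square mult_ac)
    qed
    have "?N ?p ^ 3 + ?N ?q ^ 3 \<le> 2 * b * qf d a ?p ?p + 2 * b * qf d a ?q ?q"
      using cube[of ?p] cube[of ?q] par qf_nonneg[OF a, of ?p] qf_nonneg[OF a, of ?q] by linarith
    also have "\<dots> = 2 * b * (4 * b\<^sup>2)" unfolding par[symmetric] by (simp add: distrib_left)
    finally have pq: "?N ?p ^ 3 + ?N ?q ^ 3 \<le> 8 * b ^ 3" by (simp add: power2_eq_square power3_eq_cube)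
    have "\<bar>T3 \<theta> u v v\<bar> \<le> (\<bar>T3 \<theta> ?p ?p ?p\<bar> + \<bar>T3 \<theta> ?q ?q ?q\<bar> + 2 * \<bar>T3 \<theta> u u u\<bar>) / 6"
      unfolding T3_polarization[OF \<theta>, of u v] by (simp add: field_simps)
    also have "\<dots> \<le> (K * ?N ?p ^ 3 + K * ?N ?q ^ 3 + 2 * (K * ?N u ^ 3)) / 6"
      using K[of ?p] K[of ?q] K[OF b(3)] by (simp add: field_simps)
    also have "\<dots> = K * (?N ?p ^ 3 + ?N ?q ^ 3 + 2 * b ^ 3) / 6" unfolding b(1) by (simp add: algebra_simps)
    also have "\<dots> \<le> K * (8 * b ^ 3 + 2 * b ^ 3) / 6"
      using pq \<open>0 \<le> K\<close> by (intro divide_right_mono mult_left_mono) auto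
    finally show ?thesis by simp
  qed
  show ?thesis
  proof (cases "u = zero_pt d")
    case True
    then have "cen \<theta> u y = 0" for y using \<theta> by (simp add: cen_def E_dot)
    then show ?thesis using True \<theta> by (simp add: T3_def)
  next
    case False
    then have nu: "?N u > 0" using qf_pos[OF a] uv by simp
    \<comment> \<open>Linearity in the first slot: rescaling \<open>u\<close> to the norm of
      \<open>v\<close> reduces to the case of equal norms.\<close>
    define c where "c = ?N v / ?N u"
    show ?thesis
    proof (cases "?N v = 0")
      case True
      then have "v = zero_pt d" using qf_pos[OF a uv(2)] by (cases "v = zero_pt d") auto
      then have "cen \<theta> v y = 0" for y using \<theta> by (simp add: cen_def E_dot)
      then show ?thesis using True \<theta> by (simp add: T3_def)
    next
      case False
      then have nv: "?N v > 0" using qf_nonneg[OF a, of v] by simp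
      have c: "c > 0" using nu nv by (simp add: c_def)
      have "?N (lc d c u 0 u) = c * ?N u"
        using c by (simp add: qf_lc_left qf_lc_right real_sqrt_mult power2_eq_square[symmetric] mult.assoc[symmetric])
      then have "\<bar>T3 \<theta> (lc d c u 0 u) v v\<bar> \<le> 5 / 3 * K * ?N v ^ 3"
        using nu by (intro eq) (auto simp: c_def)
      then have "c * \<bar>T3 \<theta> u v v\<bar> \<le> 5 / 3 * K * ?N v ^ 3"
        using c by (simp add: T3_scale_left[OF \<theta>] abs_mult)
      then have "\<bar>T3 \<theta> u v v\<bar> \<le> 5 / 3 * K * ?N v ^ 3 / c" using c by (simp add: field_simps)
      also have "\<dots> = 5 / 3 * K * ?N u * (?N v)\<^sup>2"
        using nu nv by (simp add: c_def power2_eq_square power3_eq_cube)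
      finally show ?thesis using qf_nonneg[OF a, of v] by simp
    qed
  qed
qed

end

section \<open>The norm and the Gaussian of a positive definite form\<close>

locale quad =
  fixes d :: nat and a :: "nat \<Rightarrow> nat \<Rightarrow> real"
  assumes posdef: "posdef d a" and d1: "1 \<le> d"
begin

definition N :: "point \<Rightarrow> real" where "N x = sqrt (qf d a x x)"

definition G :: "point \<Rightarrow> real" where "G x = exp (- qf d a x x / 2)"

definition G0 :: real where "G0 = sqrt ((2 * pi) ^ d / det (form_mat d a))"

lemma N_nonneg [simp]: "0 \<le> N x"
  by (simp add: N_def qf_nonneg[OF posdef])

lemma N_sq: "(N x)\<^sup>2 = qf d a x x"
  by (simp add: N_def qf_nonneg[OF posdef])

lemma N_zero_pt [simp]: "N (zero_pt d) = 0" by (simp add: N_def)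

lemma N_eq_0_iff: "x \<in> Rd d \<Longrightarrow> N x = 0 \<longleftrightarrow> x = zero_pt d"
  using qf_pos[OF posdef, of x] by (cases "x = zero_pt d") (simp_all add: N_def less_le)

lemma G_eq: "G x = exp (- (N x)\<^sup>2 / 2)" by (simp add: G_def N_sq)

lemma G_pos [simp]: "0 < G x" by (simp add: G_def)

lemma G_nonneg [simp]: "0 \<le> G x" by (simp add: G_def)

lemma N_measurable [measurable]: "N \<in> borel_measurable (leb d)"
  unfolding N_def by measurable

lemma G_measurable [measurable]: "G \<in> borel_measurable (leb d)"
  unfolding G_def by measurable

lemma G0_pos: "0 < G0"
  using gaussian_integral[OF posdef] by (simp add: G0_def)

lemma nn_integral_G: "(\<integral>\<^sup>+x. ennreal (G x) \<partial>leb d) = ennreal G0"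
  using gaussian_integral[OF posdef] by (simp add: G_def G0_def)

lemma q_cong_lc: "qf d a (lc d 1 x 0 x) y = qf d a x y"
  by (simp add: qf_lc_left)

lemma measurable_q [measurable]: "(\<lambda>y. qf d a v y) \<in> borel_measurable (leb d)"
  unfolding q_cong_lc[symmetric, of v] by (rule measurable_qf) auto

lemma N_lc_self [simp]: "N (lc d c x 0 z) = \<bar>c\<bar> * N x"
proof -
  have "qf d a (lc d c x 0 z) (lc d c x 0 z) = c\<^sup>2 * qf d a x x"
    by (simp add: qf_lc_left qf_lc_right power2_eq_square)
  then show ?thesis by (simp add: N_def real_sqrt_mult)
qed

lemma abs_q_le: "\<bar>qf d a x y\<bar> \<le> N x * N y"
proof -
  have "(qf d a x y)\<^sup>2 = (qf d a x (lc d 1 y 0 y))\<^sup>2" by (simp add: qf_lc_right)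
  also have "\<dots> \<le> qf d a x x * qf d a (lc d 1 y 0 y) (lc d 1 y 0 y)"
    by (rule qf_cauchy_schwarz[OF posdef]) simp
  also have "\<dots> = (N x * N y)\<^sup>2" by (simp add: N_sq power_mult_distrib qf_lc_left qf_lc_right)
  finally show ?thesis unfolding abs_le_square_iff[symmetric] by simp
qed

lemma q_commute: "qf d a x y = qf d a y x"
  by (rule qf_commute[OF posdef])

lemma N_lc_sq: "(N (lc d b x c y))\<^sup>2 = b\<^sup>2 * (N x)\<^sup>2 + 2 * b * c * qf d a x y + c\<^sup>2 * (N y)\<^sup>2"
  unfolding N_sq using q_commute[of y x] by (simp add: qf_lc_left qf_lc_right algebra_simps power2_eq_square)

lemma N_lc_le: "N (lc d b x c y) \<le> \<bar>b\<bar> * N x + \<bar>c\<bar> * N y"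
proof (rule power2_le_imp_le)
  have "b * c * qf d a x y \<le> \<bar>b * c\<bar> * (N x * N y)"
    using mult_left_mono[OF abs_q_le[of x y], of "\<bar>b * c\<bar>"] abs_le_D1[of "b * c * qf d a x y"]
    by (simp add: abs_mult)
  then show "(N (lc d b x c y))\<^sup>2 \<le> (\<bar>b\<bar> * N x + \<bar>c\<bar> * N y)\<^sup>2"
    unfolding N_lc_sq by (simp add: power2_sum power_mult_distrib abs_mult algebra_simps)
qed (simp add: add_nonneg_nonneg)

text \<open>The numerical value never matters: ball volumes and exponential integrals are multiples
  of \<open>vol\<close>, and only their ratios enter the final bounds.\<close>

definition vol :: ennreal where "vol = emeasure (leb d) {x \<in> Rd d. N x \<le> 1}"

lemma ball_sets [measurable]: "{x \<in> Rd d. N x \<le> t} \<in> sets (leb d)"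
  using measurable_sets[OF N_measurable, of "{..t}"] by (auto simp: vimage_def Int_def conj_commute)

lemma emeasure_ball:
  assumes "t > 0"
  shows "emeasure (leb d) {x \<in> Rd d. N x \<le> t} = ennreal (t ^ d) * vol"
proof -
  have "(\<integral>\<^sup>+x. indicator {x \<in> Rd d. N x \<le> t} (lc d t x 0 x) \<partial>leb d) =
    ennreal (1 / t ^ d) * (\<integral>\<^sup>+x. indicator {x \<in> Rd d. N x \<le> t} x \<partial>leb d)"
    using assms by (intro nn_integral_leb_scale) auto
  also have "(\<integral>\<^sup>+x. indicator {x \<in> Rd d. N x \<le> t} (lc d t x 0 x) \<partial>leb d) =
     (\<integral>\<^sup>+x. indicator {x \<in> Rd d. N x \<le> 1} x \<partial>leb d)"
    using assms by (intro nn_integral_cong) (auto simp: indicator_def)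
  finally have "vol = ennreal (1 / t ^ d) * emeasure (leb d) {x \<in> Rd d. N x \<le> t}"
    by (simp add: vol_def)
  then have "ennreal (t ^ d) * vol = (ennreal (t ^ d) * ennreal (1 / t ^ d)) * emeasure (leb d) {x \<in> Rd d. N x \<le> t}"
    by (simp add: mult.assoc)
  also have "ennreal (t ^ d) * ennreal (1 / t ^ d) = 1" using assms by (simp add: ennreal_mult[symmetric])
  finally show ?thesis by simp
qed

text \<open>The Gaussian is at least \<open>exp (- 1 / 2)\<close> on the unit ball and has finite
  mass.\<close>

lemma vol_finite: "vol < \<infinity>"
proof -
  have "ennreal (exp (- 1 / 2)) * vol = (\<integral>\<^sup>+x. ennreal (exp (- 1 / 2)) * indicator {x \<in> Rd d. N x \<le> 1} x \<partial>leb d)"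
    by (simp add: vol_def nn_integral_cmult)
  also have "\<dots> \<le> (\<integral>\<^sup>+x. ennreal (G x) \<partial>leb d)"
  proof (rule nn_integral_mono)
    fix x
    show "ennreal (exp (- 1 / 2)) * indicator {x \<in> Rd d. N x \<le> 1} x \<le> ennreal (G x)"
    proof (cases "N x \<le> 1")
      case True
      then have "(N x)\<^sup>2 \<le> 1" by (simp add: power_le_one)
      then show ?thesis by (auto simp: G_eq indicator_def)
    qed (simp add: indicator_def)
  qed
  also have "\<dots> < \<infinity>" by (simp add: nn_integral_G)
  finally show ?thesis by (auto simp: ennreal_mult_less_top)
qed

text \<open>Otherwise every ball, hence the whole space, would be null, against the positive mass of
  the Gaussian.\<close>

lemma vol_pos: "0 < vol"
proof (rule ccontr)
  assume "\<not> 0 < vol"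
  then have 0: "vol = 0" by (simp add: not_gr_zero)
  have "emeasure (leb d) (\<Union>n. {x \<in> Rd d. N x \<le> real (Suc n)}) = 0"
    by (intro emeasure_UN_eq_0) (auto simp: emeasure_ball 0 simp del: of_nat_Suc)
  moreover have "(\<Union>n. {x \<in> Rd d. N x \<le> real (Suc n)}) = space (leb d)"
  proof -
    have "\<exists>n. N x \<le> real (Suc n)" for x
    proof -
      obtain n where "N x \<le> real n" using real_arch_simple by blast
      then show ?thesis by (intro exI[of _ n]) simp
    qed
    then show ?thesis by auto
  qed
  ultimately have "AE x in leb d. False" using sets.top[of "leb d"] by (intro AE_I[of _ _ "space (leb d)"]) auto
  then have "AE x in leb d. ennreal (G x) = 0" by (rule eventually_mono) simp
  then have "(\<integral>\<^sup>+x. ennreal (G x) \<partial>leb d) = 0" by (subst nn_integral_0_iff_AE) auto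
  then show False using G0_pos nn_integral_G by simp
qed

text \<open>Layer-cake representation \<open>exp (- N x) = \<integral>\<^sub>0\<^sup>\<infinity> exp (- t) \<cdot> [N x \<le> t] dt\<close>.\<close>

lemma nn_integral_exp_N_1: "(\<integral>\<^sup>+x. ennreal (exp (- N x)) \<partial>leb d) = ennreal (fact d) * vol"
proof -
  interpret pair_sigma_finite lborel "leb d"
    by (intro pair_sigma_finite.intro) (auto intro: sigma_finite_lborel)
  let ?f = "\<lambda>t x. ennreal (exp (- t)) * indicator {x. N x \<le> t} x"
  have "case_prod ?f = (\<lambda>p. if N (snd p) \<le> fst p then ennreal (exp (- fst p)) else 0)"
    by (auto simp: fun_eq_iff indicator_def)
  also have "\<dots> \<in> borel_measurable (lborel \<Otimes>\<^sub>M leb d)" by measurable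
  finally have m: "case_prod ?f \<in> borel_measurable (lborel \<Otimes>\<^sub>M leb d)" .
  have "(\<integral>\<^sup>+x. ennreal (exp (- N x)) \<partial>leb d) = (\<integral>\<^sup>+x. \<integral>\<^sup>+t. ?f t x \<partial>lborel \<partial>leb d)"
  proof (rule nn_integral_cong)
    fix x
    have "(\<integral>\<^sup>+t. ennreal (exp (- t)) * indicator {N x..} t \<partial>lborel) = ennreal (0 - (- exp (- N x)))"
    proof (rule nn_integral_FTC_atLeast)
      show "((\<lambda>t::real. - exp (- t)) \<longlongrightarrow> 0) at_top"
        using tendsto_minus[OF filterlim_compose[OF exp_at_bot filterlim_uminus_at_bot_at_top]] by simp
    qed (auto intro!: derivative_eq_intros)
    moreover have "(\<integral>\<^sup>+t. ?f t x \<partial>lborel) = (\<integral>\<^sup>+t. ennreal (exp (- t)) * indicator {N x..} t \<partial>lborel)"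
      by (intro nn_integral_cong) (auto simp: indicator_def)
    ultimately show "ennreal (exp (- N x)) = (\<integral>\<^sup>+t. ?f t x \<partial>lborel)" by simp
  qed
  also have "\<dots> = (\<integral>\<^sup>+t. \<integral>\<^sup>+x. ?f t x \<partial>leb d \<partial>lborel)" using m by (rule Fubini')
  also have "\<dots> = (\<integral>\<^sup>+t. ennreal (t ^ d * exp (- t)) * indicator {0..} t * vol \<partial>lborel)"
  proof (rule nn_integral_cong_AE)
    \<comment> \<open>The scaling formula for balls needs \<open>t > 0\<close>; the single point 0
      is negligible.\<close>
    have "AE t in lborel. t \<noteq> (0::real)" by (rule AE_lborel_singleton)
    then show "AE t in lborel. (\<integral>\<^sup>+x. ?f t x \<partial>leb d) = ennreal (t ^ d * exp (- t)) * indicator {0..} t * vol"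
    proof eventually_elim
      case (elim t)
      have "(\<integral>\<^sup>+x. ?f t x \<partial>leb d) = (\<integral>\<^sup>+x. ennreal (exp (- t)) * indicator {x \<in> Rd d. N x \<le> t} x \<partial>leb d)"
        by (intro nn_integral_cong) (auto simp: indicator_def)
      also have "\<dots> = ennreal (exp (- t)) * emeasure (leb d) {x \<in> Rd d. N x \<le> t}"
        by (simp add: nn_integral_cmult)
      also have "\<dots> = ennreal (t ^ d * exp (- t)) * indicator {0..} t * vol"
      proof (cases "t > 0")
        case True
        then show ?thesis by (simp add: emeasure_ball ennreal_mult mult_ac)
      next
        case False
        with elim have "t < 0" by simp
        then have e: "{x \<in> Rd d. N x \<le> t} = {}" using N_nonneg by (auto simp: not_le intro: less_le_trans)
        show ?thesis unfolding e using \<open>t < 0\<close> by simp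
      qed
      finally show ?case .
    qed
  qed
  also have "\<dots> = ennreal (fact d) * vol"
    by (simp add: nn_integral_multc nn_intergal_power_times_exp_Ici)
  finally show ?thesis .
qed

lemma nn_integral_exp_N:
  assumes "l > 0"
  shows "(\<integral>\<^sup>+x. ennreal (exp (- (l * N x))) \<partial>leb d) = ennreal (fact d / l ^ d) * vol"
proof -
  have "(\<integral>\<^sup>+x. ennreal (exp (- (l * N x))) \<partial>leb d) = (\<integral>\<^sup>+x. ennreal (exp (- N (lc d l x 0 x))) \<partial>leb d)"
    using assms by simp
  also have "\<dots> = ennreal (1 / l ^ d) * (ennreal (fact d) * vol)"
    using assms by (subst nn_integral_leb_scale) (auto simp: nn_integral_exp_N_1)
  finally show ?thesis using assms
    by (simp add: mult.assoc[symmetric] ennreal_mult[symmetric])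
qed

text \<open>Translation by \<open>v\<close> completes the square.\<close>

lemma nn_integral_G_exp: "(\<integral>\<^sup>+y. ennreal (G y * exp (qf d a v y)) \<partial>leb d) = ennreal (exp (qf d a v v / 2) * G0)"
proof -
  have "(\<integral>\<^sup>+y. ennreal (G y * exp (qf d a v y)) \<partial>leb d) = (\<integral>\<^sup>+y. ennreal (G (lc d 1 v 1 y) * exp (qf d a v (lc d 1 v 1 y))) \<partial>leb d)"
    by (rule nn_integral_leb_translate[symmetric]) measurable
  also have "\<dots> = (\<integral>\<^sup>+y. ennreal (exp (qf d a v v / 2)) * ennreal (G y) \<partial>leb d)"
  proof (rule nn_integral_cong)
    fix y
    have "G (lc d 1 v 1 y) * exp (qf d a v (lc d 1 v 1 y)) = exp (qf d a v v / 2) * G y"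
      using q_commute[of y v] by (simp add: G_def exp_add[symmetric] qf_lc_left qf_lc_right field_simps)
    then show "ennreal (G (lc d 1 v 1 y) * exp (qf d a v (lc d 1 v 1 y))) = ennreal (exp (qf d a v v / 2)) * ennreal (G y)"
      by (simp add: ennreal_mult)
  qed
  also have "\<dots> = ennreal (exp (qf d a v v / 2) * G0)"
    using G0_pos by (simp add: nn_integral_cmult nn_integral_G ennreal_mult)
  finally show ?thesis .
qed

text \<open>Apply \<open>|t| \<le> exp t + exp (- t)\<close> to
  \<open>t = dot d g y / \<eta>\<close>. The representing vectors of \<open>t\<close> and
  \<open>- t\<close> have norm at most one, so each exponential moment is at most
  \<open>exp (1 / 2) \<le> 2\<close> times \<open>G0\<close>. The bound is free of the dimension,
  which estimating \<open>N y\<close> instead would not be.\<close>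

lemma nn_integral_G_linear:
  assumes "\<And>u. u \<in> Rd d \<Longrightarrow> \<bar>dot d g u\<bar> \<le> \<eta> * N u" "0 \<le> \<eta>"
  shows "(\<integral>\<^sup>+y. ennreal (G y * \<bar>dot d g y\<bar>) \<partial>leb d) \<le> ennreal (4 * \<eta> * G0)"
proof (cases "\<eta> = 0")
  case True
  then have "G y * \<bar>dot d g y\<bar> = 0" if "y \<in> Rd d" for y using assms(1)[OF that] by simp
  then have "(\<integral>\<^sup>+y. ennreal (G y * \<bar>dot d g y\<bar>) \<partial>leb d) = (\<integral>\<^sup>+y. 0 \<partial>leb d)"
    by (intro nn_integral_cong) simp
  then show ?thesis by simp
next
  case False
  then have \<eta>: "\<eta> > 0" using assms by simp
  obtain v where v: "v \<in> Rd d" "\<And>u. qf d a v u = dot d g u" using posdef_riesz[OF posdef] by blast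
  have "N v \<le> \<eta>"
  proof (cases "N v = 0")
    case False
    have "N v * N v = dot d g v" using v(2)[of v] N_sq[of v] by (simp add: power2_eq_square)
    also have "\<dots> \<le> \<eta> * N v" using assms(1)[OF v(1)] by simp
    finally show ?thesis using False N_nonneg[of v] by (metis less_le mult_le_cancel_right_pos)
  qed (use \<eta> in simp)
  define p where "p = lc d (1 / \<eta>) v 0 v"
  define m where "m = lc d (- 1 / \<eta>) v 0 v"
  have "N p \<le> 1" "N m \<le> 1" using \<eta> \<open>N v \<le> \<eta>\<close> by (auto simp: p_def m_def)
  then have "(N p)\<^sup>2 \<le> 1" "(N m)\<^sup>2 \<le> 1" by (auto intro: power_le_one)
  then have pm: "qf d a p p \<le> 1" "qf d a m m \<le> 1" by (auto simp: N_sq)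
  have "exp (1 / 2 :: real) \<le> 2"
  proof -
    have "exp (1 / 2 :: real) \<le> 1 + 1 / 2 + (1 / 2)\<^sup>2" by (rule exp_bound) auto
    then show ?thesis by (simp add: power2_eq_square)
  qed
  then have e: "exp (qf d a p p / 2) \<le> 2" "exp (qf d a m m / 2) \<le> 2"
    using pm by (auto intro: order_trans[of _ "exp (1 / 2)"])
  have le: "G y * \<bar>dot d g y\<bar> \<le> \<eta> * (G y * exp (qf d a p y)) + \<eta> * (G y * exp (qf d a m y))" for y
  proof -
    have "qf d a p y = dot d g y / \<eta>" "qf d a m y = - (dot d g y / \<eta>)"
      by (simp_all add: p_def m_def qf_lc_left v)
    moreover have "\<bar>t\<bar> \<le> exp t + exp (- t)" for t :: real
      using exp_ge_add_one_self[of t] exp_ge_add_one_self[of "- t"] exp_gt_zero[of t] exp_gt_zero[of "-t"] by linarith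
    ultimately have "\<bar>dot d g y / \<eta>\<bar> \<le> exp (qf d a p y) + exp (qf d a m y)" by metis
    then have "\<bar>dot d g y\<bar> \<le> \<eta> * (exp (qf d a p y) + exp (qf d a m y))"
      using \<eta> by (simp add: abs_divide field_simps)
    then have "G y * \<bar>dot d g y\<bar> \<le> G y * (\<eta> * (exp (qf d a p y) + exp (qf d a m y)))"
      by (rule mult_left_mono) simp
    then show ?thesis by (simp add: algebra_simps)
  qed
  have "(\<integral>\<^sup>+y. ennreal (G y * \<bar>dot d g y\<bar>) \<partial>leb d)
     \<le> (\<integral>\<^sup>+y. ennreal \<eta> * ennreal (G y * exp (qf d a p y)) + ennreal \<eta> * ennreal (G y * exp (qf d a m y)) \<partial>leb d)"
    using le \<eta> by (intro nn_integral_mono) (simp add: ennreal_mult[symmetric] ennreal_plus[symmetric] del: ennreal_plus)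
  also have "\<dots> = ennreal \<eta> * ennreal (exp (qf d a p p / 2) * G0) + ennreal \<eta> * ennreal (exp (qf d a m m / 2) * G0)"
    by (subst nn_integral_add) (auto simp: nn_integral_cmult nn_integral_G_exp)
  also have "\<dots> = ennreal (\<eta> * (exp (qf d a p p / 2) * G0) + \<eta> * (exp (qf d a m m / 2) * G0))"
    using \<eta> G0_pos by (simp add: ennreal_mult[symmetric] ennreal_plus[symmetric] del: ennreal_plus)
  also have "\<dots> \<le> ennreal (4 * \<eta> * G0)"
  proof (rule ennreal_leI)
    have "\<eta> * (exp (qf d a p p / 2) * G0) \<le> \<eta> * (2 * G0)" "\<eta> * (exp (qf d a m m / 2) * G0) \<le> \<eta> * (2 * G0)"
      using e \<eta> G0_pos by (auto intro!: mult_left_mono mult_right_mono)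
    then show "\<eta> * (exp (qf d a p p / 2) * G0) + \<eta> * (exp (qf d a m m / 2) * G0) \<le> 4 * \<eta> * G0" by simp
  qed
  finally show ?thesis .
qed

lemma nn_integral_NG_finite: "(\<integral>\<^sup>+x. ennreal (N x * G x) \<partial>leb d) < \<infinity>"
proof -
  have "N x * G x \<le> exp 2 * exp (- (1 * N x))" for x
  proof -
    have "N x \<le> exp (N x)" using exp_ge_add_one_self[of "N x"] by linarith
    then have "N x * G x \<le> exp (N x) * G x" by (intro mult_right_mono) auto
    also have "\<dots> = exp (N x - (N x)\<^sup>2 / 2)" by (simp add: G_eq exp_add[symmetric])
    also have "\<dots> \<le> exp (2 - N x)"
      using sum_squares_ge_zero[of "N x - 2" 0] by (simp add: power2_eq_square algebra_simps)
    finally show ?thesis by (simp add: exp_diff exp_minus field_simps)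
  qed
  then have "(\<integral>\<^sup>+x. ennreal (N x * G x) \<partial>leb d) \<le> (\<integral>\<^sup>+x. ennreal (exp 2) * ennreal (exp (- (1 * N x))) \<partial>leb d)"
    by (intro nn_integral_mono) (simp add: ennreal_mult[symmetric])
  also have "\<dots> = ennreal (exp 2) * (ennreal (fact d / 1 ^ d) * vol)"
    by (subst nn_integral_cmult) (simp_all only: nn_integral_exp_N zero_less_one, measurable)
  also have "\<dots> < \<infinity>" using vol_finite by (simp add: ennreal_mult_less_top)
  finally show ?thesis .
qed

end

section \<open>The Gaussian \<open>L\<^sup>1\<close> Poincare inequality\<close>

lemma abs_cos_sin_le:
  fixes x :: real
  assumes "0 \<le> x"
  shows "\<bar>cos x - 1\<bar> \<le> x" "\<bar>sin x\<bar> \<le> x"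
proof -
  show s: "\<bar>sin x\<bar> \<le> x" using abs_sin_x_le_abs_x[of x] assms by simp
  have "\<bar>sin (x / 2)\<bar> * \<bar>sin (x / 2)\<bar> \<le> (x / 2) * 1"
    using abs_sin_x_le_abs_x[of "x/2"] assms by (intro mult_mono) auto
  moreover have "cos x = 1 - 2 * (sin (x / 2))\<^sup>2" using cos_double_sin[of "x/2"] by simp
  ultimately show "\<bar>cos x - 1\<bar> \<le> x" by (simp add: power2_eq_square)
qed

context quad
begin

lemma G_rotate:
  assumes "c\<^sup>2 + s\<^sup>2 = 1"
  shows "G (lc d c x s y) * G (lc d c y (- s) x) = G x * G y"
proof -
  have "(N (lc d c x s y))\<^sup>2 + (N (lc d c y (- s) x))\<^sup>2 = (c\<^sup>2 + s\<^sup>2) * (N x)\<^sup>2 + (c\<^sup>2 + s\<^sup>2) * (N y)\<^sup>2"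
    unfolding N_lc_sq using q_commute[of x y] by (simp add: algebra_simps)
  then show ?thesis using assms by (simp add: G_eq exp_add[symmetric] add_divide_distrib[symmetric])
qed

lemma nn_integral_GG_rotate:
  assumes "c > 0" "c\<^sup>2 + s\<^sup>2 = 1"
    and [measurable]: "(\<lambda>(x, y). \<Phi> x y) \<in> borel_measurable (leb d \<Otimes>\<^sub>M leb d)"
  shows "(\<integral>\<^sup>+x. \<integral>\<^sup>+y. \<Phi> (lc d c x s y) (lc d c y (- s) x) * ennreal (G x * G y) \<partial>leb d \<partial>leb d) =
    (\<integral>\<^sup>+x. \<integral>\<^sup>+y. \<Phi> x y * ennreal (G x * G y) \<partial>leb d \<partial>leb d)"
proof -
  have "(\<integral>\<^sup>+x. \<integral>\<^sup>+y. \<Phi> (lc d c x s y) (lc d c y (- s) x) * ennreal (G x * G y) \<partial>leb d \<partial>leb d) =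
    (\<integral>\<^sup>+x. \<integral>\<^sup>+y. \<Phi> (lc d c x s y) (lc d c y (- s) x) * ennreal (G (lc d c x s y) * G (lc d c y (- s) x)) \<partial>leb d \<partial>leb d)"
    by (simp add: G_rotate[OF assms(2)])
  also have "\<dots> = (\<integral>\<^sup>+x. \<integral>\<^sup>+y. \<Phi> x y * ennreal (G x * G y) \<partial>leb d \<partial>leb d)"
    by (rule nn_integral_leb_rotate[OF assms(1,2), where f = "\<lambda>x y. \<Phi> x y * ennreal (G x * G y)"]) measurable
  finally show ?thesis .
qed

text \<open>Telescoping along the quarter turn from \<open>x\<close> to \<open>y\<close>, whose steps are equally distributed by
  rotation invariance.\<close>

lemma gaussian_telescope:
  fixes h :: "point \<Rightarrow> real"
  assumes [measurable]: "h \<in> borel_measurable (leb d)" and m: "m \<ge> 1"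
  shows "(\<integral>\<^sup>+x. \<integral>\<^sup>+y. ennreal \<bar>h y - h x\<bar> * ennreal (G x * G y) \<partial>leb d \<partial>leb d) \<le>
    of_nat m * (\<integral>\<^sup>+x. \<integral>\<^sup>+y. ennreal \<bar>h (lc d (cos (pi / (2 * real m))) x (sin (pi / (2 * real m))) y) - h x\<bar>
      * ennreal (G x * G y) \<partial>leb d \<partial>leb d)"
proof -
  define \<epsilon> where "\<epsilon> = pi / (2 * real m)"
  define \<Phi> where "\<Phi> = (\<lambda>x y. ennreal \<bar>h (lc d (cos \<epsilon>) x (sin \<epsilon>) y) - h x\<bar>)"
  define X where "X = (\<lambda>k x y. lc d (cos (real k * \<epsilon>)) x (sin (real k * \<epsilon>)) y)"
  define X' where "X' = (\<lambda>k x y. lc d (cos (real k * \<epsilon>)) y (- sin (real k * \<epsilon>)) x)"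
  have \<Phi>m [measurable]: "(\<lambda>(x, y). \<Phi> x y) \<in> borel_measurable (leb d \<Otimes>\<^sub>M leb d)"
    unfolding \<Phi>_def by measurable
  have step: "X (Suc k) x y = lc d (cos \<epsilon>) (X k x y) (sin \<epsilon>) (X' k x y)" for k x y
    unfolding X_def X'_def by (rule lc_cong) (simp add: distrib_right cos_add sin_add algebra_simps)
  have m\<epsilon>: "real m * \<epsilon> = pi / 2" using m by (simp add: \<epsilon>_def)
  have le: "ennreal \<bar>h y - h x\<bar> \<le> (\<Sum>k<m. \<Phi> (X k x y) (X' k x y))" if "x \<in> Rd d" "y \<in> Rd d" for x y
  proof -
    have "X 0 x y = x" "X m x y = y" using that by (simp_all add: X_def m\<epsilon>)
    then have "h y - h x = (\<Sum>k<m. h (X (Suc k) x y) - h (X k x y))"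
      using sum_lessThan_telescope[of "\<lambda>k. h (X k x y)" m] by simp
    then have "\<bar>h y - h x\<bar> \<le> (\<Sum>k<m. \<bar>h (X (Suc k) x y) - h (X k x y)\<bar>)" by (simp only: sum_abs)
    then have "ennreal \<bar>h y - h x\<bar> \<le> ennreal (\<Sum>k<m. \<bar>h (X (Suc k) x y) - h (X k x y)\<bar>)" by (rule ennreal_leI)
    also have "\<dots> = (\<Sum>k<m. \<Phi> (X k x y) (X' k x y))" unfolding \<Phi>_def step[symmetric] by (subst sum_ennreal) auto
    finally show ?thesis .
  qed
  have Xm [measurable]: "(\<lambda>(x, y). \<Phi> (X k x y) (X' k x y)) \<in> borel_measurable (leb d \<Otimes>\<^sub>M leb d)" for k
    unfolding X_def X'_def \<Phi>_def by measurable
  have "(\<integral>\<^sup>+x. \<integral>\<^sup>+y. ennreal \<bar>h y - h x\<bar> * ennreal (G x * G y) \<partial>leb d \<partial>leb d) \<le>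
    (\<integral>\<^sup>+x. \<integral>\<^sup>+y. (\<Sum>k<m. \<Phi> (X k x y) (X' k x y) * ennreal (G x * G y)) \<partial>leb d \<partial>leb d)"
    using le by (intro nn_integral_mono) (auto simp: sum_distrib_right[symmetric] intro!: mult_right_mono)
  also have "\<dots> = (\<integral>\<^sup>+x. (\<Sum>k<m. \<integral>\<^sup>+y. \<Phi> (X k x y) (X' k x y) * ennreal (G x * G y) \<partial>leb d) \<partial>leb d)"
    by (intro nn_integral_cong nn_integral_sum) measurable
  also have "\<dots> = (\<Sum>k<m. \<integral>\<^sup>+x. \<integral>\<^sup>+y. \<Phi> (X k x y) (X' k x y) * ennreal (G x * G y) \<partial>leb d \<partial>leb d)"
    by (intro nn_integral_sum sigma_finite_measure.borel_measurable_nn_integral sigma_finite_leb) measurable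
  also have "\<dots> = (\<Sum>k<m. \<integral>\<^sup>+x. \<integral>\<^sup>+y. \<Phi> x y * ennreal (G x * G y) \<partial>leb d \<partial>leb d)"
  proof (rule sum.cong)
    \<comment> \<open>\<open>k < m\<close> keeps the angle below a right angle, where the cosine is
      positive as the rotation lemma demands.\<close>
    fix k assume k: "k \<in> {..<m}"
    have "real k * \<epsilon> < real m * \<epsilon>" using k m by (intro mult_strict_right_mono) (auto simp: \<epsilon>_def)
    then have "real k * \<epsilon> < pi / 2" using m\<epsilon> by simp
    moreover have "0 \<le> real k * \<epsilon>" by (simp add: \<epsilon>_def)
    ultimately have "0 < cos (real k * \<epsilon>)" using pi_gt_zero by (intro cos_gt_zero_pi) linarith+
    then show "(\<integral>\<^sup>+x. \<integral>\<^sup>+y. \<Phi> (X k x y) (X' k x y) * ennreal (G x * G y) \<partial>leb d \<partial>leb d) =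
       (\<integral>\<^sup>+x. \<integral>\<^sup>+y. \<Phi> x y * ennreal (G x * G y) \<partial>leb d \<partial>leb d)"
      unfolding X_def X'_def by (rule nn_integral_GG_rotate) (simp_all only: \<Phi>m sin_cos_squared_add2)
  qed simp
  finally show ?thesis unfolding \<Phi>_def \<epsilon>_def[symmetric] by simp
qed

text \<open>Let the number of telescoping steps tend to infinity. The number of steps times the step
  angle is always \<open>pi / 2\<close>, the length of the quarter turn and the constant of the
  inequality, while the increments divided by the angle tend to \<open>D x y\<close>. The Lipschitz
  hypothesis supplies the dominating function; \<open>L\<close> itself leaves no trace in the
  result.\<close>

lemma gaussian_L1_poincare:
  fixes h :: "point \<Rightarrow> real"
  assumes hm [measurable]: "h \<in> borel_measurable (leb d)"
    and lip: "\<And>x y. x \<in> Rd d \<Longrightarrow> y \<in> Rd d \<Longrightarrow> \<bar>h x - h y\<bar> \<le> L * N (lc d 1 x (-1) y)" and L: "0 \<le> L"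
    and der: "\<And>x y. x \<in> Rd d \<Longrightarrow> y \<in> Rd d \<Longrightarrow> ((\<lambda>t. h (lc d 1 x t y)) has_real_derivative D x y) (at 0)"
  shows "(\<integral>\<^sup>+x. \<integral>\<^sup>+y. ennreal \<bar>h y - h x\<bar> * ennreal (G x * G y) \<partial>leb d \<partial>leb d) \<le>
    ennreal (pi / 2) * (\<integral>\<^sup>+x. \<integral>\<^sup>+y. ennreal \<bar>D x y\<bar> * ennreal (G x * G y) \<partial>leb d \<partial>leb d)"
proof -
  interpret P: pair_sigma_finite "leb d" "leb d" by (rule pair_sigma_finite_leb)
  let ?M = "leb d \<Otimes>\<^sub>M leb d"
  define \<epsilon> where "\<epsilon> = (\<lambda>m. pi / (2 * real (Suc m)))"
  define F where "F = (\<lambda>m (x, y). real (Suc m) * \<bar>h (lc d (cos (\<epsilon> m)) x (sin (\<epsilon> m)) y) - h x\<bar> * (G x * G y))"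
  define F' where "F' = (\<lambda>(x, y). (pi / 2 * \<bar>D x y\<bar>) * (G x * G y))"
  have \<epsilon>0: "0 \<le> \<epsilon> m" "\<epsilon> m > 0" for m by (simp_all add: \<epsilon>_def)
  have m\<epsilon>: "real (Suc m) * \<epsilon> m = pi / 2" for m by (simp add: \<epsilon>_def field_simps)
  have \<epsilon>lim: "\<epsilon> \<longlonglongrightarrow> 0"
  proof -
    have "(\<lambda>m. (pi / 2) * inverse (real (Suc m))) \<longlonglongrightarrow> (pi / 2) * 0"
      by (intro tendsto_intros LIMSEQ_inverse_real_of_nat)
    then show ?thesis by (simp add: \<epsilon>_def field_simps)
  qed
  have Fm [measurable]: "F m \<in> borel_measurable ?M" for m unfolding F_def by measurable
  have space: "space ?M = Rd d \<times> Rd d" by (simp add: space_pair_measure)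
  have bound: "F m (x, y) \<le> pi / 2 * L * (N x + N y) * (G x * G y)" if "x \<in> Rd d" "y \<in> Rd d" for m x y
  proof -
    have "\<bar>h (lc d (cos (\<epsilon> m)) x (sin (\<epsilon> m)) y) - h x\<bar> \<le> L * N (lc d 1 (lc d (cos (\<epsilon> m)) x (sin (\<epsilon> m)) y) (-1) x)"
      using that by (intro lip) auto
    also have "lc d 1 (lc d (cos (\<epsilon> m)) x (sin (\<epsilon> m)) y) (-1) x = lc d (cos (\<epsilon> m) - 1) x (sin (\<epsilon> m)) y"
      by (rule lc_cong) (simp add: algebra_simps)
    also have "N \<dots> \<le> \<bar>cos (\<epsilon> m) - 1\<bar> * N x + \<bar>sin (\<epsilon> m)\<bar> * N y" by (rule N_lc_le)
    also have "\<dots> \<le> \<epsilon> m * N x + \<epsilon> m * N y"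
      by (intro add_mono mult_right_mono abs_cos_sin_le \<epsilon>0) auto
    finally have "\<bar>h (lc d (cos (\<epsilon> m)) x (sin (\<epsilon> m)) y) - h x\<bar> \<le> L * (\<epsilon> m * N x + \<epsilon> m * N y)"
      using L by (simp add: mult_left_mono)
    then have "real (Suc m) * \<bar>h (lc d (cos (\<epsilon> m)) x (sin (\<epsilon> m)) y) - h x\<bar> \<le> real (Suc m) * (L * (\<epsilon> m * N x + \<epsilon> m * N y))"
      by (rule mult_left_mono) simp
    also have "\<dots> = (real (Suc m) * \<epsilon> m) * L * (N x + N y)" by (simp only: algebra_simps)
    finally have "real (Suc m) * \<bar>h (lc d (cos (\<epsilon> m)) x (sin (\<epsilon> m)) y) - h x\<bar> \<le> pi / 2 * L * (N x + N y)" unfolding m\<epsilon> .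
    then show ?thesis unfolding F_def by (auto intro!: mult_right_mono)
  qed
  have lim: "(\<lambda>m. F m (x, y)) \<longlonglongrightarrow> F' (x, y)" if xy: "x \<in> Rd d" "y \<in> Rd d" for x y
  proof -
    have 1: "(\<lambda>m. (h (lc d 1 x (\<epsilon> m) y) - h x) / \<epsilon> m) \<longlonglongrightarrow> D x y"
    proof -
      have "((\<lambda>t. (h (lc d 1 x t y) - h x) / t) \<longlongrightarrow> D x y) (at 0)"
        using der[OF xy] xy by (simp add: has_field_derivative_iff)
      moreover have "filterlim \<epsilon> (at 0) sequentially"
        using \<epsilon>lim \<epsilon>0(2) by (auto simp: filterlim_at less_imp_neq[symmetric])
      ultimately show ?thesis by (rule filterlim_compose)
    qed
    \<comment> \<open>The arc and its tangent line differ by \<open>cos t - 1\<close> in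
      \<open>x\<close> and \<open>sin t - t\<close> in \<open>y\<close>, both of smaller order than
      \<open>t\<close>, so by the Lipschitz bound the derivative along the line also serves along
      the arc.\<close>
    have 2: "(\<lambda>m. (h (lc d (cos (\<epsilon> m)) x (sin (\<epsilon> m)) y) - h (lc d 1 x (\<epsilon> m) y)) / \<epsilon> m) \<longlonglongrightarrow> 0"
    proof (rule Lim_null_comparison)
      show "eventually (\<lambda>m. norm ((h (lc d (cos (\<epsilon> m)) x (sin (\<epsilon> m)) y) - h (lc d 1 x (\<epsilon> m) y)) / \<epsilon> m)
         \<le> L * (\<bar>(cos (\<epsilon> m) - 1) / \<epsilon> m\<bar> * N x + \<bar>sin (\<epsilon> m) / \<epsilon> m - 1\<bar> * N y)) sequentially"
      proof (rule always_eventually, rule allI)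
        fix m
        have "\<bar>h (lc d (cos (\<epsilon> m)) x (sin (\<epsilon> m)) y) - h (lc d 1 x (\<epsilon> m) y)\<bar>
          \<le> L * N (lc d 1 (lc d (cos (\<epsilon> m)) x (sin (\<epsilon> m)) y) (-1) (lc d 1 x (\<epsilon> m) y))" by (intro lip) auto
        also have "lc d 1 (lc d (cos (\<epsilon> m)) x (sin (\<epsilon> m)) y) (-1) (lc d 1 x (\<epsilon> m) y) = lc d (cos (\<epsilon> m) - 1) x (sin (\<epsilon> m) - \<epsilon> m) y"
          by (rule lc_cong) (simp add: algebra_simps)
        also have "L * N \<dots> \<le> L * (\<bar>cos (\<epsilon> m) - 1\<bar> * N x + \<bar>sin (\<epsilon> m) - \<epsilon> m\<bar> * N y)"
          by (intro mult_left_mono N_lc_le L)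
        finally have "\<bar>h (lc d (cos (\<epsilon> m)) x (sin (\<epsilon> m)) y) - h (lc d 1 x (\<epsilon> m) y)\<bar> / \<epsilon> m
          \<le> L * (\<bar>cos (\<epsilon> m) - 1\<bar> * N x + \<bar>sin (\<epsilon> m) - \<epsilon> m\<bar> * N y) / \<epsilon> m"
          using \<epsilon>0(1) by (rule divide_right_mono)
        also have "\<dots> = L * (\<bar>(cos (\<epsilon> m) - 1) / \<epsilon> m\<bar> * N x + \<bar>sin (\<epsilon> m) / \<epsilon> m - 1\<bar> * N y)"
        proof -
          have "sin (\<epsilon> m) / \<epsilon> m - 1 = (sin (\<epsilon> m) - \<epsilon> m) / \<epsilon> m" using \<epsilon>0(2)[of m] by (simp add: diff_divide_distrib)
          then show ?thesis using \<epsilon>0(2)[of m] by (simp add: abs_divide add_divide_distrib distrib_left)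
        qed
        finally show "norm ((h (lc d (cos (\<epsilon> m)) x (sin (\<epsilon> m)) y) - h (lc d 1 x (\<epsilon> m) y)) / \<epsilon> m)
         \<le> L * (\<bar>(cos (\<epsilon> m) - 1) / \<epsilon> m\<bar> * N x + \<bar>sin (\<epsilon> m) / \<epsilon> m - 1\<bar> * N y)"
          using \<epsilon>0(1)[of m] by (simp add: abs_divide)
      qed
      have f: "filterlim \<epsilon> (at 0) sequentially"
        using \<epsilon>lim \<epsilon>0(2) by (auto simp: filterlim_at less_imp_neq[symmetric])
      have c: "((\<lambda>t::real. (cos t - 1) / t) \<longlongrightarrow> 0) (at 0)"
        using DERIV_cos[of "0::real"] by (simp add: has_field_derivative_iff)
      have s: "((\<lambda>t::real. sin t / t) \<longlongrightarrow> 1) (at 0)"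
        using DERIV_sin[of "0::real"] by (simp add: has_field_derivative_iff)
      have "(\<lambda>m. L * (\<bar>(cos (\<epsilon> m) - 1) / \<epsilon> m\<bar> * N x + \<bar>sin (\<epsilon> m) / \<epsilon> m - 1\<bar> * N y)) \<longlonglongrightarrow> L * (\<bar>0\<bar> * N x + \<bar>1 - 1\<bar> * N y)"
        by (intro tendsto_intros filterlim_compose[OF c f] filterlim_compose[OF s f])
      then show "(\<lambda>m. L * (\<bar>(cos (\<epsilon> m) - 1) / \<epsilon> m\<bar> * N x + \<bar>sin (\<epsilon> m) / \<epsilon> m - 1\<bar> * N y)) \<longlonglongrightarrow> 0" by simp
    qed
    have "(\<lambda>m. (pi / 2) * \<bar>(h (lc d 1 x (\<epsilon> m) y) - h x) / \<epsilon> m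
        + (h (lc d (cos (\<epsilon> m)) x (sin (\<epsilon> m)) y) - h (lc d 1 x (\<epsilon> m) y)) / \<epsilon> m\<bar> * (G x * G y)) \<longlonglongrightarrow> (pi / 2) * \<bar>D x y + 0\<bar> * (G x * G y)"
      by (intro tendsto_intros 1 2)
    moreover have "(pi / 2) * \<bar>(h (lc d 1 x (\<epsilon> m) y) - h x) / \<epsilon> m
        + (h (lc d (cos (\<epsilon> m)) x (sin (\<epsilon> m)) y) - h (lc d 1 x (\<epsilon> m) y)) / \<epsilon> m\<bar> * (G x * G y) = F m (x, y)" for m
      unfolding F_def m\<epsilon>[of m, symmetric] using \<epsilon>0(2)[of m]
      by (simp add: add_divide_distrib[symmetric] abs_divide del: of_nat_Suc)
    ultimately show ?thesis by (simp add: F'_def)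
  qed
  \<comment> \<open>The derivative \<open>D\<close> is given only pointwise; its measurability comes
    from being a limit of measurable quotients.\<close>
  have F'm [measurable]: "(\<lambda>p. if p \<in> space ?M then F' p else 0) \<in> borel_measurable ?M"
  proof (rule borel_measurable_LIMSEQ_real)
    show "(\<lambda>m. if p \<in> space ?M then F m p else 0) \<longlonglongrightarrow> (if p \<in> space ?M then F' p else 0)" for p
      using lim by (cases p) (auto simp: space)
    show "(\<lambda>p. if p \<in> space ?M then F m p else 0) \<in> borel_measurable ?M" for m
      using measurable_cong[of ?M "F m" "\<lambda>p. if p \<in> space ?M then F m p else 0"] Fm by simp
  qed
  then have F'm [measurable]: "F' \<in> borel_measurable ?M"
    using measurable_cong[of ?M "F'" "\<lambda>p. if p \<in> space ?M then F' p else 0"] by simp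
  have Dm: "(\<lambda>p. ennreal (case p of (x, y) \<Rightarrow> \<bar>D x y\<bar> * (G x * G y))) \<in> borel_measurable ?M"
  proof -
    have "(\<lambda>p. (2 / pi) * F' p) \<in> borel_measurable ?M" by measurable
    moreover have "(\<lambda>p. (2 / pi) * F' p) = (\<lambda>p. case p of (x, y) \<Rightarrow> \<bar>D x y\<bar> * (G x * G y))"
      by (auto simp: F'_def fun_eq_iff)
    ultimately show ?thesis by (simp only: measurable_compose[OF _ measurable_ennreal])
  qed
  define B where "B = (\<lambda>(x, y). pi / 2 * L * (N x + N y) * (G x * G y))"
  have Bm [measurable]: "B \<in> borel_measurable ?M" unfolding B_def by measurable
  have Bfin: "(\<integral>\<^sup>+p. ennreal (B p) \<partial>?M) < \<infinity>"
  proof -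
    have "(\<integral>\<^sup>+p. ennreal (B p) \<partial>?M) = (\<integral>\<^sup>+x. \<integral>\<^sup>+y. ennreal (B (x, y)) \<partial>leb d \<partial>leb d)"
      by (rule sigma_finite_measure.nn_integral_fst[OF sigma_finite_leb, symmetric]) measurable
    also have "\<dots> = (\<integral>\<^sup>+x. \<integral>\<^sup>+y. ennreal (pi / 2 * L) * (ennreal (N x * G x) * ennreal (G y) + ennreal (G x) * ennreal (N y * G y)) \<partial>leb d \<partial>leb d)"
      using L by (intro nn_integral_cong)
        (simp add: B_def ennreal_mult[symmetric] ennreal_plus[symmetric] algebra_simps del: ennreal_plus)
    also have "\<dots> = (\<integral>\<^sup>+x. ennreal (pi / 2 * L) * (ennreal (N x * G x) * ennreal G0 + ennreal (G x) * (\<integral>\<^sup>+y. ennreal (N y * G y) \<partial>leb d)) \<partial>leb d)"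
      by (intro nn_integral_cong) (simp add: nn_integral_cmult nn_integral_add nn_integral_G)
    also have "\<dots> = ennreal (pi / 2 * L) * ((\<integral>\<^sup>+y. ennreal (N y * G y) \<partial>leb d) * ennreal G0 + ennreal G0 * (\<integral>\<^sup>+y. ennreal (N y * G y) \<partial>leb d))"
      by (simp add: nn_integral_cmult nn_integral_add nn_integral_multc nn_integral_G)
    also have "\<dots> < \<infinity>" using nn_integral_NG_finite by (simp add: ennreal_mult_less_top)
    finally show ?thesis .
  qed
  have "(\<lambda>m. \<integral>\<^sup>+p. ennreal (F m p) \<partial>?M) \<longlonglongrightarrow> (\<integral>\<^sup>+p. ennreal (F' p) \<partial>?M)"
  proof (rule nn_integral_dominated_convergence)
    show "AE p in ?M. ennreal (F m p) \<le> ennreal (B p)" for m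
      by (rule AE_I2) (use bound in \<open>auto simp: space B_def intro!: ennreal_leI\<close>)
    show "AE p in ?M. (\<lambda>m. ennreal (F m p)) \<longlonglongrightarrow> ennreal (F' p)"
      by (rule AE_I2) (use lim in \<open>auto simp: space intro!: tendsto_ennrealI\<close>)
  qed (use Bfin in \<open>auto simp del: F_def\<close>)
  moreover have "(\<integral>\<^sup>+x. \<integral>\<^sup>+y. ennreal \<bar>h y - h x\<bar> * ennreal (G x * G y) \<partial>leb d \<partial>leb d) \<le> (\<integral>\<^sup>+p. ennreal (F m p) \<partial>?M)" for m
  proof -
    have "(\<integral>\<^sup>+p. ennreal (F m p) \<partial>?M) = (\<integral>\<^sup>+x. \<integral>\<^sup>+y. ennreal (F m (x, y)) \<partial>leb d \<partial>leb d)"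
      by (rule sigma_finite_measure.nn_integral_fst[OF sigma_finite_leb, symmetric]) measurable
    also have "\<dots> = (\<integral>\<^sup>+x. \<integral>\<^sup>+y. of_nat (Suc m) * (ennreal \<bar>h (lc d (cos (\<epsilon> m)) x (sin (\<epsilon> m)) y) - h x\<bar> * ennreal (G x * G y)) \<partial>leb d \<partial>leb d)"
      by (intro nn_integral_cong) (simp add: F_def ennreal_mult[symmetric] mult.assoc ennreal_of_nat_eq_real_of_nat del: of_nat_Suc)
    also have "\<dots> = (\<integral>\<^sup>+x. of_nat (Suc m) * (\<integral>\<^sup>+y. (ennreal \<bar>h (lc d (cos (\<epsilon> m)) x (sin (\<epsilon> m)) y) - h x\<bar> * ennreal (G x * G y)) \<partial>leb d) \<partial>leb d)"
      by (intro nn_integral_cong nn_integral_cmult) measurable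
    also have "\<dots> = of_nat (Suc m) * (\<integral>\<^sup>+x. \<integral>\<^sup>+y. (ennreal \<bar>h (lc d (cos (\<epsilon> m)) x (sin (\<epsilon> m)) y) - h x\<bar> * ennreal (G x * G y)) \<partial>leb d \<partial>leb d)"
      by (intro nn_integral_cmult) measurable
    finally show ?thesis using gaussian_telescope[OF hm, of "Suc m"] unfolding \<epsilon>_def by simp
  qed
  ultimately have "(\<integral>\<^sup>+x. \<integral>\<^sup>+y. ennreal \<bar>h y - h x\<bar> * ennreal (G x * G y) \<partial>leb d \<partial>leb d) \<le> (\<integral>\<^sup>+p. ennreal (F' p) \<partial>?M)"
    by (intro LIMSEQ_le_const) auto
  also have "(\<integral>\<^sup>+p. ennreal (F' p) \<partial>?M) = (\<integral>\<^sup>+p. ennreal (pi / 2) * ennreal (case p of (x, y) \<Rightarrow> \<bar>D x y\<bar> * (G x * G y)) \<partial>?M)"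
    by (intro nn_integral_cong) (auto simp: F'_def ennreal_mult[symmetric] mult.assoc)
  also have "\<dots> = ennreal (pi / 2) * (\<integral>\<^sup>+p. ennreal (case p of (x, y) \<Rightarrow> \<bar>D x y\<bar> * (G x * G y)) \<partial>?M)"
    by (rule nn_integral_cmult[OF Dm])
  also have "(\<integral>\<^sup>+p. ennreal (case p of (x, y) \<Rightarrow> \<bar>D x y\<bar> * (G x * G y)) \<partial>?M) =
    (\<integral>\<^sup>+x. \<integral>\<^sup>+y. ennreal (\<bar>D x y\<bar> * (G x * G y)) \<partial>leb d \<partial>leb d)"
    using sigma_finite_measure.nn_integral_fst[OF sigma_finite_leb Dm] by simp
  finally show ?thesis by (simp add: ennreal_mult)
qed

end

section \<open>Perturbations of a Gaussian density\<close>

lemma DERIV_pos_part_sq: "((\<lambda>x::real. (max 0 x)\<^sup>2) has_real_derivative 2 * max 0 x) (at x)"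
proof -
  consider "x > 0" | "x < 0" | "x = 0" by linarith
  then show ?thesis
  proof cases
    case 1
    have "((\<lambda>x::real. x\<^sup>2) has_real_derivative 2 * x) (at x)" by (auto intro!: derivative_eq_intros)
    moreover have "eventually (\<lambda>y. y\<^sup>2 = (max 0 y)\<^sup>2) (nhds x)"
      using eventually_nhds_in_open[of "{0<..}" x] 1 by (auto elim!: eventually_mono)
    ultimately have "((\<lambda>x::real. (max 0 x)\<^sup>2) has_real_derivative 2 * x) (at x)"
      by (subst (asm) DERIV_cong_ev[OF refl _ refl]) auto
    then show ?thesis using 1 by simp
  next
    case 2
    have "eventually (\<lambda>y. 0 = (max 0 y)\<^sup>2) (nhds x)"
      using eventually_nhds_in_open[of "{..<0}" x] 2 by (auto elim!: eventually_mono)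
    then have "((\<lambda>x::real. (max 0 x)\<^sup>2) has_real_derivative 0) (at x)"
      using DERIV_const[of "0::real" "at x"] by (subst (asm) DERIV_cong_ev[OF refl _ refl]) auto
    then show ?thesis using 2 by simp
  next
    case 3
    have "((\<lambda>h::real. (max 0 h)\<^sup>2 / h) \<longlongrightarrow> 0) (at 0)"
    proof (rule Lim_null_comparison)
      show "eventually (\<lambda>h::real. norm ((max 0 h)\<^sup>2 / h) \<le> \<bar>h\<bar>) (at 0)"
        by (rule always_eventually) (auto simp: max_def power2_eq_square)
      show "((\<lambda>h::real. \<bar>h\<bar>) \<longlongrightarrow> 0) (at 0)" by (rule tendsto_rabs_zero) simp
    qed
    then show ?thesis using 3 by (simp add: has_field_derivative_iff)
  qed
qed

text \<open>Squaring the positive parts makes the cutoff continuously differentiable.\<close>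

definition cutoff :: "real \<Rightarrow> real \<Rightarrow> real \<Rightarrow> real" where
  "cutoff p b v = (max 0 (1 - (max 0 ((v - p) / b))\<^sup>2))\<^sup>2"

definition cutoff' :: "real \<Rightarrow> real \<Rightarrow> real \<Rightarrow> real" where
  "cutoff' p b v = - (4 * max 0 (1 - (max 0 ((v - p) / b))\<^sup>2) * max 0 ((v - p) / b) / b)"

lemma cutoff_DERIV:
  assumes "b > 0"
  shows "(cutoff p b has_real_derivative cutoff' p b v) (at v)"
proof -
  have 1: "((\<lambda>v. (v - p) / b) has_real_derivative 1 / b) (at v)"
    using assms by (auto intro!: derivative_eq_intros)
  have 2: "((\<lambda>v. 1 - (max 0 ((v - p) / b))\<^sup>2) has_real_derivative 0 - 2 * max 0 ((v - p) / b) * (1 / b)) (at v)"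
    by (intro DERIV_diff DERIV_const DERIV_chain2[OF DERIV_pos_part_sq 1])
  show ?thesis unfolding cutoff_def[abs_def] cutoff'_def
    by (rule DERIV_cong[OF DERIV_chain2[OF DERIV_pos_part_sq 2]]) (use assms in \<open>simp add: field_simps\<close>)
qed

lemma cutoff_bounds: "0 \<le> cutoff p b v" "cutoff p b v \<le> 1"
  unfolding cutoff_def by (auto intro!: power_le_one simp: max_def)

lemma cutoff_aux:
  fixes p b v :: real
  assumes "b > 0"
  shows "v \<le> p \<Longrightarrow> max 0 ((v - p) / b) = 0"
    "p + b \<le> v \<Longrightarrow> max 0 (1 - (max 0 ((v - p) / b))\<^sup>2) = 0"
proof -
  show "v \<le> p \<Longrightarrow> max 0 ((v - p) / b) = 0" using assms by (intro max_absorb1) (simp add: field_simps)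
  assume "p + b \<le> v"
  then have 1: "1 \<le> (v - p) / b" using assms by (simp add: field_simps)
  then have "max 0 ((v - p) / b) = (v - p) / b" by simp
  moreover have "1 \<le> ((v - p) / b)\<^sup>2" using 1 by (rule one_le_power)
  ultimately show "max 0 (1 - (max 0 ((v - p) / b))\<^sup>2) = 0" by simp
qed

lemma cutoff_eq_1: "b > 0 \<Longrightarrow> v \<le> p \<Longrightarrow> cutoff p b v = 1"
  by (simp add: cutoff_def cutoff_aux)

lemma cutoff_eq_0: "b > 0 \<Longrightarrow> p + b \<le> v \<Longrightarrow> cutoff p b v = 0"
  unfolding cutoff_def by (subst cutoff_aux(2)) auto

lemma cutoff'_eq_0: "b > 0 \<Longrightarrow> v \<le> p \<or> p + b \<le> v \<Longrightarrow> cutoff' p b v = 0"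
  unfolding cutoff'_def using cutoff_aux[of b v p] by auto

lemma abs_cutoff'_le:
  assumes "b > 0"
  shows "\<bar>cutoff' p b v\<bar> \<le> 4 / b"
proof (cases "v \<le> p \<or> p + b \<le> v")
  case False
  define u where "u = (v - p) / b"
  have u: "0 \<le> u" "u \<le> 1" using assms False by (auto simp: u_def field_simps)
  then have "0 \<le> 1 - u\<^sup>2" "1 - u\<^sup>2 \<le> 1" by (auto simp: power_le_one)
  then have "0 \<le> (1 - u\<^sup>2) * u" "(1 - u\<^sup>2) * u \<le> 1 * 1" using u by (simp, intro mult_mono) auto
  moreover have "cutoff' p b v = - (4 * ((1 - u\<^sup>2) * u) / b)"
    using u \<open>0 \<le> 1 - u\<^sup>2\<close> by (simp add: cutoff'_def u_def[symmetric] max_def)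
  ultimately show ?thesis using assms by (simp add: abs_mult divide_right_mono)
qed (use assms in \<open>simp add: cutoff'_eq_0\<close>)

lemma cutoff_measurable [measurable]: "cutoff p b \<in> borel_measurable borel"
  unfolding cutoff_def[abs_def] by measurable

text \<open>The bound \<open>d^d\<close> in the shape that is consumed: one factor cancels against a
  decay rate of order \<open>sqrt d\<close>, the other matches the volume of the ball of radius
  \<open>sqrt d\<close> in \<open>z0\<close>.\<close>

lemma fact_le_sqrt_power: "fact d \<le> (sqrt (real d) ^ d) * (sqrt (real d) ^ d)"
  using fact_le_power[of d, where 'a = real] by (simp add: power_mult_distrib[symmetric])

text \<open>\<open>w\<close> stands for the unnormalised posterior density centred at the maximum likelihood estimator,
  \<open>\<phi>\<close> for the logarithm of its ratio to the Gaussian, and \<open>g\<close> for the gradient of \<open>\<phi>\<close>.\<close>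

locale tilted_gaussian = quad +
  fixes s \<alpha> \<beta> m W :: real and \<phi> w :: "point \<Rightarrow> real" and g :: "point \<Rightarrow> point"
  assumes s12: "12 \<le> s"
    and \<alpha>: "0 \<le> \<alpha>" "\<alpha> \<le> 2 / 5" and \<beta>: "0 \<le> \<beta>" "\<beta> \<le> sqrt (real d) / 6"
    and \<phi>0: "\<phi> (zero_pt d) = 0"
    and \<phi>_deriv: "\<And>y u. y \<in> Rd d \<Longrightarrow> u \<in> Rd d \<Longrightarrow> N y \<le> s * sqrt (real d) \<Longrightarrow>
        ((\<lambda>t. \<phi> (lc d 1 y t u)) has_real_derivative dot d (g y) u) (at 0)"
    and g_bound: "\<And>y u. y \<in> Rd d \<Longrightarrow> u \<in> Rd d \<Longrightarrow> N y \<le> s * sqrt (real d) \<Longrightarrow>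
        \<bar>dot d (g y) u\<bar> \<le> (\<alpha> * N y + \<beta>) * N u"
    and w_measurable [measurable]: "w \<in> borel_measurable (leb d)"
    and w_nonneg: "\<And>y. y \<in> Rd d \<Longrightarrow> 0 \<le> w y"
    and w_inner: "\<And>y. y \<in> Rd d \<Longrightarrow> N y \<le> s * sqrt (real d) \<Longrightarrow> w y = G y * exp (\<phi> y)"
    and w_outer: "\<And>y. y \<in> Rd d \<Longrightarrow> s * sqrt (real d) / 2 \<le> N y \<Longrightarrow>
        w y \<le> W * exp (- (3 / 20 * (s * sqrt (real d)) * N y))"
    and W: "0 \<le> W" "W \<le> exp (real d * m + s * real d / 6)"
begin

definition R :: real where "R = s * sqrt (real d)"

lemma sqrt_d: "1 \<le> sqrt (real d)" "sqrt (real d) * sqrt (real d) = real d"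
  using d1 by auto

lemma R_pos: "0 < R" "12 * sqrt (real d) \<le> R" "12 \<le> R" "R\<^sup>2 = s\<^sup>2 * real d"
proof -
  show "12 * sqrt (real d) \<le> R" unfolding R_def using s12 by (intro mult_right_mono) auto
  with sqrt_d(1) show "12 \<le> R" by linarith
  then show "0 < R" by simp
  show "R\<^sup>2 = s\<^sup>2 * real d" by (simp add: R_def power_mult_distrib)
qed

text \<open>The gradient bound is integrated along the ray from the origin, where \<phi> vanishes;
  comparing \<phi> and its negative with the quadratic \<open>?b\<close> avoids an integral.\<close>

lemma ray_bound:
  assumes y: "y \<in> Rd d" "N y \<le> R"
  shows "\<bar>\<phi> y\<bar> \<le> \<alpha> * (N y)\<^sup>2 / 2 + \<beta> * N y"
proof -
  let ?p = "\<lambda>t. lc d 1 (zero_pt d) t y"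
  have N: "N (?p t) = \<bar>t\<bar> * N y" for t
  proof -
    have "?p t = lc d t y 0 y" by (rule lc_cong) simp
    then show ?thesis by simp
  qed
  have D: "((\<lambda>t. \<phi> (?p t)) has_real_derivative dot d (g (?p t)) y) (at t)"
    and B: "\<bar>dot d (g (?p t)) y\<bar> \<le> \<alpha> * t * (N y)\<^sup>2 + \<beta> * N y" if "0 \<le> t" "t \<le> 1" for t
  proof -
    have "N (?p t) \<le> N y" using that mult_right_mono[of t 1 "N y"] by (simp add: N)
    then have le: "N (?p t) \<le> s * sqrt (real d)" using y by (simp add: R_def)
    show "((\<lambda>t. \<phi> (?p t)) has_real_derivative dot d (g (?p t)) y) (at t)"
      by (rule DERIV_line_shift, rule \<phi>_deriv) (use y le in auto)
    show "\<bar>dot d (g (?p t)) y\<bar> \<le> \<alpha> * t * (N y)\<^sup>2 + \<beta> * N y"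
      using g_bound[OF _ y(1) le] that by (simp add: N algebra_simps power2_eq_square)
  qed
  let ?b = "\<lambda>t. \<alpha> * t\<^sup>2 / 2 * (N y)\<^sup>2 + \<beta> * t * N y"
  have b: "(?b has_real_derivative \<alpha> * t * (N y)\<^sup>2 + \<beta> * N y) (at t)" for t
    by (auto intro!: derivative_eq_intros)
  have "?b 0 - \<phi> (?p 0) \<le> ?b 1 - \<phi> (?p 1)"
  proof (rule DERIV_nonneg_imp_nondecreasing[where f = "\<lambda>t. ?b t - \<phi> (?p t)"])
    fix t :: real assume t: "0 \<le> t" "t \<le> 1"
    show "\<exists>z. ((\<lambda>t. ?b t - \<phi> (?p t)) has_real_derivative z) (at t) \<and> 0 \<le> z"
      using DERIV_diff[OF b D[OF t]] B[OF t] abs_le_D1 by (intro exI conjI) auto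
  qed simp
  moreover have "?b 0 + \<phi> (?p 0) \<le> ?b 1 + \<phi> (?p 1)"
  proof (rule DERIV_nonneg_imp_nondecreasing[where f = "\<lambda>t. ?b t + \<phi> (?p t)"])
    fix t :: real assume t: "0 \<le> t" "t \<le> 1"
    show "\<exists>z. ((\<lambda>t. ?b t + \<phi> (?p t)) has_real_derivative z) (at t) \<and> 0 \<le> z"
      using DERIV_add[OF b D[OF t]] abs_le_D2[OF B[OF t]] by (intro exI conjI) auto
  qed simp
  moreover have "?p 0 = zero_pt d" "?p 1 = y" using y by (simp_all add: lc_eq_iff)
  ultimately show ?thesis by (simp add: \<phi>0 abs_le_iff)
qed

text \<open>Half of \<open>\<alpha> \<le> 2 / 5\<close> is taken off the Gaussian coefficient:
  \<open>1 / 2 - 1 / 5 = 3 / 10\<close>.\<close>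

lemma w_upper:
  assumes y: "y \<in> Rd d" "N y \<le> R"
  shows "w y \<le> exp (- (3 / 10 * (N y)\<^sup>2) + sqrt (real d) / 6 * N y)"
proof -
  have "\<alpha> * (N y)\<^sup>2 \<le> 2 / 5 * (N y)\<^sup>2" "\<beta> * N y \<le> sqrt (real d) / 6 * N y"
    using mult_right_mono[OF \<alpha>(2), of "(N y)\<^sup>2"] mult_right_mono[OF \<beta>(2), of "N y"] by simp_all
  with ray_bound[OF y] have "\<phi> y - (N y)\<^sup>2 / 2 \<le> - (3 / 10 * (N y)\<^sup>2) + sqrt (real d) / 6 * N y" by linarith
  then show ?thesis using w_inner[of y] y by (simp add: R_def G_eq exp_add[symmetric])
qed

text \<open>On the ball of radius \<open>sqrt d\<close> the losses add up to
  \<open>1 / 2 + 1 / 5 + 1 / 6 = 13 / 15\<close> per dimension.\<close>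

lemma w_lower:
  assumes y: "y \<in> Rd d" "N y \<le> sqrt (real d)"
  shows "exp (- (13 / 15 * real d)) \<le> w y"
proof -
  have yR: "N y \<le> R" using y(2) R_pos sqrt_d(1) by linarith
  have n2: "(N y)\<^sup>2 \<le> real d" using power_mono[OF y(2) N_nonneg, of 2] by simp
  have "\<alpha> * (N y)\<^sup>2 \<le> 2 / 5 * real d" using \<alpha> n2 by (intro mult_mono) auto
  moreover have "\<beta> * N y \<le> sqrt (real d) / 6 * sqrt (real d)"
    using \<beta> y by (intro mult_mono) auto
  then have "\<beta> * N y \<le> real d / 6" by simp
  ultimately have "- (13 / 15 * real d) \<le> \<phi> y - (N y)\<^sup>2 / 2" using ray_bound[OF y(1) yR] n2 by linarith
  then show ?thesis using w_inner[of y] y yR by (simp add: R_def G_eq exp_add[symmetric])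
qed

text \<open>The density ratio, which is controlled only on the ball of radius \<open>R\<close>, made
  into a globally Lipschitz function. In terms of the squared norm, the cutoff falls from 1 at
  radius \<open>R / 2\<close> to 0 at radius \<open>R\<close>.\<close>

definition h :: "point \<Rightarrow> real" where "h x = cutoff (R\<^sup>2 / 4) (3 * R\<^sup>2 / 4) ((N x)\<^sup>2) * exp (\<phi> x)"

lemma b_pos: "0 < 3 * R\<^sup>2 / 4" using R_pos(1) by simp

lemma cut_out: "R \<le> N x \<Longrightarrow> cutoff (R\<^sup>2 / 4) (3 * R\<^sup>2 / 4) ((N x)\<^sup>2) = 0"
  using power_mono[of R "N x" 2] R_pos(1) by (intro cutoff_eq_0[OF b_pos]) simp

lemma cut_in: "N x \<le> R / 2 \<Longrightarrow> cutoff (R\<^sup>2 / 4) (3 * R\<^sup>2 / 4) ((N x)\<^sup>2) = 1"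
  using power_mono[of "N x" "R / 2" 2] by (intro cutoff_eq_1[OF b_pos]) (simp add: power_divide)

lemma hG_eq: "x \<in> Rd d \<Longrightarrow> h x * G x = cutoff (R\<^sup>2 / 4) (3 * R\<^sup>2 / 4) ((N x)\<^sup>2) * w x"
  using w_inner[of x] cut_out[of x] by (cases "N x \<le> R") (auto simp: h_def R_def)

lemma h_measurable [measurable]: "h \<in> borel_measurable (leb d)"
proof -
  have "(\<lambda>x. cutoff (R\<^sup>2 / 4) (3 * R\<^sup>2 / 4) ((N x)\<^sup>2) * w x / G x) \<in> borel_measurable (leb d)" by measurable
  moreover have "cutoff (R\<^sup>2 / 4) (3 * R\<^sup>2 / 4) ((N x)\<^sup>2) * w x / G x = h x" if "x \<in> space (leb d)" for x
    using that hG_eq[of x, symmetric] G_pos[of x] by (simp add: less_imp_neq[symmetric])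
  ultimately show ?thesis by (rule measurable_cong[THEN iffD1, rotated])
qed

lemma h_nonneg: "0 \<le> h x"
  by (simp add: h_def cutoff_bounds)

lemma hG_le_w: "x \<in> Rd d \<Longrightarrow> h x * G x \<le> w x"
  using hG_eq[of x] w_nonneg[of x] mult_right_mono[OF cutoff_bounds(2), of "w x"] by simp

lemma hG_eq_w: "x \<in> Rd d \<Longrightarrow> N x \<le> R / 2 \<Longrightarrow> h x * G x = w x"
  using hG_eq[of x] cut_in[of x] by simp

definition v1 :: real where "v1 = enn2real vol"

lemma v1: "vol = ennreal v1" "0 < v1"
  using vol_finite vol_pos by (auto simp: v1_def enn2real_positive_iff less_top)

text \<open>A lower bound for the total mass: \<open>w_lower\<close> times the volume of the ball of
  radius \<open>sqrt d\<close>. Tails and remainders are measured against it.\<close>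

definition z0 :: real where "z0 = exp (- (13 / 15 * real d)) * sqrt (real d) ^ d * v1"

lemma z0_pos: "0 < z0" using v1 d1 by (simp add: z0_def)

lemma z0_le: "ennreal z0 \<le> (\<integral>\<^sup>+x. ennreal (h x * G x) \<partial>leb d)"
proof -
  have "ennreal z0 = ennreal (exp (- (13 / 15 * real d))) * emeasure (leb d) {x \<in> Rd d. N x \<le> sqrt (real d)}"
    using d1 v1 by (subst emeasure_ball) (simp_all add: z0_def ennreal_mult mult.assoc)
  also have "\<dots> = (\<integral>\<^sup>+x. ennreal (exp (- (13 / 15 * real d))) * indicator {x \<in> Rd d. N x \<le> sqrt (real d)} x \<partial>leb d)"
    by (simp add: nn_integral_cmult)
  also have "\<dots> \<le> (\<integral>\<^sup>+x. ennreal (h x * G x) \<partial>leb d)"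
  proof (rule nn_integral_mono)
    fix x assume "x \<in> space (leb d)"
    then have x: "x \<in> Rd d" by simp
    show "ennreal (exp (- (13 / 15 * real d))) * indicator {x \<in> Rd d. N x \<le> sqrt (real d)} x \<le> ennreal (h x * G x)"
    proof (cases "N x \<le> sqrt (real d)")
      case True
      then have "N x \<le> R / 2" using R_pos sqrt_d by linarith
      then show ?thesis using w_lower[OF x True] hG_eq_w[OF x] x True by (simp add: ennreal_leI)
    qed simp
  qed
  finally show ?thesis .
qed

definition err :: real where "err = exp (real d * (m - (s / 12)\<^sup>2))"

lemma ten_ninths_power_le_exp: "(10 / 9 :: real) ^ k \<le> exp (real k / 9)"
proof -
  have "(10 / 9 :: real) \<le> exp (1 / 9)" using exp_ge_add_one_self[of "1/9::real"] by simp
  then have "(10 / 9 :: real) ^ k \<le> exp (1 / 9) ^ k" by (rule power_mono) simp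
  then show ?thesis by (simp add: exp_of_nat_mult[symmetric])
qed

text \<open>Half of the exponent in \<open>w_outer\<close> is evaluated at radius
  \<open>R / 2\<close>, giving \<open>exp (- 3 / 80 * R^2)\<close>; the other half keeps the
  integral finite. The factorial in that integral is tamed by \<open>R \<ge> 12 * sqrt d\<close>,
  and what remains is compared with \<open>z0\<close>.\<close>

lemma tail_integral_le: "(\<integral>\<^sup>+x. ennreal (w x) * indicator {x. R / 2 \<le> N x} x \<partial>leb d) \<le> ennreal (z0 * err)"
proof -
  let ?l = "3 / 40 * R"
  have l: "?l > 0" using R_pos by simp
  have "(\<integral>\<^sup>+x. ennreal (w x) * indicator {x. R / 2 \<le> N x} x \<partial>leb d) \<le>
     (\<integral>\<^sup>+x. ennreal (W * exp (- (3 / 80 * R\<^sup>2))) * ennreal (exp (- (?l * N x))) \<partial>leb d)"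
  proof (rule nn_integral_mono)
    fix x assume "x \<in> space (leb d)"
    then have x: "x \<in> Rd d" by simp
    show "ennreal (w x) * indicator {x. R / 2 \<le> N x} x \<le> ennreal (W * exp (- (3 / 80 * R\<^sup>2))) * ennreal (exp (- (?l * N x)))"
    proof (cases "R / 2 \<le> N x")
      case True
      have "w x \<le> W * exp (- (3 / 20 * R * N x))" using w_outer[OF x] True by (simp add: R_def)
      also have "\<dots> \<le> W * exp (- (3 / 80 * R\<^sup>2) - ?l * N x)"
      proof (intro mult_left_mono W)
        have "?l * (R / 2) \<le> ?l * N x" using True l by (intro mult_left_mono) auto
        then show "exp (- (3 / 20 * R * N x)) \<le> exp (- (3 / 80 * R\<^sup>2) - ?l * N x)"
          by (simp add: power2_eq_square)
      qed
      also have "\<dots> = W * exp (- (3 / 80 * R\<^sup>2)) * exp (- (?l * N x))"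
        unfolding mult.assoc mult_exp_exp by simp
      finally show ?thesis using True W by (simp add: ennreal_mult[symmetric] ennreal_leI)
    qed simp
  qed
  also have "\<dots> = ennreal (W * exp (- (3 / 80 * R\<^sup>2))) * (ennreal (fact d / ?l ^ d) * vol)"
    by (subst nn_integral_cmult) (simp_all only: nn_integral_exp_N[OF l], measurable)
  also have "\<dots> = ennreal (W * exp (- (3 / 80 * R\<^sup>2)) * (fact d / ?l ^ d) * v1)"
    using W l v1 by (simp add: ennreal_mult[symmetric] mult.assoc)
  also have "\<dots> \<le> ennreal (z0 * err)"
  proof (rule ennreal_leI)
    have sd: "0 < sqrt (real d) ^ d" using d1 by simp
    have "9 / 10 * sqrt (real d) \<le> ?l" using R_pos(2) by simp
    then have "(9 / 10 * sqrt (real d)) ^ d \<le> ?l ^ d" by (rule power_mono) simp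
    then have "fact d / ?l ^ d \<le> fact d / (9 / 10 * sqrt (real d)) ^ d"
      using d1 R_pos(1) by (intro divide_left_mono mult_pos_pos zero_less_power) auto
    also have "\<dots> \<le> (sqrt (real d) ^ d * sqrt (real d) ^ d) / (9 / 10 * sqrt (real d)) ^ d"
      by (intro divide_right_mono fact_le_sqrt_power) simp
    also have "\<dots> = (10 / 9) ^ d * sqrt (real d) ^ d"
    proof -
      have "(10 / 9 :: real) ^ d = 1 / (9 / 10) ^ d" by (simp add: power_divide)
      moreover have "x * x / (e * x) = 1 / e * x" if "x > 0" for x e :: real using that by simp
      ultimately show ?thesis using sd by (simp only: power_mult_distrib)
    qed
    also have "\<dots> \<le> exp (real d / 9) * sqrt (real d) ^ d"
      by (intro mult_right_mono ten_ninths_power_le_exp) simp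
    finally have 1: "fact d / ?l ^ d \<le> exp (real d / 9) * sqrt (real d) ^ d" .
    have 2: "W * exp (- (3 / 80 * R\<^sup>2)) \<le> exp (real d * m + s * real d / 6) * exp (- (3 / 80 * R\<^sup>2))"
      using W by (intro mult_right_mono) auto
    have "W * exp (- (3 / 80 * R\<^sup>2)) * (fact d / ?l ^ d) \<le>
      (exp (real d * m + s * real d / 6) * exp (- (3 / 80 * R\<^sup>2))) * (exp (real d / 9) * sqrt (real d) ^ d)"
      using W l by (intro mult_mono 1 2) auto
    also have "\<dots> = exp (real d * (m + s / 6 - 3 / 80 * s\<^sup>2 + 1 / 9)) * sqrt (real d) ^ d"
      by (simp add: exp_add[symmetric] R_pos(4) algebra_simps)
    also have "\<dots> \<le> exp (real d * (- 13 / 15 + (m - (s / 12)\<^sup>2))) * sqrt (real d) ^ d"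
    proof -
      \<comment> \<open>The surplus \<open>3 / 80 - 1 / 144\<close> in the coefficient of
        \<open>s^2\<close> has to absorb \<open>s / 6\<close>, \<open>1 / 9\<close> and
        \<open>13 / 15\<close>; this is where \<open>s \<ge> 12\<close> is spent.\<close>
      have "12 * s \<le> s * s" using s12 by (intro mult_right_mono) auto
      moreover have "144 \<le> s * s" using mult_mono[OF s12 s12] s12 by simp
      ultimately have "m + s / 6 - 3 / 80 * s\<^sup>2 + 1 / 9 \<le> - 13 / 15 + (m - (s / 12)\<^sup>2)"
        by (simp add: power2_eq_square)
      then show ?thesis by (intro mult_right_mono) (auto intro!: mult_left_mono)
    qed
    also have "\<dots> = exp (- (13 / 15 * real d)) * sqrt (real d) ^ d * err"
      by (simp add: err_def exp_add[symmetric] algebra_simps)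
    finally have "W * exp (- (3 / 80 * R\<^sup>2)) * (fact d / ?l ^ d) * v1 \<le>
      exp (- (13 / 15 * real d)) * sqrt (real d) ^ d * err * v1" using v1 by (intro mult_right_mono) auto
    then show "W * exp (- (3 / 80 * R\<^sup>2)) * (fact d / ?l ^ d) * v1 \<le> z0 * err"
      by (simp add: z0_def mult_ac)
  qed
  finally show ?thesis .
qed

text \<open>Within radius \<open>8 * sqrt d\<close> the factor \<open>N x\<close> is bounded
  outright. Beyond, the Gaussian decay of \<open>w_upper\<close> leaves at most
  \<open>sqrt d * z0\<close>, that is \<open>sqrt d\<close> times the mass, whence
  \<open>8 + 1 = 9\<close>.\<close>

lemma first_moment_le:
  "(\<integral>\<^sup>+x. ennreal (N x * (h x * G x)) \<partial>leb d) \<le> ennreal (9 * sqrt (real d)) * (\<integral>\<^sup>+x. ennreal (h x * G x) \<partial>leb d)"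
proof -
  let ?r = "sqrt (real d)"
  have r: "?r > 0" "1 \<le> ?r" using sqrt_d by auto
  have "(\<integral>\<^sup>+x. ennreal (N x * (h x * G x)) \<partial>leb d) \<le>
    (\<integral>\<^sup>+x. ennreal (8 * ?r) * ennreal (h x * G x) + ennreal (?r * exp (- (9 / 5 * real d))) * ennreal (exp (- (?r * N x))) \<partial>leb d)"
  proof (rule nn_integral_mono)
    fix x assume "x \<in> space (leb d)"
    then have x: "x \<in> Rd d" by simp
    have "N x * (h x * G x) \<le> 8 * ?r * (h x * G x) + ?r * exp (- (9 / 5 * real d)) * exp (- (?r * N x))"
    proof (cases "N x \<le> 8 * ?r \<or> R \<le> N x")
      case True
      then show ?thesis
      proof
        assume "N x \<le> 8 * ?r"
        then have "N x * (h x * G x) \<le> 8 * ?r * (h x * G x)"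
          using h_nonneg by (intro mult_right_mono) auto
        then show ?thesis using r by (simp add: add_increasing2)
      next
        assume "R \<le> N x"
        then have "h x = 0" by (simp add: h_def cut_out)
        then show ?thesis using r by simp
      qed
    next
      case False
      then have nx: "8 * ?r \<le> N x" "N x \<le> R" by auto
      \<comment> \<open>The radius in units of \<open>sqrt d\<close>, which turns the exponent into
        \<open>d\<close> times a quadratic in \<open>n\<close>. For \<open>n \<ge> 8\<close> it is
        at most \<open>- 9 / 5 - n\<close>: the first summand beats the \<open>13 / 15\<close> of
        \<open>z0\<close>, the second makes the integral converge.\<close>
      define n where "n = N x / ?r"
      have n: "N x = n * ?r" "8 \<le> n" using nx r by (simp_all add: n_def field_simps)
      have N2: "(N x)\<^sup>2 = real d * n\<^sup>2" by (simp add: n power_mult_distrib)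
      have "N x * (h x * G x) \<le> N x * exp (- (3 / 10 * (N x)\<^sup>2) + ?r / 6 * N x)"
        using order_trans[OF hG_le_w[OF x] w_upper[OF x nx(2)]] by (intro mult_left_mono) auto
      also have "\<dots> \<le> (?r * exp (real d * n)) * exp (- (3 / 10 * (N x)\<^sup>2) + ?r / 6 * N x)"
      proof (intro mult_right_mono)
        have "n \<le> exp n" using exp_ge_add_one_self[of n] by linarith
        also have "\<dots> \<le> exp (real d * n)" using d1 n(2) by simp
        finally show "N x \<le> ?r * exp (real d * n)" using r by (simp add: n)
      qed simp
      also have "\<dots> = ?r * exp (real d * (n - 3 / 10 * n\<^sup>2 + n / 6))"
        unfolding N2 by (simp add: n exp_add[symmetric] algebra_simps)
      also have "\<dots> \<le> ?r * exp (real d * (- (9 / 5) - n))"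
      proof -
        have "8 * n \<le> n * n" using n by (intro mult_right_mono) auto
        then have "n - 3 / 10 * n\<^sup>2 + n / 6 \<le> - (9 / 5) - n" using n(2) unfolding power2_eq_square by linarith
        then show ?thesis using r by (intro mult_left_mono) (auto intro!: mult_left_mono)
      qed
      also have "\<dots> = ?r * exp (- (9 / 5 * real d)) * exp (- (?r * N x))"
        by (simp add: n exp_add[symmetric] algebra_simps)
      finally show ?thesis using h_nonneg[of x] r by (simp add: add_increasing)
    qed
    then show "ennreal (N x * (h x * G x)) \<le> ennreal (8 * ?r) * ennreal (h x * G x) + ennreal (?r * exp (- (9 / 5 * real d))) * ennreal (exp (- (?r * N x)))"
      using h_nonneg[of x] r by (simp add: ennreal_mult[symmetric] ennreal_plus[symmetric] ennreal_leI del: ennreal_plus)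
  qed
  also have "\<dots> = ennreal (8 * ?r) * (\<integral>\<^sup>+x. ennreal (h x * G x) \<partial>leb d) +
     ennreal (?r * exp (- (9 / 5 * real d))) * (ennreal (fact d / ?r ^ d) * vol)"
    by (subst nn_integral_add) (auto simp: nn_integral_cmult nn_integral_exp_N[OF r(1)])
  also have "ennreal (?r * exp (- (9 / 5 * real d))) * (ennreal (fact d / ?r ^ d) * vol) \<le> ennreal (?r * z0)"
  proof -
    have "fact d / ?r ^ d \<le> ?r ^ d" using fact_le_sqrt_power[of d] r by (simp add: field_simps)
    moreover have "exp (- (9 / 5 * real d)) \<le> exp (- (13 / 15 * real d))" by simp
    ultimately have "exp (- (9 / 5 * real d)) * (fact d / ?r ^ d) \<le> exp (- (13 / 15 * real d)) * ?r ^ d"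
      by (intro mult_mono) auto
    then have "?r * (exp (- (9 / 5 * real d)) * (fact d / ?r ^ d)) * v1 \<le> ?r * (exp (- (13 / 15 * real d)) * ?r ^ d) * v1"
      using r v1 by (intro mult_right_mono mult_left_mono) auto
    then have "?r * exp (- (9 / 5 * real d)) * (fact d / ?r ^ d * v1) \<le> ?r * z0"
      by (simp add: z0_def mult_ac)
    then show ?thesis using r v1 by (simp add: ennreal_mult[symmetric] ennreal_leI)
  qed
  also have "ennreal (?r * z0) \<le> ennreal ?r * (\<integral>\<^sup>+x. ennreal (h x * G x) \<partial>leb d)"
    using z0_le z0_pos r by (simp add: ennreal_mult mult_left_mono)
  also have "ennreal (8 * ?r) * (\<integral>\<^sup>+x. ennreal (h x * G x) \<partial>leb d) + ennreal ?r * (\<integral>\<^sup>+x. ennreal (h x * G x) \<partial>leb d) =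
    ennreal (9 * ?r) * (\<integral>\<^sup>+x. ennreal (h x * G x) \<partial>leb d)"
    using r by (simp add: distrib_right[symmetric] ennreal_plus[symmetric] del: ennreal_plus)
  finally show ?thesis by (simp add: add_left_mono)
qed

section \<open>The gradient of the cut density ratio\<close>

abbreviation cut :: "real \<Rightarrow> real" where "cut \<equiv> cutoff (R\<^sup>2 / 4) (3 * R\<^sup>2 / 4)"
abbreviation cut' :: "real \<Rightarrow> real" where "cut' \<equiv> cutoff' (R\<^sup>2 / 4) (3 * R\<^sup>2 / 4)"

text \<open>Half the gradient of the squared norm.\<close>

definition Aq :: "point \<Rightarrow> point" where "Aq x = (\<lambda>j. \<Sum>i<d. a i j * x i)"

lemma dot_Aq: "dot d (Aq x) y = qf d a x y"
proof -
  have "dot d (Aq x) y = (\<Sum>j<d. \<Sum>i<d. a i j * x i * y j)"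
    by (simp add: dot_def Aq_def sum_distrib_right)
  also have "\<dots> = qf d a x y" unfolding qf_def by (rule sum.swap)
  finally show ?thesis .
qed

definition gr :: "point \<Rightarrow> point" where
  "gr x = (if N x \<le> R then lc d (h x) (g x) (exp (\<phi> x) * cut' ((N x)\<^sup>2) * 2) (Aq x) else zero_pt d)"

text \<open>On the closed ball this is the product rule, available on the boundary too because
  \<open>\<phi>_deriv\<close> is two-sided there. Outside, the norm stays above \<open>R\<close> for
  a short while along the line, so \<open>h\<close> is locally zero.\<close>

lemma h_deriv:
  assumes x: "x \<in> Rd d" and y: "y \<in> Rd d"
  shows "((\<lambda>t. h (lc d 1 x t y)) has_real_derivative dot d (gr x) y) (at 0)"
proof -
  have N: "(N (lc d 1 x t y))\<^sup>2 = (N x)\<^sup>2 + 2 * t * qf d a x y + t\<^sup>2 * (N y)\<^sup>2" for t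
    by (simp add: N_lc_sq)
  have dN: "((\<lambda>t. (N (lc d 1 x t y))\<^sup>2) has_real_derivative 2 * qf d a x y) (at 0)"
    unfolding N by (auto intro!: derivative_eq_intros)
  show ?thesis
  proof (cases "N x \<le> R")
    case True
    then have "((\<lambda>t. \<phi> (lc d 1 x t y)) has_real_derivative dot d (g x) y) (at 0)"
      using \<phi>_deriv[OF x y] by (simp add: R_def)
    then have 1: "((\<lambda>t. exp (\<phi> (lc d 1 x t y))) has_real_derivative exp (\<phi> (lc d 1 x 0 y)) * dot d (g x) y) (at 0)"
      by (rule DERIV_chain2[OF DERIV_exp])
    have 2: "((\<lambda>t. cut ((N (lc d 1 x t y))\<^sup>2)) has_real_derivative cut' ((N (lc d 1 x 0 y))\<^sup>2) * (2 * qf d a x y)) (at 0)"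
      by (rule DERIV_chain2[OF cutoff_DERIV[OF b_pos] dN])
    have "((\<lambda>t. h (lc d 1 x t y)) has_real_derivative
       cut' ((N (lc d 1 x 0 y))\<^sup>2) * (2 * qf d a x y) * exp (\<phi> (lc d 1 x 0 y)) + exp (\<phi> (lc d 1 x 0 y)) * dot d (g x) y * cut ((N (lc d 1 x 0 y))\<^sup>2)) (at 0)"
      unfolding h_def by (rule DERIV_mult[OF 2 1])
    then show ?thesis using x True by (simp add: gr_def dot_lc_left dot_Aq h_def mult_ac add.commute)
  next
    case False
    then have "R\<^sup>2 < (N x)\<^sup>2" using R_pos(1) by (intro power_strict_mono) auto
    have "isCont (\<lambda>t. (N (lc d 1 x t y))\<^sup>2) 0" by (rule DERIV_isCont[OF dN])
    then have "((\<lambda>t. (N (lc d 1 x t y))\<^sup>2) \<longlongrightarrow> (N x)\<^sup>2) (at 0)"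
      using x by (simp add: isCont_def)
    then have "eventually (\<lambda>t. R\<^sup>2 < (N (lc d 1 x t y))\<^sup>2) (at 0)"
      using \<open>R\<^sup>2 < (N x)\<^sup>2\<close> by (rule order_tendstoD)
    then have "eventually (\<lambda>t. R\<^sup>2 < (N (lc d 1 x t y))\<^sup>2) (nhds 0)"
      using \<open>R\<^sup>2 < (N x)\<^sup>2\<close> x by (simp add: eventually_nhds_conv_at)
    then have "eventually (\<lambda>t. 0 = h (lc d 1 x t y)) (nhds 0)"
    proof eventually_elim
      case (elim t)
      have "R \<le> N (lc d 1 x t y)" by (rule power2_le_imp_le) (use elim in simp_all)
      then show ?case by (simp add: h_def cut_out)
    qed
    then have "((\<lambda>t. h (lc d 1 x t y)) has_real_derivative 0) (at 0)"
      using DERIV_const[of "0::real" "at 0"] by (subst (asm) DERIV_cong_ev[OF refl _ refl]) auto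
    then show ?thesis using False by (simp add: gr_def)
  qed
qed

text \<open>A bound for the dual norm of the gradient of \<open>h\<close>. The second summand stems
  from the cutoff and lives on the annulus, where the mass is already a tail.\<close>

definition eta :: "point \<Rightarrow> real" where
  "eta x = h x * (\<alpha> * N x + \<beta>) + (if R / 2 \<le> N x \<and> N x \<le> R then exp (\<phi> x) * (11 / R) else 0)"

lemma eta_nonneg: "0 \<le> eta x"
  using \<alpha> \<beta> R_pos(1) h_nonneg by (auto simp: eta_def intro!: add_nonneg_nonneg mult_nonneg_nonneg)

lemma gr_bound:
  assumes x: "x \<in> Rd d" and y: "y \<in> Rd d"
  shows "\<bar>dot d (gr x) y\<bar> \<le> eta x * N y"
proof (cases "N x \<le> R")
  case True
  have c: "\<bar>cut' ((N x)\<^sup>2)\<bar> * 2 * N x \<le> (if R / 2 \<le> N x \<and> N x \<le> R then 11 / R else 0)"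
  proof (cases "R / 2 \<le> N x")
    case t: True
    \<comment> \<open>The slope of the cutoff is at most 4 over its width
      \<open>3 * R^2 / 4\<close>, and \<open>32 / 3 \<le> 11\<close>.\<close>
    have "\<bar>cut' ((N x)\<^sup>2)\<bar> * 2 * N x \<le> 4 / (3 * R\<^sup>2 / 4) * 2 * R"
      using True by (intro mult_mono abs_cutoff'_le b_pos) auto
    also have "\<dots> \<le> 11 / R" using R_pos(1) by (simp add: power2_eq_square field_simps)
    finally show ?thesis using t True by simp
  next
    case False
    then have "(N x)\<^sup>2 \<le> (R / 2)\<^sup>2" by (intro power_mono) auto
    then have "cut' ((N x)\<^sup>2) = 0" by (intro cutoff'_eq_0[OF b_pos]) (simp add: power_divide)
    then show ?thesis using False by simp
  qed
  let ?c = "\<bar>cut' ((N x)\<^sup>2)\<bar> * 2" and ?i = "if R / 2 \<le> N x \<and> N x \<le> R then 11 / R else 0"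
  have "dot d (gr x) y = h x * dot d (g x) y + exp (\<phi> x) * cut' ((N x)\<^sup>2) * 2 * qf d a x y"
    using True by (simp add: gr_def dot_lc_left dot_Aq)
  then have "\<bar>dot d (gr x) y\<bar> \<le> h x * \<bar>dot d (g x) y\<bar> + exp (\<phi> x) * ?c * \<bar>qf d a x y\<bar>"
    using abs_triangle_ineq[of "h x * dot d (g x) y" "exp (\<phi> x) * cut' ((N x)\<^sup>2) * 2 * qf d a x y"] h_nonneg[of x]
    by (simp add: abs_mult)
  moreover have "h x * \<bar>dot d (g x) y\<bar> \<le> h x * ((\<alpha> * N x + \<beta>) * N y)"
    using g_bound[OF x y] True by (intro mult_left_mono h_nonneg) (simp add: R_def)
  moreover have "exp (\<phi> x) * ?c * \<bar>qf d a x y\<bar> \<le> exp (\<phi> x) * ?c * (N x * N y)"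
    by (intro mult_left_mono abs_q_le) simp
  moreover have "exp (\<phi> x) * ?c * (N x * N y) = exp (\<phi> x) * (?c * N x) * N y" by (simp only: mult_ac)
  moreover have "exp (\<phi> x) * (?c * N x) * N y \<le> exp (\<phi> x) * ?i * N y"
    by (intro mult_right_mono mult_left_mono c) simp_all
  ultimately have "\<bar>dot d (gr x) y\<bar> \<le> h x * ((\<alpha> * N x + \<beta>) * N y) + exp (\<phi> x) * ?i * N y" by linarith
  also have "\<dots> = eta x * N y" by (simp add: eta_def algebra_simps)
  finally show ?thesis .
next
  case False
  then show ?thesis using eta_nonneg[of x] by (simp add: gr_def)
qed

text \<open>The mean value theorem on the segment. The crude constant is harmless because the
  Poincare inequality asks only that some Lipschitz constant exist.\<close>

lemma h_lipschitz:
  obtains L where "0 \<le> L" "\<And>x y. x \<in> Rd d \<Longrightarrow> y \<in> Rd d \<Longrightarrow> \<bar>h x - h y\<bar> \<le> L * N (lc d 1 x (-1) y)"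
proof -
  define P where "P = exp (\<alpha> * R\<^sup>2 / 2 + \<beta> * R)"
  define L where "L = P * (\<alpha> * R + \<beta>) + P * (11 / R)"
  have P: "exp (\<phi> x) \<le> P" if "x \<in> Rd d" "N x \<le> R" for x
  proof -
    have "\<alpha> * (N x)\<^sup>2 \<le> \<alpha> * R\<^sup>2" "\<beta> * N x \<le> \<beta> * R"
      using \<alpha> \<beta> that by (auto intro!: mult_left_mono power_mono)
    then show ?thesis using ray_bound[OF that] by (auto simp: P_def)
  qed
  have P0: "0 \<le> P" by (simp add: P_def)
  have L0: "0 \<le> L" using \<alpha> \<beta> R_pos(1) P0 by (auto simp: L_def)
  have gL: "\<bar>dot d (gr x) y\<bar> \<le> L * N y" if "x \<in> Rd d" "y \<in> Rd d" for x y
  proof (cases "N x \<le> R")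
    case True
    have "h x \<le> 1 * P" unfolding h_def using P[OF that(1) True] by (intro mult_mono cutoff_bounds) auto
    moreover have "\<alpha> * N x + \<beta> \<le> \<alpha> * R + \<beta>" using \<alpha> True by (simp add: mult_left_mono)
    ultimately have "h x * (\<alpha> * N x + \<beta>) \<le> P * (\<alpha> * R + \<beta>)"
      using \<alpha> \<beta> P0 by (intro mult_mono) (auto intro!: add_nonneg_nonneg mult_nonneg_nonneg)
    moreover have "exp (\<phi> x) * (11 / R) \<le> P * (11 / R)" using P[OF that(1) True] R_pos(1) by (intro mult_right_mono) auto
    ultimately have "eta x \<le> L" using R_pos(1) P0 by (simp add: eta_def L_def add_increasing2)
    then show ?thesis using gr_bound[OF that] mult_right_mono[of "eta x" L "N y"] by auto
  qed (use L0 in \<open>simp add: gr_def\<close>)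
  have "\<bar>h x - h y\<bar> \<le> L * N (lc d 1 x (-1) y)" if "x \<in> Rd d" "y \<in> Rd d" for x y
  proof -
    let ?u = "lc d 1 x (-1) y"
    have "((\<lambda>t. h (lc d 1 y t ?u)) has_real_derivative dot d (gr (lc d 1 y t ?u)) ?u) (at t)" for t
      by (rule DERIV_line_shift, rule h_deriv) auto
    then obtain z where "h (lc d 1 y 1 ?u) - h (lc d 1 y 0 ?u) = (1 - 0) * dot d (gr (lc d 1 y z ?u)) ?u"
      using MVT2[of 0 1 "\<lambda>t. h (lc d 1 y t ?u)" "\<lambda>t. dot d (gr (lc d 1 y t ?u)) ?u"] by auto
    moreover have "lc d 1 y 1 ?u = x" "lc d 1 y 0 ?u = y" using that by (simp_all add: lc_eq_iff)
    ultimately show ?thesis using gL[of "lc d 1 y z ?u" ?u] by simp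
  qed
  with L0 show ?thesis by (rule that)
qed

section \<open>Total masses and the comparison with the Gaussian\<close>

definition Zh :: real where "Zh = (\<integral>x. h x * G x \<partial>leb d)"
definition Z :: real where "Z = (\<integral>x. w x \<partial>leb d)"

lemma w_nn_le: "(\<integral>\<^sup>+x. ennreal (w x) \<partial>leb d) \<le> (\<integral>\<^sup>+x. ennreal (h x * G x) \<partial>leb d) + ennreal (z0 * err)"
proof -
  have m: "{x \<in> space (leb d). R / 2 \<le> N x} \<in> sets (leb d)" by measurable
  have [measurable]: "(\<lambda>x. indicator {x. R / 2 \<le> N x} x :: ennreal) \<in> borel_measurable (leb d)"
    by (rule borel_measurable_indicator') (use m in \<open>simp add: Int_def vimage_def conj_commute\<close>)
  have "(\<integral>\<^sup>+x. ennreal (w x) \<partial>leb d) \<le> (\<integral>\<^sup>+x. ennreal (h x * G x) + ennreal (w x) * indicator {x. R / 2 \<le> N x} x \<partial>leb d)"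
    using hG_eq_w by (intro nn_integral_mono) (auto simp: indicator_def)
  also have "\<dots> = (\<integral>\<^sup>+x. ennreal (h x * G x) \<partial>leb d) + (\<integral>\<^sup>+x. ennreal (w x) * indicator {x. R / 2 \<le> N x} x \<partial>leb d)"
    by (intro nn_integral_add) auto
  finally show ?thesis using tail_integral_le by (meson add_left_mono order_trans)
qed

lemma hG_integrable: "integrable (leb d) (\<lambda>x. h x * G x)"
proof (rule integrableI_bounded)
  have "(\<integral>\<^sup>+x. ennreal (norm (h x * G x)) \<partial>leb d) \<le> (\<integral>\<^sup>+x. ennreal (exp (\<alpha> * R\<^sup>2 / 2 + \<beta> * R)) * ennreal (G x) \<partial>leb d)"
  proof (rule nn_integral_mono)
    fix x assume "x \<in> space (leb d)"
    then have x: "x \<in> Rd d" by simp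
    have "h x \<le> exp (\<alpha> * R\<^sup>2 / 2 + \<beta> * R)"
    proof (cases "N x \<le> R")
      case True
      have "\<alpha> * (N x)\<^sup>2 \<le> \<alpha> * R\<^sup>2" "\<beta> * N x \<le> \<beta> * R"
        using \<alpha> \<beta> True by (auto intro!: mult_left_mono power_mono)
      then have "exp (\<phi> x) \<le> exp (\<alpha> * R\<^sup>2 / 2 + \<beta> * R)" using ray_bound[OF x True] by auto
      then show ?thesis unfolding h_def using mult_mono[OF cutoff_bounds(2), of "exp (\<phi> x)"] by simp
    qed (simp add: h_def cut_out)
    then show "ennreal (norm (h x * G x)) \<le> ennreal (exp (\<alpha> * R\<^sup>2 / 2 + \<beta> * R)) * ennreal (G x)"
      using h_nonneg[of x] by (simp add: ennreal_mult[symmetric] ennreal_leI mult_right_mono abs_mult)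
  qed
  also have "\<dots> = ennreal (exp (\<alpha> * R\<^sup>2 / 2 + \<beta> * R)) * ennreal G0"
    by (simp add: nn_integral_cmult nn_integral_G)
  also have "\<dots> < \<infinity>" by (simp add: ennreal_mult_less_top)
  finally show "(\<integral>\<^sup>+x. ennreal (norm (h x * G x)) \<partial>leb d) < \<infinity>" .
qed measurable

lemma nn_Zh: "(\<integral>\<^sup>+x. ennreal (h x * G x) \<partial>leb d) = ennreal Zh"
  unfolding Zh_def using h_nonneg by (intro nn_integral_eq_integral hG_integrable) auto

lemma z0_le_Zh: "z0 \<le> Zh"
proof -
  have "0 \<le> Zh" unfolding Zh_def using h_nonneg by (intro integral_nonneg_AE) auto
  then show ?thesis using z0_le unfolding nn_Zh by (simp add: ennreal_le_iff)
qed

lemma Zh_pos: "0 < Zh" using z0_le_Zh z0_pos by simp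

lemma err_pos: "0 < err" by (simp add: err_def)

lemma w_integrable: "integrable (leb d) w"
proof (rule integrableI_nonneg)
  have "(\<integral>\<^sup>+x. ennreal (w x) \<partial>leb d) \<le> ennreal Zh + ennreal (z0 * err)" using w_nn_le nn_Zh by simp
  also have "\<dots> < \<infinity>" by simp
  finally show "(\<integral>\<^sup>+x. ennreal (w x) \<partial>leb d) < \<infinity>" .
qed (auto simp: w_nonneg)

lemma nn_Z: "(\<integral>\<^sup>+x. ennreal (w x) \<partial>leb d) = ennreal Z"
  unfolding Z_def by (intro nn_integral_eq_integral w_integrable) (auto simp: w_nonneg)

lemma Z_bounds: "Zh \<le> Z" "Z \<le> Zh + z0 * err"
proof -
  show 1: "Zh \<le> Z" unfolding Zh_def Z_def
    by (intro integral_mono hG_integrable w_integrable hG_le_w) simp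
  have "ennreal Z \<le> ennreal Zh + ennreal (z0 * err)" using w_nn_le nn_Zh nn_Z by simp
  also have "\<dots> = ennreal (Zh + z0 * err)" using Zh_pos z0_pos err_pos by (intro ennreal_plus[symmetric]) auto
  finally show "Z \<le> Zh + z0 * err" using Zh_pos z0_pos err_pos by (subst (asm) ennreal_le_iff) auto
qed

text \<open>The inner integral over the independent copy costs \<open>4 * G0 * eta x\<close>.
  Integrating \<open>eta\<close> against the Gaussian gives the first moment, the prior term and the
  tail, whose weight \<open>11 / R\<close> is below one since \<open>R \<ge> 12\<close>.\<close>

lemma gradient_term:
  "(\<integral>\<^sup>+x. \<integral>\<^sup>+y. ennreal \<bar>dot d (gr x) y\<bar> * ennreal (G x * G y) \<partial>leb d \<partial>leb d) \<le>
    ennreal (4 * G0 * ((9 * \<alpha> * sqrt (real d) + \<beta> + err) * Zh))"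
proof -
  have "(\<integral>\<^sup>+y. ennreal \<bar>dot d (gr x) y\<bar> * ennreal (G x * G y) \<partial>leb d) \<le> ennreal (4 * G0) * ennreal (eta x * G x)"
    if x: "x \<in> Rd d" for x
  proof -
    have [measurable]: "dot d (gr x) \<in> borel_measurable (leb d)"
    proof -
      have "(\<lambda>y. dot d (gr x) y) \<in> borel_measurable (leb d)"
        by (rule measurable_dot) (auto simp: gr_def)
      then show ?thesis by simp
    qed
    have "(\<integral>\<^sup>+y. ennreal \<bar>dot d (gr x) y\<bar> * ennreal (G x * G y) \<partial>leb d) = (\<integral>\<^sup>+y. ennreal (G x) * ennreal (G y * \<bar>dot d (gr x) y\<bar>) \<partial>leb d)"
      by (intro nn_integral_cong) (simp add: ennreal_mult[symmetric] mult_ac)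
    also have "\<dots> = ennreal (G x) * (\<integral>\<^sup>+y. ennreal (G y * \<bar>dot d (gr x) y\<bar>) \<partial>leb d)"
      by (rule nn_integral_cmult) measurable
    also have "\<dots> \<le> ennreal (G x) * ennreal (4 * eta x * G0)"
      by (intro mult_left_mono nn_integral_G_linear gr_bound x eta_nonneg) auto
    also have "\<dots> = ennreal (4 * G0) * ennreal (eta x * G x)"
      using eta_nonneg[of x] G0_pos by (simp add: ennreal_mult[symmetric] mult_ac)
    finally show ?thesis .
  qed
  then have "(\<integral>\<^sup>+x. \<integral>\<^sup>+y. ennreal \<bar>dot d (gr x) y\<bar> * ennreal (G x * G y) \<partial>leb d \<partial>leb d) \<le>
     (\<integral>\<^sup>+x. ennreal (4 * G0) * (ennreal \<alpha> * ennreal (N x * (h x * G x)) + (ennreal \<beta> * ennreal (h x * G x)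
       + ennreal (11 / R) * (ennreal (w x) * indicator {x. R / 2 \<le> N x} x))) \<partial>leb d)"
  proof (intro nn_integral_mono)
    fix x assume "x \<in> space (leb d)"
    then have x: "x \<in> Rd d" by simp
    have "eta x * G x \<le> \<alpha> * (N x * (h x * G x)) + (\<beta> * (h x * G x) + 11 / R * (w x * indicator {x. R / 2 \<le> N x} x))"
      using w_inner[OF x] w_nonneg[OF x] R_pos(1) by (auto simp: eta_def R_def[symmetric] algebra_simps indicator_def)
    then have "ennreal (eta x * G x) \<le> ennreal (\<alpha> * (N x * (h x * G x)) + (\<beta> * (h x * G x) + 11 / R * (w x * indicator {x. R / 2 \<le> N x} x)))"
      by (rule ennreal_leI)
    also have "\<dots> = ennreal \<alpha> * ennreal (N x * (h x * G x)) + (ennreal \<beta> * ennreal (h x * G x)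
       + ennreal (11 / R) * (ennreal (w x) * indicator {x. R / 2 \<le> N x} x))"
      using \<alpha> \<beta> R_pos(1) h_nonneg[of x] w_nonneg[OF x]
      by (simp add: ennreal_mult[symmetric] ennreal_plus[symmetric] indicator_def del: ennreal_plus)
    finally show "(\<integral>\<^sup>+y. ennreal \<bar>dot d (gr x) y\<bar> * ennreal (G x * G y) \<partial>leb d) \<le> ennreal (4 * G0) *
      (ennreal \<alpha> * ennreal (N x * (h x * G x)) + (ennreal \<beta> * ennreal (h x * G x) + ennreal (11 / R) * (ennreal (w x) * indicator {x. R / 2 \<le> N x} x)))"
      by (intro order_trans[OF \<open>x \<in> Rd d \<Longrightarrow> _\<close>[OF x]] mult_left_mono) auto
  qed
  also have "\<dots> = ennreal (4 * G0) * (ennreal \<alpha> * (\<integral>\<^sup>+x. ennreal (N x * (h x * G x)) \<partial>leb d) + (ennreal \<beta> * ennreal Zh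
       + ennreal (11 / R) * (\<integral>\<^sup>+x. ennreal (w x) * indicator {x. R / 2 \<le> N x} x \<partial>leb d)))"
  proof -
    have m: "{x \<in> space (leb d). R / 2 \<le> N x} \<in> sets (leb d)" by measurable
    have [measurable]: "(\<lambda>x. indicator {x. R / 2 \<le> N x} x :: ennreal) \<in> borel_measurable (leb d)"
      by (rule borel_measurable_indicator') (use m in \<open>simp add: Int_def vimage_def conj_commute\<close>)
    show ?thesis
      by (subst nn_integral_cmult, measurable, subst nn_integral_add, measurable, subst nn_integral_add, measurable)
         (simp add: nn_integral_cmult nn_Zh)
  qed
  also have "\<dots> \<le> ennreal (4 * G0) * (ennreal \<alpha> * (ennreal (9 * sqrt (real d)) * ennreal Zh) + (ennreal \<beta> * ennreal Zh + ennreal (11 / R) * ennreal (z0 * err)))"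
    using first_moment_le tail_integral_le unfolding nn_Zh by (intro mult_left_mono add_mono) auto
  also have "\<dots> = ennreal (4 * G0 * (\<alpha> * (9 * sqrt (real d) * Zh) + (\<beta> * Zh + 11 / R * (z0 * err))))"
    using \<alpha> \<beta> R_pos(1) Zh_pos z0_pos err_pos G0_pos
    by (simp add: ennreal_mult[symmetric] ennreal_plus[symmetric] del: ennreal_plus)
  also have "\<dots> \<le> ennreal (4 * G0 * ((9 * \<alpha> * sqrt (real d) + \<beta> + err) * Zh))"
  proof (intro ennreal_leI mult_left_mono)
    have "11 / R * (z0 * err) \<le> 1 * (Zh * err)"
      using R_pos(1,3) z0_le_Zh err_pos z0_pos by (intro mult_mono) auto
    then show "\<alpha> * (9 * sqrt (real d) * Zh) + (\<beta> * Zh + 11 / R * (z0 * err)) \<le> (9 * \<alpha> * sqrt (real d) + \<beta> + err) * Zh"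
      by (simp add: algebra_simps)
  qed (use G0_pos in auto)
  finally show ?thesis .
qed

lemma G_integrable: "integrable (leb d) G"
  by (rule integrableI_nonneg) (auto simp: nn_integral_G)

lemma G_integral: "(\<integral>x. G x \<partial>leb d) = G0"
  using nn_integral_G G0_pos by (subst integral_eq_nn_integral) auto

text \<open>\<open>h y * G0 - Zh\<close> is the integral of \<open>h y - h x\<close> against the
  Gaussian in \<open>x\<close>, so its L1 norm is bounded by the double integral of the Poincare
  inequality. The constant is \<open>2 * pi = 4 * (pi / 2)\<close>.\<close>

lemma cut_vs_gaussian:
  "\<bar>(\<integral>y. indicator B y * (h y * G y) \<partial>leb d) / Zh - (\<integral>y. indicator B y * G y \<partial>leb d) / G0\<bar>
    \<le> 2 * pi * (9 * \<alpha> * sqrt (real d) + \<beta> + err)" if B [measurable]: "B \<in> sets (leb d)"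
proof -
  let ?e = "9 * \<alpha> * sqrt (real d) + \<beta> + err"
  have e0: "0 \<le> ?e" using \<alpha> \<beta> err_pos by (auto intro!: add_nonneg_nonneg)
  obtain L where L: "0 \<le> L" "\<And>x y. x \<in> Rd d \<Longrightarrow> y \<in> Rd d \<Longrightarrow> \<bar>h x - h y\<bar> \<le> L * N (lc d 1 x (-1) y)"
    using h_lipschitz by blast
  have 1: "(\<integral>\<^sup>+x. \<integral>\<^sup>+y. ennreal \<bar>h y - h x\<bar> * ennreal (G x * G y) \<partial>leb d \<partial>leb d) \<le> ennreal (2 * pi * G0 * (?e * Zh))"
  proof -
    have "(\<integral>\<^sup>+x. \<integral>\<^sup>+y. ennreal \<bar>h y - h x\<bar> * ennreal (G x * G y) \<partial>leb d \<partial>leb d) \<le>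
      ennreal (pi / 2) * (\<integral>\<^sup>+x. \<integral>\<^sup>+y. ennreal \<bar>dot d (gr x) y\<bar> * ennreal (G x * G y) \<partial>leb d \<partial>leb d)"
      by (rule gaussian_L1_poincare[OF h_measurable L(2,1) h_deriv])
    also have "\<dots> \<le> ennreal (pi / 2) * ennreal (4 * G0 * (?e * Zh))"
      by (intro mult_left_mono gradient_term) simp
    also have "\<dots> = ennreal (2 * pi * G0 * (?e * Zh))"
      using e0 Zh_pos G0_pos by (simp add: ennreal_mult[symmetric])
    finally show ?thesis .
  qed
  have 2: "(\<integral>\<^sup>+y. ennreal (G y * \<bar>h y * G0 - Zh\<bar>) \<partial>leb d) \<le> (\<integral>\<^sup>+y. \<integral>\<^sup>+x. ennreal \<bar>h y - h x\<bar> * ennreal (G x * G y) \<partial>leb d \<partial>leb d)"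
  proof (rule nn_integral_mono)
    fix y assume y: "y \<in> space (leb d)"
    have i: "integrable (leb d) (\<lambda>x. (h y - h x) * G x)"
      using G_integrable hG_integrable by (simp add: left_diff_distrib)
    have "h y * G0 - Zh = (\<integral>x. (h y - h x) * G x \<partial>leb d)"
      using G_integrable hG_integrable by (simp add: left_diff_distrib G_integral Zh_def)
    then have "ennreal \<bar>h y * G0 - Zh\<bar> \<le> (\<integral>\<^sup>+x. ennreal (norm ((h y - h x) * G x)) \<partial>leb d)"
      using integral_norm_bound_ennreal[OF i] by simp
    then have "ennreal (G y) * ennreal \<bar>h y * G0 - Zh\<bar> \<le> ennreal (G y) * (\<integral>\<^sup>+x. ennreal (norm ((h y - h x) * G x)) \<partial>leb d)"
      by (rule mult_left_mono) simp
    also have "\<dots> = (\<integral>\<^sup>+x. ennreal (G y) * ennreal (norm ((h y - h x) * G x)) \<partial>leb d)"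
      by (rule nn_integral_cmult[symmetric]) measurable
    also have "\<dots> = (\<integral>\<^sup>+x. ennreal \<bar>h y - h x\<bar> * ennreal (G x * G y) \<partial>leb d)"
      by (intro nn_integral_cong) (simp add: ennreal_mult[symmetric] abs_mult mult_ac)
    finally show "ennreal (G y * \<bar>h y * G0 - Zh\<bar>) \<le> (\<integral>\<^sup>+x. ennreal \<bar>h y - h x\<bar> * ennreal (G x * G y) \<partial>leb d)"
      by (simp add: ennreal_mult)
  qed
  also have "(\<integral>\<^sup>+y. \<integral>\<^sup>+x. ennreal \<bar>h y - h x\<bar> * ennreal (G x * G y) \<partial>leb d \<partial>leb d) =
     (\<integral>\<^sup>+y. \<integral>\<^sup>+x. ennreal \<bar>h x - h y\<bar> * ennreal (G y * G x) \<partial>leb d \<partial>leb d)"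
    by (simp add: abs_minus_commute mult.commute)
  also note 1
  finally have 3: "(\<integral>\<^sup>+y. ennreal (G y * \<bar>h y * G0 - Zh\<bar>) \<partial>leb d) \<le> ennreal (2 * pi * G0 * (?e * Zh))" .
  have i: "integrable (leb d) (\<lambda>y. G y * (h y * G0 - Zh))"
  proof -
    have eq: "(\<lambda>y. G y * (h y * G0 - Zh)) = (\<lambda>y. G0 * (h y * G y) - Zh * G y)" by (simp add: algebra_simps)
    show ?thesis unfolding eq
      by (intro Bochner_Integration.integrable_diff integrable_mult_right hG_integrable G_integrable)
  qed
  have iB: "integrable (leb d) (\<lambda>y. indicator B y * f y)" if "integrable (leb d) f" for f :: "point \<Rightarrow> real"
    using integrable_real_mult_indicator[OF B that] by (simp add: mult.commute)
  have "(\<integral>y. indicator B y * (h y * G y) \<partial>leb d) * G0 - (\<integral>y. indicator B y * G y \<partial>leb d) * Zh =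
    (\<integral>y. (indicator B y * (h y * G y)) * G0 - (indicator B y * G y) * Zh \<partial>leb d)"
    using iB[OF hG_integrable] iB[OF G_integrable] by simp
  also have "\<dots> = (\<integral>y. indicator B y * (G y * (h y * G0 - Zh)) \<partial>leb d)"
    by (intro Bochner_Integration.integral_cong) (simp_all add: algebra_simps)
  finally have eq: "(\<integral>y. indicator B y * (h y * G y) \<partial>leb d) * G0 - (\<integral>y. indicator B y * G y \<partial>leb d) * Zh =
     (\<integral>y. indicator B y * (G y * (h y * G0 - Zh)) \<partial>leb d)" .
  have "ennreal \<bar>\<integral>y. indicator B y * (G y * (h y * G0 - Zh)) \<partial>leb d\<bar> \<le> (\<integral>\<^sup>+y. ennreal (norm (indicator B y * (G y * (h y * G0 - Zh)))) \<partial>leb d)"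
    using integral_norm_bound_ennreal[OF iB[OF i]] by simp
  also have "\<dots> \<le> (\<integral>\<^sup>+y. ennreal (G y * \<bar>h y * G0 - Zh\<bar>) \<partial>leb d)"
    by (intro nn_integral_mono ennreal_leI) (auto simp: indicator_def abs_mult)
  also note 3
  finally have "\<bar>\<integral>y. indicator B y * (G y * (h y * G0 - Zh)) \<partial>leb d\<bar> \<le> 2 * pi * G0 * (?e * Zh)"
    using G0_pos e0 Zh_pos by (subst (asm) ennreal_le_iff) auto
  then have "\<bar>(\<integral>y. indicator B y * (h y * G y) \<partial>leb d) * G0 - (\<integral>y. indicator B y * G y \<partial>leb d) * Zh\<bar> \<le> 2 * pi * ?e * (G0 * Zh)"
    unfolding eq by (simp only: mult_ac)
  moreover have "(\<integral>y. indicator B y * (h y * G y) \<partial>leb d) / Zh - (\<integral>y. indicator B y * G y \<partial>leb d) / G0 =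
     ((\<integral>y. indicator B y * (h y * G y) \<partial>leb d) * G0 - (\<integral>y. indicator B y * G y \<partial>leb d) * Zh) / (G0 * Zh)"
    using G0_pos Zh_pos by (simp add: field_simps)
  ultimately show ?thesis using G0_pos Zh_pos by (simp add: abs_divide divide_le_eq abs_mult)
qed

theorem tilted_vs_gaussian:
  assumes B [measurable]: "B \<in> sets (leb d)"
  shows "0 < Z" "\<bar>(\<integral>y. indicator B y * w y \<partial>leb d) / Z - (\<integral>y. indicator B y * G y \<partial>leb d) / G0\<bar>
    \<le> 60 * (\<alpha> * sqrt (real d) + \<beta> + err)"
proof -
  show Z: "0 < Z" using Z_bounds(1) Zh_pos by simp
  have iB: "integrable (leb d) (\<lambda>y. indicator B y * f y)" if "integrable (leb d) f" for f :: "point \<Rightarrow> real"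
    using integrable_real_mult_indicator[OF B that] by (simp add: mult.commute)
  let ?W = "\<integral>y. indicator B y * w y \<partial>leb d" and ?H = "\<integral>y. indicator B y * (h y * G y) \<partial>leb d"
  have HW: "?H \<le> ?W"
    using hG_le_w by (intro integral_mono iB w_integrable hG_integrable mult_left_mono) auto
  have "?W - ?H = (\<integral>y. indicator B y * (w y - h y * G y) \<partial>leb d)"
    using iB[OF w_integrable] iB[OF hG_integrable] by (simp add: right_diff_distrib)
  also have "\<dots> \<le> (\<integral>y. w y - h y * G y \<partial>leb d)"
    using hG_le_w by (intro integral_mono iB Bochner_Integration.integrable_diff w_integrable hG_integrable)
      (auto simp: indicator_def)
  also have "\<dots> = Z - Zh" using w_integrable hG_integrable by (simp add: Z_def Zh_def)
  finally have WH: "?W - ?H \<le> Z - Zh" .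
  have H0: "0 \<le> ?H" "?H \<le> Zh"
  proof -
    show "0 \<le> ?H" using h_nonneg by (intro integral_nonneg_AE) auto
    show "?H \<le> Zh" unfolding Zh_def using h_nonneg
      by (intro integral_mono iB hG_integrable) (auto simp: indicator_def)
  qed
  have dz: "Z - Zh \<le> err * Z"
  proof -
    have "z0 * err \<le> Z * err" using z0_le_Zh Z_bounds(1) err_pos by (intro mult_right_mono) auto
    then show ?thesis using Z_bounds(2) by (simp add: mult.commute)
  qed
  have "\<bar>?W / Z - ?H / Zh\<bar> \<le> err"
  proof -
    \<comment> \<open>Both terms of the numerator lie between 0 and \<open>Z - Zh\<close>, so their
      difference is no larger in modulus. Removing the cutoff therefore costs one relative tail
      mass, and not two.\<close>
    have "?W / Z - ?H / Zh = ((?W - ?H) - ?H / Zh * (Z - Zh)) / Z" using Z Zh_pos by (simp add: field_simps)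
    moreover have "0 \<le> ?H / Zh" "?H / Zh \<le> 1" using H0 Zh_pos by (auto simp: field_simps)
    then have "0 \<le> ?H / Zh * (Z - Zh)" "?H / Zh * (Z - Zh) \<le> 1 * (Z - Zh)"
      using Z_bounds(1) mult_right_mono[of "?H / Zh" 1 "Z - Zh"] mult_nonneg_nonneg[of "?H / Zh" "Z - Zh"] by linarith+
    then have "\<bar>(?W - ?H) - p\<bar> \<le> Z - Zh" if "p = ?H / Zh * (Z - Zh)" for p
      unfolding that[symmetric] using HW WH by (simp add: abs_le_iff)
    then have "\<bar>(?W - ?H) - ?H / Zh * (Z - Zh)\<bar> \<le> Z - Zh" by blast
    then have "\<bar>(?W - ?H) - ?H / Zh * (Z - Zh)\<bar> \<le> err * Z" using dz by linarith
    ultimately show ?thesis using Z by (simp add: abs_divide divide_le_eq)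
  qed
  moreover note cut_vs_gaussian[OF B]
  ultimately have "\<bar>?W / Z - (\<integral>y. indicator B y * G y \<partial>leb d) / G0\<bar> \<le> err + 2 * pi * (9 * \<alpha> * sqrt (real d) + \<beta> + err)" by linarith
  also have "\<dots> \<le> 60 * (\<alpha> * sqrt (real d) + \<beta> + err)"
  proof -
    \<comment> \<open>The largest coefficient is \<open>2 * 3.2 * 9 = 57.6\<close>, hence
      60.\<close>
    have pi: "pi < 3.2" using pi_approx by simp
    have "pi * (9 * \<alpha> * sqrt (real d) + \<beta> + err) \<le> 3.2 * (9 * \<alpha> * sqrt (real d) + \<beta> + err)"
      using pi \<alpha> \<beta> err_pos by (intro mult_right_mono) (auto intro!: add_nonneg_nonneg)
    moreover have "0 \<le> \<alpha> * sqrt (real d)" using \<alpha> by simp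
    ultimately show ?thesis using \<beta>(1) err_pos by (simp add: algebra_simps)
  qed
  finally show "\<bar>?W / Z - (\<integral>y. indicator B y * G y \<partial>leb d) / G0\<bar> \<le> 60 * (\<alpha> * sqrt (real d) + \<beta> + err)" .
qed

end

section \<open>Concentration of the score\<close>

context expfam
begin

lemma Theta_convex:
  assumes "x \<in> Theta d \<mu>" "y \<in> Theta d \<mu>" "0 \<le> t" "t \<le> 1"
  shows "lc d (1 - t) x t y \<in> Theta d \<mu>"
proof -
  have "(\<integral>\<^sup>+z. ennreal (exp (dot d (lc d (1 - t) x t y) z)) \<partial>\<mu>) \<le>
    (\<integral>\<^sup>+z. ennreal (exp (dot d x z)) + ennreal (exp (dot d y z)) \<partial>\<mu>)"
  proof (rule nn_integral_mono)
    fix z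
    have "exp (dot d (lc d (1 - t) x t y) z) \<le> exp (max (dot d x z) (dot d y z))"
    proof -
      have "(1 - t) * dot d x z \<le> (1 - t) * max (dot d x z) (dot d y z)" "t * dot d y z \<le> t * max (dot d x z) (dot d y z)"
        using assms by (auto intro!: mult_left_mono)
      then show ?thesis by (simp add: dot_lc_left algebra_simps)
    qed
    also have "\<dots> \<le> exp (dot d x z) + exp (dot d y z)" by (auto simp: max_def)
    finally show "ennreal (exp (dot d (lc d (1 - t) x t y) z)) \<le> ennreal (exp (dot d x z)) + ennreal (exp (dot d y z))"
      by (simp add: ennreal_plus[symmetric] ennreal_leI del: ennreal_plus)
  qed
  also have "\<dots> = (\<integral>\<^sup>+z. ennreal (exp (dot d x z)) \<partial>\<mu>) + (\<integral>\<^sup>+z. ennreal (exp (dot d y z)) \<partial>\<mu>)"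
    by (rule nn_integral_add) measurable
  also have "\<dots> < \<infinity>" using assms by (simp add: Theta_def)
  finally show ?thesis by (simp add: Theta_def)
qed

lemma Theta_convex_line:
  assumes "x \<in> Theta d \<mu>" "lc d 1 x 1 u \<in> Theta d \<mu>" "0 \<le> t" "t \<le> 1"
  shows "lc d 1 x t u \<in> Theta d \<mu>"
proof -
  have "lc d 1 x t u = lc d (1 - t) x t (lc d 1 x 1 u)" by (rule lc_cong) (simp add: algebra_simps)
  then show ?thesis using Theta_convex[OF assms] by simp
qed

lemma Cov_lc_right:
  "\<theta> \<in> Theta d \<mu> \<Longrightarrow> Cov \<theta> w (lc d b u c v) = b * Cov \<theta> w u + c * Cov \<theta> w v"
  unfolding Cov_commute[of \<theta> w] by (rule Cov_lc_left)

lemma Cov_nonneg: "0 \<le> Cov \<theta> u u"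
  unfolding Cov_def E_fam_def by (intro integral_nonneg_AE AE_I2) auto

end

text \<open>Since \<open>a\<close> is the information of the whole sample, \<open>N\<close> is
  \<open>sqrt n\<close> times the norm of the information at \<theta>s, and \<open>Ustar\<close> at
  \<open>2 * s\<close> becomes the ball of radius \<open>2 * s * sqrt d\<close>. Assumption
  \<open>H\<close> says that the information changes by a relative amount of at most \<kappa> per
  unit of distance.\<close>

locale near_gaussian = expfam d \<mu> + quad d a
  for d \<mu> a +
  fixes n :: nat and \<theta>s :: point and s \<kappa> :: real
  assumes a_eq: "a = (\<lambda>i j. real n * fm \<theta>s i j)" and n1: "1 \<le> n" and \<theta>s: "\<theta>s \<in> Theta d \<mu>"
    and s12: "12 \<le> s" and \<kappa>: "0 \<le> \<kappa>" "\<kappa> * (s * sqrt (real d)) \<le> 1 / 5"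
    and U: "\<And>h. h \<in> Rd d \<Longrightarrow> N h \<le> 2 * (s * sqrt (real d)) \<Longrightarrow> lc d 1 \<theta>s 1 h \<in> Theta d \<mu>"
    and H: "\<And>h u. h \<in> Rd d \<Longrightarrow> N h \<le> 2 * (s * sqrt (real d)) \<Longrightarrow> u \<in> Rd d \<Longrightarrow>
        \<bar>real n * Cov (lc d 1 \<theta>s 1 h) u u - (N u)\<^sup>2\<bar> \<le> \<kappa> * N h * (N u)\<^sup>2"
begin

definition R :: real where "R = s * sqrt (real d)"

lemma R_pos: "0 < R" "12 \<le> R" "R\<^sup>2 = s\<^sup>2 * real d"
proof -
  have "12 * 1 \<le> R" unfolding R_def using s12 d1 by (intro mult_mono) auto
  then show "12 \<le> R" "0 < R" by auto
  show "R\<^sup>2 = s\<^sup>2 * real d" by (simp add: R_def power_mult_distrib)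
qed

lemma \<kappa>R: "\<kappa> * R \<le> 1 / 5" using \<kappa> by (simp add: R_def)

lemma \<theta>s_Rd: "\<theta>s \<in> Rd d" using \<theta>s by (rule Theta_Rd)

lemma q_Cov: "qf d a u v = real n * Cov \<theta>s u v"
proof -
  have "qf d a u v = real n * qf d (fm \<theta>s) u v"
    unfolding qf_def a_eq by (simp add: sum_distrib_left mult.assoc)
  then show ?thesis by (simp add: qf_fm[OF \<theta>s])
qed

text \<open>Polarization of \<open>H\<close>. For a symmetric bilinear form bounded on the diagonal
  by the squared norm, the off-diagonal bound holds with the same constant once the two arguments
  are scaled to equal norms.\<close>

lemma Cov_diff_bound:
  assumes h: "h \<in> Rd d" "N h \<le> 2 * R" and uv: "u \<in> Rd d" "v \<in> Rd d"
  shows "\<bar>real n * Cov (lc d 1 \<theta>s 1 h) u v - qf d a u v\<bar> \<le> \<kappa> * N h * (N u * N v)"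
proof -
  let ?\<theta> = "lc d 1 \<theta>s 1 h"
  have \<theta>: "?\<theta> \<in> Theta d \<mu>" using U h by (simp add: R_def)
  define b where "b = (\<lambda>u v. real n * Cov ?\<theta> u v - qf d a u v)"
  have bb: "\<bar>b u u\<bar> \<le> \<kappa> * N h * (N u)\<^sup>2" if "u \<in> Rd d" for u
    using H[OF h(1) _ that] h by (simp add: b_def R_def N_sq)
  have bl: "b (lc d x u y v) (lc d x u y v) = x\<^sup>2 * b u u + 2 * x * y * b u v + y\<^sup>2 * b v v" for x y u v
    unfolding b_def using Cov_commute[of ?\<theta> v u] q_commute[of v u]
    by (simp add: Cov_lc_left[OF \<theta>] Cov_lc_right[OF \<theta>] qf_lc_left qf_lc_right power2_eq_square algebra_simps)
  have key: "2 * t * \<bar>b u v\<bar> \<le> \<kappa> * N h * (t\<^sup>2 * (N u)\<^sup>2 + (N v)\<^sup>2)" if "t > 0" for t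
  proof -
    let ?p = "lc d t u 1 v" and ?q = "lc d t u (-1) v"
    have e: "4 * t * b u v = b ?p ?p - b ?q ?q" by (simp add: bl)
    have "\<bar>b ?p ?p\<bar> + \<bar>b ?q ?q\<bar> \<le> \<kappa> * N h * (N ?p)\<^sup>2 + \<kappa> * N h * (N ?q)\<^sup>2"
      by (intro add_mono bb) auto
    also have "\<dots> = \<kappa> * N h * (2 * (t\<^sup>2 * (N u)\<^sup>2 + (N v)\<^sup>2))" by (simp add: N_lc_sq algebra_simps)
    finally have "\<bar>4 * t * b u v\<bar> \<le> \<kappa> * N h * (2 * (t\<^sup>2 * (N u)\<^sup>2 + (N v)\<^sup>2))" unfolding e by linarith
    then have "2 * (2 * t * \<bar>b u v\<bar>) \<le> 2 * (\<kappa> * N h * (t\<^sup>2 * (N u)\<^sup>2 + (N v)\<^sup>2))"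
      using that by (simp add: abs_mult algebra_simps)
    then show ?thesis by simp
  qed
  have "\<bar>b u v\<bar> \<le> \<kappa> * N h * (N u * N v)"
  proof (cases "u = zero_pt d \<or> v = zero_pt d")
    case True
    then have "b u v = 0"
      using \<theta> by (auto simp: b_def Cov_def cen_def E_dot)
    then show ?thesis using \<kappa> by simp
  next
    case False
    then have pos: "N u > 0" "N v > 0"
      using N_eq_0_iff[OF uv(1)] N_eq_0_iff[OF uv(2)] by (simp_all add: less_le)
    \<comment> \<open>This \<open>t\<close> balances the two squares in \<open>key\<close>.\<close>
    have "2 * (N v / N u) * \<bar>b u v\<bar> \<le> \<kappa> * N h * ((N v / N u)\<^sup>2 * (N u)\<^sup>2 + (N v)\<^sup>2)"
      using pos by (intro key) auto
    also have "\<dots> = 2 * (N v / N u) * (\<kappa> * N h * (N u * N v))"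
      using pos by (simp add: power_divide power2_eq_square)
    finally show ?thesis using pos by (simp only: mult_le_cancel_left_pos divide_pos_pos mult_pos_pos zero_less_numeral)
  qed
  then show ?thesis by (simp add: b_def)
qed

lemma N_segment:
  assumes "N h1 \<le> \<rho>" "N h2 \<le> \<rho>" "0 \<le> t" "t \<le> 1"
  shows "N (lc d (1 - t) h1 t h2) \<le> \<rho>"
proof -
  have "N (lc d (1 - t) h1 t h2) \<le> \<bar>1 - t\<bar> * N h1 + \<bar>t\<bar> * N h2" by (rule N_lc_le)
  also have "\<dots> \<le> (1 - t) * \<rho> + t * \<rho>" using assms by (intro add_mono mult_mono) auto
  finally show ?thesis by (simp add: algebra_simps)
qed

text \<open>The derivative of the mean along a segment is the covariance, so by the mean value
  theorem the mean moves like the linear map of the form, up to the relative error \<kappa> times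
  the radius.\<close>

lemma mean_diff_bound:
  assumes h: "h1 \<in> Rd d" "h2 \<in> Rd d" "N h1 \<le> \<rho>" "N h2 \<le> \<rho>" "\<rho> \<le> 2 * R" and u: "u \<in> Rd d"
  defines "y \<equiv> lc d 1 h2 (-1) h1"
  shows "\<bar>real n * (E (lc d 1 \<theta>s 1 h2) (dot d u) - E (lc d 1 \<theta>s 1 h1) (dot d u)) - qf d a u y\<bar> \<le> \<kappa> * \<rho> * (N u * N y)"
proof -
  let ?p = "\<lambda>t. lc d 1 (lc d 1 \<theta>s 1 h1) t y"
  have p: "?p t = lc d 1 \<theta>s 1 (lc d (1 - t) h1 t h2)" for t
    unfolding y_def by (rule lc_cong) (simp add: algebra_simps)
  have y: "y \<in> Rd d" by (simp add: y_def)
  have pT: "?p t \<in> Theta d \<mu>" if "0 \<le> t" "t \<le> 1" for t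
    unfolding p using N_segment[OF h(3,4) that] h(5) by (intro U) (auto simp: R_def)
  obtain z where z: "0 < z" "z < 1" "E (?p 1) (dot d u) - E (?p 0) (dot d u) = (1 - 0) * Cov (?p z) u y"
    using MVT2[of 0 1 "\<lambda>t. E (?p t) (dot d u)" "\<lambda>t. Cov (?p t) u y"] Cov_DERIV[OF pT] by auto
  have "?p 1 = lc d 1 \<theta>s 1 h2" "?p 0 = lc d 1 \<theta>s 1 h1" using h by (simp_all add: y_def lc_eq_iff)
  then have "real n * (E (lc d 1 \<theta>s 1 h2) (dot d u) - E (lc d 1 \<theta>s 1 h1) (dot d u)) - qf d a u y = real n * Cov (?p z) u y - qf d a u y"
    using z by simp
  moreover have "\<bar>real n * Cov (?p z) u y - qf d a u y\<bar> \<le> \<kappa> * N (lc d (1 - z) h1 z h2) * (N u * N y)"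
    unfolding p using N_segment[OF h(3,4), of z] h(5) z u y by (intro Cov_diff_bound) auto
  moreover have "\<kappa> * N (lc d (1 - z) h1 z h2) * (N u * N y) \<le> \<kappa> * \<rho> * (N u * N y)"
    using N_segment[OF h(3,4), of z] z \<kappa> by (intro mult_right_mono mult_left_mono) auto
  ultimately show ?thesis by linarith
qed

lemma N_ray: "0 \<le> t \<Longrightarrow> N (lc d 1 (zero_pt d) t u) = t * N u"
proof -
  assume "0 \<le> t"
  moreover have "lc d 1 (zero_pt d) t u = lc d t u 0 u" by (rule lc_cong) simp
  ultimately show ?thesis by simp
qed

lemma lc_ray: "lc d 1 \<theta>s 1 (lc d 1 (zero_pt d) t u) = lc d 1 \<theta>s t u"
  by (rule lc_cong) simp

lemma ray_Theta: "u \<in> Rd d \<Longrightarrow> 0 \<le> t \<Longrightarrow> t * N u \<le> 2 * R \<Longrightarrow> lc d 1 \<theta>s t u \<in> Theta d \<mu>"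
  using U[of "lc d 1 (zero_pt d) t u"] by (simp add: N_ray lc_ray R_def)

lemma ray_mean_bound:
  assumes u: "u \<in> Rd d" and t: "0 \<le> t" "t * N u \<le> \<rho>" "\<rho> \<le> 2 * R"
  shows "\<bar>real n * (E (lc d 1 \<theta>s t u) (dot d u) - E \<theta>s (dot d u)) - t * (N u)\<^sup>2\<bar> \<le> \<kappa> * \<rho> * (t * (N u)\<^sup>2)"
proof -
  let ?h = "lc d 1 (zero_pt d) t u"
  have "0 \<le> \<rho>" using t by (meson N_nonneg mult_nonneg_nonneg order_trans)
  then have "\<bar>real n * (E (lc d 1 \<theta>s 1 ?h) (dot d u) - E (lc d 1 \<theta>s 1 (zero_pt d)) (dot d u)) - qf d a u (lc d 1 ?h (-1) (zero_pt d))\<bar>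
      \<le> \<kappa> * \<rho> * (N u * N (lc d 1 ?h (-1) (zero_pt d)))"
    using u t by (intro mean_diff_bound) (auto simp: N_ray)
  moreover have "lc d 1 ?h (-1) (zero_pt d) = ?h" by simp
  moreover have "qf d a u ?h = t * (N u)\<^sup>2" by (simp add: qf_lc_right N_sq)
  ultimately show ?thesis using \<theta>s_Rd t by (simp add: lc_ray N_ray power2_eq_square mult_ac)
qed

text \<open>Up to distance \<open>2 R\<close> the slope is at most \<open>1 + 2 / 5\<close> times
  its Gaussian value; integrating halves this to \<open>7 / 10\<close>.\<close>

lemma psi_upper:
  assumes u: "u \<in> Rd d" "N u \<le> 2 * R"
  shows "real n * (psi d \<mu> (lc d 1 \<theta>s 1 u) - psi d \<mu> \<theta>s - E \<theta>s (dot d u)) \<le> 7 / 10 * (N u)\<^sup>2"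
proof -
  let ?f = "\<lambda>t. 7 / 10 * t\<^sup>2 * (N u)\<^sup>2 - real n * (psi d \<mu> (lc d 1 \<theta>s t u) - t * E \<theta>s (dot d u))"
  have "?f 0 \<le> ?f 1"
  proof (rule DERIV_nonneg_imp_nondecreasing[where f = ?f])
    fix t :: real assume t: "0 \<le> t" "t \<le> 1"
    then have tu: "t * N u \<le> 2 * R" using u(2) mult_right_mono[of t 1 "N u"] by simp
    have T: "lc d 1 \<theta>s t u \<in> Theta d \<mu>" by (rule ray_Theta[OF u(1) t(1) tu])
    have D: "(?f has_real_derivative 7 / 5 * t * (N u)\<^sup>2 - real n * (E (lc d 1 \<theta>s t u) (dot d u) - E \<theta>s (dot d u))) (at t)"
      by (auto intro!: derivative_eq_intros psi_DERIV[OF T])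
    have "\<kappa> * (2 * R) * (t * (N u)\<^sup>2) \<le> 2 / 5 * (t * (N u)\<^sup>2)"
      using \<kappa>R t by (intro mult_right_mono) auto
    then have "0 \<le> 7 / 5 * t * (N u)\<^sup>2 - real n * (E (lc d 1 \<theta>s t u) (dot d u) - E \<theta>s (dot d u))"
      using ray_mean_bound[OF u(1) t(1) tu] by linarith
    with D show "\<exists>z. (?f has_real_derivative z) (at t) \<and> 0 \<le> z" by blast
  qed simp
  then show ?thesis using \<theta>s_Rd by (simp add: algebra_simps)
qed

section \<open>The score and its exponential moments\<close>

abbreviation samp :: "(nat \<Rightarrow> point) measure" where "samp \<equiv> sample d n \<mu> \<theta>s"

text \<open>The score at \<theta>s in direction \<open>u\<close>: minus the directional derivative
  there of \<open>n\<close> times the normalised negative log likelihood.\<close>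

definition W :: "(nat \<Rightarrow> point) \<Rightarrow> point \<Rightarrow> real" where
  "W Y u = (\<Sum>i<n. dot d u (Y i) - E \<theta>s (dot d u))"

lemma W_dot: "W Y u = dot d (\<lambda>j. \<Sum>i<n. Y i j - E \<theta>s (\<lambda>y. y j)) u"
proof -
  have "W Y u = (\<Sum>i<n. \<Sum>j<d. (Y i j - E \<theta>s (\<lambda>y. y j)) * u j)"
    unfolding W_def E_dot[OF \<theta>s] dot_def by (simp add: sum_subtractf algebra_simps)
  also have "\<dots> = (\<Sum>j<d. \<Sum>i<n. (Y i j - E \<theta>s (\<lambda>y. y j)) * u j)" by (rule sum.swap)
  finally show ?thesis by (simp add: dot_def sum_distrib_right)
qed

interpretation Ps: prob_space "P_fam d \<mu> \<theta>s" by (rule prob_space_P_fam[OF \<theta>s])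

interpretation Pp: product_prob_space "\<lambda>_. P_fam d \<mu> \<theta>s" "{..<n}"
  by unfold_locales

lemma sample_prob_space: "prob_space samp"
  unfolding sample_def by (intro prob_space_PiM prob_space_P_fam \<theta>s)

lemma sample_component [measurable]: "i < n \<Longrightarrow> (\<lambda>Y. Y i) \<in> samp \<rightarrow>\<^sub>M leb d"
  unfolding sample_def using measurable_component_singleton[of i "{..<n}" "\<lambda>_. P_fam d \<mu> \<theta>s"]
  by (simp add: measurable_cong_sets[OF refl sets_P_fam])

lemma E_dot_measurable [measurable]:
  assumes [measurable]: "f \<in> M \<rightarrow>\<^sub>M leb d"
  shows "(\<lambda>x. E \<theta>s (dot d (f x))) \<in> borel_measurable M"
proof -
  have [measurable]: "(\<lambda>x. f x i) \<in> borel_measurable M" if "i < d" for i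
    using that measurable_compose[OF _ measurable_leb_component] assms by blast
  show ?thesis unfolding E_dot[OF \<theta>s] by simp
qed

lemma W_measurable [measurable]: "(\<lambda>(Y, u). W Y u) \<in> borel_measurable (samp \<Otimes>\<^sub>M leb d)"
proof -
  have "(\<lambda>p. dot d (snd p) (fst p i) - E \<theta>s (dot d (snd p))) \<in> borel_measurable (samp \<Otimes>\<^sub>M leb d)" if "i < n" for i
  proof -
    have [measurable]: "(\<lambda>p. fst p i) \<in> samp \<Otimes>\<^sub>M leb d \<rightarrow>\<^sub>M leb d"
      using measurable_compose[OF measurable_fst sample_component[OF that]] .
    show ?thesis by measurable
  qed
  then show ?thesis unfolding W_def split_beta by (intro borel_measurable_sum) auto
qed

text \<open>The Laplace transform of an exponential family is a ratio of normalising constants, so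
  the log moment of the sum is \<open>n\<close> times the increment of \<open>psi\<close> bounded in
  \<open>psi_upper\<close>.\<close>

lemma W_mgf:
  assumes u: "u \<in> Rd d" "N u \<le> 2 * R"
  shows "(\<integral>\<^sup>+Y. ennreal (exp (W Y u)) \<partial>samp) \<le> ennreal (exp (7 / 10 * (N u)\<^sup>2))"
proof -
  let ?m = "E \<theta>s (dot d u)"
  have T: "lc d 1 \<theta>s 1 u \<in> Theta d \<mu>" using U u by (simp add: R_def)
  have expm: "(\<lambda>y. ennreal (exp (dot d v y - c))) \<in> borel_measurable (leb d)" for v c
    by (intro measurable_compose[OF _ measurable_ennreal] measurable_compose[OF _ borel_measurable_exp]
        borel_measurable_diff dot_measurable borel_measurable_const)
  have 1: "(\<integral>\<^sup>+y. ennreal (exp (dot d u y - ?m)) \<partial>P_fam d \<mu> \<theta>s) = ennreal (exp (psi d \<mu> (lc d 1 \<theta>s 1 u) - psi d \<mu> \<theta>s - ?m))"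
  proof -
    have "(\<integral>\<^sup>+y. ennreal (exp (dot d u y - ?m)) \<partial>P_fam d \<mu> \<theta>s) =
       (\<integral>\<^sup>+y. ennreal (exp (dot d \<theta>s y - psi d \<mu> \<theta>s)) * ennreal (exp (dot d u y - ?m)) \<partial>\<mu>)"
      unfolding P_fam_def by (rule nn_integral_density) (use expm in \<open>simp_all add: measurable_cong_sets[OF sets_\<mu> refl]\<close>)
    also have "\<dots> = (\<integral>\<^sup>+y. ennreal (exp (- psi d \<mu> \<theta>s - ?m)) * ennreal (exp (dot d (lc d 1 \<theta>s 1 u) y)) \<partial>\<mu>)"
      by (intro nn_integral_cong) (simp add: ennreal_mult[symmetric] exp_add[symmetric] dot_lc_left algebra_simps)
    also have "\<dots> = ennreal (exp (- psi d \<mu> \<theta>s - ?m)) * ennreal (\<integral>y. exp (dot d (lc d 1 \<theta>s 1 u) y) \<partial>\<mu>)"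
    proof -
      have "(\<lambda>y. ennreal (exp (dot d (lc d 1 \<theta>s 1 u) y))) \<in> borel_measurable \<mu>"
        using expm[of "lc d 1 \<theta>s 1 u" 0] by (simp add: measurable_cong_sets[OF sets_\<mu> refl])
      then show ?thesis
        using nn_integral_eq_integral[OF Theta_exp_integrable[OF T]] by (simp add: nn_integral_cmult)
    qed
    also have "(\<integral>y. exp (dot d (lc d 1 \<theta>s 1 u) y) \<partial>\<mu>) = exp (psi d \<mu> (lc d 1 \<theta>s 1 u))"
      by (simp add: exp_psi[OF T] J_def)
    finally show ?thesis by (simp add: ennreal_mult[symmetric] exp_add[symmetric] algebra_simps)
  qed
  have "(\<integral>\<^sup>+Y. ennreal (exp (W Y u)) \<partial>samp) = (\<integral>\<^sup>+Y. (\<Prod>i<n. ennreal (exp (dot d u (Y i) - ?m))) \<partial>samp)"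
    by (simp add: W_def exp_sum prod_ennreal)
  also have "\<dots> = (\<Prod>i<n. (\<integral>\<^sup>+y. ennreal (exp (dot d u y - ?m)) \<partial>P_fam d \<mu> \<theta>s))"
    unfolding sample_def by (rule Pp.product_nn_integral_prod) (use expm in \<open>simp_all add: measurable_cong_sets[OF sets_P_fam refl]\<close>)
  also have "\<dots> = ennreal (exp (real n * (psi d \<mu> (lc d 1 \<theta>s 1 u) - psi d \<mu> \<theta>s - ?m)))"
    unfolding 1 by (simp add: ennreal_power exp_of_nat_mult)
  also have "\<dots> \<le> ennreal (exp (7 / 10 * (N u)\<^sup>2))"
    using psi_upper[OF u] by (intro ennreal_leI) simp
  finally show ?thesis .
qed

text \<open>For a score of norm \<open>7/10 R\<close> the exponent \<open>W Y u - 7/10 |u|^2\<close>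
  peaks at length \<open>R / 2\<close>; the further \<open>R / 10\<close> leaves room for a ball of
  directions around the peak.\<close>

definition r6 :: real where "r6 = 6 / 10 * R"

lemma r6_pos: "0 < r6" using R_pos(1) by (simp add: r6_def)

text \<open>Chernoff bound with the exponential moment averaged over all directions at once.\<close>

definition exp_moment_avg :: "(nat \<Rightarrow> point) \<Rightarrow> ennreal" where
  "exp_moment_avg Y = (\<integral>\<^sup>+u. ennreal (exp (W Y u - 7 / 10 * (N u)\<^sup>2)) * indicator {u \<in> Rd d. N u \<le> r6} u \<partial>leb d)"

text \<open>The average has mean at most the volume of the ball of directions, so Markov's
  inequality gives this event the required probability. On it the score bound holds
  deterministically.\<close>

definition good :: "(nat \<Rightarrow> point) set" where
  "good = {Y \<in> space samp. exp_moment_avg Y \<le> ennreal (exp (real d * s\<^sup>2 / 10)) * emeasure (leb d) {u \<in> Rd d. N u \<le> r6}}"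

lemma exp_moment_integrand_measurable:
  "(\<lambda>(Y, u). ennreal (exp (W Y u - 7 / 10 * (N u)\<^sup>2)) * indicator {u \<in> Rd d. N u \<le> r6} u)
    \<in> borel_measurable (samp \<Otimes>\<^sub>M leb d)"
proof -
  have [measurable]: "(\<lambda>p. indicator {u \<in> Rd d. N u \<le> r6} (snd p) :: ennreal) \<in> borel_measurable (samp \<Otimes>\<^sub>M leb d)"
    by measurable
  have [measurable]: "(\<lambda>p. W (fst p) (snd p)) \<in> borel_measurable (samp \<Otimes>\<^sub>M leb d)"
    using W_measurable by (simp add: split_beta)
  show ?thesis unfolding split_beta by measurable
qed

lemma exp_moment_avg_measurable [measurable]: "exp_moment_avg \<in> borel_measurable samp"
  unfolding exp_moment_avg_def using exp_moment_integrand_measurable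
  by (intro sigma_finite_measure.borel_measurable_nn_integral sigma_finite_leb)

lemma good_sets [measurable]: "good \<in> sets samp"
  unfolding good_def by measurable

lemma exp_moment_avg_mean: "(\<integral>\<^sup>+Y. exp_moment_avg Y \<partial>samp) \<le> emeasure (leb d) {u \<in> Rd d. N u \<le> r6}"
proof -
  interpret S: prob_space samp by (rule sample_prob_space)
  interpret P: pair_sigma_finite samp "leb d"
    by (intro pair_sigma_finite.intro) (auto intro: S.sigma_finite_measure_axioms)
  let ?B = "{u \<in> Rd d. N u \<le> r6}"
  have "(\<integral>\<^sup>+Y. exp_moment_avg Y \<partial>samp) = (\<integral>\<^sup>+u. \<integral>\<^sup>+Y. ennreal (exp (W Y u - 7 / 10 * (N u)\<^sup>2)) * indicator ?B u \<partial>samp \<partial>leb d)"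
    unfolding exp_moment_avg_def by (rule P.Fubini'[symmetric]) (rule exp_moment_integrand_measurable)
  also have "\<dots> \<le> (\<integral>\<^sup>+u. indicator ?B u \<partial>leb d)"
  proof (rule nn_integral_mono)
    fix u assume u: "u \<in> space (leb d)"
    show "(\<integral>\<^sup>+Y. ennreal (exp (W Y u - 7 / 10 * (N u)\<^sup>2)) * indicator ?B u \<partial>samp) \<le> indicator ?B u"
    proof (cases "u \<in> ?B")
      case True
      have [measurable]: "(\<lambda>Y. W Y u) \<in> borel_measurable samp"
        using measurable_compose[OF _ W_measurable, of "\<lambda>Y. (Y, u)" samp] u by simp
      have "(\<integral>\<^sup>+Y. ennreal (exp (W Y u - 7 / 10 * (N u)\<^sup>2)) * indicator ?B u \<partial>samp) =
        (\<integral>\<^sup>+Y. ennreal (exp (- (7 / 10 * (N u)\<^sup>2))) * ennreal (exp (W Y u)) \<partial>samp)"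
        using True by (intro nn_integral_cong) (simp add: ennreal_mult[symmetric] exp_add[symmetric])
      also have "\<dots> = ennreal (exp (- (7 / 10 * (N u)\<^sup>2))) * (\<integral>\<^sup>+Y. ennreal (exp (W Y u)) \<partial>samp)"
        by (rule nn_integral_cmult) measurable
      also have "\<dots> \<le> ennreal (exp (- (7 / 10 * (N u)\<^sup>2))) * ennreal (exp (7 / 10 * (N u)\<^sup>2))"
        using True R_pos(1) u by (intro mult_left_mono W_mgf) (auto simp: r6_def)
      also have "\<dots> = 1" by (simp add: ennreal_mult[symmetric] exp_minus)
      finally show ?thesis using True by simp
    qed simp
  qed
  finally show ?thesis by simp
qed

lemma ball_real: "t > 0 \<Longrightarrow> emeasure (leb d) {u \<in> Rd d. N u \<le> t} = ennreal (t ^ d * enn2real vol)"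
  using vol_finite by (simp add: emeasure_ball ennreal_mult less_top)

lemma vol_real_pos: "0 < enn2real vol"
  using vol_finite vol_pos by (auto simp: enn2real_positive_iff less_top)

lemma good_prob: "1 - exp (- (real d * s\<^sup>2 / 10)) \<le> measure samp good"
proof -
  interpret S: prob_space samp by (rule sample_prob_space)
  let ?V = "r6 ^ d * enn2real vol"
  have V: "0 < ?V" "emeasure (leb d) {u \<in> Rd d. N u \<le> r6} = ennreal ?V"
    using r6_pos vol_real_pos ball_real by auto
  let ?x = "exp (real d * s\<^sup>2 / 10) * ?V"
  have x: "?x > 0" using V by simp
  have "emeasure samp {Y \<in> space samp. 1 \<le> ennreal (1 / ?x) * exp_moment_avg Y} \<le> ennreal (1 / ?x) * (\<integral>\<^sup>+Y. exp_moment_avg Y \<partial>samp)"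
  proof -
    have "(\<integral>\<^sup>+Y. exp_moment_avg Y * indicator (space samp) Y \<partial>samp) = (\<integral>\<^sup>+Y. exp_moment_avg Y \<partial>samp)"
      by (intro nn_integral_cong) simp
    moreover have "(\<lambda>Y. exp_moment_avg Y * indicator (space samp) Y) \<in> borel_measurable samp" by measurable
    ultimately show ?thesis
      using nn_integral_Markov_inequality[of exp_moment_avg "space samp" samp "ennreal (1 / ?x)"] by simp
  qed
  also have "\<dots> \<le> ennreal (1 / ?x) * ennreal ?V"
    using exp_moment_avg_mean V by (intro mult_left_mono) auto
  also have "\<dots> = ennreal (exp (- (real d * s\<^sup>2 / 10)))"
  proof -
    have "1 / (e * V) * V = inverse e" if "V > 0" for e V :: real
      using that by (simp add: field_simps)
    then have "1 / ?x * ?V = exp (- (real d * s\<^sup>2 / 10))" using V(1) by (simp only: exp_minus)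
    then show ?thesis using x V(1) by (subst ennreal_mult[symmetric]) auto
  qed
  finally have 1: "emeasure samp {Y \<in> space samp. 1 \<le> ennreal (1 / ?x) * exp_moment_avg Y} \<le> ennreal (exp (- (real d * s\<^sup>2 / 10)))" .
  have sub: "space samp - good \<subseteq> {Y \<in> space samp. 1 \<le> ennreal (1 / ?x) * exp_moment_avg Y}"
  proof
    fix Y assume "Y \<in> space samp - good"
    then have Y: "Y \<in> space samp" "ennreal ?x < exp_moment_avg Y"
      using V(1) by (auto simp: good_def V(2) not_le ennreal_mult)
    have "1 = ennreal (1 / x) * ennreal x" if "x > 0" for x :: real
      using that by (simp add: ennreal_mult[symmetric])
    then have "1 = ennreal (1 / ?x) * ennreal ?x" using x by blast
    also have "\<dots> \<le> ennreal (1 / ?x) * exp_moment_avg Y" using Y by (intro mult_left_mono) auto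
    finally show "Y \<in> {Y \<in> space samp. 1 \<le> ennreal (1 / ?x) * exp_moment_avg Y}" using Y by simp
  qed
  have "emeasure samp (space samp - good) \<le> ennreal (exp (- (real d * s\<^sup>2 / 10)))"
    by (rule order_trans[OF emeasure_mono[OF sub] 1]) measurable
  then have "measure samp (space samp - good) \<le> exp (- (real d * s\<^sup>2 / 10))"
    by (simp add: S.emeasure_eq_measure)
  then show ?thesis using S.prob_compl[OF good_sets] by simp
qed

text \<open>If the vector \<open>v\<close> representing the score were longer than
  \<open>7/10 R\<close>, the exponent would be at least \<open>0.168 R^2\<close> on the ball of
  radius \<open>R / 10\<close> around the peak direction \<open>c\<close>. The average would then
  exceed what \<open>good\<close> allows: the volume ratio \<open>6^d\<close> is too small to
  compensate.\<close>

lemma good_W_bound: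
  assumes Y: "Y \<in> good" and u: "u \<in> Rd d"
  shows "W Y u \<le> 7 / 10 * R * N u"
proof -
  obtain v where v: "v \<in> Rd d" "\<And>u. qf d a v u = W Y u"
    using posdef_riesz[OF posdef, of "\<lambda>j. \<Sum>i<n. Y i j - E \<theta>s (\<lambda>y. y j)"] unfolding W_dot by blast
  define r1 where "r1 = R / 10"
  have r1: "0 < r1" "r6 = 6 * r1" "R = 10 * r1" using R_pos(1) by (simp_all add: r1_def r6_def)
  have "N v \<le> 7 / 10 * R"
  proof (rule ccontr)
    assume "\<not> ?thesis"
    then have D: "7 / 10 * R < N v" by simp
    then have Nv: "0 < N v" using R_pos(1) by linarith
    define c where "c = lc d (R / (2 * N v)) v 0 v"
    have Nc: "N c = R / 2" using Nv R_pos(1) by (simp add: c_def)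
    have Wc: "W Y u = 2 * N v / R * qf d a c u" for u
      using Nv R_pos(1) by (simp add: c_def qf_lc_left v(2)[symmetric])
    let ?b = "{w \<in> Rd d. N w \<le> r1}" and ?B = "{u \<in> Rd d. N u \<le> r6}"
    let ?f = "\<lambda>u. ennreal (exp (W Y u - 7 / 10 * (N u)\<^sup>2)) * indicator ?B u"
    have Wm [measurable]: "(\<lambda>u. W Y u) \<in> borel_measurable (leb d)"
      unfolding v(2)[symmetric] by measurable
    \<comment> \<open>The terms linear in \<open>w\<close> cancel between \<open>7/5 q(c, u)\<close>
      and \<open>7/10 |u|^2\<close>, leaving \<open>0.35 - 0.175 - 0.007 = 0.168\<close>.\<close>
    have low: "ennreal (exp (168 / 1000 * R\<^sup>2)) * indicator ?b w \<le> ?f (lc d 1 c 1 w)" if w: "w \<in> Rd d" for w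
    proof (cases "N w \<le> r1")
      case True
      let ?u = "lc d 1 c 1 w"
      have Nu: "N ?u \<le> r6" using N_lc_le[of 1 c 1 w] True Nc by (simp add: r1)
      have qcw: "\<bar>qf d a c w\<bar> \<le> R / 2 * r1"
        by (rule order_trans[OF abs_q_le], unfold Nc, rule mult_left_mono) (use True R_pos(1) in auto)
      have qcu: "qf d a c ?u = R\<^sup>2 / 4 + qf d a c w"
        by (simp add: qf_lc_right N_sq[symmetric] Nc power_divide)
      then have pos: "0 \<le> qf d a c ?u" using qcw by (simp add: power2_eq_square abs_le_iff r1_def)
      have "7 / 5 * qf d a c ?u \<le> 2 * N v / R * qf d a c ?u"
        using D R_pos(1) pos by (intro mult_right_mono) (auto simp: field_simps)
      moreover have "(N ?u)\<^sup>2 = R\<^sup>2 / 4 + 2 * qf d a c w + (N w)\<^sup>2"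
        by (simp add: N_lc_sq Nc power_divide)
      moreover have "(N w)\<^sup>2 \<le> r1\<^sup>2" using True by (intro power_mono) auto
      then have "(N w)\<^sup>2 \<le> R\<^sup>2 / 100" by (simp add: power_divide r1_def)
      ultimately have "168 / 1000 * R\<^sup>2 \<le> W Y ?u - 7 / 10 * (N ?u)\<^sup>2"
        unfolding Wc qcu by (simp add: algebra_simps)
      then show ?thesis using True Nu w by (simp add: ennreal_leI)
    qed simp
    have "ennreal (exp (168 / 1000 * R\<^sup>2)) * emeasure (leb d) ?b = (\<integral>\<^sup>+w. ennreal (exp (168 / 1000 * R\<^sup>2)) * indicator ?b w \<partial>leb d)"
      by (simp add: nn_integral_cmult)
    also have "\<dots> \<le> (\<integral>\<^sup>+w. ?f (lc d 1 c 1 w) \<partial>leb d)" using low by (intro nn_integral_mono) simp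
    also have "\<dots> = exp_moment_avg Y" unfolding exp_moment_avg_def by (rule nn_integral_leb_translate) measurable
    also have "\<dots> \<le> ennreal (exp (real d * s\<^sup>2 / 10)) * emeasure (leb d) ?B" using Y by (simp add: good_def)
    finally have "ennreal (exp (168 / 1000 * R\<^sup>2)) * ennreal (r1 ^ d * enn2real vol) \<le>
      ennreal (exp (real d * s\<^sup>2 / 10)) * ennreal (r6 ^ d * enn2real vol)"
      unfolding ball_real[OF r6_pos] ball_real[OF r1(1)] .
    then have "exp (168 / 1000 * R\<^sup>2) * (r1 ^ d * enn2real vol) \<le> exp (real d * s\<^sup>2 / 10) * (r6 ^ d * enn2real vol)"
      using r1(1) r6_pos by (subst (asm) (1 2) ennreal_mult[symmetric]) (auto simp: ennreal_le_iff)
    also have "\<dots> = (exp (real d * s\<^sup>2 / 10) * 6 ^ d) * (r1 ^ d * enn2real vol)"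
      unfolding r1(2) by (simp only: power_mult_distrib mult.assoc)
    finally have le: "exp (168 / 1000 * R\<^sup>2) \<le> exp (real d * s\<^sup>2 / 10) * 6 ^ d"
      by (rule mult_right_le_imp_le) (use r1(1) vol_real_pos in simp)
    have "(6::real) ^ d \<le> exp 5 ^ d" using exp_ge_add_one_self[of "5::real"] by (intro power_mono) auto
    then have "exp (real d * s\<^sup>2 / 10) * 6 ^ d \<le> exp (real d * s\<^sup>2 / 10) * exp 5 ^ d" by (intro mult_left_mono) auto
    also have "exp (real d * s\<^sup>2 / 10) * exp (5::real) ^ d = exp (real d * s\<^sup>2 / 10 + 5 * real d)"
      by (simp add: exp_add exp_of_nat_mult[symmetric] mult.commute)
    finally have "exp (168 / 1000 * R\<^sup>2) \<le> exp (real d * s\<^sup>2 / 10 + 5 * real d)" using le by linarith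
    then have le: "168 / 1000 * (real d * s\<^sup>2) \<le> real d * s\<^sup>2 / 10 + 5 * real d"
      by (simp add: R_pos(3) mult.commute)
    \<comment> \<open>The excess \<open>0.068 s^2\<close> is at least 9.79 per dimension, against
      the 5 that bounds \<open>ln 6\<close>.\<close>
    have "144 \<le> s\<^sup>2" using power_mono[OF s12, of 2] by simp
    then have "real d * 144 \<le> real d * s\<^sup>2" by (intro mult_left_mono) auto
    moreover have "1 \<le> real d" using d1 by simp
    ultimately show False using le by linarith
  qed
  then have "N v * N u \<le> 7 / 10 * R * N u" by (rule mult_right_mono) simp
  moreover have "W Y u \<le> N v * N u" using abs_q_le[of v u] v(2)[of u] by simp
  ultimately show ?thesis by linarith
qed

end

section \<open>The maximum likelihood estimator\<close>

lemma continuous_on_coord: "continuous_on A (\<lambda>x::point. x i)"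
  by (rule continuous_on_subset[OF continuous_on_product_coordinates]) simp

text \<open>Points are extensional, so the box is a product over all indices whose factors outside
  the dimension are the singleton of \<open>undefined\<close>; Tychonoff's theorem applies.\<close>

lemma compact_box:
  "compact {x \<in> Rd d. \<forall>i<d. \<bar>x i\<bar> \<le> c}"
proof -
  define S where "S = (\<lambda>i. if i < d then {- c..c} else {undefined :: real})"
  have S: "y \<in> S i \<longleftrightarrow> (if i < d then \<bar>y\<bar> \<le> c else y = undefined)" for y i
    unfolding S_def by (simp, linarith)
  have "compact (S i)" for i by (simp add: S_def)
  then have "compactin (product_topology (\<lambda>i. euclidean) UNIV) (PiE UNIV S)"
    unfolding compactin_PiE by simp
  then have "compact (PiE UNIV S)" by (simp add: euclidean_product_topology)
  moreover have "PiE UNIV S = {x \<in> Rd d. \<forall>i<d. \<bar>x i\<bar> \<le> c}"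
  proof (rule Set.set_eqI)
    fix x :: point
    have "x \<in> PiE UNIV S \<longleftrightarrow> (\<forall>i. if i < d then \<bar>x i\<bar> \<le> c else x i = undefined)"
      by (simp add: PiE_iff S)
    also have "\<dots> \<longleftrightarrow> (\<forall>i. \<not> i < d \<longrightarrow> x i = undefined) \<and> (\<forall>i<d. \<bar>x i\<bar> \<le> c)"
      by metis
    also have "(\<forall>i. \<not> i < d \<longrightarrow> x i = undefined) \<longleftrightarrow> x \<in> Rd d"
      by (simp add: Rd_def PiE_iff extensional_def)
    finally show "x \<in> PiE UNIV S \<longleftrightarrow> x \<in> {x \<in> Rd d. \<forall>i<d. \<bar>x i\<bar> \<le> c}" by simp
  qed
  ultimately show ?thesis by simp
qed

context quad
begin

lemma continuous_on_N: "continuous_on A (\<lambda>x. N (lc d 1 x (-1) y))"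
proof -
  have "N (lc d 1 x (-1) y) = sqrt (\<Sum>i<d. \<Sum>j<d. a i j * (x i - y i) * (x j - y j))" for x
    by (simp add: N_def qf_def)
  then show ?thesis by (simp, intro continuous_intros continuous_on_coord)
qed

lemma compact_ball: "compact {x \<in> Rd d. N (lc d 1 x (-1) y) \<le> r}"
proof -
  obtain l where l: "l > 0" "\<And>x. x \<in> Rd d \<Longrightarrow> l * dot d x x \<le> qf d a x x"
    using posdef_coercive[OF posdef] by blast
  define c where "c = r / sqrt l + (\<Sum>i<d. \<bar>y i\<bar>)"
  have "\<bar>x i\<bar> \<le> c" if x: "x \<in> Rd d" "N (lc d 1 x (-1) y) \<le> r" "i < d" for x i
  proof -
    let ?z = "lc d 1 x (-1) y"
    have "(?z i)\<^sup>2 \<le> dot d ?z ?z"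
      unfolding dot_def power2_eq_square using x(3) by (intro member_le_sum[of i "{..<d}" "\<lambda>i. ?z i * ?z i"]) auto
    then have "l * (?z i)\<^sup>2 \<le> l * dot d ?z ?z" using l by (intro mult_left_mono) auto
    also have "\<dots> \<le> (N ?z)\<^sup>2" using l(2)[of ?z] by (simp add: N_sq)
    finally have "(sqrt l * \<bar>?z i\<bar>)\<^sup>2 \<le> (N ?z)\<^sup>2" using l by (simp add: power_mult_distrib)
    then have "sqrt l * \<bar>?z i\<bar> \<le> N ?z" by (rule power2_le_imp_le) simp
    then have "\<bar>?z i\<bar> \<le> r / sqrt l" using x(2) l by (simp add: field_simps)
    moreover have "\<bar>y i\<bar> \<le> (\<Sum>i<d. \<bar>y i\<bar>)" using x(3) by (intro member_le_sum) auto
    ultimately show ?thesis using x(3) by (simp add: c_def)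
  qed
  then have eq: "{x \<in> Rd d. N (lc d 1 x (-1) y) \<le> r} = {x \<in> Rd d. \<forall>i<d. \<bar>x i\<bar> \<le> c} \<inter> {x. N (lc d 1 x (-1) y) \<le> r}"
    by auto
  have "closed {x. N (lc d 1 x (-1) y) \<le> r}"
    by (intro closed_Collect_le continuous_on_N continuous_on_const)
  then show ?thesis unfolding eq by (rule compact_Int_closed[OF compact_box])
qed

end

context near_gaussian
begin

definition F :: "(nat \<Rightarrow> point) \<Rightarrow> point \<Rightarrow> real" where "F Y \<theta> = real n * nll d n \<mu> Y \<theta>"

lemma F_le_iff: "F Y x \<le> F Y y \<longleftrightarrow> nll d n \<mu> Y x \<le> nll d n \<mu> Y y"
  using n1 by (simp add: F_def)

lemma F_DERIV:
  assumes "lc d 1 \<theta> t u \<in> Theta d \<mu>"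
  shows "((\<lambda>t. F Y (lc d 1 \<theta> t u)) has_real_derivative
    real n * (E (lc d 1 \<theta> t u) (dot d u) - E \<theta>s (dot d u)) - W Y u) (at t)"
proof -
  have F: "F Y (lc d 1 \<theta> t u) = real n * psi d \<mu> (lc d 1 \<theta> t u) - (\<Sum>i<n. dot d (Y i) \<theta>) - t * (\<Sum>i<n. dot d (Y i) u)" for t
    using n1 by (simp add: F_def nll_def right_diff_distrib dot_lc_right sum.distrib sum_distrib_left)
  have W: "W Y u = (\<Sum>i<n. dot d (Y i) u) - real n * E \<theta>s (dot d u)"
    by (simp add: W_def sum_subtractf dot_commute[of d u])
  show ?thesis unfolding F W
    by (auto intro!: derivative_eq_intros psi_DERIV[OF assms] simp: algebra_simps)
qed

lemma stationary:
  assumes \<theta>: "\<theta> \<in> Theta d \<mu>" and min: "\<And>y. y \<in> Theta d \<mu> \<Longrightarrow> F Y \<theta> \<le> F Y y"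
  shows "real n * (E \<theta> (dot d u) - E \<theta>s (dot d u)) = W Y u"
proof -
  obtain \<delta> where \<delta>: "\<delta> > 0" "\<And>t. \<bar>t\<bar> < \<delta> \<Longrightarrow> lc d 1 \<theta> t u \<in> Theta d \<mu>"
    using Theta_line[OF \<theta>] by blast
  have 0: "lc d 1 \<theta> 0 u = \<theta>" using Theta_Rd[OF \<theta>] by simp
  have "real n * (E (lc d 1 \<theta> 0 u) (dot d u) - E \<theta>s (dot d u)) - W Y u = 0"
  proof (rule DERIV_local_min[OF _ \<delta>(1)])
    show "((\<lambda>t. F Y (lc d 1 \<theta> t u)) has_real_derivative
      real n * (E (lc d 1 \<theta> 0 u) (dot d u) - E \<theta>s (dot d u)) - W Y u) (at 0)"
      using \<theta> by (intro F_DERIV) (simp add: 0)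
    show "\<forall>y. \<bar>0 - y\<bar> < \<delta> \<longrightarrow> F Y (lc d 1 \<theta> 0 u) \<le> F Y (lc d 1 \<theta> y u)"
      using \<delta>(2) min by (simp add: 0)
  qed
  then show ?thesis by (simp add: 0)
qed

text \<open>Strict convexity: both minimisers solve the same score equation, so the mean value
  theorem produces a point between them with zero variance in the direction joining them.\<close>

lemma minimizer_unique:
  assumes 1: "x \<in> Theta d \<mu>" "\<And>y. y \<in> Theta d \<mu> \<Longrightarrow> F Y x \<le> F Y y"
    and 2: "x' \<in> Theta d \<mu>" "\<And>y. y \<in> Theta d \<mu> \<Longrightarrow> F Y x' \<le> F Y y"
  shows "x = x'"
proof (rule ccontr)
  assume ne: "x \<noteq> x'"
  let ?u = "lc d 1 x' (-1) x"
  have p: "lc d 1 x 0 ?u = x" "lc d 1 x 1 ?u = x'"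
    using Theta_Rd 1 2 by (simp_all add: lc_eq_iff)
  have T: "lc d 1 x t ?u \<in> Theta d \<mu>" if "0 \<le> t" "t \<le> 1" for t
    by (rule Theta_convex_line[OF 1(1) _ that]) (simp only: p 2(1))
  obtain z where z: "0 < z" "z < 1" "E (lc d 1 x 1 ?u) (dot d ?u) - E (lc d 1 x 0 ?u) (dot d ?u) = (1 - 0) * Cov (lc d 1 x z ?u) ?u ?u"
    using MVT2[of 0 1 "\<lambda>t. E (lc d 1 x t ?u) (dot d ?u)" "\<lambda>t. Cov (lc d 1 x t ?u) ?u ?u"] Cov_DERIV[OF T] by auto
  have "real n * (E x (dot d ?u) - E \<theta>s (dot d ?u)) = real n * (E x' (dot d ?u) - E \<theta>s (dot d ?u))"
    using stationary[OF 1] stationary[OF 2] by simp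
  then have "E x (dot d ?u) = E x' (dot d ?u)" using n1 by simp
  then have "Cov (lc d 1 x z ?u) ?u ?u = 0" using z(3) unfolding p by simp
  moreover have "?u \<noteq> zero_pt d"
  proof
    assume u0: "?u = zero_pt d"
    then have "x' = x" using p(2) Theta_Rd[OF 1(1)] by simp
    then show False using ne by simp
  qed
  ultimately show False using Cov_pos[OF T, of z ?u] z by simp
qed

text \<open>At distance \<open>R\<close> the slope is at least \<open>(4/5 - 7/10) R |u|\<close>,
  the gain in the mean minus the score, and by convexity it only grows further out. Pulling a point
  back to the sphere of radius \<open>R\<close> therefore does not increase
  \<open>F\<close>.\<close>

lemma F_line_mono:
  assumes u: "u \<in> Rd d" "lc d 1 \<theta>s 1 u \<in> Theta d \<mu>" and Nu: "R < N u" and Y: "Y \<in> good"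
  shows "F Y (lc d 1 \<theta>s (R / N u) u) \<le> F Y (lc d 1 \<theta>s 1 u)"
proof -
  define t0 where "t0 = R / N u"
  have t0: "0 < t0" "t0 < 1" "t0 * N u = R" using Nu R_pos(1) by (auto simp: t0_def field_simps)
  have T: "lc d 1 \<theta>s t u \<in> Theta d \<mu>" if "0 \<le> t" "t \<le> 1" for t
    by (rule Theta_convex_line[OF \<theta>s u(2) that])
  let ?g = "\<lambda>t. real n * (E (lc d 1 \<theta>s t u) (dot d u) - E \<theta>s (dot d u)) - W Y u"
  have g0: "0 \<le> ?g t0"
  proof -
    have e: "t0 * (N u)\<^sup>2 = R * N u" using t0(3) by (simp add: power2_eq_square)
    have 0: "0 \<le> R * N u" using R_pos(1) by simp
    have "\<kappa> * R * (R * N u) \<le> 1 / 5 * (R * N u)" using \<kappa>R 0 by (rule mult_right_mono)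
    moreover have "W Y u \<le> 7 / 10 * (R * N u)" using good_W_bound[OF Y u(1)] by simp
    moreover have "\<bar>real n * (E (lc d 1 \<theta>s t0 u) (dot d u) - E \<theta>s (dot d u)) - R * N u\<bar> \<le> \<kappa> * R * (R * N u)"
      using ray_mean_bound[OF u(1), of t0 R] t0 R_pos(1) unfolding e by simp
    ultimately show ?thesis using 0 by linarith
  qed
  have g: "?g t0 \<le> ?g t" if "t0 \<le> t" "t \<le> 1" for t
  proof (rule DERIV_nonneg_imp_nondecreasing[OF that(1), where f = ?g])
    fix x assume x: "t0 \<le> x" "x \<le> t"
    have "lc d 1 \<theta>s x u \<in> Theta d \<mu>" using x t0 that by (intro T) auto
    then have "(?g has_real_derivative real n * Cov (lc d 1 \<theta>s x u) u u) (at x)"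
      by (auto intro!: derivative_eq_intros Cov_DERIV)
    then show "\<exists>y. (?g has_real_derivative y) (at x) \<and> 0 \<le> y" using Cov_nonneg by (intro exI conjI) auto
  qed
  have "F Y (lc d 1 \<theta>s t0 u) \<le> F Y (lc d 1 \<theta>s 1 u)"
  proof (rule DERIV_nonneg_imp_nondecreasing[where f = "\<lambda>t. F Y (lc d 1 \<theta>s t u)"])
    fix x assume x: "t0 \<le> x" "x \<le> 1"
    have "lc d 1 \<theta>s x u \<in> Theta d \<mu>" using x t0 by (intro T) auto
    from F_DERIV[OF this] show "\<exists>y. ((\<lambda>t. F Y (lc d 1 \<theta>s t u)) has_real_derivative y) (at x) \<and> 0 \<le> y"
      using g[OF x] g0 by (intro exI conjI) auto
  qed (use t0 in simp)
  then show ?thesis by (simp add: t0_def)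
qed

text \<open>It yields continuity on the ball. The slope is at most \<open>1 + 1/5\<close> from the
  mean plus \<open>7/10\<close> from the score, in units of \<open>R\<close>.\<close>

lemma F_lipschitz:
  assumes h: "h1 \<in> Rd d" "h2 \<in> Rd d" "N h1 \<le> R" "N h2 \<le> R" and Y: "Y \<in> good"
  shows "\<bar>F Y (lc d 1 \<theta>s 1 h2) - F Y (lc d 1 \<theta>s 1 h1)\<bar> \<le> 2 * R * N (lc d 1 h2 (-1) h1)"
proof -
  let ?y = "lc d 1 h2 (-1) h1"
  let ?p = "\<lambda>t. lc d 1 (lc d 1 \<theta>s 1 h1) t ?y"
  have p: "?p t = lc d 1 \<theta>s 1 (lc d (1 - t) h1 t h2)" for t by (rule lc_cong) (simp add: algebra_simps)
  have "?p t \<in> Theta d \<mu>" if "0 \<le> t" "t \<le> 1" for t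
    unfolding p using N_segment[OF h(3,4) that] R_pos(1) by (intro U) (auto simp: R_def)
  then have D: "((\<lambda>t. F Y (?p t)) has_real_derivative real n * (E (?p t) (dot d ?y) - E \<theta>s (dot d ?y)) - W Y ?y) (at t)"
    if "0 \<le> t" "t \<le> 1" for t using F_DERIV that by blast
  have B: "\<bar>real n * (E (?p t) (dot d ?y) - E \<theta>s (dot d ?y)) - W Y ?y\<bar> \<le> 2 * R * N ?y" if t: "0 \<le> t" "t \<le> 1" for t
  proof -
    let ?h = "lc d (1 - t) h1 t h2"
    have Nh: "N ?h \<le> R" by (rule N_segment[OF h(3,4) t])
    have "\<bar>real n * (E (lc d 1 \<theta>s 1 ?h) (dot d ?y) - E (lc d 1 \<theta>s 1 (zero_pt d)) (dot d ?y)) - qf d a ?y (lc d 1 ?h (-1) (zero_pt d))\<bar>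
      \<le> \<kappa> * R * (N ?y * N (lc d 1 ?h (-1) (zero_pt d)))"
      using Nh R_pos(1) by (intro mean_diff_bound) auto
    then have 1: "\<bar>real n * (E (?p t) (dot d ?y) - E \<theta>s (dot d ?y)) - qf d a ?y ?h\<bar> \<le> \<kappa> * R * (N ?y * N ?h)"
      using \<theta>s_Rd by (simp add: p)
    have "\<kappa> * R * (N ?y * N ?h) \<le> 1 / 5 * (N ?y * R)"
      using \<kappa>R Nh R_pos(1) by (intro mult_mono) auto
    moreover have "\<bar>qf d a ?y ?h\<bar> \<le> N ?y * R"
      using abs_q_le[of ?y ?h] Nh mult_left_mono[OF Nh, of "N ?y"] by simp
    moreover have "W Y ?y \<le> 7 / 10 * R * N ?y" by (rule good_W_bound[OF Y]) simp
    moreover have "W Y (lc d (-1) ?y 0 ?y) \<le> 7 / 10 * R * N (lc d (-1) ?y 0 ?y)" by (rule good_W_bound[OF Y]) simp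
    then have "- W Y ?y \<le> 7 / 10 * R * N ?y" unfolding W_dot by (simp add: dot_lc_right)
    moreover have "0 \<le> R * N ?y" using R_pos(1) by simp
    ultimately show ?thesis using 1 by (simp add: abs_le_iff mult.commute)
  qed
  obtain z where z: "0 < z" "z < 1" "F Y (?p 1) - F Y (?p 0) = (1 - 0) * (real n * (E (?p z) (dot d ?y) - E \<theta>s (dot d ?y)) - W Y ?y)"
    using MVT2[of 0 1 "\<lambda>t. F Y (?p t)" "\<lambda>t. real n * (E (?p t) (dot d ?y) - E \<theta>s (dot d ?y)) - W Y ?y"] D by auto
  moreover have "?p 0 = lc d 1 \<theta>s 1 h1" "?p 1 = lc d 1 \<theta>s 1 h2" using h by (simp_all add: lc_eq_iff)
  ultimately show ?thesis using B[of z] by simp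
qed

text \<open>Compactness gives a minimiser on the ball of radius \<open>R\<close> about \<theta>s;
  \<open>F_line_mono\<close> carries its minimality over to the rest of
  \<open>Theta\<close>.\<close>

lemma minimizer_exists:
  assumes Y: "Y \<in> good"
  obtains h where "h \<in> Rd d" "N h \<le> R" "lc d 1 \<theta>s 1 h \<in> Theta d \<mu>"
    "\<And>\<theta>. \<theta> \<in> Theta d \<mu> \<Longrightarrow> F Y (lc d 1 \<theta>s 1 h) \<le> F Y \<theta>"
proof -
  let ?K = "{x \<in> Rd d. N (lc d 1 x (-1) \<theta>s) \<le> R}"
  have bk: "lc d 1 \<theta>s 1 (lc d 1 x (-1) \<theta>s) = x" if "x \<in> Rd d" for x
    using that by (simp add: lc_eq_iff)
  have "continuous_on ?K (F Y)"
    unfolding continuous_on_def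
  proof
    fix x assume x: "x \<in> ?K"
    have "((\<lambda>y. F Y y - F Y x) \<longlongrightarrow> 0) (at x within ?K)"
    proof (rule Lim_null_comparison)
      have "\<bar>F Y y - F Y x\<bar> \<le> 2 * R * N (lc d 1 y (-1) x)" if "y \<in> ?K" for y
      proof -
        have "lc d 1 (lc d 1 y (-1) \<theta>s) (-1) (lc d 1 x (-1) \<theta>s) = lc d 1 y (-1) x" by (rule lc_cong) simp
        then show ?thesis
          using F_lipschitz[of "lc d 1 x (-1) \<theta>s" "lc d 1 y (-1) \<theta>s" Y] x that Y bk by simp
      qed
      then show "eventually (\<lambda>y. norm (F Y y - F Y x) \<le> 2 * R * N (lc d 1 y (-1) x)) (at x within ?K)"
        by (auto simp: eventually_at_filter)
      have "((\<lambda>y. N (lc d 1 y (-1) x)) \<longlongrightarrow> N (lc d 1 x (-1) x)) (at x within ?K)"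
        using continuous_on_N[of ?K x] x unfolding continuous_on_def by blast
      moreover have "lc d 1 x (-1) x = zero_pt d" by (simp add: lc_eq_iff)
      ultimately show "((\<lambda>y. 2 * R * N (lc d 1 y (-1) x)) \<longlongrightarrow> 0) (at x within ?K)"
        using tendsto_mult_left[of _ 0 _ "2 * R"] by fastforce
    qed
    then show "(F Y \<longlongrightarrow> F Y x) (at x within ?K)" by (simp add: LIM_zero_iff)
  qed
  moreover have "compact ?K" by (rule compact_ball)
  moreover have "\<theta>s \<in> ?K"
  proof -
    have "lc d 1 \<theta>s (-1) \<theta>s = zero_pt d" by (simp add: lc_eq_iff)
    then show ?thesis using \<theta>s_Rd R_pos(1) by simp
  qed
  ultimately obtain x where x: "x \<in> ?K" "\<And>y. y \<in> ?K \<Longrightarrow> F Y x \<le> F Y y"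
    using continuous_attains_inf[of ?K "F Y"] by blast
  show ?thesis
  proof (rule that)
    show "lc d 1 x (-1) \<theta>s \<in> Rd d" "N (lc d 1 x (-1) \<theta>s) \<le> R" using x by auto
    then show "lc d 1 \<theta>s 1 (lc d 1 x (-1) \<theta>s) \<in> Theta d \<mu>" using R_pos(1) by (intro U) (auto simp: R_def)
    fix \<theta> assume \<theta>: "\<theta> \<in> Theta d \<mu>"
    have "F Y x \<le> F Y \<theta>"
    proof (cases "\<theta> \<in> ?K")
      case False
      let ?u = "lc d 1 \<theta> (-1) \<theta>s"
      have Nu: "R < N ?u" using False Theta_Rd[OF \<theta>] by auto
      let ?y = "lc d 1 \<theta>s (R / N ?u) ?u"
      have "lc d 1 ?y (-1) \<theta>s = lc d (R / N ?u) ?u 0 ?u" by (rule lc_cong) simp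
      then have "?y \<in> ?K" using Nu R_pos(1) by simp
      then have "F Y x \<le> F Y ?y" by (rule x(2))
      also have "\<dots> \<le> F Y (lc d 1 \<theta>s 1 ?u)"
        using Nu Y \<theta> bk[OF Theta_Rd[OF \<theta>]] by (intro F_line_mono) auto
      finally show ?thesis using bk[OF Theta_Rd[OF \<theta>]] by simp
    qed (use x in blast)
    then show "F Y (lc d 1 \<theta>s 1 (lc d 1 x (-1) \<theta>s)) \<le> F Y \<theta>" using x bk by simp
  qed
qed

lemma MLE_good:
  assumes Y: "Y \<in> good"
  shows "\<exists>h. h \<in> Rd d \<and> N h \<le> R \<and> MLE d n \<mu> Y = lc d 1 \<theta>s 1 h" "MLE_exists_unique d n \<mu> Y"
    "MLE d n \<mu> Y \<in> Theta d \<mu>" "\<And>\<theta>. \<theta> \<in> Theta d \<mu> \<Longrightarrow> F Y (MLE d n \<mu> Y) \<le> F Y \<theta>"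
proof -
  obtain h where h: "h \<in> Rd d" "N h \<le> R" "lc d 1 \<theta>s 1 h \<in> Theta d \<mu>"
    "\<And>\<theta>. \<theta> \<in> Theta d \<mu> \<Longrightarrow> F Y (lc d 1 \<theta>s 1 h) \<le> F Y \<theta>" using minimizer_exists[OF Y] by blast
  have iff: "is_arg_min (nll d n \<mu> Y) (\<lambda>\<theta>. \<theta> \<in> Theta d \<mu>) x \<longleftrightarrow> x \<in> Theta d \<mu> \<and> (\<forall>y\<in>Theta d \<mu>. F Y x \<le> F Y y)" for x
    unfolding F_le_iff is_arg_min_def by (auto simp: not_less)
  have ex1: "\<exists>!x. is_arg_min (nll d n \<mu> Y) (\<lambda>\<theta>. \<theta> \<in> Theta d \<mu>) x"
    unfolding iff using h minimizer_unique by (intro ex1I[of _ "lc d 1 \<theta>s 1 h"]) blast+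
  have eq: "MLE d n \<mu> Y = lc d 1 \<theta>s 1 h"
    unfolding MLE_def arg_min_on_def arg_min_def by (rule some1_equality[OF ex1]) (simp add: iff h)
  show "\<exists>h. h \<in> Rd d \<and> N h \<le> R \<and> MLE d n \<mu> Y = lc d 1 \<theta>s 1 h" using h eq by blast
  show "MLE_exists_unique d n \<mu> Y" unfolding MLE_exists_unique_def by (rule ex1)
  show "MLE d n \<mu> Y \<in> Theta d \<mu>" "\<And>\<theta>. \<theta> \<in> Theta d \<mu> \<Longrightarrow> F Y (MLE d n \<mu> Y) \<le> F Y \<theta>"
    unfolding eq by (rule h)+
qed

end

section \<open>Gradients and the Fisher information along a segment\<close>

lemma vnorm_nonneg [simp]: "0 \<le> vnorm v"
  by (simp add: vnorm_def scalar_prod_def sum_nonneg)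

lemma vnorm_vec: "vnorm (Matrix.vec d x) = sqrt (dot d x x)"
  by (simp add: vnorm_def scalar_prod_def dot_def atLeast0LessThan)

lemma vnorm_diff_vec_line: "vnorm (diff_vec d (lc d 1 x t u) x) = \<bar>t\<bar> * vnorm (Matrix.vec d u)"
proof -
  have "diff_vec d (lc d 1 x t u) x = Matrix.vec d (\<lambda>i. t * u i)"
    by (simp add: diff_vec_def) (intro eq_vecI, auto)
  then have "vnorm (diff_vec d (lc d 1 x t u) x) = sqrt (t\<^sup>2 * dot d u u)"
    by (simp add: vnorm_vec dot_def sum_distrib_left power2_eq_square mult_ac)
  then show ?thesis by (simp add: vnorm_vec real_sqrt_mult)
qed

lemma abs_dot_le_vnorm: "\<bar>\<Sum>i<d. g i * (y i - x i)\<bar> \<le> vnorm (Matrix.vec d g) * vnorm (diff_vec d y x)"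
  using vnorm_cauchy_schwarz[of "Matrix.vec d g" d "diff_vec d y x"]
  by (simp add: diff_vec_def scalar_prod_def atLeast0LessThan)

lemma has_grad_line:
  assumes f: "has_grad d f x g" and x: "x \<in> Rd d"
  shows "((\<lambda>t. f (lc d 1 x t u)) has_real_derivative dot d g u) (at 0)"
  unfolding has_field_derivative_iff
proof (rule LIM_I)
  fix \<epsilon> :: real assume \<epsilon>: "0 < \<epsilon>"
  define c where "c = vnorm (Matrix.vec d u) + 1"
  have c: "c > 0" "vnorm (Matrix.vec d u) < c" by (auto simp: c_def add_nonneg_pos)
  obtain r where r: "r > 0" "\<And>y. y \<in> Rd d \<Longrightarrow> vnorm (diff_vec d y x) < r \<Longrightarrow>
      \<bar>f y - f x - (\<Sum>i<d. g i * (y i - x i))\<bar> \<le> \<epsilon> / c * vnorm (diff_vec d y x)"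
    using f divide_pos_pos[OF \<epsilon> c(1)] unfolding has_grad_def by blast
  show "\<exists>\<delta>>0. \<forall>t. t \<noteq> 0 \<and> norm (t - 0) < \<delta> \<longrightarrow>
      norm ((f (lc d 1 x t u) - f (lc d 1 x 0 u)) / (t - 0) - dot d g u) < \<epsilon>"
  proof (intro exI[of _ "r / c"] conjI allI impI)
    show "0 < r / c" using r c by simp
    fix t :: real assume t: "t \<noteq> 0 \<and> norm (t - 0) < r / c"
    have vn: "vnorm (diff_vec d (lc d 1 x t u) x) = \<bar>t\<bar> * vnorm (Matrix.vec d u)" by (rule vnorm_diff_vec_line)
    have "\<bar>t\<bar> * vnorm (Matrix.vec d u) \<le> \<bar>t\<bar> * c" using c by (intro mult_left_mono) auto
    also have "\<dots> < r" using t c by (simp add: field_simps)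
    finally have "\<bar>f (lc d 1 x t u) - f x - (\<Sum>i<d. g i * (lc d 1 x t u i - x i))\<bar> \<le> \<epsilon> / c * (\<bar>t\<bar> * vnorm (Matrix.vec d u))"
      using r(2)[of "lc d 1 x t u"] unfolding vn by simp
    moreover have "(\<Sum>i<d. g i * (lc d 1 x t u i - x i)) = t * dot d g u"
      by (simp add: dot_def sum_distrib_left mult_ac)
    ultimately have 1: "\<bar>f (lc d 1 x t u) - f x - t * dot d g u\<bar> \<le> \<epsilon> / c * (\<bar>t\<bar> * vnorm (Matrix.vec d u))" by simp
    have "\<epsilon> / c * (\<bar>t\<bar> * vnorm (Matrix.vec d u)) < \<epsilon> / c * (\<bar>t\<bar> * c)"
      using \<epsilon> c t by (intro mult_strict_left_mono) auto
    with 1 have 2: "\<bar>f (lc d 1 x t u) - f x - t * dot d g u\<bar> < \<epsilon> * \<bar>t\<bar>" using c by simp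
    have "(f (lc d 1 x t u) - f x) / t - dot d g u = (f (lc d 1 x t u) - f x - t * dot d g u) / t"
      using t by (simp add: field_simps)
    then have "\<bar>(f (lc d 1 x t u) - f x) / t - dot d g u\<bar> < \<epsilon>"
      using 2 t by (simp add: abs_divide divide_less_eq)
    then show "norm ((f (lc d 1 x t u) - f (lc d 1 x 0 u)) / (t - 0) - dot d g u) < \<epsilon>" using x by simp
  qed
qed

lemma has_grad_unique:
  assumes "has_grad d f x g" "has_grad d f x g'" "x \<in> Rd d"
  shows "g = g'"
proof (rule Rd_eqI[of _ d])
  show "g \<in> Rd d" "g' \<in> Rd d" using assms by (auto simp: has_grad_def)
  fix i assume "i < d"
  have "dot d g u = dot d g' u" for u
    by (rule DERIV_unique[OF has_grad_line[OF assms(1,3)] has_grad_line[OF assms(2,3)]])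
  from this[of "\<lambda>j. if j = i then 1 else 0"] \<open>i < d\<close> show "g i = g' i"
    by (simp add: dot_def if_distrib [of "\<lambda>z. _ * z"] cong: if_cong)
qed

lemma grad_eq: "has_grad d f x g \<Longrightarrow> x \<in> Rd d \<Longrightarrow> grad d f x = g"
  unfolding grad_def using has_grad_unique by (intro the_equality) auto

lemma has_grad_ln:
  assumes f: "has_grad d f x g" and x: "x \<in> Rd d" and pos: "f x > 0"
  shows "has_grad d (\<lambda>y. ln (f y)) x (lc d (1 / f x) g 0 g)"
  unfolding has_grad_def
proof (intro conjI allI impI)
  fix e :: real assume e: "0 < e"
  define L where "L = vnorm (Matrix.vec d g) + 1"
  have L: "L > 0" by (simp add: L_def add_nonneg_pos)
  \<comment> \<open>Half of the tolerance \<open>e\<close> pays for linearising \<open>ln\<close> at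
    \<open>f x\<close>, the other half, through \<open>e2\<close>, for linearising \<open>f\<close>.
    \<open>L\<close> bounds the growth rate of \<open>f\<close> near \<open>x\<close>.\<close>
  define e1 where "e1 = e / (2 * L)"
  have e1: "e1 > 0" using e L by (simp add: e1_def)
  have "(ln has_derivative (\<lambda>h. h * (1 / f x))) (at (f x))"
    by (rule has_derivative_eq_rhs[OF DERIV_ln_divide[OF pos, unfolded has_field_derivative_def]]) (simp add: fun_eq_iff)
  then obtain \<delta> where \<delta>: "\<delta> > 0" "\<And>b. \<bar>b - f x\<bar> < \<delta> \<Longrightarrow> \<bar>ln b - ln (f x) - (b - f x) / f x\<bar> \<le> e1 * \<bar>b - f x\<bar>"
    unfolding has_derivative_at_alt using e1 by (auto simp: divide_inverse)
  define e2 where "e2 = min 1 (e * f x / 2)"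
  have e2: "e2 > 0" "e2 \<le> 1" "e2 / f x \<le> e / 2" using e pos by (auto simp: e2_def field_simps min_def)
  obtain r where r: "r > 0" "\<And>y. y \<in> Rd d \<Longrightarrow> vnorm (diff_vec d y x) < r \<Longrightarrow>
      \<bar>f y - f x - (\<Sum>i<d. g i * (y i - x i))\<bar> \<le> e2 * vnorm (diff_vec d y x)"
    using f e2(1) unfolding has_grad_def by blast
  show "\<exists>r>0. \<forall>y\<in>Rd d. vnorm (diff_vec d y x) < r \<longrightarrow>
      \<bar>ln (f y) - ln (f x) - (\<Sum>i<d. lc d (1 / f x) g 0 g i * (y i - x i))\<bar> \<le> e * vnorm (diff_vec d y x)"
  proof (intro exI[of _ "min r (\<delta> / L)"] conjI ballI impI)
    show "0 < min r (\<delta> / L)" using r \<delta> L by simp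
    fix y assume y: "y \<in> Rd d" and v: "vnorm (diff_vec d y x) < min r (\<delta> / L)"
    let ?v = "vnorm (diff_vec d y x)" and ?l = "\<Sum>i<d. g i * (y i - x i)"
    have 1: "\<bar>f y - f x - ?l\<bar> \<le> e2 * ?v" using r(2)[OF y] v by simp
    have "\<bar>f y - f x\<bar> \<le> e2 * ?v + vnorm (Matrix.vec d g) * ?v"
      using 1 abs_dot_le_vnorm[where d = d and g = g and y = y and x = x] by linarith
    also have "\<dots> \<le> L * ?v" using mult_right_mono[OF e2(2), of ?v] by (simp add: L_def distrib_right)
    finally have 2: "\<bar>f y - f x\<bar> \<le> L * ?v" .
    moreover have "L * ?v < \<delta>" using v L by (simp add: field_simps)
    ultimately have 3: "\<bar>ln (f y) - ln (f x) - (f y - f x) / f x\<bar> \<le> e1 * \<bar>f y - f x\<bar>" by (intro \<delta>(2)) linarith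
    have 4: "e1 * \<bar>f y - f x\<bar> \<le> e / 2 * ?v"
    proof -
      have "e1 * \<bar>f y - f x\<bar> \<le> e1 * (L * ?v)" using 2 e1 by (intro mult_left_mono) auto
      then show ?thesis using L by (simp add: e1_def)
    qed
    have 5: "\<bar>(f y - f x) / f x - ?l / f x\<bar> \<le> e / 2 * ?v"
    proof -
      have "\<bar>(f y - f x) / f x - ?l / f x\<bar> = \<bar>f y - f x - ?l\<bar> / f x"
        using pos by (simp add: diff_divide_distrib[symmetric] abs_divide)
      also have "\<dots> \<le> e2 * ?v / f x" using 1 pos by (intro divide_right_mono) auto
      also have "\<dots> = e2 / f x * ?v" by simp
      also have "\<dots> \<le> e / 2 * ?v" by (intro mult_right_mono e2) simp
      finally show ?thesis .
    qed
    have "(\<Sum>i<d. lc d (1 / f x) g 0 g i * (y i - x i)) = ?l / f x"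
      by (simp add: sum_divide_distrib)
    then show "\<bar>ln (f y) - ln (f x) - (\<Sum>i<d. lc d (1 / f x) g 0 g i * (y i - x i))\<bar> \<le> e * ?v"
      using 3 4 5 by linarith
  qed
qed simp

context expfam
begin

text \<open>The derivative of the covariance along the segment is a mixed third moment, which
  \<open>T3_mixed_bound\<close> controls by the pure ones.\<close>

lemma Cov_lipschitz:
  assumes \<theta>s: "\<theta>s \<in> Theta d \<mu>" and K: "0 \<le> K"
    and T: "\<And>t. 0 \<le> t \<Longrightarrow> t \<le> 1 \<Longrightarrow> lc d 1 \<theta>s t h \<in> Theta d \<mu>"
    and T3: "\<And>t w. 0 \<le> t \<Longrightarrow> t \<le> 1 \<Longrightarrow> w \<in> Rd d \<Longrightarrow>
      \<bar>T3 (lc d 1 \<theta>s t h) w w w\<bar> \<le> K * sqrt (Cov \<theta>s w w) ^ 3"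
    and hu: "h \<in> Rd d" "u \<in> Rd d"
  shows "\<bar>Cov (lc d 1 \<theta>s 1 h) u u - Cov \<theta>s u u\<bar> \<le> 5 / 3 * K * sqrt (Cov \<theta>s h h) * Cov \<theta>s u u"
proof -
  obtain z where z: "0 < z" "z < 1"
    "Cov (lc d 1 \<theta>s 1 h) u u - Cov (lc d 1 \<theta>s 0 h) u u = (1 - 0) * T3 (lc d 1 \<theta>s z h) h u u"
    using MVT2[of 0 1 "\<lambda>t. Cov (lc d 1 \<theta>s t h) u u" "\<lambda>t. T3 (lc d 1 \<theta>s t h) h u u"] T3_DERIV[OF T] by auto
  have "\<bar>T3 (lc d 1 \<theta>s z h) h u u\<bar> \<le> 5 / 3 * K * sqrt (qf d (fm \<theta>s) h h) * qf d (fm \<theta>s) u u"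
    using z T T3 by (intro T3_mixed_bound posdef_fm \<theta>s K hu) (auto simp: qf_fm[OF \<theta>s])
  then show ?thesis using z Theta_Rd[OF \<theta>s] by (simp add: qf_fm[OF \<theta>s])
qed

end

lemma powr_three_halves: "0 < x \<Longrightarrow> x powr (3 / 2) = sqrt x ^ 3"
proof -
  assume x: "0 < x"
  have "sqrt x ^ 3 = (x powr (1 / 2)) powr (real 3)"
    using x by (subst powr_realpow) (auto simp: powr_half_sqrt)
  also have "\<dots> = x powr (3 / 2)" by (simp add: powr_powr)
  finally show ?thesis by simp
qed

section \<open>The posterior around the maximum likelihood estimator\<close>

context near_gaussian
begin

lemma psi_measurable [measurable]: "psi d \<mu> \<in> borel_measurable (leb d)"
proof -
  have m: "(\<lambda>(\<theta>, y). ennreal (exp (dot d \<theta> y))) \<in> borel_measurable (leb d \<Otimes>\<^sub>M \<mu>)"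
  proof -
    have "(\<lambda>p. ennreal (exp (dot d (fst p) (snd p)))) \<in> borel_measurable (leb d \<Otimes>\<^sub>M leb d)" by measurable
    then show ?thesis by (simp add: split_beta measurable_cong_sets[OF sets_pair_measure_cong[OF refl sets_\<mu>] refl])
  qed
  then have "(\<lambda>\<theta>. \<integral>\<^sup>+y. ennreal (exp (dot d \<theta> y)) \<partial>\<mu>) \<in> borel_measurable (leb d)"
    by (rule sigma_finite_measure.borel_measurable_nn_integral[OF sigma_finite])
  then have "(\<lambda>\<theta>. ln (enn2real (\<integral>\<^sup>+y. ennreal (exp (dot d \<theta> y)) \<partial>\<mu>))) \<in> borel_measurable (leb d)"
    by measurable
  moreover have "psi d \<mu> \<theta> = ln (enn2real (\<integral>\<^sup>+y. ennreal (exp (dot d \<theta> y)) \<partial>\<mu>))" for \<theta>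
  proof -
    have "dot d \<theta> \<in> borel_measurable \<mu>" using dot_measurable measurable_cong_sets[OF sets_\<mu> refl] by blast
    then have "(\<lambda>y. exp (dot d \<theta> y)) \<in> borel_measurable \<mu>" by measurable
    then show ?thesis by (simp add: psi_def integral_eq_nn_integral)
  qed
  ultimately show ?thesis by (simp add: measurable_cong[of "leb d" "psi d \<mu>"])
qed

lemma Theta_measurable [measurable]: "Theta d \<mu> \<in> sets (leb d)"
proof -
  have m: "(\<lambda>(\<theta>, y). ennreal (exp (dot d \<theta> y))) \<in> borel_measurable (leb d \<Otimes>\<^sub>M \<mu>)"
  proof -
    have "(\<lambda>p. ennreal (exp (dot d (fst p) (snd p)))) \<in> borel_measurable (leb d \<Otimes>\<^sub>M leb d)" by measurable
    then show ?thesis by (simp add: split_beta measurable_cong_sets[OF sets_pair_measure_cong[OF refl sets_\<mu>] refl])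
  qed
  then have [measurable]: "(\<lambda>\<theta>. \<integral>\<^sup>+y. ennreal (exp (dot d \<theta> y)) \<partial>\<mu>) \<in> borel_measurable (leb d)"
    by (rule sigma_finite_measure.borel_measurable_nn_integral[OF sigma_finite])
  have "{\<theta> \<in> space (leb d). (\<integral>\<^sup>+y. ennreal (exp (dot d \<theta> y)) \<partial>\<mu>) < \<infinity>} \<in> sets (leb d)" by measurable
  then show ?thesis by (simp add: Theta_def)
qed

lemma F_measurable [measurable]: "F Y \<in> borel_measurable (leb d)"
proof -
  have "dot d (Y i) \<in> borel_measurable (leb d)" for i by (rule dot_measurable)
  then have "(\<lambda>\<theta>. \<Sum>i<n. dot d (Y i) \<theta>) \<in> borel_measurable (leb d)" by measurable
  then show ?thesis unfolding F_def[abs_def] nll_def by measurable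
qed

end

text \<open>One sample from the good event, with the suprema replaced by their pointwise
  consequences: \<beta> stands for \<open>delta01\<close> over \<open>sqrt n\<close>, and
  \<open>m\<close> for \<open>M0\<close>.\<close>

locale bvm_sample = near_gaussian +
  fixes \<pi>0 :: "point \<Rightarrow> real" and \<beta> m :: real and Y :: "nat \<Rightarrow> point"
  assumes prior: "is_prior d \<mu> \<pi>0"
    and \<beta>: "0 \<le> \<beta>" "\<beta> \<le> sqrt (real d) / 6"
    and prior_grad: "\<And>\<theta>. \<theta> \<in> Rd d \<Longrightarrow> N (lc d 1 \<theta> (-1) \<theta>s) \<le> 2 * (s * sqrt (real d)) \<Longrightarrow>
        \<exists>g. has_grad d (\<lambda>\<theta>. ln (\<pi>0 \<theta>)) \<theta> g \<and> (\<forall>u\<in>Rd d. \<bar>dot d g u\<bar> \<le> \<beta> * N u)"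
    and m: "\<And>\<theta>. \<theta> \<in> Theta d \<mu> \<Longrightarrow> \<pi>0 \<theta> \<le> exp (real d * m) * \<pi>0 \<theta>s"
    and Y: "Y \<in> good"
begin

definition hm :: point where
  "hm = (SOME h. h \<in> Rd d \<and> N h \<le> R \<and> MLE d n \<mu> Y = lc d 1 \<theta>s 1 h)"

abbreviation mle :: point where "mle \<equiv> MLE d n \<mu> Y"

lemma hm: "hm \<in> Rd d" "N hm \<le> R" "mle = lc d 1 \<theta>s 1 hm"
proof -
  have "hm \<in> Rd d \<and> N hm \<le> R \<and> MLE d n \<mu> Y = lc d 1 \<theta>s 1 hm"
    unfolding hm_def by (rule someI_ex[OF MLE_good(1)[OF Y]])
  then show "hm \<in> Rd d" "N hm \<le> R" "mle = lc d 1 \<theta>s 1 hm" by simp_all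
qed

lemma mle: "mle \<in> Theta d \<mu>" "\<And>\<theta>. \<theta> \<in> Theta d \<mu> \<Longrightarrow> F Y mle \<le> F Y \<theta>" "mle \<in> Rd d"
  using MLE_good(3,4)[OF Y] Theta_Rd[OF MLE_good(3)[OF Y]] by simp_all

lemma mle_score: "real n * (E mle (dot d u) - E \<theta>s (dot d u)) = W Y u"
  by (rule stationary[OF mle(1,2)])

abbreviation sh :: "point \<Rightarrow> point" where "sh y \<equiv> lc d 1 mle 1 y"

lemma shift_eq: "sh y = lc d 1 \<theta>s 1 (lc d 1 hm 1 y)"
  unfolding hm(3) by (rule lc_cong) simp

lemma N_hm_add: "N y \<le> R \<Longrightarrow> N (lc d 1 hm 1 y) \<le> 2 * R"
  using N_lc_le[of 1 hm 1 y] hm(2) by simp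

lemma shift_Theta: "y \<in> Rd d \<Longrightarrow> N y \<le> R \<Longrightarrow> sh y \<in> Theta d \<mu>"
  unfolding shift_eq using N_hm_add by (intro U) (simp_all add: R_def)

lemma shift_line: "lc d 1 (sh y) t u = sh (lc d 1 y t u)"
  by (rule lc_cong) simp

text \<open>Seen from the estimator, a ball of radius \<open>R\<close> lies within
  \<open>2 R\<close> of \<theta>s, hence the factor 2.\<close>

lemma mean_shift_bound:
  assumes "y \<in> Rd d" "N y \<le> R" "u \<in> Rd d"
  shows "\<bar>real n * (E (sh y) (dot d u) - E mle (dot d u)) - qf d a u y\<bar> \<le> 2 * \<kappa> * R * (N u * N y)"
proof -
  have "lc d 1 (lc d 1 hm 1 y) (-1) hm = y" using assms(1) by (simp add: lc_eq_iff)
  then show ?thesis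
    using mean_diff_bound[of hm "lc d 1 hm 1 y" "2 * R" u] hm N_hm_add[OF assms(2)] assms R_pos(1)
    unfolding shift_eq hm(3)[symmetric] by (simp add: mult_ac)
qed

lemma prior_shift_grad:
  assumes "y \<in> Rd d" "N y \<le> R"
  shows "\<exists>g. has_grad d (\<lambda>\<theta>. ln (\<pi>0 \<theta>)) (sh y) g \<and> (\<forall>u\<in>Rd d. \<bar>dot d g u\<bar> \<le> \<beta> * N u)"
proof (rule prior_grad)
  have "lc d 1 (sh y) (-1) \<theta>s = lc d 1 hm 1 y" unfolding shift_eq by (rule lc_cong) simp
  then show "N (lc d 1 (sh y) (-1) \<theta>s) \<le> 2 * (s * sqrt (real d))" using N_hm_add[OF assms(2)] by (simp add: R_def)
qed simp

definition pg :: "point \<Rightarrow> point" where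
  "pg y = (SOME g. has_grad d (\<lambda>\<theta>. ln (\<pi>0 \<theta>)) (sh y) g \<and> (\<forall>u\<in>Rd d. \<bar>dot d g u\<bar> \<le> \<beta> * N u))"

lemma pg:
  assumes "y \<in> Rd d" "N y \<le> R"
  shows "has_grad d (\<lambda>\<theta>. ln (\<pi>0 \<theta>)) (sh y) (pg y)" "\<And>u. u \<in> Rd d \<Longrightarrow> \<bar>dot d (pg y) u\<bar> \<le> \<beta> * N u"
  using someI_ex[OF prior_shift_grad[OF assms]] unfolding pg_def by blast+

definition \<phi> :: "point \<Rightarrow> real" where
  "\<phi> y = - (F Y (sh y) - F Y mle) + qf d a y y / 2 + (ln (\<pi>0 (sh y)) - ln (\<pi>0 mle))"

definition gg :: "point \<Rightarrow> point" where
  "gg y = (\<lambda>i. - (real n * (E (sh y) (\<lambda>z. z i) - E mle (\<lambda>z. z i))) + (\<Sum>j<d. a j i * y j) + pg y i)"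

lemma dot_gg:
  assumes "y \<in> Rd d" "N y \<le> R"
  shows "dot d (gg y) u = - (real n * (E (sh y) (dot d u) - E mle (dot d u))) + qf d a y u + dot d (pg y) u"
proof -
  have q: "qf d a y u = (\<Sum>i<d. (\<Sum>j<d. a j i * y j) * u i)"
    unfolding qf_def sum_distrib_right by (rule sum.swap)
  have split: "(\<Sum>i<d. (- (c * (e i - f i)) + b i + p i) * u i) =
      - (c * ((\<Sum>i<d. u i * e i) - (\<Sum>i<d. u i * f i))) + (\<Sum>i<d. b i * u i) + (\<Sum>i<d. p i * u i)"
    for c and e f b p :: point
    by (simp add: sum_distrib_left sum_subtractf[symmetric] sum.distrib[symmetric] sum_negf[symmetric] algebra_simps)
  show ?thesis
    unfolding E_dot[OF shift_Theta[OF assms]] E_dot[OF mle(1)] q dot_def gg_def by (rule split)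
qed

lemma \<phi>_deriv:
  assumes y: "y \<in> Rd d" "N y \<le> R" and u: "u \<in> Rd d"
  shows "((\<lambda>t. \<phi> (lc d 1 y t u)) has_real_derivative dot d (gg y) u) (at_within 0 UNIV)"
proof -
  have T: "lc d 1 (sh y) 0 u \<in> Theta d \<mu>" using shift_Theta[OF y] by simp
  have D1: "((\<lambda>t. F Y (sh (lc d 1 y t u))) has_real_derivative real n * (E (sh y) (dot d u) - E mle (dot d u))) (at_within 0 UNIV)"
  proof -
    \<comment> \<open>The random score drops out: at the minimiser it equals the displacement of the
      mean, so only mean differences relative to the estimator remain.\<close>
    have "real n * (E (sh y) (dot d u) - E \<theta>s (dot d u)) - W Y u = real n * (E (sh y) (dot d u) - E mle (dot d u))"
      using mle_score[of u] by (simp add: algebra_simps)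
    moreover have "lc d 1 (sh y) 0 u = sh y" by simp
    ultimately show ?thesis using F_DERIV[OF T, of Y] unfolding shift_line by simp
  qed
  have D2: "((\<lambda>t. ln (\<pi>0 (sh (lc d 1 y t u)))) has_real_derivative dot d (pg y) u) (at_within 0 UNIV)"
    using has_grad_line[OF pg(1)[OF y], of u] unfolding shift_line by simp
  have q: "qf d a (lc d 1 y t u) (lc d 1 y t u) = qf d a y y + 2 * t * qf d a y u + t\<^sup>2 * qf d a u u" for t
    using q_commute[of u y] by (simp add: qf_lc_left qf_lc_right power2_eq_square algebra_simps)
  have D3: "((\<lambda>t. qf d a (lc d 1 y t u) (lc d 1 y t u)) has_real_derivative 2 * qf d a y u) (at_within 0 UNIV)"
    unfolding q by (auto intro!: derivative_eq_intros)
  have "((\<lambda>t. - (F Y (sh (lc d 1 y t u)) - F Y mle) + qf d a (lc d 1 y t u) (lc d 1 y t u) / 2 + (ln (\<pi>0 (sh (lc d 1 y t u))) - ln (\<pi>0 mle)))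
     has_real_derivative - (real n * (E (sh y) (dot d u) - E mle (dot d u)) - 0) + 2 * qf d a y u / 2 + (dot d (pg y) u - 0)) (at_within 0 UNIV)"
    by (intro DERIV_add DERIV_minus DERIV_diff DERIV_cdivide DERIV_const D1 D2 D3)
  then show ?thesis unfolding \<phi>_def dot_gg[OF y] by simp
qed

lemma gg_bound:
  assumes y: "y \<in> Rd d" "N y \<le> R" and u: "u \<in> Rd d"
  shows "\<bar>dot d (gg y) u\<bar> \<le> (2 * \<kappa> * R * N y + \<beta>) * N u"
proof -
  have "\<bar>dot d (gg y) u\<bar> \<le> 2 * \<kappa> * R * (N u * N y) + \<beta> * N u"
    unfolding dot_gg[OF y] using mean_shift_bound[OF y u] pg(2)[OF y u] q_commute[of u y] by linarith
  then show ?thesis by (simp add: algebra_simps)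
qed

lemma prior_pos: "\<theta> \<in> Theta d \<mu> \<Longrightarrow> 0 < \<pi>0 \<theta>"
  using prior by (simp add: is_prior_def)

text \<open>The posterior density at the shifted point divided by its value at the estimator;
  outside \<open>Theta\<close> it is zero.\<close>

definition w :: "point \<Rightarrow> real" where
  "w y = indicator (Theta d \<mu>) (sh y) * (exp (- (F Y (sh y) - F Y mle)) * (\<pi>0 (sh y) / \<pi>0 mle))"

lemma prior_measurable [measurable]: "\<pi>0 \<in> borel_measurable (leb d)"
  using prior by (simp add: is_prior_def)

lemma shift_measurable [measurable]: "sh \<in> leb d \<rightarrow>\<^sub>M leb d"
  by (rule measurable_lc) (use mle(3) in auto)

lemma w_measurable [measurable]: "w \<in> borel_measurable (leb d)"
  unfolding w_def[abs_def] by measurable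

lemma w_nonneg: "0 \<le> w y"
  using prior_pos[of "sh y"] prior_pos[OF mle(1)] by (auto simp: w_def indicator_def)

lemma w_inner:
  assumes "y \<in> Rd d" "N y \<le> R"
  shows "w y = G y * exp (\<phi> y)"
proof -
  have "G y * exp (\<phi> y) = exp (- (F Y (sh y) - F Y mle)) * exp (ln (\<pi>0 (sh y)) - ln (\<pi>0 mle))"
    by (simp add: G_def \<phi>_def exp_add[symmetric])
  also have "exp (ln (\<pi>0 (sh y)) - ln (\<pi>0 mle)) = \<pi>0 (sh y) / \<pi>0 mle"
    using prior_pos[OF shift_Theta[OF assms]] prior_pos[OF mle(1)] by (simp add: exp_diff)
  finally show ?thesis using shift_Theta[OF assms] by (simp add: w_def)
qed

text \<open>Up to radius \<open>R / 2\<close> the slope along the ray is at least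
  \<open>1 - 2/5 = 3/5\<close> of the Gaussian one; afterwards convexity keeps it above its value
  there. Integrating the two pieces leaves at least half of
  \<open>3/5 * (R / 2) * N y\<close>.\<close>

lemma F_growth:
  assumes y: "y \<in> Rd d" "R / 2 \<le> N y" "sh y \<in> Theta d \<mu>"
  shows "3 / 20 * R * N y \<le> F Y (sh y) - F Y mle"
proof -
  define t0 where "t0 = R / 2 / N y"
  have Ny: "0 < N y" using y(2) R_pos(1) by linarith
  have t0: "0 < t0" "t0 \<le> 1" "t0 * N y = R / 2" using y(2) Ny R_pos(1) by (auto simp: t0_def field_simps)
  have T: "lc d 1 mle t y \<in> Theta d \<mu>" if "0 \<le> t" "t \<le> 1" for t
    by (rule Theta_convex_line[OF mle(1) y(3) that])
  let ?f = "\<lambda>t. F Y (lc d 1 mle t y)" and ?g = "\<lambda>t. real n * (E (lc d 1 mle t y) (dot d y) - E mle (dot d y))"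
  have D: "(?f has_real_derivative ?g t) (at_within t UNIV)" if "0 \<le> t" "t \<le> 1" for t
  proof -
    have "real n * (E (lc d 1 mle t y) (dot d y) - E \<theta>s (dot d y)) - W Y y = ?g t"
      using mle_score[of y] by (simp add: algebra_simps)
    then show ?thesis using F_DERIV[OF T[OF that], of Y] by simp
  qed
  have small: "3 / 5 * t * (N y)\<^sup>2 \<le> ?g t" if t: "0 \<le> t" "t \<le> t0" for t
  proof -
    let ?z = "lc d t y 0 y"
    have "t * N y \<le> R / 2" using t t0(3) mult_right_mono[OF t(2), of "N y"] by simp
    then have Nz: "N ?z \<le> R" using t R_pos(1) by simp
    have az: "sh ?z = lc d 1 mle t y" by (rule lc_cong) simp
    have e: "N y * N ?z = t * (N y)\<^sup>2" using t by (simp add: power2_eq_square)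
    have q: "qf d a y ?z = t * (N y)\<^sup>2" by (simp add: qf_lc_right N_sq)
    have "\<bar>?g t - t * (N y)\<^sup>2\<bar> \<le> 2 * \<kappa> * R * (t * (N y)\<^sup>2)"
      using mean_shift_bound[OF _ Nz y(1)] unfolding az e q by simp
    moreover have "2 * \<kappa> * R * (t * (N y)\<^sup>2) \<le> 2 / 5 * (t * (N y)\<^sup>2)"
      using \<kappa>R t by (intro mult_right_mono) auto
    ultimately show ?thesis by linarith
  qed
  have large: "?g t0 \<le> ?g t" if t: "t0 \<le> t" "t \<le> 1" for t
  proof (rule DERIV_nonneg_imp_nondecreasing[OF t(1), where f = ?g])
    fix x assume x: "t0 \<le> x" "x \<le> t"
    have Tx: "lc d 1 mle x y \<in> Theta d \<mu>" using x t0 t by (intro T) simp_all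
    have "(?g has_real_derivative real n * Cov (lc d 1 mle x y) y y) (at_within x UNIV)"
      using DERIV_cmult[OF DERIV_diff[OF Cov_DERIV[OF Tx, of y] DERIV_const[of "E mle (dot d y)"]], of "real n"] by simp
    then show "\<exists>y. (?g has_real_derivative y) (at_within x UNIV) \<and> 0 \<le> y" using Cov_nonneg by (intro exI conjI) auto
  qed
  have 1: "?f 0 - 3 / 10 * 0\<^sup>2 * (N y)\<^sup>2 \<le> ?f t0 - 3 / 10 * t0\<^sup>2 * (N y)\<^sup>2"
  proof (rule DERIV_nonneg_imp_nondecreasing[where f = "\<lambda>t. ?f t - 3 / 10 * t\<^sup>2 * (N y)\<^sup>2"])
    fix t assume t: "0 \<le> t" "t \<le> t0"
    have "((\<lambda>t. 3 / 10 * t\<^sup>2 * (N y)\<^sup>2) has_real_derivative 3 / 5 * t * (N y)\<^sup>2) (at_within t UNIV)"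
      by (auto intro!: derivative_eq_intros)
    then have "((\<lambda>t. ?f t - 3 / 10 * t\<^sup>2 * (N y)\<^sup>2) has_real_derivative ?g t - 3 / 5 * t * (N y)\<^sup>2) (at_within t UNIV)"
      using D[of t] t t0 by (intro DERIV_diff) simp_all
    then show "\<exists>z. ((\<lambda>t. ?f t - 3 / 10 * t\<^sup>2 * (N y)\<^sup>2) has_real_derivative z) (at_within t UNIV) \<and> 0 \<le> z"
      using small[OF t] by (intro exI conjI) auto
  qed (use t0 in simp)
  have 2: "?f t0 - t0 * (3 / 5 * t0 * (N y)\<^sup>2) \<le> ?f 1 - 1 * (3 / 5 * t0 * (N y)\<^sup>2)"
  proof (rule DERIV_nonneg_imp_nondecreasing[where f = "\<lambda>t. ?f t - t * (3 / 5 * t0 * (N y)\<^sup>2)"])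
    fix t assume t: "t0 \<le> t" "t \<le> 1"
    have "((\<lambda>t. t * (3 / 5 * t0 * (N y)\<^sup>2)) has_real_derivative 3 / 5 * t0 * (N y)\<^sup>2) (at_within t UNIV)"
      by (auto intro!: derivative_eq_intros)
    then have "((\<lambda>t. ?f t - t * (3 / 5 * t0 * (N y)\<^sup>2)) has_real_derivative ?g t - 3 / 5 * t0 * (N y)\<^sup>2) (at_within t UNIV)"
      using D[of t] t t0 by (intro DERIV_diff) simp_all
    then show "\<exists>z. ((\<lambda>t. ?f t - t * (3 / 5 * t0 * (N y)\<^sup>2)) has_real_derivative z) (at_within t UNIV) \<and> 0 \<le> z"
      using small[of t0] large[OF t] t0 by (intro exI conjI) auto
  qed (use t0 in simp)
  have "?f 1 - ?f 0 \<ge> 3 / 5 * (t0 * (N y)\<^sup>2) - 3 / 10 * (t0 * (t0 * (N y)\<^sup>2))"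
    using 1 2 by (simp add: power2_eq_square algebra_simps)
  moreover have "t0 * (t0 * (N y)\<^sup>2) \<le> 1 * (t0 * (N y)\<^sup>2)" using t0 by (intro mult_right_mono) auto
  moreover have "t0 * (N y)\<^sup>2 = R / 2 * N y" using t0(3) by (simp add: power2_eq_square)
  ultimately show ?thesis using mle(3) by simp
qed

definition Wc :: real where "Wc = exp (real d * m) * \<pi>0 \<theta>s / \<pi>0 mle"

lemma w_outer:
  assumes "y \<in> Rd d" "R / 2 \<le> N y"
  shows "w y \<le> Wc * exp (- (3 / 20 * R * N y))"
proof (cases "sh y \<in> Theta d \<mu>")
  case True
  have "exp (- (F Y (sh y) - F Y mle)) \<le> exp (- (3 / 20 * R * N y))"
    using F_growth[OF assms True] by simp
  moreover have "\<pi>0 (sh y) / \<pi>0 mle \<le> Wc"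
    unfolding Wc_def using m[OF True] prior_pos[OF mle(1)] by (intro divide_right_mono) auto
  ultimately have "exp (- (F Y (sh y) - F Y mle)) * (\<pi>0 (sh y) / \<pi>0 mle) \<le> exp (- (3 / 20 * R * N y)) * Wc"
    using prior_pos[OF True] prior_pos[OF mle(1)] by (intro mult_mono) auto
  then show ?thesis using True by (simp add: w_def mult.commute)
next
  case False
  then show ?thesis using prior_pos[OF mle(1)] prior_pos[OF \<theta>s] by (simp add: w_def Wc_def)
qed

text \<open>\<open>M0\<close> is normalised at \<theta>s but \<open>w\<close> at the estimator.
  Moving between them costs at most \<beta> times the distance \<open>R\<close>, a term linear in
  \<open>s\<close> which the quadratic gain in the tail absorbs.\<close>

lemma prior_ratio: "ln (\<pi>0 \<theta>s) - ln (\<pi>0 mle) \<le> s * real d / 6"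
proof -
  have G: "\<exists>g. has_grad d (\<lambda>\<theta>. ln (\<pi>0 \<theta>)) (lc d 1 \<theta>s t hm) g \<and> (\<forall>u\<in>Rd d. \<bar>dot d g u\<bar> \<le> \<beta> * N u)"
    if t: "0 \<le> t" "t \<le> 1" for t
  proof (rule prior_grad)
    have "lc d 1 (lc d 1 \<theta>s t hm) (-1) \<theta>s = lc d t hm 0 hm" by (rule lc_cong) simp
    then have "N (lc d 1 (lc d 1 \<theta>s t hm) (-1) \<theta>s) = t * N hm" using t by simp
    also have "\<dots> \<le> 1 * R" using t hm(2) by (intro mult_mono) auto
    also have "\<dots> \<le> 2 * (s * sqrt (real d))" using R_pos(1) by (simp add: R_def)
    finally show "N (lc d 1 (lc d 1 \<theta>s t hm) (-1) \<theta>s) \<le> 2 * (s * sqrt (real d))" .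
  qed simp
  then obtain g where g: "\<And>t. 0 \<le> t \<Longrightarrow> t \<le> 1 \<Longrightarrow> has_grad d (\<lambda>\<theta>. ln (\<pi>0 \<theta>)) (lc d 1 \<theta>s t hm) (g t)"
    "\<And>t u. 0 \<le> t \<Longrightarrow> t \<le> 1 \<Longrightarrow> u \<in> Rd d \<Longrightarrow> \<bar>dot d (g t) u\<bar> \<le> \<beta> * N u" by metis
  have "((\<lambda>t. ln (\<pi>0 (lc d 1 \<theta>s t hm))) has_real_derivative dot d (g t) hm) (at_within t UNIV)"
    if "0 \<le> t" "t \<le> 1" for t
    by (rule DERIV_line_shift[where f = "\<lambda>x. ln (\<pi>0 x)"], rule has_grad_line[OF g(1)[OF that]]) simp
  then obtain z where z: "0 < z" "z < 1"
    "ln (\<pi>0 (lc d 1 \<theta>s 1 hm)) - ln (\<pi>0 (lc d 1 \<theta>s 0 hm)) = (1 - 0) * dot d (g z) hm"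
    using MVT2[of 0 1 "\<lambda>t. ln (\<pi>0 (lc d 1 \<theta>s t hm))" "\<lambda>t. dot d (g t) hm"] by auto
  have "\<bar>dot d (g z) hm\<bar> \<le> \<beta> * N hm" using z hm(1) by (intro g(2)) auto
  also have "\<dots> \<le> sqrt (real d) / 6 * R" using \<beta> hm(2) by (intro mult_mono) auto
  also have "\<dots> = s * real d / 6" by (simp add: R_def)
  finally show ?thesis using z(3) hm(3) \<theta>s_Rd by (simp add: abs_le_iff)
qed

lemma Wc_bounds: "0 \<le> Wc" "Wc \<le> exp (real d * m + s * real d / 6)"
proof -
  have p: "0 < \<pi>0 mle" "0 < \<pi>0 \<theta>s" using prior_pos mle(1) \<theta>s by auto
  then show "0 \<le> Wc" by (simp add: Wc_def)
  have "\<pi>0 \<theta>s / \<pi>0 mle = exp (ln (\<pi>0 \<theta>s) - ln (\<pi>0 mle))" using p by (simp add: exp_diff)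
  also have "\<dots> \<le> exp (s * real d / 6)" using prior_ratio by simp
  finally show "Wc \<le> exp (real d * m + s * real d / 6)"
    by (simp add: Wc_def exp_add mult_left_mono times_divide_eq_right[symmetric] del: times_divide_eq_right)
qed

sublocale tg: tilted_gaussian d a s "2 * \<kappa> * R" \<beta> m Wc \<phi> w gg
proof
  show "0 \<le> 2 * \<kappa> * R" "2 * \<kappa> * R \<le> 2 / 5" using \<kappa> \<kappa>R R_pos(1) by auto
  show "\<phi> (zero_pt d) = 0" using mle(3) by (simp add: \<phi>_def)
qed (use s12 \<beta> \<phi>_deriv gg_bound w_nonneg w_inner w_outer Wc_bounds in \<open>auto simp: R_def[symmetric]\<close>)

section \<open>Transfer to the posterior and its Gaussian approximation\<close>

lemma sh_preimage: "B \<in> sets (leb d) \<Longrightarrow> {y \<in> Rd d. sh y \<in> B} \<in> sets (leb d)"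
  using measurable_sets[OF shift_measurable, of B] by (simp add: vimage_def Int_def conj_commute)

lemma measure_density_shift:
  fixes f :: "point \<Rightarrow> ennreal" and f' :: "point \<Rightarrow> real"
  assumes B: "B \<in> sets (leb d)" and f [measurable]: "f \<in> borel_measurable (leb d)"
    and eq: "\<And>y. y \<in> Rd d \<Longrightarrow> f (sh y) = ennreal (f' y / z)"
    and f': "integrable (leb d) f'" "\<And>y. y \<in> Rd d \<Longrightarrow> 0 \<le> f' y" and z: "0 < z"
  shows "measure (density (leb d) f) B = (\<integral>y. indicator {y \<in> Rd d. sh y \<in> B} y * f' y \<partial>leb d) / z"
proof -
  note [measurable] = B sh_preimage[OF B]
  let ?B = "{y \<in> Rd d. sh y \<in> B}"
  have i: "integrable (leb d) (\<lambda>y. indicator ?B y * f' y)"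
    using integrable_real_mult_indicator[OF sh_preimage[OF B] f'(1)] by (simp add: mult.commute)
  have "emeasure (density (leb d) f) B = (\<integral>\<^sup>+x. f x * indicator B x \<partial>leb d)" by (simp add: emeasure_density)
  also have "\<dots> = (\<integral>\<^sup>+y. f (sh y) * indicator B (sh y) \<partial>leb d)"
    by (rule nn_integral_leb_translate[symmetric]) measurable
  also have "\<dots> = (\<integral>\<^sup>+y. ennreal (indicator ?B y * f' y / z) \<partial>leb d)"
    by (intro nn_integral_cong) (auto simp: eq indicator_def)
  also have "\<dots> = ennreal (\<integral>y. indicator ?B y * f' y / z \<partial>leb d)"
    using f'(2) z i by (intro nn_integral_eq_integral) (auto simp: indicator_def)
  finally have "emeasure (density (leb d) f) B = ennreal ((\<integral>y. indicator ?B y * f' y \<partial>leb d) / z)" by simp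
  moreover have "0 \<le> (\<integral>y. indicator ?B y * f' y \<partial>leb d)"
    using f'(2) by (intro integral_nonneg_AE AE_I2) (auto simp: indicator_def)
  ultimately show ?thesis using z by (simp add: measure_def)
qed

lemma posterior_measure:
  assumes B: "B \<in> sets (leb d)"
  shows "measure (posterior d n \<mu> \<pi>0 Y) B = (\<integral>y. indicator {y \<in> Rd d. sh y \<in> B} y * w y \<partial>leb d) / tg.Z"
proof -
  define w0 where "w0 = (\<lambda>\<theta>. ennreal (indicator (Theta d \<mu>) \<theta> * (exp (- real n * nll d n \<mu> Y \<theta>) * \<pi>0 \<theta>)))"
  define c where "c = exp (- F Y mle) * \<pi>0 mle"
  have c: "c > 0" using prior_pos[OF mle(1)] by (simp add: c_def)
  have Z: "0 < tg.Z" using tg.tilted_vs_gaussian(1)[OF B] .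
  have F: "real n * nll d n \<mu> Y \<theta> = F Y \<theta>" for \<theta> by (simp add: F_def)
  have w0m [measurable]: "w0 \<in> borel_measurable (leb d)"
    unfolding w0_def mult_minus_left F by measurable
  have w0: "w0 (sh y) = ennreal (c * w y)" for y
  proof -
    have "exp (- F Y (sh y)) * \<pi>0 (sh y) = c * (exp (- (F Y (sh y) - F Y mle)) * (\<pi>0 (sh y) / \<pi>0 mle))"
      using prior_pos[OF mle(1)] by (simp add: c_def exp_diff exp_minus field_simps)
    then show ?thesis unfolding w0_def w_def mult_minus_left F
      by (cases "sh y \<in> Theta d \<mu>") simp_all
  qed
  have "(\<integral>\<^sup>+\<theta>. w0 \<theta> \<partial>leb d) = (\<integral>\<^sup>+y. w0 (sh y) \<partial>leb d)"
    by (rule nn_integral_leb_translate[symmetric]) measurable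
  also have "\<dots> = (\<integral>\<^sup>+y. ennreal c * ennreal (w y) \<partial>leb d)"
    using c w_nonneg by (intro nn_integral_cong) (simp add: w0 ennreal_mult)
  also have "\<dots> = ennreal (c * tg.Z)"
    using c Z by (simp add: nn_integral_cmult tg.nn_Z ennreal_mult)
  finally have int: "(\<integral>\<^sup>+\<theta>. w0 \<theta> \<partial>leb d) = ennreal (c * tg.Z)" .
  have "posterior d n \<mu> \<pi>0 Y = density (leb d) (\<lambda>\<theta>. w0 \<theta> / ennreal (c * tg.Z))"
    unfolding posterior_def Let_def w0_def[symmetric] int ..
  moreover have "measure (density (leb d) (\<lambda>\<theta>. w0 \<theta> / ennreal (c * tg.Z))) B =
     (\<integral>y. indicator {y \<in> Rd d. sh y \<in> B} y * w y \<partial>leb d) / tg.Z"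
  proof (rule measure_density_shift[OF B])
    show "w0 (sh y) / ennreal (c * tg.Z) = ennreal (w y / tg.Z)" for y
    proof -
      have "ennreal (c * w y) / ennreal (c * tg.Z) = ennreal (c * w y / (c * tg.Z))"
        using c Z w_nonneg by (intro divide_ennreal) auto
      then show ?thesis using c by (simp add: w0)
    qed
  qed (use tg.w_integrable w_nonneg Z in auto)
  ultimately show ?thesis by simp
qed

text \<open>\<open>gaussian\<close> inverts its covariance argument, which is itself an inverse; the
  two inversions cancel and the determinant becomes its reciprocal, leaving the form
  \<open>a\<close>.\<close>

lemma gamma_star_eq: "gamma_star d n \<mu> \<theta>s Y = density (leb d) (\<lambda>x. ennreal (G (lc d 1 x (-1) mle) / G0))"
proof -
  have A: "smult_mat (real n) (Fmat d \<mu> \<theta>s) = form_mat d a"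
    unfolding Fmat_form a_eq by (intro eq_matI) (auto simp: form_mat_def)
  let ?A = "form_mat d a"
  have det: "0 < det ?A" using gaussian_integral[OF posdef] by simp
  note car = form_mat_carrier(1)[of d a]
  note inv = invertible_matE[OF car less_imp_neq[OF det, symmetric]]
  have ii: "inv_mat (inv_mat ?A) = ?A" by (rule inverse_mat_unique[OF inv(1) car inv(3)])
  have "det ?A * det (inv_mat ?A) = 1" using det_mult[OF car inv(1)] inv(2) by simp
  then have di: "det (inv_mat ?A) = 1 / det ?A" using det by (simp add: field_simps)
  have q: "scalar_prod (diff_vec d x mle) (mult_mat_vec ?A (diff_vec d x mle)) = qf d a (lc d 1 x (-1) mle) (lc d 1 x (-1) mle)" for x
  proof -
    have "diff_vec d x mle = Matrix.vec d (lc d 1 x (-1) mle)" unfolding diff_vec_def by (intro eq_vecI) auto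
    then show ?thesis by (simp add: scalar_prod_form_mat)
  qed
  show ?thesis unfolding gamma_star_def gaussian_def A ii di q by (simp add: G_def G0_def)
qed

lemma gamma_star_measure:
  assumes B: "B \<in> sets (leb d)"
  shows "measure (gamma_star d n \<mu> \<theta>s Y) B = (\<integral>y. indicator {y \<in> Rd d. sh y \<in> B} y * G y \<partial>leb d) / G0"
  unfolding gamma_star_eq
proof (rule measure_density_shift[OF B])
  show "ennreal (G (lc d 1 (sh y) (-1) mle) / G0) = ennreal (G y / G0)" if "y \<in> Rd d" for y
  proof -
    have "lc d 1 (sh y) (-1) mle = y" using that by (simp add: lc_eq_iff)
    then show ?thesis by simp
  qed
  show "(\<lambda>x. ennreal (G (lc d 1 x (-1) mle) / G0)) \<in> borel_measurable (leb d)"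
  proof -
    have [measurable]: "(\<lambda>x. lc d 1 x (-1) mle) \<in> leb d \<rightarrow>\<^sub>M leb d"
      by (rule measurable_lc) (use mle(3) in auto)
    show ?thesis by measurable
  qed
qed (use tg.G_integrable G0_pos in auto)

lemma TV_bound:
  "TV (posterior d n \<mu> \<pi>0 Y) (gamma_star d n \<mu> \<theta>s Y)
    \<le> ereal (60 * (2 * \<kappa> * (s * real d) + \<beta> + exp (real d * (m - (s / 12)\<^sup>2))))"
  unfolding TV_def
proof (rule SUP_least)
  fix B assume "B \<in> sets (posterior d n \<mu> \<pi>0 Y)"
  then have B: "B \<in> sets (leb d)" by (simp add: posterior_def Let_def)
  have "\<bar>measure (posterior d n \<mu> \<pi>0 Y) B - measure (gamma_star d n \<mu> \<theta>s Y) B\<bar> \<le> 60 * (2 * \<kappa> * R * sqrt (real d) + \<beta> + tg.err)"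
    unfolding posterior_measure[OF B] gamma_star_measure[OF B] by (rule tg.tilted_vs_gaussian(2)[OF sh_preimage[OF B]])
  also have "2 * \<kappa> * R * sqrt (real d) = 2 * \<kappa> * (s * real d)" by (simp add: R_def)
  finally show "ereal \<bar>measure (posterior d n \<mu> \<pi>0 Y) B - measure (gamma_star d n \<mu> \<theta>s Y) B\<bar>
    \<le> ereal (60 * (2 * \<kappa> * (s * real d) + \<beta> + exp (real d * (m - (s / 12)\<^sup>2))))"
    unfolding tg.err_def by simp
qed

end

section \<open>The suprema over \<open>Ustar\<close>\<close>

lemma log_concave_sigma_finite:
  assumes "has_log_concave_density d \<mu>"
  shows "sigma_finite_measure \<mu>"
proof -
  obtain f where f: "f \<in> borel_measurable (leb d)" "\<mu> = density (leb d) (\<lambda>x. ennreal (f x))"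
    using assms by (auto simp: has_log_concave_density_def)
  interpret sigma_finite_measure "leb d" by simp
  show ?thesis unfolding f(2) using f(1)
    by (subst sigma_finite_iff_density_finite) auto
qed

lemma (in expfam) T3_scale: "\<theta> \<in> Theta d \<mu> \<Longrightarrow> T3 \<theta> (lc d c w 0 w) (lc d c w 0 w) (lc d c w 0 w) = c ^ 3 * T3 \<theta> w w w"
  by (simp add: T3_def cen_lc E_cmult[symmetric] power3_eq_cube mult_ac)

text \<open>The supremum in \<open>delta3\<close> carries no absolute value; the lower bound comes
  from the direction \<open>- w\<close>, since a third moment is odd.\<close>

lemma (in expfam) delta3_T3_bound:
  assumes \<theta>s: "\<theta>s \<in> Theta d \<mu>" and \<theta>: "\<theta> \<in> Ustar d n \<mu> \<theta>s r" "\<theta> \<in> Theta d \<mu>"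
    and K: "delta3 d n \<mu> \<theta>s r \<le> ereal K" and w: "w \<in> Rd d"
  shows "\<bar>T3 \<theta> w w w\<bar> \<le> K * sqrt (Cov \<theta>s w w) ^ 3"
proof -
  have le: "T3 \<theta> w w w \<le> K * sqrt (Cov \<theta>s w w) ^ 3" if w: "w \<in> Rd d" for w
  proof (cases "w = zero_pt d")
    case True
    then have "cen \<theta> w y = 0" "cen \<theta>s w y = 0" for y using \<theta>(2) \<theta>s by (simp_all add: cen_def E_dot)
    then show ?thesis using \<theta>(2) \<theta>s by (simp add: T3_def Cov_def)
  next
    case False
    have pos: "0 < Cov \<theta>s w w" by (rule Cov_pos[OF \<theta>s w False])
    have "ereal (central_moment d \<mu> \<theta> 3 w / central_moment d \<mu> \<theta>s 2 w powr (3 / 2)) \<le> delta3 d n \<mu> \<theta>s r"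
      unfolding delta3_def using \<theta>(1) w False by (intro SUP_upper2[of "(\<theta>, w)"]) auto
    then have "T3 \<theta> w w w / sqrt (Cov \<theta>s w w) ^ 3 \<le> K"
      using order_trans[OF _ K] unfolding central_moment_3 central_moment_2 powr_three_halves[OF pos] by fastforce
    then show ?thesis using pos by (simp add: divide_le_eq)
  qed
  have "Cov \<theta>s (lc d (-1) w 0 w) (lc d (-1) w 0 w) = Cov \<theta>s w w"
    by (simp add: Cov_lc_left[OF \<theta>s] Cov_lc_right[OF \<theta>s])
  then have "- T3 \<theta> w w w \<le> K * sqrt (Cov \<theta>s w w) ^ 3"
    using le[of "lc d (-1) w 0 w"] unfolding T3_scale[OF \<theta>(2)] by simp
  then show ?thesis using le[OF w] by (simp add: abs_le_iff)
qed

lemma ereal_powr_mono: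
  assumes "0 \<le> x" "x \<le> ereal y" "0 < p"
  shows "ereal_powr x p \<le> ereal (y powr p)"
proof -
  obtain r where r: "x = ereal r" "0 \<le> r" "r \<le> y" using assms by (cases x) auto
  then show ?thesis using assms(3) by (simp add: ereal_powr_def powr_mono2)
qed

lemma opnorm_one_nonneg: "0 \<le> opnorm (1\<^sub>m d)"
proof -
  let ?S = "{v \<in> carrier_vec (dim_col (1\<^sub>m d :: real Matrix.mat)). vnorm v \<le> 1}"
  have "vnorm (mult_mat_vec (1\<^sub>m d) (0\<^sub>v d)) \<le> opnorm (1\<^sub>m d)"
    unfolding opnorm_def
  proof (rule cSUP_upper)
    show "0\<^sub>v d \<in> ?S" by (auto simp: vnorm_def)
    show "bdd_above ((\<lambda>v. vnorm (mult_mat_vec (1\<^sub>m d) v)) ` ?S)"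
      by (rule bdd_aboveI2[of _ _ 1]) auto
  qed
  then show ?thesis using vnorm_nonneg order_trans by blast
qed

text \<open>At \<theta>s the normalised information is the identity. Nonnegativity is the
  precondition under which \<open>ereal_powr\<close> is monotone, so that the bound on
  \<open>delta2\<close> can be inserted in the hypothesis on \<open>C23\<close>.\<close>

lemma (in expfam) delta2_nonneg:
  assumes "\<theta>s \<in> Theta d \<mu>" "0 \<le> r"
  shows "0 \<le> delta2 d n \<mu> \<theta>s r"
proof -
  note i = inv_sqrt_mat_form_mat[OF posdef_fm[OF assms(1)]]
  let ?B = "sqrt_mat (form_mat d (fm \<theta>s))" and ?C = "inv_sqrt_mat (form_mat d (fm \<theta>s))"
  have "?C * form_mat d (fm \<theta>s) * ?C = ?C * (?B * ?B) * ?C" by (simp only: i(5))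
  also have "\<dots> = (?C * ?B) * (?B * ?C)"
    using i(1,2) by (simp add: assoc_mult_mat[of _ d d _ d _ d])
  also have "\<dots> = 1\<^sub>m d" by (simp add: i(3,4))
  finally have eq: "?C * form_mat d (fm \<theta>s) * ?C = 1\<^sub>m d" .
  have "wnorm (Fmat d \<mu> \<theta>s) (diff_vec d \<theta>s \<theta>s) = 0"
    unfolding Fmat_form diff_vec_def wnorm_form_mat[OF posdef_fm[OF assms(1)]] by (simp add: qf_def)
  then have "\<theta>s \<in> Ustar d n \<mu> \<theta>s r" using assms Theta_Rd by (simp add: Ustar_def)
  then have "ereal (opnorm (1\<^sub>m d)) \<le> delta2 d n \<mu> \<theta>s r"
    unfolding delta2_def by (intro SUP_upper2[of \<theta>s]) (simp_all add: Fmat_form eq)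
  then show ?thesis using opnorm_one_nonneg[of d] by (meson ereal_less_eq(5) order_trans)
qed

lemma posdef_scale:
  assumes "posdef d a" "0 < c"
  shows "posdef d (\<lambda>i j. c * a i j)"
proof -
  have "qf d (\<lambda>i j. c * a i j) x x = c * qf d a x x" for x
    by (simp add: qf_def sum_distrib_left mult.assoc)
  then show ?thesis using assms by (auto simp: posdef_def)
qed

context expfam
begin

text \<open>Here the constants meet: \<open>5/3\<close> from polarization times
  \<open>(3/2) powr (3/2) \<le> 15/8\<close> is at most \<open>16/5\<close>, and the smallness
  condition with its factor 16 then gives exactly \<open>1/5\<close> at distance
  \<open>R\<close>.\<close>

lemma near_gaussianI:
  assumes d: "1 \<le> d" and n: "1 \<le> n" and \<theta>s: "\<theta>s \<in> Theta d \<mu>" and s: "12 \<le> s"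
    and sub: "Ustar d n \<mu> \<theta>s (2 * s) \<subseteq> Theta d \<mu>"
    and c: "0 < c" "s * sqrt (real d / real n) \<le> inverse (16 * c)"
    and d3: "delta3 d n \<mu> \<theta>s (2 * s) \<le> ereal (c * (3 / 2) powr (3 / 2))"
  defines "a \<equiv> \<lambda>i j. real n * fm \<theta>s i j"
  shows "near_gaussian d \<mu> a n \<theta>s s (16 / 5 * c / sqrt (real n))"
    and "\<And>\<theta>. \<theta> \<in> Rd d \<Longrightarrow> quad.N d a (lc d 1 \<theta> (-1) \<theta>s) \<le> 2 * (s * sqrt (real d)) \<Longrightarrow> \<theta> \<in> Ustar d n \<mu> \<theta>s (2 * s)"
proof -
  have sn: "0 < sqrt (real n)" using n by simp
  interpret quad d a
    using posdef_scale[OF posdef_fm[OF \<theta>s], of "real n"] n d by unfold_locales (auto simp: a_def)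
  have q: "qf d a u v = real n * Cov \<theta>s u v" for u v
    unfolding a_def qf_fm[OF \<theta>s, symmetric] by (simp add: qf_def sum_distrib_left mult.assoc)
  have N: "N u = sqrt (real n) * sqrt (Cov \<theta>s u u)" for u
    by (simp add: N_def q real_sqrt_mult)
  have Us: "\<theta> \<in> Ustar d n \<mu> \<theta>s (2 * s)" if "\<theta> \<in> Rd d" "N (lc d 1 \<theta> (-1) \<theta>s) \<le> 2 * (s * sqrt (real d))" for \<theta>
  proof -
    let ?h = "lc d 1 \<theta> (-1) \<theta>s"
    have "diff_vec d \<theta> \<theta>s = Matrix.vec d ?h" unfolding diff_vec_def by (intro eq_vecI) auto
    then have "wnorm (Fmat d \<mu> \<theta>s) (diff_vec d \<theta> \<theta>s) = sqrt (Cov \<theta>s ?h ?h)"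
      by (simp only: Fmat_form wnorm_form_mat[OF posdef_fm[OF \<theta>s]] qf_fm[OF \<theta>s])
    moreover have "sqrt (Cov \<theta>s ?h ?h) \<le> 2 * s * sqrt (real d / real n)"
      using that(2) sn unfolding N by (simp add: real_sqrt_divide field_simps)
    ultimately show ?thesis using that(1) by (simp add: Ustar_def)
  qed
  show "\<theta> \<in> Ustar d n \<mu> \<theta>s (2 * s)" if "\<theta> \<in> Rd d" "N (lc d 1 \<theta> (-1) \<theta>s) \<le> 2 * (s * sqrt (real d))" for \<theta>
    using Us that .
  have UsT: "lc d 1 \<theta>s 1 h \<in> Ustar d n \<mu> \<theta>s (2 * s)" "lc d 1 \<theta>s 1 h \<in> Theta d \<mu>"
    if "h \<in> Rd d" "N h \<le> 2 * (s * sqrt (real d))" for h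
  proof -
    have "lc d 1 (lc d 1 \<theta>s 1 h) (-1) \<theta>s = h" using that by (simp add: lc_eq_iff)
    then show "lc d 1 \<theta>s 1 h \<in> Ustar d n \<mu> \<theta>s (2 * s)" using that by (intro Us) auto
    then show "lc d 1 \<theta>s 1 h \<in> Theta d \<mu>" using sub by blast
  qed
  define K where "K = c * (3 / 2) powr (3 / 2)"
  have K: "0 \<le> K" "5 / 3 * K \<le> 16 / 5 * c"
  proof -
    show "0 \<le> K" using c by (simp add: K_def)
    have "sqrt (3 / 2) \<le> (5 / 4 :: real)" by (intro real_le_lsqrt) (auto simp: power2_eq_square)
    moreover have "(3 / 2) powr (3 / 2) = sqrt (3 / 2) * (sqrt (3 / 2) * sqrt (3 / 2) :: real)"
      by (simp add: powr_three_halves power3_eq_cube)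
    ultimately have "(3 / 2) powr (3 / 2) \<le> (15 / 8 :: real)" by simp
    then have "c * (3 / 2) powr (3 / 2) \<le> c * (15 / 8)" using c by (intro mult_left_mono) auto
    then show "5 / 3 * K \<le> 16 / 5 * c" using c by (simp add: K_def)
  qed
  show "near_gaussian d \<mu> a n \<theta>s s (16 / 5 * c / sqrt (real n))"
  proof unfold_locales
    show "0 \<le> 16 / 5 * c / sqrt (real n)" using c sn by simp
    have "s * sqrt (real d) / sqrt (real n) \<le> 1 / (16 * c)"
      using c by (simp add: real_sqrt_divide inverse_eq_divide)
    then have "16 / 5 * c * (s * sqrt (real d) / sqrt (real n)) \<le> 16 / 5 * c * (1 / (16 * c))"
      using c by (intro mult_left_mono) auto
    then show "16 / 5 * c / sqrt (real n) * (s * sqrt (real d)) \<le> 1 / 5" using c by simp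
    fix h assume h: "h \<in> Rd d" "N h \<le> 2 * (s * sqrt (real d))"
    show "lc d 1 \<theta>s 1 h \<in> Theta d \<mu>" by (rule UsT(2)[OF h])
    fix u assume u: "u \<in> Rd d"
    have in_U: "lc d 1 \<theta>s t h \<in> Ustar d n \<mu> \<theta>s (2 * s)" "lc d 1 \<theta>s t h \<in> Theta d \<mu>" if "0 \<le> t" "t \<le> 1" for t
    proof -
      have eq: "lc d 1 \<theta>s 1 (lc d t h 0 h) = lc d 1 \<theta>s t h" by (rule lc_cong) simp
      have "t * N h \<le> 1 * (2 * (s * sqrt (real d)))" using that h(2) by (intro mult_mono) auto
      then have "N (lc d t h 0 h) \<le> 2 * (s * sqrt (real d))" using that by simp
      from UsT[OF lc_in_Rd this]
      show "lc d 1 \<theta>s t h \<in> Ustar d n \<mu> \<theta>s (2 * s)" "lc d 1 \<theta>s t h \<in> Theta d \<mu>" unfolding eq by auto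
    qed
    have A: "\<bar>Cov (lc d 1 \<theta>s 1 h) u u - Cov \<theta>s u u\<bar> \<le> 5 / 3 * K * sqrt (Cov \<theta>s h h) * Cov \<theta>s u u"
    proof (rule Cov_lipschitz[OF \<theta>s K(1) in_U(2) _ h(1) u])
      fix t :: real and w :: point assume t: "0 \<le> t" "t \<le> 1" and w: "w \<in> Rd d"
      show "\<bar>T3 (lc d 1 \<theta>s t h) w w w\<bar> \<le> K * sqrt (Cov \<theta>s w w) ^ 3"
        by (rule delta3_T3_bound[OF \<theta>s in_U[OF t] _ w]) (use d3 in \<open>simp add: K_def\<close>)
    qed
    have B: "5 / 3 * K * sqrt (Cov \<theta>s h h) * Cov \<theta>s u u \<le> 16 / 5 * c * sqrt (Cov \<theta>s h h) * Cov \<theta>s u u"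
      by (intro mult_right_mono K Cov_nonneg real_sqrt_ge_zero \<theta>s h u)
    have "real n * \<bar>Cov (lc d 1 \<theta>s 1 h) u u - Cov \<theta>s u u\<bar> \<le> real n * (16 / 5 * c * sqrt (Cov \<theta>s h h) * Cov \<theta>s u u)"
      by (rule mult_left_mono[OF order_trans[OF A B]]) simp
    then have "\<bar>real n * Cov (lc d 1 \<theta>s 1 h) u u - real n * Cov \<theta>s u u\<bar> \<le> real n * (16 / 5 * c * sqrt (Cov \<theta>s h h) * Cov \<theta>s u u)"
      by (simp add: right_diff_distrib[symmetric] abs_mult)
    moreover have "(N u)\<^sup>2 = real n * Cov \<theta>s u u" by (simp add: N_sq q)
    moreover have "16 / 5 * c / sqrt (real n) * N h = 16 / 5 * c * sqrt (Cov \<theta>s h h)" using sn by (simp add: N)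
    ultimately show "\<bar>real n * Cov (lc d 1 \<theta>s 1 h) u u - (N u)\<^sup>2\<bar> \<le> 16 / 5 * c / sqrt (real n) * N h * (N u)\<^sup>2"
      by (simp only: mult_ac)
  qed (use n \<theta>s s in \<open>auto simp: a_def\<close>)
qed

text \<open>A finite \<open>delta01\<close> selects the branch where the prior is positive and
  continuously differentiable; the chain rule for \<open>ln\<close> then identifies the gradient
  that the supremum measures.\<close>

lemma delta01_gradient:
  assumes \<theta>s: "\<theta>s \<in> Theta d \<mu>" and \<delta>: "delta01 d n \<mu> \<pi>0 \<theta>s r = ereal \<delta>" and \<theta>: "\<theta> \<in> Ustar d n \<mu> \<theta>s r"
  obtains g where "has_grad d (\<lambda>\<theta>. ln (\<pi>0 \<theta>)) \<theta> g" "\<And>u. \<bar>dot d g u\<bar> \<le> \<delta> * sqrt (Cov \<theta>s u u)"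
proof -
  have c: "C1_on d \<pi>0 (Ustar d n \<mu> \<theta>s r)" "0 < \<pi>0 \<theta>"
    using \<delta> \<theta> unfolding delta01_def by (auto split: if_splits)
  obtain g0 where g0: "has_grad d \<pi>0 \<theta> g0" using c(1) \<theta> unfolding C1_on_def by blast
  have R: "\<theta> \<in> Rd d" using \<theta> by (simp add: Ustar_def)
  let ?g = "lc d (1 / \<pi>0 \<theta>) g0 0 g0"
  have g: "has_grad d (\<lambda>\<theta>. ln (\<pi>0 \<theta>)) \<theta> ?g" by (rule has_grad_ln[OF g0 R c(2)])
  have S: "(SUP \<theta> \<in> Ustar d n \<mu> \<theta>s r. ereal (dual_wnorm (Fmat d \<mu> \<theta>s)
      (Matrix.vec d (grad d (\<lambda>\<theta>. ln (\<pi>0 \<theta>)) \<theta>)))) = ereal \<delta>"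
    using \<delta> unfolding delta01_def by (auto split: if_splits)
  have "ereal (dual_wnorm (Fmat d \<mu> \<theta>s) (Matrix.vec d (grad d (\<lambda>\<theta>. ln (\<pi>0 \<theta>)) \<theta>))) \<le> ereal \<delta>"
    unfolding S[symmetric] by (rule SUP_upper[OF \<theta>])
  then have D: "dual_wnorm (form_mat d (fm \<theta>s)) (Matrix.vec d ?g) \<le> \<delta>"
    by (simp add: grad_eq[OF g R] Fmat_form)
  have "\<bar>dot d ?g u\<bar> \<le> \<delta> * sqrt (Cov \<theta>s u u)" for u
  proof -
    have "\<bar>dot d ?g u\<bar> \<le> dual_wnorm (form_mat d (fm \<theta>s)) (Matrix.vec d ?g) * sqrt (qf d (fm \<theta>s) u u)"
      by (rule dual_wnorm_bound[OF posdef_fm[OF \<theta>s]])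
    also have "\<dots> \<le> \<delta> * sqrt (qf d (fm \<theta>s) u u)"
      using D qf_nonneg[OF posdef_fm[OF \<theta>s]] by (intro mult_right_mono) auto
    finally show ?thesis by (simp add: qf_fm[OF \<theta>s])
  qed
  with g show ?thesis by (rule that)
qed

end

lemma delta01_nonneg: "\<theta> \<in> Ustar d n \<mu> \<theta>s r \<Longrightarrow> 0 \<le> delta01 d n \<mu> \<pi>0 \<theta>s r"
  unfolding delta01_def by (auto intro!: SUP_upper2[of \<theta>] simp: dual_wnorm_def)

theorem proposition4p10:
  fixes C23 :: real
  assumes C23: "\<And>d n \<mu> \<theta>s s.
      \<lbrakk>1 \<le> d; 1 \<le> n; regular_minimal_family d \<mu>; has_log_concave_density d \<mu>;
       \<theta>s \<in> Theta d \<mu>; 0 \<le> s; Ustar d n \<mu> \<theta>s s \<subseteq> Theta d \<mu>\<rbrakk>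
      \<Longrightarrow> delta3 d n \<mu> \<theta>s s \<le> ereal C23 * ereal_powr (delta2 d n \<mu> \<theta>s s) (3 / 2)"
  shows "\<exists>C::real. C > 0 \<and>
    (\<forall>(d::nat) (n::nat) (\<mu>::point measure) (\<theta>s::point) (\<pi>0::point \<Rightarrow> real) (s::real).
       1 \<le> d \<and> 1 \<le> n \<and> regular_minimal_family d \<mu> \<and> has_log_concave_density d \<mu>
       \<and> \<theta>s \<in> Theta d \<mu> \<and> is_prior d \<mu> \<pi>0
       \<and> 12 \<le> s
       \<and> delta2 d n \<mu> \<theta>s (2 * s) \<le> ereal (3 / 2)
       \<and> s * sqrt (real d / real n) \<le> inverse (16 * C23)
       \<and> delta01 d n \<mu> \<pi>0 \<theta>s (2 * s) \<le> ereal (sqrt (real n * real d) / 6)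
       \<and> Ustar d n \<mu> \<theta>s (2 * s) \<subseteq> Theta d \<mu>
       \<longrightarrow>
       (\<exists>E \<in> sets (sample d n \<mu> \<theta>s).
          1 - exp (- (real d * s\<^sup>2 / 10)) \<le> measure (sample d n \<mu> \<theta>s) E
          \<and> (\<forall>Y \<in> E. MLE_exists_unique d n \<mu> Y
               \<and> TV (posterior d n \<mu> \<pi>0 Y) (gamma_star d n \<mu> \<theta>s Y)
                   \<le> ereal C *
                      (delta01 d n \<mu> \<pi>0 \<theta>s (2 * s) / ereal (sqrt (real n))
                       + ereal (s * (real d / sqrt (real n)))
                       + ereal_exp (ereal (real d) * (M0 d \<mu> \<pi>0 \<theta>s - ereal ((s / 12)\<^sup>2)))))))"
proof (rule exI[of _ "60 * (1 + 7 * \<bar>C23\<bar>)"], intro conjI allI impI)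
  \<comment> \<open>60 comes from the Gaussian comparison, and 7 bounds \<open>2 * 16 / 5\<close>,
    the constant in \<open>2 * \<kappa> * s * d\<close>. The absolute value makes the witness
    positive before the sign of \<open>C23\<close> is known.\<close>
  let ?C = "60 * (1 + 7 * \<bar>C23\<bar>)"
  show "?C > 0" by simp
  fix d n :: nat and \<mu> :: "point measure" and \<theta>s :: point and \<pi>0 :: "point \<Rightarrow> real" and s :: real
  let ?\<Delta> = "delta01 d n \<mu> \<pi>0 \<theta>s (2 * s)" and ?M = "M0 d \<mu> \<pi>0 \<theta>s"
  assume H: "1 \<le> d \<and> 1 \<le> n \<and> regular_minimal_family d \<mu> \<and> has_log_concave_density d \<mu>
       \<and> \<theta>s \<in> Theta d \<mu> \<and> is_prior d \<mu> \<pi>0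
       \<and> 12 \<le> s
       \<and> delta2 d n \<mu> \<theta>s (2 * s) \<le> ereal (3 / 2)
       \<and> s * sqrt (real d / real n) \<le> inverse (16 * C23)
       \<and> ?\<Delta> \<le> ereal (sqrt (real n * real d) / 6)
       \<and> Ustar d n \<mu> \<theta>s (2 * s) \<subseteq> Theta d \<mu>"
  then have d: "1 \<le> d" and n: "1 \<le> n" and reg: "regular_minimal_family d \<mu>" and lcd: "has_log_concave_density d \<mu>"
    and \<theta>s: "\<theta>s \<in> Theta d \<mu>" and prior: "is_prior d \<mu> \<pi>0" and s: "12 \<le> s"
    and d2: "delta2 d n \<mu> \<theta>s (2 * s) \<le> ereal (3 / 2)"
    and small: "s * sqrt (real d / real n) \<le> inverse (16 * C23)"
    and d01: "?\<Delta> \<le> ereal (sqrt (real n * real d) / 6)" and sub: "Ustar d n \<mu> \<theta>s (2 * s) \<subseteq> Theta d \<mu>"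
    by auto
  have sn: "0 < sqrt (real n)" using n by simp
  have c: "0 < C23" \<comment> \<open>for \<open>C23 = 0\<close> because \<open>inverse 0 = 0\<close>\<close>
  proof -
    have "0 < s * sqrt (real d / real n)" using s d n by simp
    then have "0 < inverse (16 * C23)" using small by linarith
    then show ?thesis by simp
  qed
  interpret expfam d \<mu> by (rule expfam.intro, rule reg, rule log_concave_sigma_finite[OF lcd])
  define a where "a = (\<lambda>i j. real n * fm \<theta>s i j)"
  define \<kappa> where "\<kappa> = 16 / 5 * C23 / sqrt (real n)"
  have d3: "delta3 d n \<mu> \<theta>s (2 * s) \<le> ereal (C23 * (3 / 2) powr (3 / 2))"
  proof -
    have "delta3 d n \<mu> \<theta>s (2 * s) \<le> ereal C23 * ereal_powr (delta2 d n \<mu> \<theta>s (2 * s)) (3 / 2)"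
      using s by (intro C23 d n reg lcd \<theta>s sub) simp
    also have "\<dots> \<le> ereal C23 * ereal ((3 / 2) powr (3 / 2))"
      using c s by (intro ereal_mult_left_mono ereal_powr_mono d2 delta2_nonneg[OF \<theta>s]) auto
    finally show ?thesis by simp
  qed
  interpret near_gaussian d \<mu> a n \<theta>s s \<kappa>
    unfolding a_def \<kappa>_def by (rule near_gaussianI(1)[OF d n \<theta>s s sub c small d3])
  have in_U: "\<theta> \<in> Ustar d n \<mu> \<theta>s (2 * s)" if "\<theta> \<in> Rd d" "N (lc d 1 \<theta> (-1) \<theta>s) \<le> 2 * (s * sqrt (real d))" for \<theta>
    using near_gaussianI(2)[OF d n \<theta>s s sub c small d3 that(1)] that(2) by (simp add: a_def)
  have "\<theta>s \<in> Ustar d n \<mu> \<theta>s (2 * s)"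
  proof (rule in_U[OF \<theta>s_Rd])
    have "lc d 1 \<theta>s (-1) \<theta>s = zero_pt d" by (simp add: lc_eq_iff)
    then show "N (lc d 1 \<theta>s (-1) \<theta>s) \<le> 2 * (s * sqrt (real d))" using s by simp
  qed
  then have "0 \<le> ?\<Delta>" by (rule delta01_nonneg)
  with d01 obtain \<delta> where \<delta>: "?\<Delta> = ereal \<delta>" "0 \<le> \<delta>" "\<delta> \<le> sqrt (real n * real d) / 6"
    by (cases ?\<Delta>) auto
  define \<beta> where "\<beta> = \<delta> / sqrt (real n)"
  show "\<exists>E \<in> sets samp. 1 - exp (- (real d * s\<^sup>2 / 10)) \<le> measure samp E
          \<and> (\<forall>Y \<in> E. MLE_exists_unique d n \<mu> Y
               \<and> TV (posterior d n \<mu> \<pi>0 Y) (gamma_star d n \<mu> \<theta>s Y)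
                   \<le> ereal ?C * (?\<Delta> / ereal (sqrt (real n)) + ereal (s * (real d / sqrt (real n)))
                       + ereal_exp (ereal (real d) * (?M - ereal ((s / 12)\<^sup>2)))))"
  proof (intro bexI[of _ good] conjI ballI good_prob good_sets)
    fix Y assume Y: "Y \<in> good"
    show "MLE_exists_unique d n \<mu> Y" by (rule MLE_good(2)[OF Y])
    let ?S = "SUP \<theta> \<in> Theta d \<mu>. ereal (\<pi>0 \<theta> / \<pi>0 \<theta>s)"
    have \<pi>pos: "0 < \<pi>0 \<theta>" if "\<theta> \<in> Theta d \<mu>" for \<theta> using prior that by (simp add: is_prior_def)
    \<comment> \<open>The point \<theta>s itself contributes ratio 1, which keeps
      \<open>ereal_ln\<close> in its regular branch when the supremum is finite.\<close>
    have S1: "1 \<le> ?S" using \<theta>s \<pi>pos[OF \<theta>s] by (intro SUP_upper2[of \<theta>s]) (auto simp: one_ereal_def)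
    show "TV (posterior d n \<mu> \<pi>0 Y) (gamma_star d n \<mu> \<theta>s Y)
       \<le> ereal ?C * (?\<Delta> / ereal (sqrt (real n)) + ereal (s * (real d / sqrt (real n)))
          + ereal_exp (ereal (real d) * (?M - ereal ((s / 12)\<^sup>2))))"
    \<comment> \<open>For an unbounded prior \<open>M0\<close> and with it the right-hand side are
      infinite.\<close>
    proof (cases "?S = \<infinity>")
      case True
      then have "?M = \<infinity>" using d by (simp add: M0_def ereal_ln_def)
      then show ?thesis using d sn \<delta>(1) by (simp add: ereal_exp_def)
    next
      case False
      then obtain m' where m': "?S = ereal m'" "1 \<le> m'" using S1 by (cases ?S) (auto simp: one_ereal_def)
      define m where "m = ln m' / real d"
      have em: "exp (real d * m) = m'" using d m'(2) by (simp add: m_def)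
      have M: "?M = ereal m" using d m'(2) by (simp add: M0_def ereal_ln_def m'(1) m_def)
      interpret bvm_sample d \<mu> a n \<theta>s s \<kappa> \<pi>0 \<beta> m Y
      proof unfold_locales
        show "is_prior d \<mu> \<pi>0" "Y \<in> good" by fact+
        show "0 \<le> \<beta>" using \<delta> sn by (simp add: \<beta>_def)
        show "\<beta> \<le> sqrt (real d) / 6" using \<delta>(3) sn by (simp add: \<beta>_def real_sqrt_mult field_simps)
        show "\<pi>0 \<theta> \<le> exp (real d * m) * \<pi>0 \<theta>s" if "\<theta> \<in> Theta d \<mu>" for \<theta>
        proof -
          have "ereal (\<pi>0 \<theta> / \<pi>0 \<theta>s) \<le> ereal m'" unfolding m'(1)[symmetric] by (rule SUP_upper[OF that])
          then show ?thesis using \<pi>pos[OF \<theta>s] unfolding em by (simp add: field_simps)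
        qed
        fix \<theta> assume \<theta>: "\<theta> \<in> Rd d" "N (lc d 1 \<theta> (-1) \<theta>s) \<le> 2 * (s * sqrt (real d))"
        obtain g where g: "has_grad d (\<lambda>\<theta>. ln (\<pi>0 \<theta>)) \<theta> g" "\<And>u. \<bar>dot d g u\<bar> \<le> \<delta> * sqrt (Cov \<theta>s u u)"
          using delta01_gradient[OF \<theta>s \<delta>(1) in_U[OF \<theta>]] by blast
        have "\<delta> * sqrt (Cov \<theta>s u u) = \<beta> * N u" for u
          using sn by (simp add: \<beta>_def N_def q_Cov real_sqrt_mult)
        then show "\<exists>g. has_grad d (\<lambda>\<theta>. ln (\<pi>0 \<theta>)) \<theta> g \<and> (\<forall>u\<in>Rd d. \<bar>dot d g u\<bar> \<le> \<beta> * N u)"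
          using g by auto
      qed
      let ?e = "exp (real d * (m - (s / 12)\<^sup>2))"
      have "2 * \<kappa> * (s * real d) + \<beta> + ?e \<le> (1 + 7 * \<bar>C23\<bar>) * (\<beta> + s * (real d / sqrt (real n)) + ?e)"
      proof -
        define x where "x = s * (real d / sqrt (real n))"
        have x: "0 \<le> x" using s sn by (simp add: x_def)
        have "2 * \<kappa> * (s * real d) = 32 / 5 * C23 * x" by (simp add: \<kappa>_def x_def)
        also have "\<dots> \<le> 7 * C23 * x" using c x by (intro mult_right_mono) auto
        finally have "2 * \<kappa> * (s * real d) + \<beta> + ?e \<le> 7 * C23 * x + \<beta> + ?e" by simp
        also have "\<dots> \<le> (1 + 7 * \<bar>C23\<bar>) * (\<beta> + x + ?e)"
          using c x \<beta>(1) by (simp add: algebra_simps add_nonneg_nonneg)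
        finally show ?thesis by (simp add: x_def)
      qed
      then have "60 * (2 * \<kappa> * (s * real d) + \<beta> + ?e)
          \<le> 60 * ((1 + 7 * \<bar>C23\<bar>) * (\<beta> + s * (real d / sqrt (real n)) + ?e))"
        by (rule mult_left_mono) simp
      then have "60 * (2 * \<kappa> * (s * real d) + \<beta> + ?e) \<le> ?C * (\<beta> + s * (real d / sqrt (real n)) + ?e)"
        by (simp only: mult.assoc)
      then have "TV (posterior d n \<mu> \<pi>0 Y) (gamma_star d n \<mu> \<theta>s Y) \<le> ereal (?C * (\<beta> + s * (real d / sqrt (real n)) + ?e))"
        using TV_bound by (meson ereal_less_eq(3) order_trans)
      then show ?thesis using sn by (simp add: M \<delta>(1) \<beta>_def ereal_exp_def)
    qed
  qed
qed

end
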